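(* Let $N\ge 1$ and $b>-N/2$. The $(\mathfrak g,\widetilde K)$-module $\omega_b$ on $W_{b,alg}$ (defined in the context) lifts to a unitary representation of $\widetilde{SL}(2,\mathbb R)$. More precisely, there exists a unique unitary representation $\Omega_b$ of $\widetilde{SL}(2,\mathbb R)$ on $L^2(\mathbb R^N,|x|^{2b}dx)$ such that for each $X\in\mathfrak{sl}_2(\mathbb R)$ and $v\in W_{b,alg}$, $$\left.\frac{d}{dt}\right|_{t=0}\Omega_b(e^{tX})v=\omega_b(X)v,$$ and for each $k\in\widetilde K$ and $v\in W_{b,alg}$, $$\Omega_b(k)v=\omega_b(k)v.$$
   Context: $\mathcal H^m(\mathbb R^N)$ is the space of homogeneous harmonic polynomials of degree $m$ on $\mathbb R^N$ with complex coefficients, $\lambda_{N,m}:=\frac{N-2}{2}+m$, and $L_\ell^{(\nu)}(t):=\sum_{k=0}^{\ell}\frac{(-1)^k\Gamma(\nu+\ell+1)}{\Gamma(\nu+k+1)(\ell-k)!}\frac{t^k}{k!}$ ($\ell\in\mathbb Z_{\ge0}$, $\nu>-1$) is the Laguerre polynomial. For $p\in\mathcal H^m(\mathbb R^N)$ and $\ell\in\mathbb Z_{\ge0}$ put $\Phi_{b,\ell,p}(x):=e^{-|x|^2/2}L_\ell^{(b+\lambda_{N,m})}(|x|^2)p(x)$. $W_{b,alg}\subset L^2(\mathbb R^N,|x|^{2b}dx)$ is the complex linear span of all $\Phi_{b,\ell,p}$ ($\ell,m\in\mathbb Z_{\ge 0}$, $p\in\mathcal H^m(\mathbb R^N)$).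 $E=\sum_{k=1}^N x_k\partial_{x_k}$ is the Euler operator. The operator $H_b$ on $W_{b,alg}$ is $H_b:=\Delta+\frac{2b}{|x|^2}\mathcal R$, where $\mathcal R$ is the linear operator determined by $\mathcal R\bigl(f(|x|^2)p(x)\bigr)=E\bigl(f(|x|^2)\bigr)p(x)$ for $p\in\mathcal H^m(\mathbb R^N)$, $m\ge 0$. $\widetilde{SL}(2,\mathbb R)$ is the universal covering of $SL(2,\mathbb R)$, $e^X$ denotes its exponential map, $\mathfrak g=\mathfrak{sl}_2(\mathbb R)$, and $\widetilde K=\widetilde{SO}(2)=\{e^{t\left(\begin{smallmatrix}0&-1\\1&0\end{smallmatrix}\right)}:t\in\mathbb R\}\cong\mathbb R$. The module $\omega_b$ is $W_{b,alg}$ with $\mathfrak g$ acting by $$\omega_b\begin{pmatrix}0&1\\0&0\end{pmatrix}=\tfrac i2|x|^2,\qquad \omega_b\begin{pmatrix}0&0\\1&0\end{pmatrix}=\tfrac i2H_b,\qquad \omega_b\begin{pmatrix}1&0\\0&-1\end{pmatrix}=E+\tfrac{N+2b}2,$$ and with $e^{t\left(\begin{smallmatrix}0&-1\\1&0\end{smallmatrix}\right)}\in\widetilde K$ acting by $e^{\frac{it}{2}(H_b-|x|^2)}$; here $\frac12(H_b-|x|^2)$ is diagonal on the vectors $\Phi_{b,\ell,p}$ ($p\in\mathcal H^m(\mathbb R^N)$) with eigenvalue $-(b+\lambda_{N,m}+2\ell+1)$. Unitary representations are understood to be strongly continuous. *)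

theory Defs
  imports "HOL-Analysis.Analysis" "HOL-Library.Function_Algebras"
begin

section \<open>The universal covering group of $SL(2,\mathbb R)$\<close>

definition SL2R :: "(real^2^2) set" where
  "SL2R = {A. det A = 1}"

definition sl2 :: "(real^2^2) set" where
  "sl2 = {X. trace X = 0}"

lemma SL2R_mult: "A \<in> SL2R \<Longrightarrow> B \<in> SL2R \<Longrightarrow> A ** B \<in> SL2R"
  by (simp add: SL2R_def det_mul)

lemma mat_1_in_SL2R: "mat 1 \<in> SL2R"
  by (simp add: SL2R_def)

definition adjugate2 :: "real^2^2 \<Rightarrow> real^2^2" where
  "adjugate2 A = vector [vector [A$2$2, - A$1$2], vector [- A$2$1, A$1$1]]"

lemma adjugate2_SL2R: "A \<in> SL2R \<Longrightarrow> adjugate2 A \<in> SL2R"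
  by (simp add: SL2R_def adjugate2_def det_2 algebra_simps)

lemma adjugate2_mult:
  assumes "A \<in> SL2R"
  shows "adjugate2 A ** A = mat 1" "A ** adjugate2 A = mat 1"
  using assms
  by (auto simp: SL2R_def adjugate2_def det_2 vec_eq_iff forall_2 matrix_matrix_mult_def sum_2 mat_def
      algebra_simps)

lemma continuous_on_mmult:
  fixes f g :: "'a::topological_space \<Rightarrow> real^'n^'n"
  assumes "continuous_on S f" "continuous_on S g"
  shows "continuous_on S (\<lambda>x. f x ** g x)"
  unfolding matrix_matrix_mult_def
  by (intro continuous_intros assms)

lemma continuous_on_adjugate2:
  assumes "continuous_on S f"
  shows "continuous_on S (\<lambda>x. adjugate2 (f x))"
proof -
  have eq: "adjugate2 A = (\<chi> i j. if i = 1 then (if j = 1 then A$2$2 else - A$1$2)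
                                 else (if j = 1 then - A$2$1 else A$1$1))" for A
    by (simp add: adjugate2_def vec_eq_iff forall_2)
  have "continuous_on S (\<lambda>x. if i = 1 then (if j = 1 then f x$2$2 else - f x$1$2)
                                 else (if j = 1 then - f x$2$1 else f x$1$1))" for i j :: 2
    by (cases "i = 1"; cases "j = 1") (auto intro!: continuous_intros assms)
  then show ?thesis
    unfolding eq by (intro continuous_intros)
qed

text \<open>Standard model of the universal covering of a connected, locally contractible group: homotopy
  classes, with fixed end points, of paths starting at the identity; multiplication is pointwise.\<close>

definition sl2_path_rel :: "(real \<Rightarrow> real^2^2) \<Rightarrow> (real \<Rightarrow> real^2^2) \<Rightarrow> bool" where
  "sl2_path_rel p q \<longleftrightarrow> pathstart p = mat 1 \<and> homotopic_paths SL2R p q"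

lemma sl2_path_rel_refl_iff:
  "sl2_path_rel p p \<longleftrightarrow> path p \<and> path_image p \<subseteq> SL2R \<and> pathstart p = mat 1"
  by (auto simp: sl2_path_rel_def)

lemma sl2_path_rel_one: "sl2_path_rel (\<lambda>t. mat 1) (\<lambda>t. mat 1)"
  by (auto simp: sl2_path_rel_refl_iff path_def path_image_def pathstart_def mat_1_in_SL2R)

lemma part_equivp_sl2_path_rel: "part_equivp sl2_path_rel"
proof (rule part_equivpI)
  show "\<exists>p. sl2_path_rel p p" using sl2_path_rel_one by blast
  show "symp sl2_path_rel"
    by (metis homotopic_paths_imp_pathstart homotopic_paths_sym sl2_path_rel_def sympI)
  show "transp sl2_path_rel"
    by (auto intro!: transpI simp: sl2_path_rel_def intro: homotopic_paths_trans)
qed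

quotient_type sl2_cover = "real \<Rightarrow> real^2^2" / partial: sl2_path_rel
  by (rule part_equivp_sl2_path_rel)

lemma homotopic_paths_mmult:
  assumes "homotopic_paths SL2R p p'" "homotopic_paths SL2R q q'"
  shows "homotopic_paths SL2R (\<lambda>t. p t ** q t) (\<lambda>t. p' t ** q' t)"
proof -
  obtain h :: "real \<times> real \<Rightarrow> real^2^2" where h: "continuous_on ({0..1} \<times> {0..1}) h" "h \<in> ({0..1} \<times> {0..1}) \<rightarrow> SL2R"
    "\<forall>x\<in>{0..1}. h (0, x) = p x" "\<forall>x\<in>{0..1}. h (1, x) = p' x"
    "\<forall>t\<in>{0..1}. pathstart (h \<circ> Pair t) = pathstart p \<and> pathfinish (h \<circ> Pair t) = pathfinish p"
    using assms(1) unfolding homotopic_paths by blast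
  obtain k :: "real \<times> real \<Rightarrow> real^2^2" where k: "continuous_on ({0..1} \<times> {0..1}) k" "k \<in> ({0..1} \<times> {0..1}) \<rightarrow> SL2R"
    "\<forall>x\<in>{0..1}. k (0, x) = q x" "\<forall>x\<in>{0..1}. k (1, x) = q' x"
    "\<forall>t\<in>{0..1}. pathstart (k \<circ> Pair t) = pathstart q \<and> pathfinish (k \<circ> Pair t) = pathfinish q"
    using assms(2) unfolding homotopic_paths by blast
  show ?thesis
    unfolding homotopic_paths
  proof (intro exI conjI)
    show "continuous_on ({0..1} \<times> {0..1}) (\<lambda>z. h z ** k z)"
      by (intro continuous_on_mmult h k)
    show "(\<lambda>z. h z ** k z) \<in> ({0..1} \<times> {0..1}) \<rightarrow> SL2R"
      using h(2) k(2) by (auto intro!: SL2R_mult simp: Pi_iff)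
  qed (use h k in \<open>auto simp: pathstart_def pathfinish_def\<close>)
qed

lemma sl2_path_rel_mult:
  "sl2_path_rel p p' \<Longrightarrow> sl2_path_rel q q' \<Longrightarrow> sl2_path_rel (\<lambda>t. p t ** q t) (\<lambda>t. p' t ** q' t)"
  by (auto simp: sl2_path_rel_def pathstart_def intro: homotopic_paths_mmult)

instantiation sl2_cover :: monoid_mult
begin

lift_definition one_sl2_cover :: sl2_cover is "\<lambda>t. mat 1"
  by (rule sl2_path_rel_one)

lift_definition times_sl2_cover :: "sl2_cover \<Rightarrow> sl2_cover \<Rightarrow> sl2_cover" is
  "\<lambda>p q t. p t ** q t"
  by (rule sl2_path_rel_mult)

instance
proof
  fix a b c :: sl2_cover
  show "a * b * c = a * (b * c)"
    by transfer (simp add: matrix_mul_assoc sl2_path_rel_mult)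
  show "1 * a = a" "a * 1 = a"
    by (transfer; simp)+
qed

end

lemma sl2_cover_inverse: "\<exists>h::sl2_cover. h * g = 1 \<and> g * h = 1"
proof transfer
  fix p assume p: "sl2_path_rel p p"
  then have pS: "path p" "path_image p \<subseteq> SL2R" "pathstart p = mat 1"
    by (auto simp: sl2_path_rel_refl_iff)
  let ?h = "\<lambda>t. adjugate2 (p t)"
  have mem: "p t \<in> SL2R" if "t \<in> {0..1}" for t
    using pS(2) that by (auto simp: path_image_def)
  have h: "sl2_path_rel ?h ?h"
    using pS mem
    by (auto simp: sl2_path_rel_refl_iff path_def path_image_def pathstart_def
        intro!: continuous_on_adjugate2 adjugate2_SL2R)
       (simp add: adjugate2_def vec_eq_iff forall_2 mat_def)
  have const: "sl2_path_rel r (\<lambda>t. mat 1)" if "\<And>t. t \<in> {0..1} \<Longrightarrow> r t = mat 1" for r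
    using homotopic_paths_eq[of "\<lambda>t. mat 1" SL2R r] sl2_path_rel_one that
    by (auto simp: sl2_path_rel_refl_iff sl2_path_rel_def homotopic_paths_sym pathstart_def)
  have 1: "sl2_path_rel (\<lambda>t. ?h t ** p t) (\<lambda>t. mat 1)" "sl2_path_rel (\<lambda>t. p t ** ?h t) (\<lambda>t. mat 1)"
    by (auto intro!: const simp: adjugate2_mult mem)
  show "\<exists>h\<in>{h. sl2_path_rel h h}. sl2_path_rel (\<lambda>t. h t ** p t) (\<lambda>t. mat 1)
          \<and> sl2_path_rel (\<lambda>t. p t ** h t) (\<lambda>t. mat 1)"
    by (intro bexI[of _ ?h] conjI CollectI h 1)
qed

text \<open>The covering topology: the classes of the concatenations \<^term>\<open>p +++ q\<close>, with \<^term>\<open>q\<close> a path in a given neighbourhood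
  of the end point of \<^term>\<open>p\<close>, form a neighbourhood base at the class of \<^term>\<open>p\<close>.\<close>

instantiation sl2_cover :: topological_space
begin

definition open_sl2_cover :: "sl2_cover set \<Rightarrow> bool" where
  "open_sl2_cover U \<longleftrightarrow>
    (\<forall>p. sl2_path_rel p p \<and> abs_sl2_cover p \<in> U \<longrightarrow>
      (\<exists>e>0. \<forall>q. path q \<and> path_image q \<subseteq> SL2R \<inter> ball (pathfinish p) e \<and> pathstart q = pathfinish p
              \<longrightarrow> abs_sl2_cover (p +++ q) \<in> U))"

instance
proof
  show "open (UNIV :: sl2_cover set)"
    by (auto simp: open_sl2_cover_def intro: exI[of _ 1])
next
  fix S T :: "sl2_cover set"
  assume S: "open S" and T: "open T"
  show "open (S \<inter> T)"
    unfolding open_sl2_cover_def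
  proof (intro allI impI)
    fix p assume p: "sl2_path_rel p p \<and> abs_sl2_cover p \<in> S \<inter> T"
    obtain d where d: "d > 0" "\<And>q. path q \<Longrightarrow> path_image q \<subseteq> SL2R \<inter> ball (pathfinish p) d \<Longrightarrow>
        pathstart q = pathfinish p \<Longrightarrow> abs_sl2_cover (p +++ q) \<in> S"
      using S p unfolding open_sl2_cover_def by blast
    obtain e where e: "e > 0" "\<And>q. path q \<Longrightarrow> path_image q \<subseteq> SL2R \<inter> ball (pathfinish p) e \<Longrightarrow>
        pathstart q = pathfinish p \<Longrightarrow> abs_sl2_cover (p +++ q) \<in> T"
      using T p unfolding open_sl2_cover_def by blast
    show "\<exists>e>0. \<forall>q. path q \<and> path_image q \<subseteq> SL2R \<inter> ball (pathfinish p) e \<and> pathstart q = pathfinish p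
              \<longrightarrow> abs_sl2_cover (p +++ q) \<in> S \<inter> T"
      using d e by (intro exI[of _ "min d e"]) (auto simp: subset_iff)
  qed
next
  fix K :: "sl2_cover set set"
  assume "\<forall>S\<in>K. open S"
  then show "open (\<Union>K)"
    unfolding open_sl2_cover_def by (meson UnionE UnionI)
qed

end

definition mat_exp :: "real^'n^'n \<Rightarrow> real^'n^'n" where
  "mat_exp X = (\<Sum>k. (1 / fact k) *\<^sub>R (((**) X ^^ k) (mat 1)))"

text \<open>For $X \in \mathfrak{sl}_2$ the one-parameter group $t \mapsto e^{tX}$ of the covering group is the
  lift of $t \mapsto \exp(tX)$ starting at the identity, so $e^X$ is the class of $s \mapsto \exp(sX)$.\<close>

definition cover_exp :: "real^2^2 \<Rightarrow> sl2_cover" where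
  "cover_exp X = abs_sl2_cover (\<lambda>s. mat_exp (s *\<^sub>R X))"

definition Jmat :: "real^2^2" where
  "Jmat = vector [vector [0, -1], vector [1, 0]]"


section \<open>Complex $L^2$ spaces and unitary representations\<close>

definition sq_integrable :: "'a measure \<Rightarrow> ('a \<Rightarrow> complex) set" where
  "sq_integrable M = {f \<in> borel_measurable M. integrable M (\<lambda>x. (cmod (f x))\<^sup>2)}"

definition ae_rel :: "'a measure \<Rightarrow> (('a \<Rightarrow> complex) \<times> ('a \<Rightarrow> complex)) set" where
  "ae_rel M = {(f, g). f \<in> sq_integrable M \<and> g \<in> sq_integrable M \<and> (AE x in M. f x = g x)}"

definition L2 :: "'a measure \<Rightarrow> ('a \<Rightarrow> complex) set set" where
  "L2 M = sq_integrable M // ae_rel M"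

definition l2_class :: "'a measure \<Rightarrow> ('a \<Rightarrow> complex) \<Rightarrow> ('a \<Rightarrow> complex) set" where
  "l2_class M f = ae_rel M `` {f}"

definition l2_rep :: "('a \<Rightarrow> complex) set \<Rightarrow> 'a \<Rightarrow> complex" where
  "l2_rep u = (SOME f. f \<in> u)"

definition l2_add :: "'a measure \<Rightarrow> ('a \<Rightarrow> complex) set \<Rightarrow> ('a \<Rightarrow> complex) set \<Rightarrow> ('a \<Rightarrow> complex) set" where
  "l2_add M u v = l2_class M (\<lambda>x. l2_rep u x + l2_rep v x)"

definition l2_scale :: "'a measure \<Rightarrow> complex \<Rightarrow> ('a \<Rightarrow> complex) set \<Rightarrow> ('a \<Rightarrow> complex) set" where
  "l2_scale M c u = l2_class M (\<lambda>x. c * l2_rep u x)"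

definition l2_diff :: "'a measure \<Rightarrow> ('a \<Rightarrow> complex) set \<Rightarrow> ('a \<Rightarrow> complex) set \<Rightarrow> ('a \<Rightarrow> complex) set" where
  "l2_diff M u v = l2_add M u (l2_scale M (-1) v)"

definition l2_inner :: "'a measure \<Rightarrow> ('a \<Rightarrow> complex) set \<Rightarrow> ('a \<Rightarrow> complex) set \<Rightarrow> complex" where
  "l2_inner M u v = (LINT x|M. l2_rep u x * cnj (l2_rep v x))"

definition l2_norm :: "'a measure \<Rightarrow> ('a \<Rightarrow> complex) set \<Rightarrow> real" where
  "l2_norm M u = sqrt (Re (l2_inner M u u))"

lemma equiv_ae_rel: "equiv (sq_integrable M) (ae_rel M)"
  by (rule equivI) (auto simp: ae_rel_def refl_on_def sym_def trans_def)

lemma l2_class_in_L2: "f \<in> sq_integrable M \<Longrightarrow> l2_class M f \<in> L2 M"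
  by (simp add: l2_class_def L2_def quotientI)

lemma l2_class_eq_iff:
  assumes "f \<in> sq_integrable M" "g \<in> sq_integrable M"
  shows "l2_class M f = l2_class M g \<longleftrightarrow> (AE x in M. f x = g x)"
  unfolding l2_class_def eq_equiv_class_iff[OF equiv_ae_rel assms]
  using assms by (simp add: ae_rel_def)

lemma l2_rep_class:
  assumes "f \<in> sq_integrable M"
  shows "l2_rep (l2_class M f) \<in> sq_integrable M" "AE x in M. l2_rep (l2_class M f) x = f x"
proof -
  have mem: "f \<in> l2_class M f"
    using assms by (simp add: l2_class_def ae_rel_def)
  have "l2_rep (l2_class M f) \<in> l2_class M f"
    unfolding l2_rep_def by (rule someI[where P = "\<lambda>g. g \<in> l2_class M f", OF mem])
  then have "(f, l2_rep (l2_class M f)) \<in> ae_rel M" by (simp add: l2_class_def)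
  then show "l2_rep (l2_class M f) \<in> sq_integrable M" "AE x in M. l2_rep (l2_class M f) x = f x"
    by (auto simp: ae_rel_def eq_commute)
qed

text \<open>Unitary operators are extensional functions on \<^term>\<open>L2 M\<close>, so that uniqueness can be
  expressed by equality in HOL.\<close>

definition unitary_op :: "'a measure \<Rightarrow> (('a \<Rightarrow> complex) set \<Rightarrow> ('a \<Rightarrow> complex) set) \<Rightarrow> bool" where
  "unitary_op M U \<longleftrightarrow>
     U \<in> extensional (L2 M) \<and> bij_betw U (L2 M) (L2 M) \<and>
     (\<forall>u\<in>L2 M. \<forall>v\<in>L2 M. U (l2_add M u v) = l2_add M (U u) (U v)) \<and>
     (\<forall>c. \<forall>u\<in>L2 M. U (l2_scale M c u) = l2_scale M c (U u)) \<and>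
     (\<forall>u\<in>L2 M. \<forall>v\<in>L2 M. l2_inner M (U u) (U v) = l2_inner M u v)"

definition unitary_rep ::
    "'a measure \<Rightarrow> ('g::{monoid_mult, topological_space} \<Rightarrow> ('a \<Rightarrow> complex) set \<Rightarrow> ('a \<Rightarrow> complex) set) \<Rightarrow> bool" where
  "unitary_rep M \<Omega> \<longleftrightarrow>
     (\<forall>g. unitary_op M (\<Omega> g)) \<and>
     (\<forall>u\<in>L2 M. \<Omega> 1 u = u) \<and>
     (\<forall>g h. \<forall>u\<in>L2 M. \<Omega> (g * h) u = \<Omega> g (\<Omega> h u)) \<and>
     (\<forall>u\<in>L2 M. \<forall>g. ((\<lambda>h. l2_norm M (l2_diff M (\<Omega> h u) (\<Omega> g u))) \<longlongrightarrow> 0) (at g))"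

definition l2_has_derivative_at_0 ::
    "'a measure \<Rightarrow> (real \<Rightarrow> ('a \<Rightarrow> complex) set) \<Rightarrow> ('a \<Rightarrow> complex) set \<Rightarrow> bool" where
  "l2_has_derivative_at_0 M \<phi> D \<longleftrightarrow> D \<in> L2 M \<and>
     ((\<lambda>t. l2_norm M (l2_diff M (l2_scale M (complex_of_real (1 / t)) (l2_diff M (\<phi> t) (\<phi> 0))) D))
        \<longlongrightarrow> 0) (at 0)"


section \<open>The module $\omega_b$\<close>

definition cscale :: "complex \<Rightarrow> ('a \<Rightarrow> complex) \<Rightarrow> 'a \<Rightarrow> complex" where
  "cscale c f = (\<lambda>x. c * f x)"

interpretation cfun: vector_space cscale
  by standard (auto simp: cscale_def fun_eq_iff algebra_simps)

definition cscale2 ::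
    "complex \<Rightarrow> ('a \<Rightarrow> complex) \<times> ('a \<Rightarrow> complex) \<Rightarrow> ('a \<Rightarrow> complex) \<times> ('a \<Rightarrow> complex)" where
  "cscale2 c z = (cscale c (fst z), cscale c (snd z))"

interpretation cfun2: vector_space cscale2
  by standard (auto simp: cscale2_def cscale_def fun_eq_iff algebra_simps)

text \<open>The linear operator determined by prescribed values on a spanning set: \<^term>\<open>S\<close> consists of pairs
  (vector, value), and the graph of the operator is the complex linear span of \<^term>\<open>S\<close>.\<close>

definition linear_op_from ::
    "(('a \<Rightarrow> complex) \<times> ('a \<Rightarrow> complex)) set \<Rightarrow> ('a \<Rightarrow> complex) \<Rightarrow> ('a \<Rightarrow> complex)" where
  "linear_op_from S u = (THE v. (u, v) \<in> cfun2.span S)"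

definition partial_deriv :: "'n \<Rightarrow> (real^'n \<Rightarrow> complex) \<Rightarrow> real^'n \<Rightarrow> complex" where
  "partial_deriv i f x = vector_derivative (\<lambda>t. f (x + t *\<^sub>R axis i 1)) (at 0)"

definition laplacian :: "(real^'n \<Rightarrow> complex) \<Rightarrow> real^'n \<Rightarrow> complex" where
  "laplacian f x = (\<Sum>i\<in>UNIV. partial_deriv i (partial_deriv i f) x)"

definition euler :: "(real^'n \<Rightarrow> complex) \<Rightarrow> real^'n \<Rightarrow> complex" where
  "euler f x = (\<Sum>i\<in>UNIV. complex_of_real (x $ i) * partial_deriv i f x)"

definition monomial :: "('n \<Rightarrow> nat) \<Rightarrow> real^'n \<Rightarrow> complex" where
  "monomial \<alpha> x = (\<Prod>i\<in>UNIV. complex_of_real (x $ i) ^ \<alpha> i)"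

definition homogeneous_poly :: "nat \<Rightarrow> (real^'n \<Rightarrow> complex) set" where
  "homogeneous_poly m = cfun.span {monomial \<alpha> |\<alpha>. (\<Sum>i\<in>UNIV. \<alpha> i) = m}"

definition harmonic_poly :: "nat \<Rightarrow> (real^'n \<Rightarrow> complex) set" where
  "harmonic_poly m = {p \<in> homogeneous_poly m. \<forall>x. laplacian p x = 0}"

definition lambda :: "'n itself \<Rightarrow> nat \<Rightarrow> real" where
  "lambda _ m = (real CARD('n) - 2) / 2 + real m"

definition laguerre :: "nat \<Rightarrow> real \<Rightarrow> real \<Rightarrow> real" where
  "laguerre l \<nu> t = (\<Sum>k\<le>l. (-1) ^ k * Gamma (\<nu> + real l + 1) / (Gamma (\<nu> + real k + 1) * fact (l - k))
                          * (t ^ k / fact k))"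

definition Phi :: "real \<Rightarrow> nat \<Rightarrow> nat \<Rightarrow> (real^'n \<Rightarrow> complex) \<Rightarrow> real^'n \<Rightarrow> complex" where
  "Phi b l m p x =
     complex_of_real (exp (- (norm x)\<^sup>2 / 2) * laguerre l (b + lambda TYPE('n) m) ((norm x)\<^sup>2)) * p x"

definition W_alg :: "real \<Rightarrow> (real^'n \<Rightarrow> complex) set" where
  "W_alg b = cfun.span {Phi b l m p |l m p. p \<in> harmonic_poly m}"

definition weighted_measure :: "real \<Rightarrow> (real^'n) measure" where
  "weighted_measure b = density lborel (\<lambda>x. ennreal (norm x powr (2 * b)))"

definition R_op :: "(real^'n \<Rightarrow> complex) \<Rightarrow> real^'n \<Rightarrow> complex" where
  "R_op = linear_op_from
     {(\<lambda>x. f ((norm x)\<^sup>2) * p x, \<lambda>x. euler (\<lambda>y. f ((norm y)\<^sup>2)) x * p x) |(f :: real \<Rightarrow> complex) p m.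
        (\<forall>t. f differentiable (at t)) \<and> p \<in> harmonic_poly m}"

text \<open>The formula for $H_b$ makes sense off the origin only; the value at the origin is the continuous
  extension (on \<^term>\<open>W_alg b\<close> the second term has a removable singularity), so that \<^term>\<open>W_alg b\<close> is
  literally preserved.\<close>

definition H_op :: "real \<Rightarrow> (real^'n \<Rightarrow> complex) \<Rightarrow> real^'n \<Rightarrow> complex" where
  "H_op b u x =
     (let h = (\<lambda>y. laplacian u y + complex_of_real (2 * b / (norm y)\<^sup>2) * R_op u y)
      in if x = 0 then Lim (at 0) h else h x)"

definition omega :: "real \<Rightarrow> real^2^2 \<Rightarrow> (real^'n \<Rightarrow> complex) \<Rightarrow> real^'n \<Rightarrow> complex" where
  "omega b X u x =
     complex_of_real (X$1$2) * (\<i> / 2 * complex_of_real ((norm x)\<^sup>2) * u x) +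
     complex_of_real (X$2$1) * (\<i> / 2 * H_op b u x) +
     complex_of_real (X$1$1) * (euler u x + complex_of_real ((real CARD('n) + 2 * b) / 2) * u x)"

text \<open>The operator $A = \frac12 (H_b - |x|^2)$ is diagonalisable on \<^term>\<open>W_alg b\<close>, and $e^{itA}$ is the linear
  operator multiplying each eigenvector of $A$ with eigenvalue $\mu$ by $e^{it\mu}$.\<close>

definition A_op :: "real \<Rightarrow> (real^'n \<Rightarrow> complex) \<Rightarrow> real^'n \<Rightarrow> complex" where
  "A_op b u x = (H_op b u x - complex_of_real ((norm x)\<^sup>2) * u x) / 2"

definition omega_K :: "real \<Rightarrow> real \<Rightarrow> (real^'n \<Rightarrow> complex) \<Rightarrow> real^'n \<Rightarrow> complex" where
  "omega_K b t = linear_op_from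
     {(u, cscale (exp (\<i> * complex_of_real t * \<mu>)) u) |u \<mu>. u \<in> W_alg b \<and> A_op b u = cscale \<mu> u}"

end

theory Submission
  imports Defs "HOL-Complex_Analysis.Riemann_Mapping"
begin

text \<open>
  The idea is to let the group act on Gaussians and to see the module $W_{b,alg}$ as the Taylor coefficients of
  a holomorphic family of them. For a harmonic polynomial $p$ of degree $m$ and $\tau$ in the upper half plane put
  $\psi_\tau^p(x) = p(x) e^{i \tau |x|^2 / 2}$. In the representation to be constructed an element of the
  covering group with matrix $A$, lower row $(c, d)$, should act by
  \[ \psi_\tau^p \mapsto (c \tau + d)^{-\kappa} \psi_{A \tau}^p, \qquad \kappa = b + m + N/2, \]
  where the real power is made single valued by the covering: a point of the covering group is a homotopy class of
  paths, and \<^term>\<open>autlog\<close> continues $\log(c \tau + d)$ along the path, starting from $0$.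

  Homogeneity and analytic continuation give
  $\langle \psi_\tau^p, \psi_\sigma^q \rangle = const \cdot (-i(\tau - \bar\sigma))^{-\kappa}$ when $p$, $q$ have equal
  degree (\<open>psi_gram\<close>), and $0$ otherwise (\<open>harmonic_orthogonal\<close>). Since
  $A \tau - \overline{A \sigma} = (\tau - \bar\sigma) / ((c \tau + d) \overline{(c \sigma + d)})$, the inner products
  of the transformed Gaussians are the old ones; \<open>Ln_mob_diff\<close> is this identity for the continued logarithms.
  The Gaussians are total (\<open>psi_total\<close>): every polynomial is a combination of products of a power of $|x|^2$ with
  a harmonic polynomial, and polynomials times Gaussians are total by Stone--Weierstrass. A map between total
  families with equal inner products extends to an isometry (\<open>L2_isometry_extension\<close>). It is characterised by its
  inner products with Gaussians, and so linearity, the group law and strong continuity can all be checked on Gaussians.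

  For $v(x) = p(x) |x|^{2j} e^{-|x|^2/2}$ the pairing of $v$ with a moving Gaussian is an explicit function of $\tau$;
  differentiating it gives the pairing of $\omega_b(X) v$ with that Gaussian
  (\<open>gop_ebas_weak_derivative_0\<close>). As the module is stable under $\omega_b$, the mean value inequality turns these weak
  derivatives into a derivative in norm (\<open>gop_derivative\<close>). On eigenvectors of $\frac12(H_b - |x|^2)$ the pairing
  solves a linear scalar equation, and this gives the action of $\widetilde K$ (\<open>gop_eigenvector\<close>). Here
  it has to be shown first that $\mathcal R$ is well defined (\<open>R_op_eq\<close>) and that the vectors $\Phi_{b,\ell,p}$ are
  eigenvectors spanning the same space as the vectors $v$ (\<open>Phi_eigenvector\<close>, \<open>W_alg_ospan\<close>).

  For uniqueness, two solutions agree on $\widetilde K$ by assumption. The vectors $v$ are analytic for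
  multiplication by $\frac i2 |x|^2$, and all derivatives of $t \mapsto \langle \Omega(e^{tE}) v, w \rangle$ at $0$ are
  prescribed, so that two solutions agree at $e^{tE}$, $E$ the upper nilpotent matrix, first for small and then for all $t$.
  Together with $\widetilde K$ these elements generate the covering group (\<open>cover_induct\<close>).
\<close>

section \<open>Inner products and isometries of $L^2$\<close>

text \<open>The analysis is done with functions; classes modulo null sets are used in the final statements only.\<close>

definition ip :: "'a measure \<Rightarrow> ('a \<Rightarrow> complex) \<Rightarrow> ('a \<Rightarrow> complex) \<Rightarrow> complex" where
  "ip M f g = (LINT x|M. f x * cnj (g x))"

definition nrm :: "'a measure \<Rightarrow> ('a \<Rightarrow> complex) \<Rightarrow> real" where
  "nrm M f = sqrt (LINT x|M. (cmod (f x))\<^sup>2)"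

lemma sq_measurable: "f \<in> sq_integrable M \<Longrightarrow> f \<in> borel_measurable M"
  by (simp add: sq_integrable_def)

lemma sq_integrableD: "f \<in> sq_integrable M \<Longrightarrow> integrable M (\<lambda>x. (cmod (f x))\<^sup>2)"
  by (simp add: sq_integrable_def)

lemma borel_measurable_cnj [measurable (raw)]:
  "f \<in> borel_measurable M \<Longrightarrow> (\<lambda>x. cnj (f x)) \<in> borel_measurable M"
  by (rule borel_measurable_continuous_on[OF continuous_on_cnj[OF continuous_on_id]])

lemma integrable_ip:
  assumes f: "f \<in> sq_integrable M" and g: "g \<in> sq_integrable M"
  shows "integrable M (\<lambda>x. f x * cnj (g x))"
proof (rule Bochner_Integration.integrable_bound)
  show "integrable M (\<lambda>x. (cmod (f x))\<^sup>2 + (cmod (g x))\<^sup>2)"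
    using sq_integrableD[OF f] sq_integrableD[OF g] by simp
  show "(\<lambda>x. f x * cnj (g x)) \<in> borel_measurable M"
    using sq_measurable[OF f] sq_measurable[OF g] by measurable
  have "a * b \<le> a\<^sup>2 + b\<^sup>2" if "a \<ge> 0" "b \<ge> 0" for a b :: real
    using that sum_squares_bound[of a b] mult_nonneg_nonneg[OF that] by linarith
  then show "AE x in M. norm (f x * cnj (g x)) \<le> norm ((cmod (f x))\<^sup>2 + (cmod (g x))\<^sup>2)"
    by (auto simp: norm_mult)
qed

lemma sq_subspace: "cfun.subspace (sq_integrable M)"
proof (rule cfun.subspaceI)
  show "0 \<in> sq_integrable M" by (simp add: sq_integrable_def zero_fun_def)
next
  fix f g assume f: "f \<in> sq_integrable M" and g: "g \<in> sq_integrable M"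
  have [measurable]: "f \<in> borel_measurable M" "g \<in> borel_measurable M"
    using f g by (auto simp: sq_measurable)
  have "integrable M (\<lambda>x. (cmod (f x + g x))\<^sup>2)"
  proof (rule Bochner_Integration.integrable_bound)
    show "integrable M (\<lambda>x. 2 * (cmod (f x))\<^sup>2 + 2 * (cmod (g x))\<^sup>2)"
      using sq_integrableD[OF f] sq_integrableD[OF g] by simp
    have "(cmod (u + v))\<^sup>2 \<le> 2 * (cmod u)\<^sup>2 + 2 * (cmod v)\<^sup>2" for u v
    proof -
      have "(cmod (u + v))\<^sup>2 \<le> (cmod u + cmod v)\<^sup>2"
        by (intro power_mono norm_triangle_ineq norm_ge_zero)
      also have "\<dots> \<le> 2 * (cmod u)\<^sup>2 + 2 * (cmod v)\<^sup>2"
        using sum_squares_bound[of "cmod u" "cmod v"] by (simp add: power2_sum)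
      finally show ?thesis .
    qed
    then show "AE x in M. norm ((cmod (f x + g x))\<^sup>2) \<le> norm (2 * (cmod (f x))\<^sup>2 + 2 * (cmod (g x))\<^sup>2)"
      by auto
  qed measurable
  then show "f + g \<in> sq_integrable M"
    by (simp add: sq_integrable_def plus_fun_def)
next
  fix c f assume f: "f \<in> sq_integrable M"
  then show "cscale c f \<in> sq_integrable M"
    by (auto simp: sq_integrable_def cscale_def norm_mult power_mult_distrib)
qed

lemmas sq_add = cfun.subspace_add[OF sq_subspace]
lemmas sq_diff = cfun.subspace_diff[OF sq_subspace]
lemmas sq_cscale = cfun.subspace_scale[OF sq_subspace]
lemmas sq_zero = cfun.subspace_0[OF sq_subspace]

lemma ip_add_left:
  assumes "f \<in> sq_integrable M" "g \<in> sq_integrable M" "h \<in> sq_integrable M"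
  shows "ip M (f + g) h = ip M f h + ip M g h"
  using assms by (simp add: ip_def distrib_right integrable_ip)

lemma ip_cscale_left: "ip M (cscale c f) h = c * ip M f h"
  by (simp add: ip_def cscale_def mult.assoc)

lemma ip_commute: "ip M g f = cnj (ip M f g)"
proof -
  have "ip M g f = (LINT x|M. cnj (f x * cnj (g x)))"
    by (simp add: ip_def mult.commute)
  also have "\<dots> = cnj (ip M f g)" unfolding ip_def by (rule Bochner_Integration.integral_cnj)
  finally show ?thesis .
qed

lemma ip_add_right:
  assumes "f \<in> sq_integrable M" "g \<in> sq_integrable M" "h \<in> sq_integrable M"
  shows "ip M h (f + g) = ip M h f + ip M h g"
  using ip_add_left[OF assms] ip_commute by (metis complex_cnj_add)

lemma ip_cscale_right: "ip M h (cscale c f) = cnj c * ip M h f"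
  using ip_cscale_left[of M c f h] ip_commute by (metis complex_cnj_mult)

lemma ip_zero [simp]: "ip M 0 f = 0" "ip M f 0 = 0" "ip M (\<lambda>x. 0) f = 0" "ip M f (\<lambda>x. 0) = 0"
  by (simp_all add: ip_def)

lemma ip_diff_left:
  assumes "f \<in> sq_integrable M" "g \<in> sq_integrable M" "h \<in> sq_integrable M"
  shows "ip M (f - g) h = ip M f h - ip M g h"
  using assms by (simp add: ip_def left_diff_distrib integrable_ip)

lemma ip_diff_right:
  assumes "f \<in> sq_integrable M" "g \<in> sq_integrable M" "h \<in> sq_integrable M"
  shows "ip M h (f - g) = ip M h f - ip M h g"
  using ip_diff_left[OF assms] ip_commute by (metis complex_cnj_diff)

lemma ip_cong_AE:
  assumes "f \<in> sq_integrable M" "g \<in> sq_integrable M" "f' \<in> sq_integrable M" "g' \<in> sq_integrable M"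
    and "AE x in M. f x = f' x" "AE x in M. g x = g' x"
  shows "ip M f g = ip M f' g'"
  unfolding ip_def
  by (rule integral_cong_AE)
     (use assms in \<open>auto intro!: borel_measurable_times borel_measurable_cnj simp: sq_measurable\<close>)

lemma nrm_nonneg [simp]: "nrm M f \<ge> 0" by (simp add: nrm_def)

lemma nrm_power2: "(nrm M f)\<^sup>2 = (LINT x|M. (cmod (f x))\<^sup>2)"
  by (simp add: nrm_def)

lemma ip_self: "ip M f f = complex_of_real ((nrm M f)\<^sup>2)"
  unfolding ip_def nrm_power2 by (simp only: complex_norm_square[symmetric] integral_complex_of_real)

lemma nrm_cscale: "nrm M (cscale c f) = cmod c * nrm M f"
  by (simp add: nrm_def cscale_def norm_mult power_mult_distrib real_sqrt_mult)

lemma nrm_zero [simp]: "nrm M 0 = 0" by (simp add: nrm_def)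

lemma nrm_minus: "nrm M (f - g) = nrm M (g - f)"
  by (simp add: nrm_def norm_minus_commute)

lemma nrm_cong_AE:
  assumes "f \<in> sq_integrable M" "g \<in> sq_integrable M" "AE x in M. f x = g x"
  shows "nrm M f = nrm M g"
  unfolding nrm_def
  by (intro arg_cong[where f=sqrt] integral_cong_AE) (use assms in \<open>auto simp: sq_integrable_def\<close>)

lemma nrm_eq_0_iff:
  assumes "f \<in> sq_integrable M"
  shows "nrm M f = 0 \<longleftrightarrow> (AE x in M. f x = 0)"
  using integral_nonneg_eq_0_iff_AE[OF sq_integrableD[OF assms]] by (simp add: nrm_def)

lemma nrm_add_power2:
  assumes "f \<in> sq_integrable M" "g \<in> sq_integrable M"
  shows "(nrm M (f + g))\<^sup>2 = (nrm M f)\<^sup>2 + (nrm M g)\<^sup>2 + 2 * Re (ip M f g)"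
proof -
  have "complex_of_real ((nrm M (f + g))\<^sup>2) = ip M f f + ip M g g + (ip M f g + cnj (ip M f g))"
    unfolding ip_self[symmetric] using assms
    by (simp add: ip_add_left ip_add_right sq_add ip_commute[of M g f])
  also have "\<dots> = complex_of_real ((nrm M f)\<^sup>2 + (nrm M g)\<^sup>2 + 2 * Re (ip M f g))"
    by (simp only: ip_self complex_add_cnj of_real_add)
  finally show ?thesis by (simp only: of_real_eq_iff)
qed

lemma nrm_diff_power2:
  assumes "f \<in> sq_integrable M" "g \<in> sq_integrable M"
  shows "(nrm M (f - g))\<^sup>2 = (nrm M f)\<^sup>2 + (nrm M g)\<^sup>2 - 2 * Re (ip M f g)"
proof -
  have "f - g = f + cscale (-1) g" by (auto simp: cscale_def)
  then show ?thesis
    using nrm_add_power2[OF assms(1) sq_cscale[OF assms(2), of "-1"]]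
    unfolding \<open>f - g = _\<close> nrm_cscale ip_cscale_right by simp
qed

lemma ip_Cauchy_Schwarz:
  assumes f: "f \<in> sq_integrable M" and g: "g \<in> sq_integrable M"
  shows "cmod (ip M f g) \<le> nrm M f * nrm M g"
proof (cases "nrm M g = 0")
  case True
  then have "AE x in M. g x = 0" using nrm_eq_0_iff[OF g] by simp
  then have "ip M f g = ip M f 0"
    by (intro ip_cong_AE) (auto simp: f g sq_zero)
  then show ?thesis using True by simp
next
  case False
  define c where "c = ip M f g / complex_of_real ((nrm M g)\<^sup>2)"
  have "0 \<le> (nrm M (f - cscale c g))\<^sup>2" by simp
  also have "\<dots> = (nrm M f)\<^sup>2 + (cmod c * nrm M g)\<^sup>2 - 2 * Re (cnj c * ip M f g)"
    by (simp add: nrm_diff_power2 f g sq_cscale nrm_cscale ip_cscale_right)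
  also have "cnj c * ip M f g = complex_of_real ((cmod (ip M f g))\<^sup>2 / (nrm M g)\<^sup>2)"
    unfolding c_def using complex_norm_square[of "ip M f g"] by (simp add: mult.commute)
  also have "(cmod c * nrm M g)\<^sup>2 = (cmod (ip M f g))\<^sup>2 / (nrm M g)\<^sup>2"
    using False by (simp add: c_def norm_divide power_mult_distrib power_divide norm_power) (simp add: field_simps power2_eq_square power4_eq_xxxx)
  finally have "(cmod (ip M f g))\<^sup>2 / (nrm M g)\<^sup>2 \<le> (nrm M f)\<^sup>2" by simp
  then have "(cmod (ip M f g))\<^sup>2 \<le> (nrm M f * nrm M g)\<^sup>2"
    using False by (simp add: divide_le_eq power_mult_distrib)
  then show ?thesis by (rule power2_le_imp_le) simp
qed

lemma nrm_triangle:
  assumes f: "f \<in> sq_integrable M" and g: "g \<in> sq_integrable M"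
  shows "nrm M (f + g) \<le> nrm M f + nrm M g"
proof (rule power2_le_imp_le)
  have "Re (ip M f g) \<le> nrm M f * nrm M g"
    using ip_Cauchy_Schwarz[OF f g] complex_Re_le_cmod order_trans by blast
  then show "(nrm M (f + g))\<^sup>2 \<le> (nrm M f + nrm M g)\<^sup>2"
    by (simp add: nrm_add_power2 f g power2_sum)
qed simp

lemma nrm_triangle_diff:
  assumes "f \<in> sq_integrable M" "g \<in> sq_integrable M" "h \<in> sq_integrable M"
  shows "nrm M (f - h) \<le> nrm M (f - g) + nrm M (g - h)"
proof -
  have "f - h = (f - g) + (g - h)" by simp
  then show ?thesis using nrm_triangle[of "f - g" M "g - h"] assms by (simp only: sq_diff)
qed

lemma nrm_diff_abs:
  assumes "f \<in> sq_integrable M" "g \<in> sq_integrable M"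
  shows "\<bar>nrm M f - nrm M g\<bar> \<le> nrm M (f - g)"
  using nrm_triangle[of "f - g" M g] nrm_triangle[of "g - f" M f] assms
  by (simp add: sq_diff nrm_minus[of M f g])

lemma nrm_tendsto:
  assumes "\<And>n. f n \<in> sq_integrable M" "g \<in> sq_integrable M" "((\<lambda>n. nrm M (f n - g)) \<longlongrightarrow> 0) F"
  shows "((\<lambda>n. nrm M (f n)) \<longlongrightarrow> nrm M g) F"
proof -
  have "((\<lambda>n. nrm M (f n) - nrm M g) \<longlongrightarrow> 0) F"
    by (rule Lim_null_comparison[OF _ assms(3)]) (simp add: nrm_diff_abs assms)
  then show ?thesis by (simp add: LIM_zero_iff)
qed

lemma ip_tendsto_left:
  assumes "\<And>n. f n \<in> sq_integrable M" "g \<in> sq_integrable M" "h \<in> sq_integrable M"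
    "((\<lambda>n. nrm M (f n - g)) \<longlongrightarrow> 0) F"
  shows "((\<lambda>n. ip M (f n) h) \<longlongrightarrow> ip M g h) F"
proof -
  have "((\<lambda>n. ip M (f n) h - ip M g h) \<longlongrightarrow> 0) F"
  proof (rule Lim_null_comparison)
    show "\<forall>\<^sub>F n in F. norm (ip M (f n) h - ip M g h) \<le> nrm M (f n - g) * nrm M h"
      using assms by (auto intro!: always_eventually ip_Cauchy_Schwarz sq_diff simp flip: ip_diff_left)
    show "((\<lambda>n. nrm M (f n - g) * nrm M h) \<longlongrightarrow> 0) F"
      using tendsto_mult_left_zero[OF assms(4)] .
  qed
  then show ?thesis by (simp add: LIM_zero_iff)
qed

lemma nn_integral_sq:
  assumes "f \<in> sq_integrable M"
  shows "(\<integral>\<^sup>+x. ennreal ((cmod (f x))\<^sup>2) \<partial>M) = ennreal ((nrm M f)\<^sup>2)"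
  unfolding nrm_power2 by (rule nn_integral_eq_integral) (auto simp: sq_integrableD assms)

lemma sq_integrableI_nn:
  assumes "f \<in> borel_measurable M" "(\<integral>\<^sup>+x. ennreal ((cmod (f x))\<^sup>2) \<partial>M) \<le> ennreal (C\<^sup>2)" "C \<ge> 0"
  shows "f \<in> sq_integrable M" "nrm M f \<le> C"
proof -
  have "integrable M (\<lambda>x. (cmod (f x))\<^sup>2)"
    using assms by (intro integrableI_nonneg) (auto simp: le_less_trans less_top)
  then show *: "f \<in> sq_integrable M" using assms by (simp add: sq_integrable_def)
  have "ennreal ((nrm M f)\<^sup>2) \<le> ennreal (C\<^sup>2)" using nn_integral_sq[OF *] assms by simp
  then have "(nrm M f)\<^sup>2 \<le> C\<^sup>2" by simp
  then show "nrm M f \<le> C" using assms(3) by (rule power2_le_imp_le)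
qed

text \<open>Riesz--Fischer for a rapidly converging sequence: the partial sums of $|f_{k+1} - f_k|$ increase and are bounded in
  $L^2$, hence finite almost everywhere, which gives a pointwise limit; Fatou's lemma bounds its distance from $f_n$.\<close>

lemma L2_complete:
  assumes f: "\<And>n::nat. f n \<in> sq_integrable M"
    and fast: "\<And>n. nrm M (f (Suc n) - f n) \<le> (1/2) ^ n"
  obtains g where "g \<in> sq_integrable M" "(\<lambda>n. nrm M (f n - g)) \<longlonglongrightarrow> 0"
proof -
  have [measurable]: "f n \<in> borel_measurable M" for n using f sq_measurable by blast
  define d where "d k x = cmod (f (Suc k) x - f k x)" for k x
  define S where "S n = (\<lambda>x. complex_of_real (\<Sum>k<n. d k x))" for n
  have dsq: "(\<lambda>x. complex_of_real (d k x)) \<in> sq_integrable M"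
    and dn: "nrm M (\<lambda>x. complex_of_real (d k x)) \<le> (1/2)^k" for k
    using sq_diff[OF f f, of "Suc k" k] fast[of k]
    by (auto simp: sq_integrable_def d_def nrm_def)
  have S: "S n \<in> sq_integrable M \<and> nrm M (S n) \<le> (\<Sum>k<n. (1/2)^k)" for n
  proof (induction n)
    case 0 have "S 0 = 0" by (auto simp: S_def)
    then show ?case by (simp only: sq_zero nrm_zero) simp
  next
    case (Suc n)
    have "S (Suc n) = S n + (\<lambda>x. complex_of_real (d n x))" by (auto simp: S_def)
    moreover have "S n + (\<lambda>x. complex_of_real (d n x)) \<in> sq_integrable M"
      using Suc dsq by (blast intro: sq_add)
    moreover have "nrm M (S n + (\<lambda>x. complex_of_real (d n x))) \<le> (\<Sum>k<Suc n. (1/2)^k)"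
      using conjunct2[OF Suc] nrm_triangle[OF conjunct1[OF Suc] dsq, of n] dn[of n]
      unfolding sum.lessThan_Suc by linarith
    ultimately show ?case by (simp only:)
  qed
  have geo: "(\<Sum>k<n. (1/2::real)^k) \<le> 2" for n
    by (simp add: sum_gp_strict)
  have "(\<integral>\<^sup>+x. (SUP n. ennreal ((cmod (S n x))\<^sup>2)) \<partial>M) = (SUP n. (\<integral>\<^sup>+x. ennreal ((cmod (S n x))\<^sup>2) \<partial>M))"
  proof (rule nn_integral_monotone_convergence_SUP)
    show "incseq (\<lambda>n x. ennreal ((cmod (S n x))\<^sup>2))"
    proof (intro incseq_SucI le_funI ennreal_leI power_mono)
      fix n x
      have "cmod (S n x) = (\<Sum>k<n. d k x)" for n
        unfolding S_def by (subst norm_of_real) (simp add: d_def sum_nonneg)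
      then show "cmod (S n x) \<le> cmod (S (Suc n) x)" by (simp add: d_def)
    qed simp
    show "(\<lambda>x. ennreal ((cmod (S n x))\<^sup>2)) \<in> borel_measurable M" for n
      using sq_measurable[OF conjunct1[OF S[of n]]] by measurable
  qed
  also have "\<dots> \<le> ennreal 4"
  proof (rule SUP_least)
    fix n
    have "nrm M (S n) \<le> 2" using S[of n] geo[of n] by linarith
    then have "(nrm M (S n))\<^sup>2 \<le> 2\<^sup>2" by (intro power_mono) auto
    then show "(\<integral>\<^sup>+x. ennreal ((cmod (S n x))\<^sup>2) \<partial>M) \<le> ennreal 4"
      using S[of n] by (simp add: nn_integral_sq ennreal_le_iff[of 4, simplified])
  qed
  finally have fin: "(\<integral>\<^sup>+x. (SUP n. ennreal ((cmod (S n x))\<^sup>2)) \<partial>M) \<noteq> \<infinity>" by (auto simp: top_unique)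
  have "AE x in M. (SUP n. ennreal ((cmod (S n x))\<^sup>2)) \<noteq> \<infinity>"
  proof (rule nn_integral_PInf_AE[OF _ fin])
    have [measurable]: "S n \<in> borel_measurable M" for n using S sq_measurable by blast
    show "(\<lambda>x. SUP n. ennreal ((cmod (S n x))\<^sup>2)) \<in> borel_measurable M" by measurable
  qed
  then have conv: "AE x in M. convergent (\<lambda>n. f n x)"
  proof eventually_elim
    case (elim x)
    then obtain C where C: "(SUP n. ennreal ((cmod (S n x))\<^sup>2)) = ennreal C" "C \<ge> 0"
      by (cases "SUP n. ennreal ((cmod (S n x))\<^sup>2)") auto
    have "(\<Sum>k<n. d k x) \<le> sqrt C" for n
    proof (rule real_le_rsqrt)
      have "ennreal ((cmod (S n x))\<^sup>2) \<le> ennreal C" unfolding C(1)[symmetric] by (rule SUP_upper) simp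
      then have "(cmod (S n x))\<^sup>2 \<le> C" using C(2) by (simp add: ennreal_le_iff)
      then show "(\<Sum>k<n. d k x)\<^sup>2 \<le> C" by (simp add: S_def del: of_real_sum)
    qed
    then have "summable (\<lambda>k. d k x)" by (intro bounded_imp_summable[where B="sqrt C"])
       (auto simp: d_def lessThan_Suc_atMost[symmetric] simp del: sum.lessThan_Suc)
    then have "summable (\<lambda>k. f (Suc k) x - f k x)" unfolding d_def by (rule summable_norm_cancel)
    then have "convergent (\<lambda>n. \<Sum>k<n. f (Suc k) x - f k x)" by (simp add: summable_iff_convergent)
    then have "convergent (\<lambda>n. f n x - f 0 x)" by (simp only: sum_lessThan_telescope[of "\<lambda>k. f k x"])
    from convergent_add[OF this convergent_const[of "f 0 x"]] show ?case by simp
  qed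
  define g where "g x = lim (\<lambda>n. f n x)" for x
  have [measurable]: "g \<in> borel_measurable M"
    unfolding g_def by (rule borel_measurable_lim_metric) simp
  have nm: "nrm M (f m - f n) \<le> 2 * (1/2)^n" if "n \<le> m" for m n
  proof -
    have "nrm M (f (n + k) - f n) \<le> (1/2)^n * (\<Sum>i<k. (1/2)^i)" for k
    proof (induction k)
      case 0
      show ?case by (simp add: nrm_def)
    next
      case (Suc k)
      have "nrm M (f (n + Suc k) - f n) \<le> nrm M (f (Suc (n + k)) - f (n + k)) + nrm M (f (n + k) - f n)"
        using nrm_triangle_diff[OF f f f, of "Suc (n + k)" n "n + k"] by (simp only: add_Suc_right)
      also have "\<dots> \<le> (1/2)^(n + k) + (1/2)^n * (\<Sum>i<k. (1/2)^i)" by (intro add_mono fast Suc)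
      also have "\<dots> = (1/2)^n * (\<Sum>i<Suc k. (1/2)^i)" by (simp add: distrib_left power_add)
      finally show ?case .
    qed
    from this[of "m - n"] have "nrm M (f m - f n) \<le> (1/2)^n * (\<Sum>i<m - n. (1/2)^i)"
      unfolding le_add_diff_inverse[OF that] .
    also have "\<dots> \<le> (1/2)^n * 2" by (intro mult_left_mono geo) simp
    finally show ?thesis by simp
  qed
  have fg: "f n - g \<in> sq_integrable M \<and> nrm M (f n - g) \<le> 2 * (1/2)^n" for n
  proof -
    have "(\<integral>\<^sup>+x. ennreal ((cmod ((f n - g) x))\<^sup>2) \<partial>M)
        = (\<integral>\<^sup>+x. liminf (\<lambda>m. ennreal ((cmod ((f m - f n) x))\<^sup>2)) \<partial>M)"
    proof (rule nn_integral_cong_AE, use conv in eventually_elim)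
      case (elim x)
      then have "(\<lambda>m. f m x) \<longlonglongrightarrow> g x" unfolding g_def by (simp add: convergent_LIMSEQ_iff)
      then have "(\<lambda>m. ennreal ((cmod (f m x - f n x))\<^sup>2)) \<longlonglongrightarrow> ennreal ((cmod (g x - f n x))\<^sup>2)"
        by (intro tendsto_ennrealI tendsto_intros)
      from lim_imp_Liminf[OF _ this] show ?case by (simp add: norm_minus_commute)
    qed
    also have "\<dots> \<le> liminf (\<lambda>m. \<integral>\<^sup>+x. ennreal ((cmod ((f m - f n) x))\<^sup>2) \<partial>M)"
      by (rule nn_integral_liminf) simp
    also have "\<dots> \<le> ennreal ((2 * (1/2)^n)\<^sup>2)"
    proof (rule Liminf_le)
      show "\<forall>\<^sub>F m in sequentially. (\<integral>\<^sup>+x. ennreal ((cmod ((f m - f n) x))\<^sup>2) \<partial>M) \<le> ennreal ((2 * (1/2)^n)\<^sup>2)"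
        using eventually_ge_at_top[of n]
      proof eventually_elim
        case (elim m)
        have "(nrm M (f m - f n))\<^sup>2 \<le> (2 * (1/2)^n)\<^sup>2" using nm[OF elim] by (intro power_mono) auto
        then show ?case using nn_integral_sq[OF sq_diff[OF f f, of m n]] by (simp add: ennreal_leI)
      qed
    qed simp
    finally have le: "(\<integral>\<^sup>+x. ennreal ((cmod ((f n - g) x))\<^sup>2) \<partial>M) \<le> ennreal ((2 * (1/2)^n)\<^sup>2)" .
    have "f n - g \<in> borel_measurable M" by (simp add: fun_diff_def)
    then show ?thesis by (intro conjI sq_integrableI_nn[OF _ le]) simp_all
  qed
  have "f 0 - (f 0 - g) = g" by (simp add: fun_eq_iff)
  then have "g \<in> sq_integrable M" using sq_diff[OF f conjunct1[OF fg], of 0 0] by (simp only:)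
  moreover have "(\<lambda>n. nrm M (f n - g)) \<longlonglongrightarrow> 0"
  proof (rule Lim_null_comparison)
    show "\<forall>\<^sub>F n in sequentially. norm (nrm M (f n - g)) \<le> 2 * (1/2)^n" using fg by simp
    show "(\<lambda>n. 2 * (1/2)^n :: real) \<longlonglongrightarrow> 0"
      using tendsto_mult_right_zero[OF LIMSEQ_power_zero[of "1/2::real"]] by simp
  qed
  ultimately show ?thesis using that by blast
qed

text \<open>The orthogonal projection of \<^term>\<open>f\<close> to the closure of \<^term>\<open>S\<close>, found as the limit of a minimising sequence in
  \<^term>\<open>S\<close>, which is a Cauchy sequence by the parallelogram identity.\<close>

lemma L2_projection:
  assumes S: "cfun.subspace S" and Ssq: "S \<subseteq> sq_integrable M" and f: "f \<in> sq_integrable M"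
  obtains s g where "\<And>n::nat. s n \<in> S" "g \<in> sq_integrable M" "(\<lambda>n. nrm M (s n - g)) \<longlonglongrightarrow> 0"
    "\<And>v. v \<in> S \<Longrightarrow> ip M (f - g) v = 0"
proof -
  define D where "D = (\<lambda>s. (nrm M (f - s))\<^sup>2) ` S"
  define d where "d = Inf D"
  have D: "D \<noteq> {}" "bdd_below D" using cfun.subspace_0[OF S] by (auto simp: D_def intro: bdd_belowI[of _ 0])
  have dle: "d \<le> (nrm M (f - s))\<^sup>2" if "s \<in> S" for s
    unfolding d_def using that D by (intro cInf_lower) (auto simp: D_def)
  have "\<exists>s\<in>S. (nrm M (f - s))\<^sup>2 < d + (1/4)^n / 4" for n
    using cInf_lessD[OF D(1), of "d + (1/4)^n / 4"] by (auto simp: d_def D_def)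
  then obtain s where s: "s n \<in> S" and sd: "(nrm M (f - s n))\<^sup>2 < d + (1/4)^n / 4" for n by metis
  have ssq: "s n \<in> sq_integrable M" for n using s Ssq by auto
  have "nrm M (s (Suc n) - s n) \<le> (1/2)^n" for n
  proof (rule power2_le_imp_le)
    let ?u = "f - s n" and ?v = "f - s (Suc n)"
    let ?m = "cscale (1/2) (s n + s (Suc n))"
    have u: "?u \<in> sq_integrable M" and v: "?v \<in> sq_integrable M" by (auto simp: sq_diff f ssq)
    have m: "?m \<in> S" by (intro cfun.subspace_scale[OF S] cfun.subspace_add[OF S] s)
    have "?u + ?v = cscale 2 (f - ?m)" by (auto simp: cscale_def fun_eq_iff field_simps)
    then have "(nrm M (?u + ?v))\<^sup>2 = 4 * (nrm M (f - ?m))\<^sup>2"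
      by (simp add: nrm_cscale power_mult_distrib)
    moreover have "?u - ?v = s (Suc n) - s n" by (auto simp: fun_eq_iff)
    ultimately have "(nrm M (s (Suc n) - s n))\<^sup>2 = 2 * (nrm M ?u)\<^sup>2 + 2 * (nrm M ?v)\<^sup>2 - 4 * (nrm M (f - ?m))\<^sup>2"
      using nrm_add_power2[OF u v] nrm_diff_power2[OF u v] by simp
    also have "\<dots> \<le> 2 * (d + (1/4)^n / 4) + 2 * (d + (1/4)^Suc n / 4) - 4 * d"
      by (intro diff_mono add_mono mult_left_mono less_imp_le[OF sd] dle[OF m]) auto
    also have "\<dots> \<le> (1/4)^n" by simp
    also have "\<dots> = ((1/2)^n)\<^sup>2" by (simp add: power2_eq_square flip: power_mult_distrib)
    finally show "(nrm M (s (Suc n) - s n))\<^sup>2 \<le> ((1/2)^n)\<^sup>2" .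
  qed simp
  from L2_complete[OF ssq this] obtain g where g: "g \<in> sq_integrable M" and lim: "(\<lambda>n. nrm M (s n - g)) \<longlonglongrightarrow> 0" .
  have lim': "(\<lambda>n. (nrm M (f - s n - v))\<^sup>2) \<longlonglongrightarrow> (nrm M (f - g - v))\<^sup>2" if v: "v \<in> sq_integrable M" for v
  proof (intro tendsto_power nrm_tendsto)
    have "f - s n - v - (f - g - v) = g - s n" for n by (auto simp: fun_eq_iff)
    then show "(\<lambda>n. nrm M (f - s n - v - (f - g - v))) \<longlonglongrightarrow> 0"
      using lim by (simp add: nrm_minus[of M g])
  qed (auto simp: sq_diff f ssq g v)
  have "ip M (f - g) v = 0" if v: "v \<in> S" for v
  proof -
    have vsq: "v \<in> sq_integrable M" using v Ssq by auto
    have fg: "f - g \<in> sq_integrable M" by (simp add: sq_diff f g)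
    have up: "(nrm M (f - g))\<^sup>2 \<le> d"
    proof (rule LIMSEQ_le)
      show "(\<lambda>n. (nrm M (f - s n))\<^sup>2) \<longlonglongrightarrow> (nrm M (f - g))\<^sup>2" using lim'[OF sq_zero] by simp
      show "(\<lambda>n. d + (1/4)^n / 4) \<longlonglongrightarrow> d"
        using tendsto_add[OF tendsto_const tendsto_divide[OF LIMSEQ_power_zero[of "1/4::real"] tendsto_const[of 4]]]
        by fastforce
    qed (use sd less_imp_le in auto)
    have low: "d \<le> (nrm M (f - g - w))\<^sup>2" if w: "w \<in> S" for w
    proof (rule LIMSEQ_le_const)
      show "(\<lambda>n. (nrm M (f - s n - w))\<^sup>2) \<longlonglongrightarrow> (nrm M (f - g - w))\<^sup>2" using lim' w Ssq by auto
      have "d \<le> (nrm M (f - s n - w))\<^sup>2" for n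
        using dle[OF cfun.subspace_add[OF S s w], of n] by (simp add: diff_diff_eq)
      then show "\<exists>N. \<forall>n\<ge>N. d \<le> (nrm M (f - s n - w))\<^sup>2" by blast
    qed
    let ?z = "ip M (f - g) v"
    define K where "K = (nrm M v)\<^sup>2 + 1"
    have K: "K > 0" by (simp add: K_def add_nonneg_pos)
    define t where "t = 1 / K"
    have t: "t > 0" using K by (simp add: t_def)
    have "0 \<le> (nrm M (f - g - cscale (of_real t * ?z) v))\<^sup>2 - (nrm M (f - g))\<^sup>2"
      using up low[OF cfun.subspace_scale[OF S v, of "of_real t * ?z"]] by linarith
    also have "\<dots> = t\<^sup>2 * (cmod ?z)\<^sup>2 * (nrm M v)\<^sup>2 - 2 * t * (cmod ?z)\<^sup>2"
    proof -
      have "Re (cnj ?z * ?z) = (cmod ?z)\<^sup>2" by (simp only: cmod_power2) (simp add: power2_eq_square)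
      then show ?thesis using t
        by (simp add: nrm_diff_power2 fg vsq sq_cscale nrm_cscale ip_cscale_right norm_mult power_mult_distrib
            mult.assoc)
    qed
    also have "\<dots> = (cmod ?z)\<^sup>2 * t * (t * (nrm M v)\<^sup>2 - 2)" by (simp add: algebra_simps power2_eq_square)
    finally have "0 \<le> (cmod ?z)\<^sup>2 * t * (t * (nrm M v)\<^sup>2 - 2)" .
    moreover have "t * (nrm M v)\<^sup>2 - 2 < 0"
      using K by (simp add: t_def K_def divide_simps)
    ultimately have "(cmod ?z)\<^sup>2 * t \<le> 0" by (simp add: zero_le_mult_iff)
    then show ?thesis using t by (simp add: mult_le_0_iff)
  qed
  then show ?thesis using that s g lim by blast
qed

text \<open>A total subspace is dense, because its residual after projection is orthogonal to it.\<close>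

lemma L2_dense:
  assumes S: "cfun.subspace S" "S \<subseteq> sq_integrable M" and f: "f \<in> sq_integrable M"
    and total: "\<And>f. f \<in> sq_integrable M \<Longrightarrow> (\<And>v. v \<in> S \<Longrightarrow> ip M f v = 0) \<Longrightarrow> AE x in M. f x = 0"
    and e: "e > 0"
  shows "\<exists>s\<in>S. nrm M (s - f) < e"
proof -
  obtain s g where s: "\<And>n::nat. s n \<in> S" "g \<in> sq_integrable M" "(\<lambda>n. nrm M (s n - g)) \<longlonglongrightarrow> 0"
    "\<And>v. v \<in> S \<Longrightarrow> ip M (f - g) v = 0"
    using L2_projection[OF S f] by blast
  have "AE x in M. (f - g) x = 0" using total[of "f - g"] s f sq_diff by blast
  then have fg: "nrm M (g - f) = 0" using nrm_eq_0_iff[OF sq_diff[OF f s(2)]] by (simp add: nrm_minus)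
  obtain n where n: "nrm M (s n - g) < e"
    using order_tendstoD(2)[OF s(3) e] by (auto simp: eventually_sequentially)
  have "nrm M (s n - f) \<le> nrm M (s n - g) + nrm M (g - f)"
    using s S f by (intro nrm_triangle_diff) auto
  with n fg have "nrm M (s n - f) < e" by linarith
  with s(1) show ?thesis by blast
qed

text \<open>The span of the pairs \<^term>\<open>(u i, v i)\<close> is the graph of an isometry: equality of the Gram matrices gives equality of
  inner products on the whole span. Approximating \<^term>\<open>f\<close> by first components, the second components form a Cauchy
  sequence, and its limit is the image of \<^term>\<open>f\<close>. Working with pairs avoids showing that the map on the span is single valued.\<close>

lemma L2_isometry_extension:
  fixes u v :: "'i \<Rightarrow> 'a \<Rightarrow> complex"
  assumes u: "\<And>i. i \<in> I \<Longrightarrow> u i \<in> sq_integrable M" and v: "\<And>i. i \<in> I \<Longrightarrow> v i \<in> sq_integrable M"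
    and gram: "\<And>i j. i \<in> I \<Longrightarrow> j \<in> I \<Longrightarrow> ip M (v i) (v j) = ip M (u i) (u j)"
    and total: "\<And>f. f \<in> sq_integrable M \<Longrightarrow> (\<And>i. i \<in> I \<Longrightarrow> ip M f (u i) = 0) \<Longrightarrow> AE x in M. f x = 0"
    and f: "f \<in> sq_integrable M"
  obtains h where "h \<in> sq_integrable M" "nrm M h = nrm M f" "\<And>i. i \<in> I \<Longrightarrow> ip M h (v i) = ip M f (u i)"
proof -
  define Z where "Z = cfun2.span {(u i, v i) |i. i \<in> I}"
  have Zsub: "cfun2.subspace Z" by (simp add: Z_def)
  have Zsq: "fst z \<in> sq_integrable M \<and> snd z \<in> sq_integrable M" if "z \<in> Z" for z
    using that unfolding Z_def
  proof (induction rule: cfun2.span_induct_alt)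
    case base show ?case by (simp only: fst_zero snd_zero sq_zero)
  next
    case (step c x y)
    then show ?case by (auto simp only: cscale2_def fst_add snd_add fst_conv snd_conv intro!: u v sq_add sq_cscale)
  qed
  have Zind: "P z" if z: "z \<in> Z" and P0: "P 0"
    and "\<And>c i y. i \<in> I \<Longrightarrow> fst y \<in> sq_integrable M \<Longrightarrow> snd y \<in> sq_integrable M \<Longrightarrow> P y \<Longrightarrow>
      P (cscale c (u i) + fst y, cscale c (v i) + snd y)" for P z
  proof -
    have "(fst z \<in> sq_integrable M \<and> snd z \<in> sq_integrable M) \<and> P z"
      using z unfolding Z_def
    proof (induction rule: cfun2.span_induct_alt)
      case base show ?case by (simp only: fst_zero snd_zero sq_zero P0)
    next
      case (step c x y)
      then obtain i where i: "i \<in> I" "x = (u i, v i)" by auto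
      have *: "cscale2 c x + y = (cscale c (u i) + fst y, cscale c (v i) + snd y)"
        by (simp add: i cscale2_def prod_eq_iff)
      show ?case unfolding * fst_conv snd_conv
        using step i that(3) by (blast intro: sq_add sq_cscale u v)
    qed
    then show ?thesis by simp
  qed
  have Z1: "ip M (snd z) (v i) = ip M (fst z) (u i)" if "z \<in> Z" "i \<in> I" for z i
    by (rule Zind[OF that(1)])
       (simp_all only: ip_zero fst_zero snd_zero fst_conv snd_conv ip_add_left ip_cscale_left u v sq_cscale gram that(2))
  have Z2: "ip M (snd z) (snd w) = ip M (fst z) (fst w)" if "w \<in> Z" "z \<in> Z" for z w
    by (rule Zind[OF that(1)])
       (simp_all only: ip_zero fst_zero snd_zero fst_conv snd_conv ip_add_right ip_cscale_right u v sq_cscale Z1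
          that(2) Zsq[OF that(2)])
  have Znrm: "nrm M (snd z) = nrm M (fst z)" if "z \<in> Z" for z
  proof -
    have "(nrm M (snd z))\<^sup>2 = (nrm M (fst z))\<^sup>2"
      using Z2[OF that that] by (simp only: ip_self of_real_eq_iff)
    then show ?thesis by (simp add: power2_eq_iff_nonneg)
  qed
  have "cfun.subspace (fst ` Z)"
  proof (rule cfun.subspaceI)
    show "0 \<in> fst ` Z" using cfun2.subspace_0[OF Zsub] by (metis fst_zero imageI)
    fix x y c assume "x \<in> fst ` Z"
    then obtain z where z: "z \<in> Z" "x = fst z" by auto
    show "cscale c x \<in> fst ` Z"
      using cfun2.subspace_scale[OF Zsub z(1), of c] z(2) by (force simp: cscale2_def)
    assume "y \<in> fst ` Z"
    then obtain w where w: "w \<in> Z" "y = fst w" by auto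
    show "x + y \<in> fst ` Z"
      using cfun2.subspace_add[OF Zsub z(1) w(1)] z(2) w(2) by (metis fst_add imageI)
  qed
  then have dense: "\<exists>s\<in>fst ` Z. nrm M (s - f) < e" if "e > 0" for e
  proof (rule L2_dense[OF _ _ f _ that])
    show "fst ` Z \<subseteq> sq_integrable M" using Zsq by auto
    fix w assume w: "w \<in> sq_integrable M" and orth: "\<And>v. v \<in> fst ` Z \<Longrightarrow> ip M w v = 0"
    show "AE x in M. w x = 0"
    proof (rule total[OF w])
      fix i assume "i \<in> I"
      then have "(u i, v i) \<in> Z" unfolding Z_def by (intro cfun2.span_base) auto
      then have "u i \<in> fst ` Z" by force
      then show "ip M w (u i) = 0" by (rule orth)
    qed
  qed
  \<comment> \<open>The rate makes consecutive terms at most $(1/2)^n$ apart, as completeness requires.\<close>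
  have "\<forall>n::nat. \<exists>z. z \<in> Z \<and> nrm M (fst z - f) < (1/2)^n / 2"
  proof
    fix n :: nat
    have "\<exists>s\<in>fst ` Z. nrm M (s - f) < (1/2)^n / 2" by (rule dense) simp
    then show "\<exists>z. z \<in> Z \<and> nrm M (fst z - f) < (1/2)^n / 2" by blast
  qed
  from choice[OF this] obtain z where z: "z n \<in> Z" and zf: "nrm M (fst (z n) - f) < (1/2)^n / 2" for n :: nat
    by blast
  have zsq: "fst (z n) \<in> sq_integrable M" "snd (z n) \<in> sq_integrable M" for n using Zsq[OF z] by auto
  have "nrm M (snd (z (Suc n)) - snd (z n)) \<le> (1/2)^n" for n
  proof -
    have "nrm M (snd (z (Suc n)) - snd (z n)) = nrm M (fst (z (Suc n)) - fst (z n))"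
      using Znrm[OF cfun2.subspace_diff[OF Zsub z z, of "Suc n" n]] by simp
    also have "\<dots> \<le> nrm M (fst (z (Suc n)) - f) + nrm M (f - fst (z n))"
      by (intro nrm_triangle_diff zsq f)
    also have "\<dots> \<le> (1/2)^Suc n / 2 + (1/2)^n / 2"
      using zf[of n] zf[of "Suc n"] by (simp add: nrm_minus[of M f])
    also have "\<dots> \<le> (1/2)^n" by simp
    finally show ?thesis .
  qed
  from L2_complete[OF zsq(2) this] obtain h where h: "h \<in> sq_integrable M"
    and lh: "(\<lambda>n. nrm M (snd (z n) - h)) \<longlonglongrightarrow> 0" .
  have lf: "(\<lambda>n. nrm M (fst (z n) - f)) \<longlonglongrightarrow> 0"
  proof (rule Lim_null_comparison)
    show "\<forall>\<^sub>F n in sequentially. norm (nrm M (fst (z n) - f)) \<le> (1/2)^n / 2"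
      by (intro always_eventually allI) (simp only: real_norm_def abs_of_nonneg[OF nrm_nonneg] less_imp_le[OF zf])
    show "(\<lambda>n. (1/2)^n / 2 :: real) \<longlonglongrightarrow> 0"
      using tendsto_divide[OF LIMSEQ_power_zero[of "1/2::real"] tendsto_const[of 2]] by simp
  qed
  show ?thesis
  proof
    show "h \<in> sq_integrable M" by (rule h)
    show "nrm M h = nrm M f"
      using nrm_tendsto[OF zsq(2) h lh] nrm_tendsto[OF zsq(1) f lf] Znrm[OF z] LIMSEQ_unique by simp
    fix i assume i: "i \<in> I"
    show "ip M h (v i) = ip M f (u i)"
      using ip_tendsto_left[OF zsq(2) h v[OF i] lh] ip_tendsto_left[OF zsq(1) f u[OF i] lf] Z1[OF z i]
        LIMSEQ_unique by simp
  qed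
qed

section \<open>Partial derivatives of polynomials\<close>

text \<open>A relational form of \<^const>\<open>partial_deriv\<close>, which carries differentiability and can be composed by rules.\<close>

definition has_pd :: "(real^'n \<Rightarrow> complex) \<Rightarrow> 'n \<Rightarrow> real^'n \<Rightarrow> complex \<Rightarrow> bool" where
  "has_pd f i x d \<longleftrightarrow> ((\<lambda>t. f (x + t *\<^sub>R axis i 1)) has_vector_derivative d) (at 0)"

lemma partial_deriv_eq: "has_pd f i x d \<Longrightarrow> partial_deriv i f x = d"
  by (simp add: has_pd_def partial_deriv_def vector_derivative_at)

lemma has_pd_const: "has_pd (\<lambda>x. c) i x 0"
  by (simp add: has_pd_def)

lemma has_pd_add: "has_pd f i x d \<Longrightarrow> has_pd g i x e \<Longrightarrow> has_pd (\<lambda>x. f x + g x) i x (d + e)"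
  unfolding has_pd_def by (rule has_vector_derivative_add)

lemma has_pd_cmult: "has_pd f i x d \<Longrightarrow> has_pd (\<lambda>x. c * f x) i x (c * d)"
  unfolding has_pd_def by (rule has_vector_derivative_mult_right)

lemma has_pd_mult: "has_pd f i x d \<Longrightarrow> has_pd g i x e \<Longrightarrow> has_pd (\<lambda>x. f x * g x) i x (f x * e + d * g x)"
  unfolding has_pd_def using has_vector_derivative_mult[of "\<lambda>t. f (x + t *\<^sub>R axis i 1)" d 0 UNIV "\<lambda>t. g (x + t *\<^sub>R axis i 1)" e]
  by simp

lemma has_pd_coord: "has_pd (\<lambda>x. complex_of_real (x $ j)) i x (if j = i then 1 else 0)"
proof -
  have "((\<lambda>t. complex_of_real (x $ j + t * (if j = i then 1 else 0))) has_vector_derivative of_real (if j = i then 1 else 0)) (at 0)"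
    by (intro has_vector_derivative_of_real) (auto intro!: derivative_eq_intros)
  then show ?thesis unfolding has_pd_def by (simp add: axis_def if_distrib cong: if_cong)
qed

lemma norm_add_axis: "(norm (x + t *\<^sub>R axis i 1 :: real^'n))\<^sup>2 = (norm x)\<^sup>2 + 2 * t * x $ i + t\<^sup>2"
  unfolding power2_norm_eq_inner
  by (simp add: inner_add_left inner_add_right inner_axis inner_axis' power2_eq_square algebra_simps)

lemma has_pd_radial:
  assumes "(g has_vector_derivative g') (at ((norm x)\<^sup>2))"
  shows "has_pd (\<lambda>x. g ((norm x)\<^sup>2)) i x (complex_of_real (2 * x $ i) * g')"
proof -
  have "((\<lambda>t. (norm x)\<^sup>2 + 2 * t * x $ i + t\<^sup>2) has_real_derivative 2 * x $ i) (at 0)"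
    by (auto intro!: derivative_eq_intros)
  then have "((\<lambda>t. (norm x)\<^sup>2 + 2 * t * x $ i + t\<^sup>2) has_vector_derivative 2 * x $ i) (at 0)"
    by (simp add: has_real_derivative_iff_has_vector_derivative)
  from vector_diff_chain_at[OF this, of g g'] assms show ?thesis
    unfolding has_pd_def norm_add_axis by (simp add: o_def scaleR_conv_of_real)
qed

lemma euler_eq:
  assumes "\<And>i. has_pd f i x (d i)"
  shows "euler f x = (\<Sum>i\<in>UNIV. complex_of_real (x $ i) * d i)"
  using partial_deriv_eq[OF assms] by (simp add: euler_def)

lemma laplacian_eq:
  assumes "\<And>i x. has_pd f i x (d i x)" "\<And>i. has_pd (d i) i x (e i)"
  shows "laplacian f x = (\<Sum>i\<in>UNIV. e i)"
proof -
  have "partial_deriv i f = d i" for i using partial_deriv_eq[OF assms(1)] by auto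
  then show ?thesis using partial_deriv_eq[OF assms(2)] by (simp add: laplacian_def)
qed

lemma hp_subspace: "cfun.subspace (homogeneous_poly m)"
  by (simp add: homogeneous_poly_def)

lemma hp_0: "(\<lambda>x. 0) \<in> homogeneous_poly m"
  using cfun.subspace_0[OF hp_subspace] by (simp add: zero_fun_def)

lemma hp_add: "p \<in> homogeneous_poly m \<Longrightarrow> q \<in> homogeneous_poly m \<Longrightarrow> (\<lambda>x. p x + q x) \<in> homogeneous_poly m"
  using cfun.subspace_add[OF hp_subspace] by (fastforce simp: plus_fun_def)

lemma hp_cmult: "p \<in> homogeneous_poly m \<Longrightarrow> (\<lambda>x. c * p x) \<in> homogeneous_poly m"
  using cfun.subspace_scale[OF hp_subspace] by (fastforce simp: cscale_def)

lemma hp_diff: "p \<in> homogeneous_poly m \<Longrightarrow> q \<in> homogeneous_poly m \<Longrightarrow> (\<lambda>x. p x - q x) \<in> homogeneous_poly m"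
  using hp_add[of p m "\<lambda>x. (-1) * q x"] hp_cmult[of q m "-1"] by simp

lemma hp_sum: "(\<And>a. a \<in> A \<Longrightarrow> p a \<in> homogeneous_poly m) \<Longrightarrow> (\<lambda>x. \<Sum>a\<in>A. p a x) \<in> homogeneous_poly m"
  by (induction A rule: infinite_finite_induct) (auto intro: hp_0 hp_add)

lemma hp_monomial: "(\<Sum>i\<in>UNIV. \<alpha> i) = m \<Longrightarrow> monomial \<alpha> \<in> homogeneous_poly m"
  unfolding homogeneous_poly_def by (rule cfun.span_base) auto

lemma hp_induct [consumes 1, case_names zero step]:
  assumes "p \<in> homogeneous_poly m" "P (\<lambda>x. 0)"
    "\<And>c \<alpha> q. (\<Sum>i\<in>UNIV. \<alpha> i) = m \<Longrightarrow> q \<in> homogeneous_poly m \<Longrightarrow> P q \<Longrightarrow> P (\<lambda>x. c * monomial \<alpha> x + q x)"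
  shows "P p"
proof -
  have "p \<in> homogeneous_poly m \<and> P p"
    using assms(1) unfolding homogeneous_poly_def
  proof (induction rule: cfun.span_induct_alt)
    case base
    then show ?case using assms(2) hp_0 by (simp add: zero_fun_def homogeneous_poly_def)
  next
    case (step c x y)
    then obtain \<alpha> where \<alpha>: "(\<Sum>i\<in>UNIV. \<alpha> i) = m" "x = monomial \<alpha>" by auto
    have "cscale c x + y = (\<lambda>x. c * monomial \<alpha> x + y x)" by (simp add: fun_eq_iff cscale_def \<alpha>)
    then show ?case using step \<alpha> assms(3)[of \<alpha> y c] hp_add[OF hp_cmult[OF hp_monomial[OF \<alpha>(1)]], of y c]
      by (simp add: homogeneous_poly_def)
  qed
  then show ?thesis by simp
qed

lemma monomial_mult: "monomial \<alpha> x * monomial \<beta> x = monomial (\<lambda>i. \<alpha> i + \<beta> i) x"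
  by (simp add: monomial_def power_add prod.distrib)

lemma hp_mult:
  assumes p: "p \<in> homogeneous_poly m" and q: "q \<in> homogeneous_poly n"
  shows "(\<lambda>x. p x * q x) \<in> homogeneous_poly (m + n)"
  using p
proof (induction rule: hp_induct)
  case zero show ?case by (simp add: hp_0)
next
  case (step c \<alpha> p')
  have "(\<lambda>x. monomial \<alpha> x * q x) \<in> homogeneous_poly (m + n)"
    using q
  proof (induction rule: hp_induct)
    case zero show ?case by (simp add: hp_0)
  next
    case (step d \<beta> q')
    have "monomial (\<lambda>i. \<alpha> i + \<beta> i) \<in> homogeneous_poly (m + n)"
      using step \<open>sum \<alpha> UNIV = m\<close> by (intro hp_monomial) (simp add: sum.distrib)
    from hp_add[OF hp_cmult[OF this] step(3), of d] show ?case
      by (simp add: distrib_left monomial_mult[symmetric] mult.left_commute)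
  qed
  from hp_add[OF hp_cmult[OF this] step(3), of c] show ?case by (simp add: distrib_right mult.assoc)
qed

lemma hp_const: "(\<lambda>x. c) \<in> homogeneous_poly 0"
  using hp_cmult[OF hp_monomial[of "\<lambda>i. 0" 0], of c] by (simp add: monomial_def)

lemma hp_coord: "(\<lambda>x. complex_of_real (x $ i)) \<in> homogeneous_poly 1"
proof -
  have "monomial (\<lambda>j. if j = i then 1 else 0) = (\<lambda>x. complex_of_real (x $ i))"
    by (simp add: monomial_def fun_eq_iff if_distrib prod.delta cong: if_cong)
  with hp_monomial[of "\<lambda>j. if j = i then 1 else 0" 1] show ?thesis by simp
qed

lemma norm_sq_coord: "complex_of_real ((norm (x::real^'n))\<^sup>2) = (\<Sum>i\<in>UNIV. complex_of_real (x $ i) * complex_of_real (x $ i))"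
  unfolding power2_norm_eq_inner by (simp add: inner_vec_def)

lemma hp_norm_sq: "(\<lambda>x::real^'n. complex_of_real ((norm x)\<^sup>2)) \<in> homogeneous_poly 2"
  unfolding norm_sq_coord using hp_mult[OF hp_coord hp_coord] by (intro hp_sum) (simp add: numeral_2_eq_2)

lemma hp_norm_sq_power: "(\<lambda>x::real^'n. complex_of_real ((norm x)\<^sup>2) ^ j) \<in> homogeneous_poly (2 * j)"
proof (induction j)
  case 0 show ?case using hp_const[of 1] by simp
next
  case (Suc j) then show ?case using hp_mult[OF hp_norm_sq Suc] by simp
qed

lemma hp_cnj: "p \<in> homogeneous_poly m \<Longrightarrow> (\<lambda>x. cnj (p x)) \<in> homogeneous_poly m"
proof (induction rule: hp_induct)
  case (step c \<alpha> q)
  have "cnj (monomial \<alpha> x) = monomial \<alpha> x" for x by (simp add: monomial_def)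
  with hp_add[OF hp_cmult[OF hp_monomial[OF step(1)]] step(3), of "cnj c"] show ?case by simp
qed (simp add: hp_0)

lemma hp_homogeneous: "p \<in> homogeneous_poly m \<Longrightarrow> p (t *\<^sub>R x) = of_real t ^ m * p x"
proof (induction rule: hp_induct)
  case (step c \<alpha> q)
  have "monomial \<alpha> (t *\<^sub>R x) = of_real t ^ m * monomial \<alpha> x"
    using step(1) by (simp add: monomial_def power_mult_distrib prod.distrib power_sum[symmetric])
  with step show ?case by (simp add: algebra_simps)
qed simp

lemma hp_continuous: "p \<in> homogeneous_poly m \<Longrightarrow> continuous_on S p"
proof (induction rule: hp_induct)
  case (step c \<alpha> q)
  have "continuous_on S (monomial \<alpha>)" unfolding monomial_def[abs_def] by (intro continuous_intros)
  with step show ?case by (intro continuous_intros)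
qed simp

lemma hp_bound:
  "p \<in> homogeneous_poly m \<Longrightarrow> \<exists>C\<ge>0. \<forall>x. cmod (p x) \<le> C * norm x ^ m"
proof (induction rule: hp_induct)
  case zero show ?case by (auto intro: exI[of _ 0])
next
  case (step c \<alpha> q)
  then obtain C where C: "C \<ge> 0" "\<And>x. cmod (q x) \<le> C * norm x ^ m" by auto
  have mon: "cmod (monomial \<alpha> x) \<le> norm x ^ m" for x
  proof -
    have "cmod (monomial \<alpha> x) = (\<Prod>i\<in>UNIV. \<bar>x $ i\<bar> ^ \<alpha> i)"
      by (simp add: monomial_def norm_power flip: prod_norm)
    also have "\<dots> \<le> (\<Prod>i\<in>UNIV. norm x ^ \<alpha> i)"
      by (intro prod_mono conjI power_mono component_le_norm_cart) auto
    also have "\<dots> = norm x ^ m" using step(1) by (simp add: power_sum[symmetric])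
    finally show ?thesis .
  qed
  show ?case
  proof (intro exI[of _ "cmod c + C"] conjI allI)
    fix x
    have "cmod (c * monomial \<alpha> x + q x) \<le> cmod c * cmod (monomial \<alpha> x) + cmod (q x)"
      by (rule order_trans[OF norm_triangle_ineq]) (simp add: norm_mult)
    also have "\<dots> \<le> cmod c * norm x ^ m + C * norm x ^ m"
      by (intro add_mono mult_left_mono mon C) auto
    finally show "cmod (c * monomial \<alpha> x + q x) \<le> (cmod c + C) * norm x ^ m" by (simp add: distrib_right)
  qed (use C in auto)
qed

lemma has_pd_monomial:
  "has_pd (monomial \<alpha>) i x (of_nat (\<alpha> i) * monomial (\<alpha>(i := \<alpha> i - 1)) x)"
proof -
  let ?c = "\<Prod>j\<in>UNIV - {i}. complex_of_real (x $ j) ^ \<alpha> j"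
  have split: "monomial \<beta> y = complex_of_real (y $ i) ^ \<beta> i * (\<Prod>j\<in>UNIV - {i}. complex_of_real (y $ j) ^ \<beta> j)" for \<beta> and y
    unfolding monomial_def by (rule prod.remove) auto
  have "((\<lambda>t. complex_of_real ((x $ i + t) ^ \<alpha> i) * ?c) has_vector_derivative
      of_real (of_nat (\<alpha> i) * (x $ i) ^ (\<alpha> i - 1)) * ?c) (at 0)"
    by (intro has_vector_derivative_mult_left has_vector_derivative_of_real)
       (auto intro!: derivative_eq_intros)
  moreover have "monomial \<alpha> (x + t *\<^sub>R axis i 1) = complex_of_real ((x $ i + t) ^ \<alpha> i) * ?c" for t
    unfolding split by (simp add: axis_def)
  moreover have "monomial (\<alpha>(i := \<alpha> i - 1)) x = complex_of_real (x $ i) ^ (\<alpha> i - 1) * ?c"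
    unfolding split[of "\<alpha>(i := \<alpha> i - 1)"] by (intro arg_cong2[where f = "(*)"] prod.cong) auto
  ultimately show ?thesis unfolding has_pd_def by (simp add: mult.assoc)
qed

lemma hp_deriv_exists:
  fixes p :: "real^'n \<Rightarrow> complex"
  assumes "p \<in> homogeneous_poly m"
  shows "\<exists>D. (\<forall>i. D i \<in> homogeneous_poly (m - 1)) \<and> (m = 0 \<longrightarrow> (\<forall>i. D i = (\<lambda>x. 0))) \<and> (\<forall>i x. has_pd p i x (D i x)) \<and>
     (\<forall>x. (\<Sum>i\<in>UNIV. complex_of_real (x $ i) * D i x) = of_nat m * p x)"
  using assms
proof (induction rule: hp_induct)
  case zero
  show ?case by (intro exI[of _ "\<lambda>i x. 0"]) (simp add: hp_0 has_pd_const)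
next
  case (step c \<alpha> q)
  from step(3) obtain D where D': "(\<forall>i. D i \<in> homogeneous_poly (m - 1)) \<and> (m = 0 \<longrightarrow> (\<forall>i. D i = (\<lambda>x. 0))) \<and>
     (\<forall>i x. has_pd q i x (D i x)) \<and> (\<forall>x. (\<Sum>i\<in>UNIV. complex_of_real (x $ i) * D i x) = of_nat m * q x)"
    by (elim exE)
  then have D: "\<And>i. D i \<in> homogeneous_poly (m - 1)" "m = 0 \<Longrightarrow> (\<forall>i. D i = (\<lambda>x. 0))" "\<And>i x. has_pd q i x (D i x)"
    "\<And>x. (\<Sum>i\<in>UNIV. complex_of_real (x $ i) * D i x) = of_nat m * q x" by simp_all
  let ?D = "\<lambda>i x. c * (of_nat (\<alpha> i) * monomial (\<alpha>(i := \<alpha> i - 1)) x) + D i x"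
  have x: "complex_of_real (x $ i) * (of_nat (\<alpha> i) * monomial (\<alpha>(i := \<alpha> i - 1)) x) = of_nat (\<alpha> i) * monomial \<alpha> x" for i x
  proof (cases "\<alpha> i = 0")
    case False
    have split: "monomial \<beta> x = complex_of_real (x $ i) ^ \<beta> i * (\<Prod>j\<in>UNIV - {i}. complex_of_real (x $ j) ^ \<beta> j)" for \<beta>
      unfolding monomial_def by (rule prod.remove) auto
    have "(\<Prod>j\<in>UNIV - {i}. complex_of_real (x $ j) ^ (\<alpha>(i := \<alpha> i - 1)) j) = (\<Prod>j\<in>UNIV - {i}. complex_of_real (x $ j) ^ \<alpha> j)"
      by (rule prod.cong) auto
    then show ?thesis using False unfolding split[of \<alpha>] split[of "\<alpha>(i := \<alpha> i - 1)"]
      by (cases "\<alpha> i") simp_all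
  qed simp
  show ?case
  proof (intro exI[of _ ?D] conjI allI impI)
    fix i
    have "\<alpha> i = 0 \<or> (\<Sum>j\<in>UNIV. (\<alpha>(i := \<alpha> i - 1)) j) = m - 1"
    proof (cases "\<alpha> i = 0")
      case False
      have "(\<Sum>j\<in>UNIV. (\<alpha>(i := \<alpha> i - 1)) j) = (\<alpha> i - 1) + (\<Sum>j\<in>UNIV - {i}. \<alpha> j)"
        by (subst sum.remove[of _ i]) (auto intro: sum.cong)
      moreover have "m = \<alpha> i + (\<Sum>j\<in>UNIV - {i}. \<alpha> j)" unfolding step(1)[symmetric] by (rule sum.remove) auto
      ultimately show ?thesis using False by simp
    qed simp
    then have "(\<lambda>x. of_nat (\<alpha> i) * monomial (\<alpha>(i := \<alpha> i - 1)) x) \<in> homogeneous_poly (m - 1)"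
    proof
      assume "\<alpha> i = 0"
      then show ?thesis using hp_0 by simp
    next
      assume "(\<Sum>j\<in>UNIV. (\<alpha>(i := \<alpha> i - 1)) j) = m - 1"
      then show ?thesis by (intro hp_cmult hp_monomial)
    qed
    from hp_add[OF hp_cmult[OF this] D(1)] show "?D i \<in> homogeneous_poly (m - 1)" .
    show "?D i = (\<lambda>x. 0)" if "m = 0"
      using that D(2) step(1) by (auto simp: fun_eq_iff)
    show "has_pd (\<lambda>x. c * monomial \<alpha> x + q x) i x (?D i x)" for x
      by (intro has_pd_add has_pd_cmult has_pd_monomial D)
  next
    fix x
    have "(\<Sum>i\<in>UNIV. complex_of_real (x $ i) * ?D i x)
       = (\<Sum>i\<in>UNIV. c * (of_nat (\<alpha> i) * monomial \<alpha> x)) + (\<Sum>i\<in>UNIV. complex_of_real (x $ i) * D i x)"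
      unfolding sum.distrib[symmetric]
    proof (rule sum.cong)
      fix i show "complex_of_real (x $ i) * ?D i x = c * (of_nat (\<alpha> i) * monomial \<alpha> x) + complex_of_real (x $ i) * D i x"
        using x[of x i] by (simp add: distrib_left mult.left_commute[of _ c])
    qed simp
    also have "(\<Sum>i\<in>UNIV. c * (of_nat (\<alpha> i) * monomial \<alpha> x)) = of_nat m * (c * monomial \<alpha> x)"
      unfolding step(1)[symmetric] by (simp add: sum_distrib_right sum_distrib_left mult.left_commute)
    finally show "(\<Sum>i\<in>UNIV. complex_of_real (x $ i) * ?D i x) = of_nat m * (c * monomial \<alpha> x + q x)"
      by (simp only: D(4) distrib_left[of "of_nat m"])
  qed
qed

lemma hp_pd:
  assumes "p \<in> homogeneous_poly m"
  shows "has_pd p i x (partial_deriv i p x)" "partial_deriv i p \<in> homogeneous_poly (m - 1)"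
    "m = 0 \<Longrightarrow> partial_deriv i p = (\<lambda>x. 0)"
    "(\<Sum>i\<in>UNIV. complex_of_real (x $ i) * partial_deriv i p x) = of_nat m * p x"
proof -
  from hp_deriv_exists[OF assms] obtain D where D': "(\<forall>i. D i \<in> homogeneous_poly (m - 1)) \<and>
     (m = 0 \<longrightarrow> (\<forall>i. D i = (\<lambda>x. 0))) \<and>
     (\<forall>i x. has_pd p i x (D i x)) \<and> (\<forall>x. (\<Sum>i\<in>UNIV. complex_of_real (x $ i) * D i x) = of_nat m * p x)"
    by (elim exE)
  then have D: "\<And>i. D i \<in> homogeneous_poly (m - 1)" "m = 0 \<Longrightarrow> (\<forall>i. D i = (\<lambda>x. 0))" "\<And>i x. has_pd p i x (D i x)"
    "\<And>x. (\<Sum>i\<in>UNIV. complex_of_real (x $ i) * D i x) = of_nat m * p x" by simp_all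
  have eq: "partial_deriv i p = D i" for i using partial_deriv_eq[OF D(3)] by auto
  show "has_pd p i x (partial_deriv i p x)" "partial_deriv i p \<in> homogeneous_poly (m - 1)"
    "m = 0 \<Longrightarrow> partial_deriv i p = (\<lambda>x. 0)"
    "(\<Sum>i\<in>UNIV. complex_of_real (x $ i) * partial_deriv i p x) = of_nat m * p x"
    unfolding eq using D by auto
qed

lemma hp_laplacian:
  assumes "p \<in> homogeneous_poly m"
  shows "laplacian p \<in> homogeneous_poly (m - 2)" "m < 2 \<Longrightarrow> laplacian p = (\<lambda>x. 0)"
proof -
  have 1: "partial_deriv i p \<in> homogeneous_poly (m - 1)" for i using hp_pd[OF assms] by auto
  have eq: "laplacian p = (\<lambda>x. \<Sum>i\<in>UNIV. partial_deriv i (partial_deriv i p) x)"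
    by (simp add: laplacian_def fun_eq_iff)
  show "laplacian p \<in> homogeneous_poly (m - 2)"
    unfolding eq using hp_pd(2)[OF 1] by (intro hp_sum) (simp add: numeral_2_eq_2)
  show "laplacian p = (\<lambda>x. 0)" if "m < 2"
    unfolding eq using hp_pd(3)[OF 1] that by (simp add: fun_eq_iff)
qed

lemma laplacian_add_hp:
  assumes p: "p \<in> homogeneous_poly m" and q: "q \<in> homogeneous_poly m"
  shows "laplacian (\<lambda>x. c * p x + q x) x = c * laplacian p x + laplacian q x"
proof -
  have "laplacian (\<lambda>x. c * p x + q x) x
      = (\<Sum>i\<in>UNIV. c * partial_deriv i (partial_deriv i p) x + partial_deriv i (partial_deriv i q) x)"
    by (rule laplacian_eq[where d = "\<lambda>i x. c * partial_deriv i p x + partial_deriv i q x"])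
       (intro has_pd_add has_pd_cmult hp_pd(1)[OF p] hp_pd(1)[OF q] hp_pd(1)[OF hp_pd(2)[OF p]] hp_pd(1)[OF hp_pd(2)[OF q]])+
  then show ?thesis by (simp add: laplacian_def sum.distrib sum_distrib_left)
qed

lemma has_pd_radial_hp:
  assumes p: "p \<in> homogeneous_poly m" and g: "\<And>t. (g has_vector_derivative g1 t) (at t)"
  shows "has_pd (\<lambda>x. g ((norm x)\<^sup>2) * p x) i x
    (2 * of_real (x $ i) * (g1 ((norm x)\<^sup>2) * p x) + g ((norm x)\<^sup>2) * partial_deriv i p x)"
  using has_pd_mult[OF has_pd_radial[OF g] hp_pd(1)[OF p]] by (simp add: algebra_simps)

lemma radial_hp_second:
  assumes p: "p \<in> homogeneous_poly m" and g: "\<And>t. (g has_vector_derivative g1 t) (at t)"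
    and g1: "\<And>t. (g1 has_vector_derivative g2 t) (at t)"
  shows "has_pd (\<lambda>x. 2 * of_real (x $ i) * (g1 ((norm x)\<^sup>2) * p x) + g ((norm x)\<^sup>2) * partial_deriv i p x) i x
    (2 * g1 ((norm x)\<^sup>2) * p x + 4 * (of_real (x $ i) * of_real (x $ i)) * (g2 ((norm x)\<^sup>2) * p x)
      + 4 * of_real (x $ i) * partial_deriv i p x * g1 ((norm x)\<^sup>2)
      + g ((norm x)\<^sup>2) * partial_deriv i (partial_deriv i p) x)"
proof -
  have a: "has_pd (\<lambda>x. 2 * of_real (x $ i)) i x (2 * 1)"
    using has_pd_cmult[OF has_pd_coord[of i i x], of 2] by simp
  show ?thesis
    using has_pd_add[OF has_pd_mult[OF a has_pd_radial_hp[OF p g1]] has_pd_radial_hp[OF hp_pd(2)[OF p, of i] g]]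
    by (simp add: algebra_simps)
qed

lemma radial_hp_second_sum:
  fixes x :: "real^'n"
  assumes p: "p \<in> homogeneous_poly m"
  shows "(\<Sum>i\<in>UNIV. 2 * g1 ((norm x)\<^sup>2) * p x + 4 * (of_real (x $ i) * of_real (x $ i)) * (g2 ((norm x)\<^sup>2) * p x)
      + 4 * of_real (x $ i) * partial_deriv i p x * g1 ((norm x)\<^sup>2)
      + g ((norm x)\<^sup>2) * partial_deriv i (partial_deriv i p) x)
   = (4 * of_real ((norm x)\<^sup>2) * g2 ((norm x)\<^sup>2) + (2 * of_nat CARD('n) + 4 * of_nat m) * g1 ((norm x)\<^sup>2)) * p x
     + g ((norm x)\<^sup>2) * laplacian p x"
proof -
  have "(\<Sum>i\<in>UNIV. 4 * of_real (x $ i) * partial_deriv i p x * g1 ((norm x)\<^sup>2)) = 4 * g1 ((norm x)\<^sup>2) * (of_nat m * p x)"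
    unfolding hp_pd(4)[OF p, symmetric] sum_distrib_left by (simp add: algebra_simps)
  moreover have "(\<Sum>i\<in>UNIV. 4 * (of_real (x $ i) * of_real (x $ i)) * (g2 ((norm x)\<^sup>2) * p x))
      = 4 * of_real ((norm x)\<^sup>2) * (g2 ((norm x)\<^sup>2) * p x)"
    unfolding norm_sq_coord sum_distrib_left sum_distrib_right by (simp add: algebra_simps)
  ultimately show ?thesis
    by (simp add: sum.distrib laplacian_def sum_distrib_left algebra_simps)
qed

lemma laplacian_radial_hp:
  fixes p :: "real^'n \<Rightarrow> complex"
  assumes p: "p \<in> homogeneous_poly m" and g: "\<And>t. (g has_vector_derivative g1 t) (at t)"
    and g1: "\<And>t. (g1 has_vector_derivative g2 t) (at t)"
  shows "laplacian (\<lambda>x. g ((norm x)\<^sup>2) * p x) x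
   = (4 * of_real ((norm x)\<^sup>2) * g2 ((norm x)\<^sup>2) + (2 * of_nat CARD('n) + 4 * of_nat m) * g1 ((norm x)\<^sup>2)) * p x
     + g ((norm x)\<^sup>2) * laplacian p x"
  unfolding radial_hp_second_sum[OF p, symmetric]
  by (rule laplacian_eq) (rule has_pd_radial_hp[OF p g], rule radial_hp_second[OF p g g1])

section \<open>Harmonic polynomials\<close>

lemma harmonicD:
  assumes "p \<in> harmonic_poly m"
  shows "p \<in> homogeneous_poly m" "laplacian p x = 0"
  using assms by (auto simp: harmonic_poly_def)

lemma harmonic_subspace: "cfun.subspace (harmonic_poly m :: (real^'n \<Rightarrow> complex) set)"
proof (rule cfun.subspaceI)
  have "laplacian (\<lambda>x. 0) x = 0" for x :: "real^'n"
    using laplacian_add_hp[OF hp_0 hp_0, of 1 x] by simp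
  then show "(0 :: real^'n \<Rightarrow> complex) \<in> harmonic_poly m" unfolding harmonic_poly_def zero_fun_def using hp_0 by blast
next
  fix p q :: "real^'n \<Rightarrow> complex" assume p: "p \<in> harmonic_poly m" and q: "q \<in> harmonic_poly m"
  have "laplacian (\<lambda>x. p x + q x) x = 0" for x
    using laplacian_add_hp[OF harmonicD(1)[OF p] harmonicD(1)[OF q], of 1 x] p q by (simp add: harmonicD)
  then show "p + q \<in> harmonic_poly m"
    using p q by (auto simp: harmonic_poly_def plus_fun_def intro: hp_add)
next
  fix c and p :: "real^'n \<Rightarrow> complex" assume p: "p \<in> harmonic_poly m"
  have "laplacian (\<lambda>x. c * p x) x = 0" for x
    using laplacian_add_hp[OF harmonicD(1)[OF p] hp_cmult[OF harmonicD(1)[OF p], of 0], of c x]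
      laplacian_add_hp[OF harmonicD(1)[OF p] hp_0, of 0 x]
      laplacian_add_hp[OF hp_0 hp_0, of 1 x] by (simp add: harmonicD[OF p])
  then show "cscale c p \<in> harmonic_poly m"
    using p by (auto simp: harmonic_poly_def cscale_def intro: hp_cmult)
qed

lemma harmonic_cnj:
  assumes p: "p \<in> harmonic_poly m"
  shows "(\<lambda>x. cnj (p x)) \<in> harmonic_poly m"
proof -
  have cnj: "has_pd (\<lambda>x. cnj (f x)) i x (cnj d)" if "has_pd f i x d" for f :: "real^'n \<Rightarrow> complex" and i x d
    using that unfolding has_pd_def by (rule has_vector_derivative_cnj)
  note hp = harmonicD(1)[OF p]
  have "laplacian (\<lambda>x. cnj (p x)) x = (\<Sum>i\<in>UNIV. cnj (partial_deriv i (partial_deriv i p) x))" for x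
    by (rule laplacian_eq[where d = "\<lambda>i x. cnj (partial_deriv i p x)"])
       (intro cnj hp_pd(1)[OF hp] hp_pd(1)[OF hp_pd(2)[OF hp]])+
  also have "\<dots> x = cnj (laplacian p x)" for x by (simp add: laplacian_def)
  finally show ?thesis using hp_cnj[OF hp] harmonicD(2)[OF p] by (simp add: harmonic_poly_def)
qed

definition radial_harmonics :: "nat \<Rightarrow> (real^'n \<Rightarrow> complex) set" where
  "radial_harmonics m = {\<lambda>x. complex_of_real ((norm x)\<^sup>2) ^ j * h x |j k h. 2 * j + k = m \<and> h \<in> harmonic_poly k}"

lemma power_has_vector_derivative:
  "((\<lambda>t. complex_of_real t ^ n) has_vector_derivative of_nat n * complex_of_real t ^ (n - 1)) (at t within S)"
proof -
  have "((\<lambda>z. z ^ n) has_field_derivative of_nat n * complex_of_real t ^ (n - 1)) (at (complex_of_real t))"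
    by (auto intro!: derivative_eq_intros)
  from has_vector_derivative_real_field[OF this] show ?thesis by simp
qed

text \<open>The Laplacian maps $|x|^{2(j+1)} h$, $h$ harmonic of degree $k$, to a positive multiple of $|x|^{2j} h$, and so every combination
  of such products has a preimage of the same kind.\<close>

lemma radial_harmonics_lift:
  fixes v :: "real^'n \<Rightarrow> complex"
  assumes "v \<in> cfun.span (radial_harmonics m)"
  shows "\<exists>w\<in>cfun.span (radial_harmonics (m + 2)). w \<in> homogeneous_poly (m + 2) \<and> (\<forall>x. laplacian w x = v x)"
  using assms
proof (induction rule: cfun.span_induct_alt)
  case base
  show ?case
  proof (rule bexI[of _ 0], intro conjI allI)
    show "0 \<in> homogeneous_poly (m + 2)" by (rule cfun.subspace_0[OF hp_subspace])
    show "laplacian 0 x = 0 x" for x :: "real^'n"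
      using harmonicD(2)[OF cfun.subspace_0[OF harmonic_subspace]] by simp
  qed (rule cfun.span_zero)
next
  case (step c u y)
  obtain j k h where u: "u = (\<lambda>x. complex_of_real ((norm x)\<^sup>2) ^ j * h x)" and jk: "2 * j + k = m" and h: "h \<in> harmonic_poly k"
    using step(1) by (auto simp: radial_harmonics_def)
  obtain w where w: "w \<in> cfun.span (radial_harmonics (m + 2))" "w \<in> homogeneous_poly (m + 2)" "\<And>x. laplacian w x = y x"
    using step by auto
  define a :: complex where "a = of_nat (Suc j) * (2 * of_nat CARD('n) + 4 * of_nat j + 4 * of_nat k)"
  have "a = of_nat (Suc j * (2 * CARD('n) + 4 * j + 4 * k))"
    by (simp add: a_def distrib_right)
  then have a0: "a \<noteq> 0" by (simp del: of_nat_mult of_nat_add)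
  define q where "q = (\<lambda>x::real^'n. complex_of_real ((norm x)\<^sup>2) ^ Suc j * h x)"
  have q: "q \<in> homogeneous_poly (m + 2)"
    using hp_mult[OF hp_norm_sq_power[of "Suc j"] harmonicD(1)[OF h]] jk by (simp add: q_def algebra_simps)
  have qS: "q \<in> radial_harmonics (m + 2)"
    unfolding radial_harmonics_def q_def using jk h by (intro CollectI exI[of _ "Suc j"] exI[of _ k] exI[of _ h]) auto
  have lq: "laplacian q x = a * u x" for x
  proof -
    have "((\<lambda>t. of_nat (Suc j) * complex_of_real t ^ j) has_vector_derivative
        of_nat (Suc j) * (of_nat j * complex_of_real t ^ (j - 1))) (at t)" for t
      by (intro has_vector_derivative_mult_right power_has_vector_derivative)
    from laplacian_radial_hp[OF harmonicD(1)[OF h] _ this, of "\<lambda>t. complex_of_real t ^ Suc j" x]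
    have "laplacian q x = (4 * of_real ((norm x)\<^sup>2) * (of_nat (Suc j) * (of_nat j * complex_of_real ((norm x)\<^sup>2) ^ (j - 1))) +
        (2 * of_nat CARD('n) + 4 * of_nat k) * (of_nat (Suc j) * complex_of_real ((norm x)\<^sup>2) ^ j)) * h x"
      using power_has_vector_derivative[of "Suc j"] harmonicD(2)[OF h] by (simp add: q_def)
    also have "\<dots> = a * u x"
      by (cases j) (simp_all add: a_def u algebra_simps)
    finally show ?thesis .
  qed
  show ?case
  proof (intro bexI[of _ "cscale (c / a) q + w"] conjI allI)
    show "cscale (c / a) q + w \<in> cfun.span (radial_harmonics (m + 2))"
      by (intro cfun.span_add cfun.span_scale w cfun.span_base qS)
    show "cscale (c / a) q + w \<in> homogeneous_poly (m + 2)"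
      by (intro cfun.subspace_add[OF hp_subspace] cfun.subspace_scale[OF hp_subspace] q w)
    show "laplacian (cscale (c / a) q + w) x = (cscale c u + y) x" for x
      using laplacian_add_hp[OF q w(2), of "c / a" x] a0 by (simp add: plus_fun_def cscale_def lq w)
  qed
qed

text \<open>By induction the Laplacian of \<^term>\<open>p\<close> is a combination of products of powers of $|x|^2$ with harmonic polynomials; lifting it
  through the Laplacian and subtracting leaves a harmonic polynomial.\<close>

theorem hp_decomposition:
  fixes p :: "real^'n \<Rightarrow> complex"
  assumes "p \<in> homogeneous_poly m"
  shows "p \<in> cfun.span (radial_harmonics m)"
  using assms
proof (induction m arbitrary: p rule: less_induct)
  case (less m)
  have harm: "h \<in> cfun.span (radial_harmonics m)" if "h \<in> harmonic_poly m" for h :: "real^'n \<Rightarrow> complex"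
    by (rule cfun.span_base, unfold radial_harmonics_def, intro CollectI exI[of _ 0] exI[of _ m] exI[of _ h])
       (simp add: that)
  show ?case
  proof (cases "m < 2")
    case True
    then show ?thesis using harm less.prems hp_laplacian(2)[OF less.prems] by (simp add: harmonic_poly_def)
  next
    case False
    then have m: "m - 2 + 2 = m" by simp
    have "laplacian p \<in> cfun.span (radial_harmonics (m - 2))"
      using False by (intro less.IH hp_laplacian less.prems) auto
    from radial_harmonics_lift[OF this, unfolded m]
    obtain w where w: "w \<in> cfun.span (radial_harmonics m)" "w \<in> homogeneous_poly m" "\<And>x. laplacian w x = laplacian p x"
      by auto
    have "(\<lambda>x. (-1) * w x + p x) \<in> harmonic_poly m"
      using laplacian_add_hp[OF w(2) less.prems, of "-1"] w(3) hp_add[OF hp_cmult[OF w(2)] less.prems, of "-1"]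
      by (simp add: harmonic_poly_def)
    then have "(\<lambda>x. (-1) * w x + p x) + w \<in> cfun.span (radial_harmonics m)"
      by (intro cfun.span_add harm w)
    moreover have "(\<lambda>x. (-1) * w x + p x) + w = p" by (simp add: fun_eq_iff)
    ultimately show ?thesis by simp
  qed
qed

section \<open>Integrability of powers of the norm times Gaussians\<close>

lemma power_le_fact_exp: "0 \<le> (y::real) \<Longrightarrow> y ^ k \<le> fact k * exp y"
proof -
  assume y: "0 \<le> y"
  have "(\<Sum>n\<in>{k}. inverse (fact n) * y ^ n) \<le> (\<Sum>n. inverse (fact n) * y ^ n)"
    by (rule sum_le_suminf) (use y summable_exp[of y] in auto)
  also have "\<dots> = exp y" by (simp add: exp_def)
  finally show ?thesis by (simp add: field_simps)
qed

lemma dyadic_small: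
  fixes r :: real assumes "0 < r" "r < 1"
  obtains k :: nat where "(1/2)^Suc k \<le> r" "r < (1/2)^k"
proof -
  obtain n :: nat where n: "(1/2)^n < r" using real_arch_pow_inv[OF assms(1), of "1/2"] by auto
  define m where "m = (LEAST n::nat. (1/2)^n \<le> r)"
  have m: "(1/2)^m \<le> r" unfolding m_def by (rule LeastI[of _ n]) (use n in simp)
  then obtain k where k: "m = Suc k" using assms(2) by (cases m) auto
  have "\<not> (1/2)^k \<le> r" using not_less_Least[of k "\<lambda>n. (1/2)^n \<le> r"] k by (simp add: m_def)
  then show ?thesis using that[of k] m k by auto
qed

lemma dyadic_large:
  fixes r :: real assumes "1 \<le> r"
  obtains k :: nat where "2^k \<le> r" "r < 2^Suc k"
proof -
  obtain n :: nat where n: "r < 2^n" using real_arch_pow[of 2 r] by auto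
  define m where "m = (LEAST n::nat. r < 2^n)"
  have m: "r < 2^m" unfolding m_def by (rule LeastI[of _ n]) (use n in simp)
  then obtain k where k: "m = Suc k" using assms by (cases m) auto
  have "\<not> r < 2^k" using not_less_Least[of k "\<lambda>n. r < 2^n"] k by (simp add: m_def)
  then show ?thesis using that[of k] m k by auto
qed

text \<open>Comparison with a series over balls replaces polar coordinates: only the volume of a ball, a constant
  times $r^N$, enters.\<close>

lemma nn_integral_ball_series:
  fixes c r :: "nat \<Rightarrow> real" and f :: "real^'n \<Rightarrow> real"
  assumes f: "\<And>x. f x \<noteq> 0 \<Longrightarrow> \<exists>k. f x \<le> c k \<and> norm x < r k" and [measurable]: "f \<in> borel_measurable borel"
    and cr: "\<And>k. c k \<ge> 0" "\<And>k. r k \<ge> 0" and s: "summable (\<lambda>k. c k * r k ^ CARD('n))"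
  shows "(\<integral>\<^sup>+x. ennreal (f x) \<partial>lborel) < \<infinity>"
proof -
  have "(\<integral>\<^sup>+x. ennreal (f x) \<partial>lborel) \<le> (\<integral>\<^sup>+x. (\<Sum>k. ennreal (c k) * indicator (ball (0::real^'n) (r k)) x) \<partial>lborel)"
  proof (rule nn_integral_mono)
    fix x :: "real^'n"
    show "ennreal (f x) \<le> (\<Sum>k. ennreal (c k) * indicator (ball (0::real^'n) (r k)) x)"
    proof (cases "f x = 0")
      case False
      then obtain k where k: "f x \<le> c k" "norm x < r k" using f by blast
      have "ennreal (f x) \<le> (\<Sum>k\<in>{k}. ennreal (c k) * indicator (ball (0::real^'n) (r k)) x)"
        using k by (simp add: ennreal_leI)
      also have "\<dots> \<le> (\<Sum>k. ennreal (c k) * indicator (ball (0::real^'n) (r k)) x)"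
        by (rule sum_le_suminf) auto
      finally show ?thesis .
    qed simp
  qed
  also have "\<dots> = (\<Sum>k. \<integral>\<^sup>+x. ennreal (c k) * indicator (ball (0::real^'n) (r k)) x \<partial>lborel)"
    by (rule nn_integral_suminf) (intro borel_measurable_times_ennreal borel_measurable_const borel_measurable_indicator, simp)
  also have "\<dots> = (\<Sum>k. ennreal (unit_ball_vol (real CARD('n)) * (c k * r k ^ CARD('n))))"
    using cr by (intro suminf_cong, subst nn_integral_cmult_indicator)
      (simp_all add: emeasure_ball ennreal_mult[symmetric] mult.left_commute)
  also have "\<dots> < \<infinity>"
  proof -
    have "(\<Sum>k. ennreal (unit_ball_vol (real CARD('n)) * (c k * r k ^ CARD('n)))) =
       ennreal (\<Sum>k. unit_ball_vol (real CARD('n)) * (c k * r k ^ CARD('n)))"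
      by (rule suminf_ennreal2) (use cr s in \<open>auto intro!: summable_mult\<close>)
    then show ?thesis by simp
  qed
  finally show ?thesis .
qed

text \<open>Near $0$ the function is compared with constants on dyadic balls of radius $2^{-k}$, where the condition
  $a > -N$ makes the series geometric; away from $0$ the exponential is bounded by a high negative power, and the balls
  have radius $2^{k+1}$.\<close>

lemma integrable_powr_gauss:
  assumes a: "a > - real CARD('n)" and s: "s > 0"
  shows "integrable lborel (\<lambda>x::real^'n. norm x powr a * exp (- s * (norm x)\<^sup>2))"
proof (rule integrableI_nonneg)
  let ?n = "real CARD('n)"
  let ?f = "\<lambda>x::real^'n. norm x powr a * exp (- s * (norm x)\<^sup>2)"
  let ?f1 = "\<lambda>x::real^'n. indicator (ball 0 1) x * ?f x"
  let ?f2 = "\<lambda>x::real^'n. indicator (- ball 0 1) x * ?f x"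
  have [measurable]: "?f \<in> borel_measurable borel" by measurable
  have [measurable]: "ball (0::real^'n) 1 \<in> sets borel" by simp
  have m1: "?f1 \<in> borel_measurable borel" and m2: "?f2 \<in> borel_measurable borel" by measurable
  have "(\<integral>\<^sup>+x. ennreal (?f1 x) \<partial>lborel) < \<infinity>"
  proof (rule nn_integral_ball_series[where c = "\<lambda>k. 2 powr \<bar>a\<bar> * (2 powr (- a)) ^ k" and r = "\<lambda>k. (1/2)^k"])
    fix x :: "real^'n" assume "?f1 x \<noteq> 0"
    then have x: "norm x < 1" "norm x > 0" by (auto simp: indicator_def split: if_splits)
    then obtain k where k: "(1/2)^Suc k \<le> norm x" "norm x < (1/2)^k" by (metis dyadic_small)
    have "norm x powr a \<le> 2 powr \<bar>a\<bar> * (2 powr (- a)) ^ k"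
    proof (cases "a \<ge> 0")
      case True
      have "norm x powr a \<le> ((1/2)^k) powr a" using k True by (intro powr_mono2) auto
      also have "\<dots> = (2 powr (- a)) ^ k" by (simp add: powr_power powr_minus powr_divide power_one_over powr_powr flip: powr_realpow)
        (simp add: powr_minus powr_divide powr_powr inverse_eq_divide mult.commute)
      also have "\<dots> \<le> 2 powr \<bar>a\<bar> * (2 powr (- a)) ^ k" by (simp add: mult_le_cancel_right1 ge_one_powr_ge_zero)
      finally show ?thesis .
    next
      case False
      have "norm x powr a \<le> ((1/2)^Suc k) powr a" using k False x by (intro powr_mono2') auto
      also have "(1/2::real)^Suc k = 2 powr (- real (Suc k))" by (simp add: powr_minus powr_realpow power_one_over inverse_eq_divide del: power_Suc of_nat_Suc)
      also have "\<dots> powr a = 2 powr (- a) * (2 powr (- a)) ^ k"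
        by (simp add: powr_powr powr_power flip: powr_add) (simp add: algebra_simps)
      finally show ?thesis using False by simp
    qed
    moreover have "exp (- s * (norm x)\<^sup>2) \<le> 1" using s by simp
    ultimately have "?f x \<le> 2 powr \<bar>a\<bar> * (2 powr (- a)) ^ k * 1" by (intro mult_mono) auto
    then have "?f1 x \<le> 2 powr \<bar>a\<bar> * (2 powr (- a)) ^ k" using x by simp
    then show "\<exists>k. ?f1 x \<le> 2 powr \<bar>a\<bar> * (2 powr (- a)) ^ k \<and> norm x < (1/2)^k" using k by blast
  next
    have e: "(2 powr (- a)) ^ k * ((1/2)^k)^CARD('n) = (2 powr (- a - ?n)) ^ k" for k
    proof -
      have "((1/2::real)^k)^CARD('n) = ((1/2)^CARD('n))^k" by (simp add: power_mult[symmetric] mult.commute)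
      also have "(1/2::real)^CARD('n) = 2 powr (- ?n)" by (simp add: powr_minus powr_realpow power_one_over inverse_eq_divide)
      finally show ?thesis by (simp add: powr_diff powr_minus field_simps flip: power_mult_distrib)
    qed
    have "2 powr (- a - ?n) < 1" using a by (simp add: powr_less_one)
    then have "summable (\<lambda>k. 2 powr \<bar>a\<bar> * (2 powr (- a - ?n)) ^ k)" by (intro summable_mult summable_geometric) auto
    then show "summable (\<lambda>k. 2 powr \<bar>a\<bar> * (2 powr (- a)) ^ k * ((1/2)^k)^CARD('n))" by (simp add: e mult.assoc)
  qed (use m1 in auto)
  moreover have "(\<integral>\<^sup>+x. ennreal (?f2 x) \<partial>lborel) < \<infinity>"
  proof -
    obtain K :: nat where K: "real K \<ge> a + ?n + 1" using real_arch_simple by blast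
    define C where "C = fact K / s^K"
    have C: "C \<ge> 0" using s by (simp add: C_def)
    show ?thesis
    proof (rule nn_integral_ball_series[where c = "\<lambda>k. C * (1 / 2 ^ (CARD('n) + 1)) ^ k" and r = "\<lambda>k. 2^Suc k"])
      fix x :: "real^'n" assume "?f2 x \<noteq> 0"
      then have x: "norm x \<ge> 1" by (auto simp: indicator_def split: if_splits)
      then obtain k where k: "2^k \<le> norm x" "norm x < 2^Suc k" by (metis dyadic_large)
      let ?r = "norm x"
      define y where "y = s * ?r\<^sup>2"
      have y: "y > 0" unfolding y_def using s x by (intro mult_pos_pos zero_less_power) linarith+
      have "y^K \<le> fact K * exp y" by (rule power_le_fact_exp) (use y in simp)
      moreover have "y^K > 0" using y by simp
      ultimately have "exp (- y) \<le> fact K / y^K"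
        by (simp add: exp_minus field_simps)
      then have "exp (- s * ?r\<^sup>2) \<le> fact K / (s * ?r\<^sup>2)^K" by (simp add: y_def)
      also have "\<dots> = C / ?r^(2*K)" by (simp add: C_def power_mult_distrib power_mult)
      finally have e: "exp (- s * ?r\<^sup>2) \<le> C / ?r^(2*K)" .
      have "?f x \<le> ?r powr (real K - ?n - 1) * (C / ?r^(2*K))"
        using x K by (intro mult_mono e powr_mono) auto
      also have "\<dots> = C * ?r powr (- real K - ?n - 1)"
      proof -
        have "?r^(2*K) = ?r powr (2 * real K)" using powr_realpow[of ?r "2*K"] less_le_trans[OF zero_less_one x] by simp
        then have "?r powr (real K - ?n - 1) * (C / ?r^(2*K)) = C * ?r powr ((real K - ?n - 1) - 2 * real K)"
          by (simp only: powr_diff[of ?r _ "2 * real K"]) simp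
        also have "(real K - ?n - 1) - 2 * real K = - real K - ?n - 1" by simp
        finally show ?thesis .
      qed
      also have "\<dots> \<le> C * ?r powr (- (?n + 1))"
        using x C by (intro mult_left_mono powr_mono) auto
      also have "?r powr (- (?n + 1)) = 1 / ?r ^ (CARD('n) + 1)"
        using powr_realpow[of ?r "CARD('n) + 1"] less_le_trans[OF zero_less_one x]
        by (simp only: powr_minus inverse_eq_divide of_nat_add of_nat_1)
      also have "C * (1 / ?r ^ (CARD('n) + 1)) \<le> C * (1 / (2^k) ^ (CARD('n) + 1))"
        using k C less_le_trans[OF zero_less_one x]
        by (intro mult_left_mono divide_left_mono power_mono mult_pos_pos zero_less_power) auto
      also have "(2^k::real) ^ (CARD('n) + 1) = (2 ^ (CARD('n) + 1)) ^ k"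
        by (simp only: power_mult[symmetric] mult.commute)
      finally have "?f2 x \<le> C * (1 / 2 ^ (CARD('n) + 1)) ^ k" using x by (simp add: power_one_over)
      then show "\<exists>k. ?f2 x \<le> C * (1 / 2 ^ (CARD('n) + 1)) ^ k \<and> norm x < 2^Suc k" using k by blast
    next
      have "C * (1 / 2 ^ (CARD('n) + 1)) ^ k * (2^Suc k)^CARD('n) = C * 2^CARD('n) * (1/2)^k" for k
      proof -
        have "(2^Suc k :: real)^CARD('n) = 2^CARD('n) * (2^CARD('n))^k"
          by (simp add: power_mult_distrib power_mult[symmetric] mult.commute)
        then show ?thesis by (simp add: power_divide power_mult_distrib)
      qed
      then show "summable (\<lambda>k. C * (1 / 2 ^ (CARD('n) + 1)) ^ k * (2^Suc k)^CARD('n))"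
        by (simp only:) (intro summable_mult summable_geometric, simp)
    qed (use m2 C in auto)
  qed
  moreover have "(\<integral>\<^sup>+x. ennreal (?f x) \<partial>lborel) = (\<integral>\<^sup>+x. ennreal (?f1 x) \<partial>lborel) + (\<integral>\<^sup>+x. ennreal (?f2 x) \<partial>lborel)"
    using m1 m2 by (subst nn_integral_add[symmetric]) (auto intro!: nn_integral_cong simp: indicator_def)
  ultimately show "(\<integral>\<^sup>+x. ennreal (?f x) \<partial>lborel) < \<infinity>" by simp
qed auto

lemma integrable_poly_gauss_lborel:
  fixes F :: "real^'n \<Rightarrow> complex"
  assumes a: "a > - real CARD('n)" and s: "Re s > 0" and [measurable]: "F \<in> borel_measurable borel"
    and F: "\<And>x. cmod (F x) \<le> C * norm x ^ d"
  shows "integrable lborel (\<lambda>x. norm x powr a *\<^sub>R (F x * exp (- s * of_real ((norm x)\<^sup>2))))"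
proof (rule Bochner_Integration.integrable_bound)
  show "integrable lborel (\<lambda>x::real^'n. C * (norm x powr (a + d) * exp (- Re s * (norm x)\<^sup>2)))"
    using a s by (intro integrable_mult_right integrable_powr_gauss) auto
  have "norm x powr a * (cmod (F x) * exp (- Re s * (norm x)\<^sup>2)) \<le> \<bar>C * (norm x powr (a + d) * exp (- Re s * (norm x)\<^sup>2))\<bar>" for x
  proof (cases "x = 0")
    case False
    have "norm x powr a * (cmod (F x) * exp (- Re s * (norm x)\<^sup>2)) \<le> norm x powr a * (C * norm x ^ d * exp (- Re s * (norm x)\<^sup>2))"
      by (intro mult_left_mono mult_right_mono F) auto
    also have "\<dots> = C * (norm x powr (a + d) * exp (- Re s * (norm x)\<^sup>2))"
      using False by (simp add: powr_add powr_realpow)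
    finally show ?thesis by linarith
  qed simp
  then show "AE x in lborel. norm (norm x powr a *\<^sub>R (F x * exp (- s * of_real ((norm x)\<^sup>2))))
     \<le> norm (C * (norm x powr (a + d) * exp (- Re s * (norm x)\<^sup>2)))"
    by (simp add: norm_mult)
qed measurable

lemma sets_weighted [simp, measurable_cong]: "sets (weighted_measure b) = sets borel"
  by (simp add: weighted_measure_def)

lemma space_weighted [simp]: "space (weighted_measure b) = UNIV"
  by (simp add: weighted_measure_def)

lemma measurable_weighted [simp]: "borel_measurable (weighted_measure b) = borel_measurable borel"
  by (rule measurable_cong_sets) auto

lemma integrable_weighted:
  fixes f :: "real^'n \<Rightarrow> complex"
  assumes "f \<in> borel_measurable borel"
  shows "integrable (weighted_measure b) f \<longleftrightarrow> integrable lborel (\<lambda>x. norm x powr (2 * b) *\<^sub>R f x)"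
  unfolding weighted_measure_def by (rule integrable_density) (use assms in auto)

lemma integral_weighted:
  fixes f :: "real^'n \<Rightarrow> complex"
  assumes "f \<in> borel_measurable borel"
  shows "(LINT x|weighted_measure b. f x) = (LINT x|lborel. norm x powr (2 * b) *\<^sub>R f x)"
  unfolding weighted_measure_def by (rule integral_density) (use assms in auto)

lemma integrable_poly_gauss:
  fixes F :: "real^'n \<Rightarrow> complex"
  assumes b: "b > - real CARD('n) / 2" and s: "Re s > 0" and m: "F \<in> borel_measurable borel"
    and F: "\<And>x. cmod (F x) \<le> C * norm x ^ d"
  shows "integrable (weighted_measure b) (\<lambda>x. F x * exp (- s * of_real ((norm x)\<^sup>2)))"
proof -
  have "(\<lambda>x. F x * exp (- s * of_real ((norm x)\<^sup>2))) \<in> borel_measurable borel"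
    using m by measurable
  from integrable_weighted[OF this] show ?thesis
    using integrable_poly_gauss_lborel[OF _ s m F, of "2 * b"] b by simp
qed

lemma hp_measurable: "p \<in> homogeneous_poly m \<Longrightarrow> p \<in> borel_measurable borel"
  by (intro borel_measurable_continuous_onI hp_continuous)

lemma hp_integrable:
  fixes p :: "real^'n \<Rightarrow> complex"
  assumes "b > - real CARD('n) / 2" "Re s > 0" "p \<in> homogeneous_poly m"
  shows "integrable (weighted_measure b) (\<lambda>x. p x * exp (- s * of_real ((norm x)\<^sup>2)))"
  using hp_bound[OF assms(3)] integrable_poly_gauss[OF assms(1,2) hp_measurable[OF assms(3)]] by blast

lemma weighted_0: "integrable (weighted_measure 0) f \<longleftrightarrow> integrable lborel f"
    "(LINT x|weighted_measure 0. f x) = (LINT x|lborel. f x)" if "f \<in> borel_measurable borel" for f :: "real^'n \<Rightarrow> complex"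
proof -
  have ae: "AE x::real^'n in lborel. x \<noteq> 0" by (rule AE_lborel_singleton)
  have eq: "AE x::real^'n in lborel. norm x powr (2 * 0) *\<^sub>R f x = f x"
    using ae by eventually_elim simp
  have "integrable lborel (\<lambda>x::real^'n. norm x powr (2 * 0) *\<^sub>R f x) \<longleftrightarrow> integrable lborel f"
    by (rule integrable_cong_AE) (use that eq in auto)
  then show "integrable (weighted_measure 0) f \<longleftrightarrow> integrable lborel f" by (simp only: integrable_weighted[OF that])
  have "(LINT x|lborel. norm x powr (2 * 0) *\<^sub>R f x) = (LINT x|lborel. f x)"
    by (rule integral_cong_AE) (use that eq in auto)
  then show "(LINT x|weighted_measure 0. f x) = (LINT x|lborel. f x)" by (simp only: integral_weighted[OF that])
qed

section \<open>Laplace-type transforms\<close>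

text \<open>A Laplace transform in the variable $|x|^2$. The index \<^term>\<open>k\<close> counts differentiations in \<^term>\<open>s\<close>, up to sign.\<close>

definition gtrans :: "(real^'n) measure \<Rightarrow> (real^'n \<Rightarrow> complex) \<Rightarrow> nat \<Rightarrow> complex \<Rightarrow> complex" where
  "gtrans M f k s = (LINT x|M. f x * of_real ((norm x)\<^sup>2) ^ k * exp (- s * of_real ((norm x)\<^sup>2)))"

definition gauss_integrable :: "(real^'n) measure \<Rightarrow> (real^'n \<Rightarrow> complex) \<Rightarrow> bool" where
  "gauss_integrable M f \<longleftrightarrow> sets M = sets borel \<and> f \<in> borel_measurable M \<and>
    (\<forall>k s. Re s > 0 \<longrightarrow> integrable M (\<lambda>x. f x * of_real ((norm x)\<^sup>2) ^ k * exp (- s * of_real ((norm x)\<^sup>2))))"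

lemma gauss_integrableD:
  "gauss_integrable M f \<Longrightarrow> Re s > 0 \<Longrightarrow> integrable M (\<lambda>x. f x * of_real ((norm x)\<^sup>2) ^ k * exp (- s * of_real ((norm x)\<^sup>2)))"
  by (simp add: gauss_integrable_def)

lemma cmod_exp_minus_linear: "cmod (exp z - 1 - z) \<le> (cmod z)\<^sup>2 * exp (cmod z)"
proof -
  have "cmod (exp z - (\<Sum>k\<le>1. z ^ k / fact k)) \<le> exp \<bar>Re z\<bar> * cmod z ^ Suc 1 / fact 1" by (rule Taylor_exp)
  then have "cmod (exp z - 1 - z) \<le> exp \<bar>Re z\<bar> * (cmod z)\<^sup>2" by (simp add: numeral_2_eq_2 diff_diff_eq)
  also have "\<dots> \<le> exp (cmod z) * (cmod z)\<^sup>2" by (intro mult_right_mono) (auto simp: abs_Re_le_cmod)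
  finally show ?thesis by (simp add: mult.commute)
qed

text \<open>The remainder $e^z - 1 - z$ with $z = -h |x|^2$ is at most $|z|^2 e^{|z|}$; for $|h| < Re(s) / 2$ this is dominated by a Gaussian
  of half the exponent, which gives an error of order $h$ in the difference quotient.\<close>

lemma gtrans_deriv:
  assumes f: "gauss_integrable M f" and s: "Re s > 0"
  shows "(gtrans M f k has_field_derivative - gtrans M f (Suc k) s) (at s)"
proof -
  have [measurable]: "f \<in> borel_measurable M" and sets: "sets M = sets borel" using f by (auto simp: gauss_integrable_def)
  have [measurable]: "(\<lambda>x. norm x) \<in> borel_measurable M" using sets by (simp add: measurable_cong_sets[OF sets refl])
  let ?Q = "\<lambda>x::real^'a. (norm x)\<^sup>2"
  define r where "r = Re s / 2"
  have r: "r > 0" using s by (simp add: r_def)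
  define K where "K = (LINT x|M. cmod (f x * of_real (?Q x) ^ (k + 2) * exp (- of_real r * of_real (?Q x))))"
  have bound: "cmod ((gtrans M f k (s + h) - gtrans M f k s) / h - - gtrans M f (Suc k) s) \<le> cmod h * K"
    if h: "h \<noteq> 0" "cmod h < r" for h
  proof -
    have "\<bar>Re h\<bar> < r" using h(2) abs_Re_le_cmod le_less_trans by blast
    then have sh: "Re (s + h) > 0" by (simp add: r_def)
    let ?F = "\<lambda>x. f x * of_real (?Q x) ^ k * exp (- (s + h) * of_real (?Q x)) - f x * of_real (?Q x) ^ k * exp (- s * of_real (?Q x))
      + h * (f x * of_real (?Q x) ^ Suc k * exp (- s * of_real (?Q x)))"
    have I: "gtrans M f k (s + h) - gtrans M f k s + h * gtrans M f (Suc k) s = (LINT x|M. ?F x)"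
      unfolding gtrans_def using gauss_integrableD[OF f s] gauss_integrableD[OF f sh]
      by (simp del: power_Suc)
    have pt: "cmod (?F x) \<le> (cmod h)\<^sup>2 * cmod (f x * of_real (?Q x) ^ (k + 2) * exp (- of_real r * of_real (?Q x)))" for x
    proof -
      let ?z = "- h * of_real (?Q x)"
      have cz: "cmod ?z = cmod h * ?Q x" by (simp add: norm_mult norm_power)
      have "?F x = f x * of_real (?Q x) ^ k * exp (- s * of_real (?Q x)) * (exp ?z - 1 - ?z)"
        by (simp add: algebra_simps flip: exp_add)
      then have "cmod (?F x) = cmod (f x) * ?Q x ^ k * exp (- Re s * ?Q x) * cmod (exp ?z - 1 - ?z)"
        by (simp add: norm_mult norm_power)
      also have "\<dots> \<le> cmod (f x) * ?Q x ^ k * exp (- Re s * ?Q x) * ((cmod ?z)\<^sup>2 * exp (cmod ?z))"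
        by (intro mult_left_mono cmod_exp_minus_linear) auto
      also have "\<dots> = (cmod h)\<^sup>2 * (cmod (f x) * ?Q x ^ (k + 2)) * (exp (- Re s * ?Q x) * exp (cmod h * ?Q x))"
        unfolding cz by (simp add: power_mult_distrib power_add power2_eq_square)
      also have "\<dots> \<le> (cmod h)\<^sup>2 * (cmod (f x) * ?Q x ^ (k + 2)) * exp (- r * ?Q x)"
      proof (intro mult_left_mono)
        have "- Re s * ?Q x + cmod h * ?Q x \<le> - r * ?Q x"
          using mult_right_mono[of "cmod h" r "?Q x"] h(2) by (simp add: r_def algebra_simps)
        then show "exp (- Re s * ?Q x) * exp (cmod h * ?Q x) \<le> exp (- r * ?Q x)" by (simp flip: exp_add)
      qed auto
      finally show ?thesis by (simp add: norm_mult norm_power)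
    qed
    have "cmod (LINT x|M. ?F x) \<le> (LINT x|M. cmod (?F x))" by (rule integral_norm_bound)
    also have "\<dots> \<le> (LINT x|M. (cmod h)\<^sup>2 * cmod (f x * of_real (?Q x) ^ (k + 2) * exp (- of_real r * of_real (?Q x))))"
    proof (rule integral_mono)
      show "integrable M (\<lambda>x. cmod (?F x))"
        by (intro integrable_norm Bochner_Integration.integrable_add Bochner_Integration.integrable_diff
            integrable_mult_right gauss_integrableD[OF f] s sh)
      show "integrable M (\<lambda>x. (cmod h)\<^sup>2 * cmod (f x * of_real (?Q x) ^ (k + 2) * exp (- of_real r * of_real (?Q x))))"
        by (intro integrable_mult_right integrable_norm gauss_integrableD[OF f]) (use r in simp)
    qed (rule pt)
    also have "\<dots> = (cmod h)\<^sup>2 * K" by (simp add: K_def)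
    finally have "cmod (gtrans M f k (s + h) - gtrans M f k s + h * gtrans M f (Suc k) s) \<le> (cmod h)\<^sup>2 * K" by (simp add: I)
    moreover have "(gtrans M f k (s + h) - gtrans M f k s) / h - - gtrans M f (Suc k) s
       = (gtrans M f k (s + h) - gtrans M f k s + h * gtrans M f (Suc k) s) / h" using h(1) by (simp add: field_simps)
    ultimately show ?thesis using h(1) by (simp add: norm_divide divide_le_eq power2_eq_square mult.commute mult.left_commute)
  qed
  have "((\<lambda>h. (gtrans M f k (s + h) - gtrans M f k s) / h - - gtrans M f (Suc k) s) \<longlongrightarrow> 0) (at 0)"
  proof (rule Lim_null_comparison)
    show "\<forall>\<^sub>F h in at 0. norm ((gtrans M f k (s + h) - gtrans M f k s) / h - - gtrans M f (Suc k) s) \<le> cmod h * K"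
      unfolding eventually_at by (intro exI[of _ r]) (use r bound in auto)
    show "((\<lambda>h. cmod h * K) \<longlongrightarrow> 0) (at 0)" by (auto intro!: tendsto_eq_intros)
  qed
  then show ?thesis unfolding DERIV_def by (rule LIM_zero_cancel)
qed

lemma gtrans_holomorphic: "gauss_integrable M f \<Longrightarrow> gtrans M f k holomorphic_on {s. Re s > 0}"
  using gtrans_deriv[of M f _ k] by (auto simp: holomorphic_on_open open_halfspace_Re_gt)

lemma right_half_plane: "open {s. Re s > 0}" "connected {s. Re s > 0}" "convex {s. Re s > 0}"
  using convex_halfspace_Re_gt[of 0] by (auto simp: open_halfspace_Re_gt convex_connected)

lemma holomorphic_zero_on_positive_reals:
  assumes "f holomorphic_on {s. Re s > 0}" "\<And>t. t > 0 \<Longrightarrow> f (complex_of_real t) = 0" "Re s > 0"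
  shows "f s = 0"
proof (rule analytic_continuation[OF assms(1) right_half_plane(1,2), of "complex_of_real ` {0<..}" 1 s])
  show "1 islimpt complex_of_real ` {0<..}"
  proof (unfold islimpt_approachable, intro allI impI)
    fix e :: real assume e: "e > 0"
    show "\<exists>x'\<in>complex_of_real ` {0<..}. x' \<noteq> 1 \<and> dist x' 1 < e"
    proof (intro bexI[of _ "complex_of_real (1 + e/2)"] conjI)
      show "dist (complex_of_real (1 + e/2)) 1 < e" using e by (simp add: dist_norm norm_divide)
      show "complex_of_real (1 + e/2) \<noteq> 1" using e by simp
      show "complex_of_real (1 + e/2) \<in> complex_of_real ` {0<..}" by (rule imageI) (use e in simp)
    qed
  qed
qed (use assms in auto)

lemma gtrans_all_zero:
  assumes f: "gauss_integrable M f" and 0: "\<And>s. Re s > 0 \<Longrightarrow> gtrans M f 0 s = 0" and s: "Re s > 0"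
  shows "gtrans M f k s = 0"
  using s
proof (induction k arbitrary: s)
  case (Suc k)
  have "((\<lambda>_. 0) has_field_derivative - gtrans M f (Suc k) s) (at s)"
    by (rule has_field_derivative_transform_within_open[OF gtrans_deriv[OF f Suc.prems] right_half_plane(1)])
       (use Suc in auto)
  with DERIV_const[of 0 "at s"] show ?case using DERIV_unique by fastforce
qed (rule 0)

text \<open>The vanishing numbers are, up to sign, all derivatives at one point of a function holomorphic on a connected set.\<close>

lemma gtrans_zero_of_derivs:
  assumes f: "gauss_integrable M f" and s0: "Re s0 > 0" and 0: "\<And>k. gtrans M f k s0 = 0" and s: "Re s > 0"
  shows "gtrans M f 0 s = 0"
proof (rule holomorphic_fun_eq_0_on_connected[OF gtrans_holomorphic[OF f] right_half_plane(1,2)])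
  have "Re z > 0 \<Longrightarrow> (deriv ^^ n) (gtrans M f 0) z = (-1)^n * gtrans M f n z" for n z
  proof (induction n arbitrary: z)
    case (Suc n)
    have "((\<lambda>z. (-1)^n * gtrans M f n z) has_field_derivative (-1)^n * (- gtrans M f (Suc n) z)) (at z)"
      by (intro DERIV_cmult gtrans_deriv f Suc.prems)
    then have "((deriv ^^ n) (gtrans M f 0) has_field_derivative (-1)^n * (- gtrans M f (Suc n) z)) (at z)"
      by (rule has_field_derivative_transform_within_open[OF _ right_half_plane(1)]) (use Suc in auto)
    then show ?case by (simp add: DERIV_imp_deriv)
  qed simp
  then show "(deriv ^^ n) (gtrans M f 0) s0 = 0" for n using s0 0 by simp
qed (use s0 s in auto)

section \<open>Gaussian integrals of homogeneous polynomials\<close>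

lemma hp_mult_norm_sq:
  fixes p :: "real^'n \<Rightarrow> complex"
  assumes "p \<in> homogeneous_poly m"
  shows "(\<lambda>x. p x * complex_of_real ((norm x)\<^sup>2) ^ k) \<in> homogeneous_poly (m + 2 * k)"
  by (rule hp_mult[OF assms hp_norm_sq_power])

lemma hp_gauss_integrable:
  fixes p :: "real^'n \<Rightarrow> complex"
  assumes b: "b > - real CARD('n) / 2" and p: "p \<in> homogeneous_poly m"
  shows "gauss_integrable (weighted_measure b) p"
  unfolding gauss_integrable_def
  using hp_integrable[OF b _ hp_mult_norm_sq[OF p]] hp_measurable[OF p] by simp

lemma integral_lborel_scale:
  fixes f :: "real^'n \<Rightarrow> complex"
  assumes f[measurable]: "f \<in> borel_measurable borel" and c: "c > 0"
  shows "(LINT x|lborel. f x) = (c ^ CARD('n)) *\<^sub>R (LINT x|lborel. f (c *\<^sub>R x))"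
proof -
  have "(LINT x|lborel. f x) = (LINT x|density (distr lborel borel (\<lambda>x. 0 + c *\<^sub>R x)) (\<lambda>_. \<bar>c\<bar>^DIM(real^'n)). f x)"
    using lborel_affine[of c "0::real^'n"] c by (subst (1) lborel_affine[of c "0::real^'n"]) auto
  also have "\<dots> = (LINT x|distr lborel borel (\<lambda>x. 0 + c *\<^sub>R x). (\<bar>c\<bar>^DIM(real^'n)) *\<^sub>R f x)"
    by (rule integral_density) auto
  also have "\<dots> = (LINT x|lborel. (\<bar>c\<bar>^DIM(real^'n)) *\<^sub>R f (0 + c *\<^sub>R x))"
    by (rule integral_distr) auto
  finally show ?thesis using c by simp
qed

text \<open>The substitution $x \mapsto s^{-1/2} x$.\<close>

lemma gtrans_hp_real:
  fixes p :: "real^'n \<Rightarrow> complex"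
  assumes p: "p \<in> homogeneous_poly d" and s: "s > 0"
  shows "gtrans (weighted_measure b) p 0 (of_real s) =
    of_real (s powr (- (b + (real d + real CARD('n)) / 2))) * gtrans (weighted_measure b) p 0 1"
proof -
  have [measurable]: "p \<in> borel_measurable borel" by (rule hp_measurable[OF p])
  define c where "c = s powr (- 1/2)"
  have c: "c > 0" using s by (simp add: c_def)
  have "c\<^sup>2 = s powr (- 1)" unfolding c_def power2_eq_square powr_add[symmetric] by simp
  then have sc: "s * c\<^sup>2 = 1" using s by (simp add: powr_minus)
  have "gtrans (weighted_measure b) p 0 (of_real s) = (LINT x|lborel. norm x powr (2 * b) *\<^sub>R (p x * exp (- of_real s * of_real ((norm x)\<^sup>2))))"
    unfolding gtrans_def by (subst integral_weighted) auto
  also have "\<dots> = (c ^ CARD('n)) *\<^sub>R (LINT x|lborel. norm (c *\<^sub>R x) powr (2 * b) *\<^sub>R (p (c *\<^sub>R x) * exp (- of_real s * of_real ((norm (c *\<^sub>R x))\<^sup>2))))"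
    by (rule integral_lborel_scale[OF _ c]) auto
  also have "(\<lambda>x. norm (c *\<^sub>R x) powr (2 * b) *\<^sub>R (p (c *\<^sub>R x) * exp (- of_real s * of_real ((norm (c *\<^sub>R x))\<^sup>2))))
     = (\<lambda>x. of_real (c powr (2 * b) * c ^ d) * (norm x powr (2 * b) *\<^sub>R (p x * exp (- 1 * of_real ((norm x)\<^sup>2)))))"
  proof
    fix x :: "real^'n"
    have "of_real s * of_real ((norm (c *\<^sub>R x))\<^sup>2) = complex_of_real (s * c\<^sup>2 * (norm x)\<^sup>2)"
      using c by (simp add: power_mult_distrib mult.assoc)
    then have e: "- of_real s * of_real ((norm (c *\<^sub>R x))\<^sup>2) = - complex_of_real ((norm x)\<^sup>2)" by (simp add: sc)
    have n: "norm (c *\<^sub>R x) powr (2 * b) = c powr (2 * b) * norm x powr (2 * b)"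
      using c by (simp add: powr_mult)
    show "norm (c *\<^sub>R x) powr (2 * b) *\<^sub>R (p (c *\<^sub>R x) * exp (- of_real s * of_real ((norm (c *\<^sub>R x))\<^sup>2)))
     = of_real (c powr (2 * b) * c ^ d) * (norm x powr (2 * b) *\<^sub>R (p x * exp (- 1 * of_real ((norm x)\<^sup>2))))"
      unfolding e n hp_homogeneous[OF p] by (simp add: scaleR_conv_of_real mult_ac)
  qed
  also have "(c ^ CARD('n)) *\<^sub>R (LINT x|lborel. of_real (c powr (2 * b) * c ^ d) * (norm x powr (2 * b) *\<^sub>R (p x * exp (- 1 * of_real ((norm x)\<^sup>2)))))
     = of_real (c ^ CARD('n) * (c powr (2 * b) * c ^ d)) * (LINT x|lborel. norm x powr (2 * b) *\<^sub>R (p x * exp (- 1 * of_real ((norm x)\<^sup>2))))"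
    by (simp add: scaleR_conv_of_real)
  also have "(LINT x|lborel. norm x powr (2 * b) *\<^sub>R (p x * exp (- 1 * of_real ((norm x)\<^sup>2)))) = gtrans (weighted_measure b) p 0 1"
    unfolding gtrans_def by (subst integral_weighted) auto
  also have "c ^ CARD('n) * (c powr (2 * b) * c ^ d) = c powr (2 * b + (real d + real CARD('n)))"
    using c by (simp add: powr_add powr_realpow)
  also have "\<dots> = s powr (- (b + (real d + real CARD('n)) / 2))"
    by (simp add: c_def powr_powr field_simps)
  finally show ?thesis .
qed

text \<open>Both sides are holomorphic in the right half plane and agree on the positive axis.\<close>

lemma gtrans_hp:
  fixes p :: "real^'n \<Rightarrow> complex"
  assumes b: "b > - real CARD('n) / 2" and p: "p \<in> homogeneous_poly d" and s: "Re s > 0"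
  shows "gtrans (weighted_measure b) p 0 s =
    exp (- of_real (b + (real d + real CARD('n)) / 2) * Ln s) * gtrans (weighted_measure b) p 0 1"
proof -
  let ?a = "complex_of_real (b + (real d + real CARD('n)) / 2)"
  let ?f = "\<lambda>s. gtrans (weighted_measure b) p 0 s - exp (- ?a * Ln s) * gtrans (weighted_measure b) p 0 1"
  have "?f s = 0"
  proof (rule holomorphic_zero_on_positive_reals[OF _ _ s])
    show "?f holomorphic_on {s. Re s > 0}"
      by (intro holomorphic_intros gtrans_holomorphic hp_gauss_integrable[OF b p])
         (auto simp: complex_nonpos_Reals_iff)
    fix t :: real assume t: "t > 0"
    have "complex_of_real (t powr (- (b + (real d + real CARD('n)) / 2))) = exp (- ?a * Ln (of_real t))"
      using t by (simp add: powr_def Ln_of_real exp_of_real[symmetric] mult.commute)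
    then show "?f (of_real t) = 0" using gtrans_hp_real[OF p t, of b] by simp
  qed
  then show ?thesis by simp
qed

text \<open>The derivative in \<^term>\<open>s\<close> of the homogeneity relation; this recursion is what makes the action of $\mathfrak{sl}_2$ on
  polynomials times Gaussians match derivatives of \<^const>\<open>gtrans\<close>.\<close>

lemma gtrans_hp_Suc:
  fixes p :: "real^'n \<Rightarrow> complex"
  assumes b: "b > - real CARD('n) / 2" and p: "p \<in> homogeneous_poly d" and s: "Re s > 0"
  shows "s * gtrans (weighted_measure b) p (Suc k) s =
    of_real (b + (real d + real CARD('n)) / 2 + real k) * gtrans (weighted_measure b) p k s"
  using s
proof (induction k arbitrary: s)
  let ?a = "complex_of_real (b + (real d + real CARD('n)) / 2)"
  let ?G = "gtrans (weighted_measure b) p"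
  note g = hp_gauss_integrable[OF b p]
  case 0
  have "((\<lambda>s. exp (- ?a * Ln s) * ?G 0 1) has_field_derivative exp (- ?a * Ln s) * (- ?a * inverse s) * ?G 0 1) (at s)"
  proof -
    have "s \<notin> \<real>\<^sub>\<le>\<^sub>0" using 0 by (auto simp: complex_nonpos_Reals_iff)
    then show ?thesis
      by (intro DERIV_cmult_right DERIV_fun_exp DERIV_cmult has_field_derivative_Ln)
  qed
  then have "(?G 0 has_field_derivative exp (- ?a * Ln s) * (- ?a * inverse s) * ?G 0 1) (at s)"
  proof (rule has_field_derivative_transform_within_open[OF _ right_half_plane(1)])
    show "s \<in> {s. 0 < Re s}" using 0 by simp
    show "exp (- ?a * Ln x) * ?G 0 1 = ?G 0 x" if "x \<in> {s. 0 < Re s}" for x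
      by (rule gtrans_hp[OF b p, symmetric]) (use that in simp)
  qed
  from DERIV_unique[OF gtrans_deriv[OF g 0] this]
  have "- ?G (Suc 0) s = - (exp (- ?a * Ln s) * (?a * inverse s) * ?G 0 1)"
    by (simp only: mult_minus_left mult_minus_right minus_mult_minus)
  then have "?G (Suc 0) s = exp (- ?a * Ln s) * (?a * inverse s) * ?G 0 1" by (simp only: neg_equal_iff_equal)
  also have "\<dots> = inverse s * (?a * (exp (- ?a * Ln s) * ?G 0 1))" by (simp only: mult_ac)
  also have "exp (- ?a * Ln s) * ?G 0 1 = ?G 0 s" by (rule gtrans_hp[OF b p 0, symmetric])
  finally have eq: "?G (Suc 0) s = inverse s * (?a * ?G 0 s)" .
  have "s \<noteq> 0" using 0 by auto
  then have "s * ?G (Suc 0) s = ?a * ?G 0 s" unfolding eq mult.assoc[symmetric] by (simp only: right_inverse[OF \<open>s \<noteq> 0\<close>] mult_1_left)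
  then show ?case by (simp only: of_nat_0 add_0_right)
next
  let ?a = "complex_of_real (b + (real d + real CARD('n)) / 2)"
  let ?G = "gtrans (weighted_measure b) p"
  note g = hp_gauss_integrable[OF b p]
  case (Suc k)
  have "((\<lambda>s. s * ?G (Suc k) s - (?a + of_nat k) * ?G k s) has_field_derivative
     (1 * ?G (Suc k) s + (- ?G (Suc (Suc k)) s) * s - (?a + of_nat k) * (- ?G (Suc k) s))) (at s)"
    by (intro DERIV_diff DERIV_mult DERIV_ident DERIV_cmult gtrans_deriv g Suc.prems)
  then have "((\<lambda>s. 0) has_field_derivative
     (1 * ?G (Suc k) s + (- ?G (Suc (Suc k)) s) * s - (?a + of_nat k) * (- ?G (Suc k) s))) (at s)"
  proof (rule has_field_derivative_transform_within_open[OF _ right_half_plane(1)])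
    show "s \<in> {s. 0 < Re s}" using Suc.prems by simp
    show "x * ?G (Suc k) x - (?a + of_nat k) * ?G k x = 0" if "x \<in> {s. 0 < Re s}" for x
      using Suc.IH[of x] that by simp
  qed
  have "s * B = (c + 1) * A" if "1 * A + (- B) * s - c * (- A) = 0" for A B c :: complex
    using that by (simp add: algebra_simps)
  from this[OF DERIV_unique[OF \<open>((\<lambda>s. 0) has_field_derivative _) _\<close> DERIV_const]]
  have "s * ?G (Suc (Suc k)) s = (?a + of_nat k + 1) * ?G (Suc k) s" .
  also have "?a + of_nat k + 1 = of_real (b + (real d + real CARD('n)) / 2 + real (Suc k))" by simp
  finally show ?case .
qed

subsection \<open>Orthogonality of harmonic polynomials of different degrees\<close>

lemma integral_lborel_translate:
  fixes f :: "real^'n \<Rightarrow> complex"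
  assumes "f \<in> borel_measurable borel"
  shows "(LINT x|lborel. f (c + x)) = (LINT x|lborel. f x)" "integrable lborel (\<lambda>x. f (c + x)) = integrable lborel f"
proof -
  have "(LINT x|lborel. f x) = (LINT x|distr lborel borel ((+) c). f x)" by (simp add: lborel_distr_plus)
  also have "\<dots> = (LINT x|lborel. f (c + x))" by (rule integral_distr) (use assms in auto)
  finally show "(LINT x|lborel. f (c + x)) = (LINT x|lborel. f x)" ..
  have "integrable lborel f = integrable (distr lborel borel ((+) c)) f" by (simp add: lborel_distr_plus)
  also have "\<dots> = integrable lborel (\<lambda>x. f (c + x))" by (rule integrable_distr_eq) (use assms in auto)
  finally show "integrable lborel (\<lambda>x. f (c + x)) = integrable lborel f" ..
qed

text \<open>Translation in the coordinate direction does not change the integral, so that the integral of every difference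
  quotient vanishes; the bound by \<^term>\<open>B\<close> allows the limit under the integral.\<close>

lemma integral_pd_zero:
  fixes f g :: "real^'n \<Rightarrow> complex" and B :: "real^'n \<Rightarrow> real"
  assumes f: "integrable lborel f" and pd: "\<And>x. has_pd f i x (g x)"
    and g: "g \<in> borel_measurable borel" and B: "integrable lborel B"
    and bound: "\<And>x t. 0 \<le> t \<Longrightarrow> t \<le> 1 \<Longrightarrow> cmod (g (x + t *\<^sub>R axis i 1)) \<le> B x"
  shows "(LINT x|lborel. g x) = 0"
proof -
  have fm[measurable]: "f \<in> borel_measurable borel" using f by auto
  let ?e = "axis i 1 :: real^'n"
  let ?h = "\<lambda>k::nat. 1 / real (Suc k)"
  let ?u = "\<lambda>k x. of_nat (Suc k) * (f (?h k *\<^sub>R ?e + x) - f x)"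
  have d: "((\<lambda>t. f (x + t *\<^sub>R ?e)) has_vector_derivative g (x + t *\<^sub>R ?e)) (at t)" for x t
  proof -
    have "((\<lambda>s. f (x + t *\<^sub>R ?e + s *\<^sub>R ?e)) has_vector_derivative g (x + t *\<^sub>R ?e)) (at 0)"
      using pd[of "x + t *\<^sub>R ?e"] by (simp add: has_pd_def)
    then have "((\<lambda>s. f (x + (t + s) *\<^sub>R ?e)) has_vector_derivative g (x + t *\<^sub>R ?e)) (at 0)"
      by (simp add: algebra_simps)
    then have "((\<lambda>s. f (x + (t + (s - t)) *\<^sub>R ?e)) has_vector_derivative g (x + t *\<^sub>R ?e)) (at t)"
      using vector_diff_chain_at[of "\<lambda>s. s - t" 1 t "\<lambda>s. f (x + (t + s) *\<^sub>R ?e)" "g (x + t *\<^sub>R ?e)"]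
      by (simp add: o_def has_vector_derivative_diff_const[of id t 1 "at t", simplified])
    then show ?thesis by simp
  qed
  have lim: "(\<lambda>k. LINT x|lborel. ?u k x) \<longlonglongrightarrow> (LINT x|lborel. g x)"
  proof (rule integral_dominated_convergence[OF _ _ B])
    show "AE x in lborel. (\<lambda>k. ?u k x) \<longlonglongrightarrow> g x"
    proof (rule AE_I2)
      fix x
      have "((\<lambda>t. (f (x + t *\<^sub>R ?e) - f x) /\<^sub>R t) \<longlongrightarrow> g x) (at 0)"
      proof (rule LIM_zero_cancel, rule tendsto_norm_zero_cancel)
        have "((\<lambda>h. norm (f (x + h *\<^sub>R ?e) - f x - h *\<^sub>R g x) / norm h) \<longlongrightarrow> 0) (at 0)"
          using d[of x 0] by (simp add: has_vector_derivative_def has_derivative_at)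
        then show "((\<lambda>t. norm ((f (x + t *\<^sub>R ?e) - f x) /\<^sub>R t - g x)) \<longlongrightarrow> 0) (at 0)"
        proof (rule Lim_transform_eventually)
          show "\<forall>\<^sub>F t in at 0. norm (f (x + t *\<^sub>R ?e) - f x - t *\<^sub>R g x) / norm t = norm ((f (x + t *\<^sub>R ?e) - f x) /\<^sub>R t - g x)"
            unfolding eventually_at_filter
          proof (intro always_eventually allI impI)
            fix t :: real assume t: "t \<noteq> 0"
            then have "(f (x + t *\<^sub>R ?e) - f x) /\<^sub>R t - g x = (f (x + t *\<^sub>R ?e) - f x - t *\<^sub>R g x) /\<^sub>R t"
              by (simp add: scaleR_diff_right)
            then show "norm (f (x + t *\<^sub>R ?e) - f x - t *\<^sub>R g x) / norm t = norm ((f (x + t *\<^sub>R ?e) - f x) /\<^sub>R t - g x)"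
              by (simp add: divide_inverse mult.commute)
          qed
        qed
      qed
      then have "(\<lambda>k. (f (x + ?h k *\<^sub>R ?e) - f x) /\<^sub>R ?h k) \<longlonglongrightarrow> g x"
        by (rule filterlim_compose) (auto simp: filterlim_at LIMSEQ_inverse_real_of_nat divide_inverse simp del: of_nat_Suc)
      then show "(\<lambda>k. ?u k x) \<longlonglongrightarrow> g x"
        by (simp add: scaleR_conv_of_real add.commute divide_inverse del: of_nat_Suc)
    qed
    show "AE x in lborel. norm (?u k x) \<le> B x" for k
    proof (rule AE_I2)
      fix x
      have h: "0 < ?h k" "?h k \<le> 1" by (auto simp: divide_simps)
      have "\<exists>t\<in>{0<..<?h k}. norm (f (x + ?h k *\<^sub>R ?e) - f (x + 0 *\<^sub>R ?e)) \<le> norm ((?h k - 0) *\<^sub>R g (x + t *\<^sub>R ?e))"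
        by (rule mvt_general[OF h(1)])
           (use d in \<open>auto simp: has_vector_derivative_def intro!: continuous_at_imp_continuous_on has_vector_derivative_continuous\<close>)
      then obtain t where t: "0 < t" "t < ?h k" "cmod (f (x + ?h k *\<^sub>R ?e) - f x) \<le> ?h k * cmod (g (x + t *\<^sub>R ?e))"
        using h(1) by (auto simp: norm_mult)
      have "cmod (f (x + ?h k *\<^sub>R ?e) - f x) \<le> ?h k * B x"
        using t(1) order_trans[OF less_imp_le[OF t(2)] h(2)] h(1)
        by (intro order_trans[OF t(3)] mult_left_mono bound) auto
      then have "real (Suc k) * cmod (f (?h k *\<^sub>R ?e + x) - f x) \<le> B x"
        by (simp add: add.commute field_simps)
      then show "norm (?u k x) \<le> B x" by (simp only: norm_mult norm_of_nat)
    qed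
  qed (use g in auto)
  have "(LINT x|lborel. ?u k x) = 0" for k
    using integral_lborel_translate[OF fm, of "?h k *\<^sub>R ?e"] f by simp
  then have "(\<lambda>k. LINT x|lborel. ?u k x) = (\<lambda>k. 0)" by (rule ext)
  with lim have "(\<lambda>k. 0) \<longlonglongrightarrow> (LINT x|lborel. g x)" by (simp only:)
  then show ?thesis using LIMSEQ_unique tendsto_const by blast
qed

lemma gauss_shift_bound:
  fixes x :: "real^'n" and i :: 'n
  assumes s: "s > 0" and t: "0 \<le> t" "t \<le> 1"
  defines "y \<equiv> x + t *\<^sub>R axis i 1"
  shows "(1 + norm y)^d * exp (- s * (norm y)\<^sup>2) \<le> (4^d * exp s) * ((1 + norm x ^ d) * exp (- (s / 2) * (norm x)\<^sup>2))"
proof -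
  have n1: "norm (t *\<^sub>R axis i (1::real)) \<le> 1" using t by simp
  have y1: "norm y \<le> norm x + 1" unfolding y_def using norm_triangle_ineq[of x "t *\<^sub>R axis i 1"] n1 by linarith
  have x1: "norm x \<le> norm y + 1"
    unfolding y_def using norm_triangle_ineq4[of "x + t *\<^sub>R axis i 1" "t *\<^sub>R axis i 1"] n1 by simp
  have p: "(1 + norm y)^d \<le> 4^d * (1 + norm x ^ d)"
  proof (cases "norm x \<le> 1")
    case True
    then have "(1 + norm y)^d \<le> 4^d" using y1 by (intro power_mono) auto
    also have "\<dots> \<le> 4^d * (1 + norm x ^ d)" by simp
    finally show ?thesis .
  next
    case False
    then have "(1 + norm y)^d \<le> (4 * norm x)^d" using y1 by (intro power_mono) auto
    also have "\<dots> \<le> 4^d * (1 + norm x ^ d)" by (simp add: power_mult_distrib)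
    finally show ?thesis .
  qed
  have "(norm x)\<^sup>2 \<le> (norm y + 1)\<^sup>2" using x1 by (intro power_mono) auto
  also have "\<dots> \<le> 2 * (norm y)\<^sup>2 + 2" using zero_le_power2[of "norm y - 1"] by (simp add: power2_eq_square algebra_simps)
  finally have "- s * (norm y)\<^sup>2 \<le> s + (- (s / 2) * (norm x)\<^sup>2)"
    using s mult_left_mono[of "(norm x)\<^sup>2" "2 * (norm y)\<^sup>2 + 2" "s / 2"] by (simp add: algebra_simps)
  then have e: "exp (- s * (norm y)\<^sup>2) \<le> exp s * exp (- (s / 2) * (norm x)\<^sup>2)" by (simp flip: exp_add)
  have "(1 + norm y)^d * exp (- s * (norm y)\<^sup>2) \<le> (4^d * (1 + norm x ^ d)) * (exp s * exp (- (s / 2) * (norm x)\<^sup>2))"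
    by (intro mult_mono p e) auto
  then show ?thesis by (simp add: mult_ac)
qed

lemma has_pd_gauss:
  fixes x :: "real^'n" and s :: complex
  shows "has_pd (\<lambda>x::real^'n. exp (- s * of_real ((norm x)\<^sup>2))) i x (- 2 * s * of_real (x $ i) * exp (- s * of_real ((norm x)\<^sup>2)))"
proof -
  have "((\<lambda>t. exp (- s * of_real t)) has_vector_derivative - s * exp (- s * of_real t)) (at t)" for t
  proof -
    have "((\<lambda>z. exp (- s * z)) has_field_derivative - s * exp (- s * of_real t)) (at (of_real t))"
      by (auto intro!: derivative_eq_intros)
    from has_vector_derivative_real_field[OF this] show ?thesis .
  qed
  from has_pd_radial[OF this, where x = x and i = i] show ?thesis by (simp add: mult_ac)
qed

lemma integral_hp_gauss_pd:
  fixes P :: "real^'n \<Rightarrow> complex"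
  assumes P: "P \<in> homogeneous_poly d" and s: "s > 0"
  shows "(LINT x|lborel. (partial_deriv i P x - 2 * of_real s * of_real (x $ i) * P x) * exp (- of_real s * of_real ((norm x)\<^sup>2))) = 0"
proof -
  let ?e = "\<lambda>x::real^'n. exp (- complex_of_real s * of_real ((norm x)\<^sup>2))"
  let ?g = "\<lambda>x. (partial_deriv i P x - 2 * of_real s * of_real (x $ i) * P x) * ?e x"
  obtain C1 where C1: "C1 \<ge> 0" "\<And>x. cmod (partial_deriv i P x) \<le> C1 * norm x ^ (d - 1)"
    using hp_bound[OF hp_pd(2)[OF P]] by blast
  obtain C2 where C2: "C2 \<ge> 0" "\<And>x. cmod (P x) \<le> C2 * norm x ^ d"
    using hp_bound[OF P] by blast
  define C where "C = C1 + 2 * s * C2"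
  have C: "C \<ge> 0" using C1 C2 s by (simp add: C_def)
  have gb: "cmod (?g x) \<le> C * ((1 + norm x) ^ (d + 1) * exp (- s * (norm x)\<^sup>2))" for x
  proof -
    have "cmod (partial_deriv i P x) \<le> C1 * (1 + norm x) ^ (d + 1)"
    proof -
      have "norm x ^ (d - 1) \<le> (1 + norm x) ^ (d - 1)" by (intro power_mono) auto
      also have "\<dots> \<le> (1 + norm x) ^ (d + 1)" by (intro power_increasing) auto
      finally show ?thesis using C1 by (meson mult_left_mono order_trans)
    qed
    moreover have "cmod (2 * of_real s * of_real (x $ i) * P x) \<le> 2 * s * C2 * (1 + norm x) ^ (d + 1)"
    proof -
      have "cmod (2 * of_real s * of_real (x $ i) * P x) = 2 * s * (\<bar>x $ i\<bar> * cmod (P x))"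
        using s by (simp add: norm_mult)
      also have "\<dots> \<le> 2 * s * ((1 + norm x) * (C2 * (1 + norm x) ^ d))"
      proof (intro mult_left_mono mult_mono)
        show "\<bar>x $ i\<bar> \<le> 1 + norm x" using component_le_norm_cart[of x i] by simp
        have "C2 * norm x ^ d \<le> C2 * (1 + norm x) ^ d" using C2(1) by (intro mult_left_mono power_mono) auto
        with C2(2)[of x] show "cmod (P x) \<le> C2 * (1 + norm x) ^ d" by linarith
      qed (use s in auto)
      finally show ?thesis by (simp add: mult_ac)
    qed
    ultimately have "cmod (partial_deriv i P x - 2 * of_real s * of_real (x $ i) * P x) \<le> C * (1 + norm x) ^ (d + 1)"
      using norm_triangle_ineq4[of "partial_deriv i P x" "2 * of_real s * of_real (x $ i) * P x"]
      by (simp add: C_def distrib_right)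
    then have "cmod (partial_deriv i P x - 2 * of_real s * of_real (x $ i) * P x) * cmod (?e x) \<le> C * (1 + norm x) ^ (d + 1) * cmod (?e x)"
      by (rule mult_right_mono) simp
    then show ?thesis by (simp add: norm_mult mult.assoc)
  qed
  show ?thesis
  proof (rule integral_pd_zero[where f = "\<lambda>x. P x * ?e x" and i = i and
        B = "\<lambda>x. C * ((4^(d+1) * exp s) * ((1 + norm x ^ (d+1)) * exp (- (s / 2) * (norm x)\<^sup>2)))"])
    have "integrable (weighted_measure 0) (\<lambda>x. P x * ?e x)"
      by (rule hp_integrable[OF _ _ P]) (use s in auto)
    then show "integrable lborel (\<lambda>x. P x * ?e x)"
      using weighted_0(1)[of "\<lambda>x. P x * ?e x"] hp_measurable[OF P] by simp
    show "has_pd (\<lambda>x. P x * ?e x) i x (?g x)" for x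
      using has_pd_mult[OF hp_pd(1)[OF P, of i x] has_pd_gauss[of "of_real s" i x]] by (simp add: algebra_simps)
    show "?g \<in> borel_measurable borel"
      using hp_measurable[OF P] hp_measurable[OF hp_pd(2)[OF P, of i]] by measurable
    have int1: "integrable lborel (\<lambda>x::real^'n. norm x ^ k * exp (- (s / 2) * (norm x)\<^sup>2))" for k
    proof -
      have ae: "AE x::real^'n in lborel. norm x powr real k * exp (- (s / 2) * (norm x)\<^sup>2) = norm x ^ k * exp (- (s / 2) * (norm x)\<^sup>2)"
        using AE_lborel_singleton[of "0::real^'n"] by eventually_elim (simp add: powr_realpow)
      have i: "integrable lborel (\<lambda>x::real^'n. norm x powr real k * exp (- (s / 2) * (norm x)\<^sup>2))"
        by (rule integrable_powr_gauss) (use s in \<open>auto intro: less_le_trans[of _ 0]\<close>)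
      show ?thesis by (rule integrable_cong_AE_imp[OF i _ ae]) measurable
    qed
    show "integrable lborel (\<lambda>x::real^'n. C * ((4^(d+1) * exp s) * ((1 + norm x ^ (d+1)) * exp (- (s / 2) * (norm x)\<^sup>2))))"
      using int1[of 0] int1[of "d+1"] by (intro integrable_mult_right) (simp add: distrib_right)
    show "cmod (?g (x + t *\<^sub>R axis i 1)) \<le> C * ((4^(d+1) * exp s) * ((1 + norm x ^ (d+1)) * exp (- (s / 2) * (norm x)\<^sup>2)))"
      if "0 \<le> t" "t \<le> 1" for x :: "real^'n" and t
      by (rule order_trans[OF gb mult_left_mono[OF gauss_shift_bound[OF s that] C]])
  qed
qed

text \<open>Green's formula for $p \nabla q - q \nabla p$ against the weight $|x|^{2k} e^{-s|x|^2}$. The divergence of the field vanishes for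
  harmonic $p$, $q$, and by Euler's identity its radial component is $(n - m) p q$. What remains expresses the integral with exponent $k$
  by the one with exponent $k - 1$, and it vanishes when $k = 0$.\<close>

lemma harmonic_orthogonal_lborel:
  fixes p q :: "real^'n \<Rightarrow> complex"
  assumes p: "p \<in> harmonic_poly m" and q: "q \<in> harmonic_poly n" and mn: "m \<noteq> n" and s: "s > 0"
  shows "gtrans (weighted_measure 0) (\<lambda>x. p x * q x) k (of_real s) = 0"
proof (induction k rule: less_induct)
  case (less k)
  note hp = harmonicD(1)[OF p] and hq = harmonicD(1)[OF q]
  let ?Q = "\<lambda>x::real^'n. complex_of_real ((norm x)\<^sup>2)"
  let ?e = "\<lambda>x::real^'n. exp (- complex_of_real s * ?Q x)"
  let ?R = "\<lambda>i x. p x * partial_deriv i q x - q x * partial_deriv i p x"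
  let ?pq = "\<lambda>x. p x * q x"
  have pq: "?pq \<in> homogeneous_poly (m + n)" by (rule hp_mult[OF hp hq])
  have R: "?R i \<in> homogeneous_poly (m + n - 1)" for i
  proof (rule hp_diff)
    show "(\<lambda>x. p x * partial_deriv i q x) \<in> homogeneous_poly (m + n - 1)"
      using hp_mult[OF hp hp_pd(2)[OF hq, of i]] hp_pd(3)[OF hq, of i] hp_0 by (cases "n = 0") simp_all
    show "(\<lambda>x. q x * partial_deriv i p x) \<in> homogeneous_poly (m + n - 1)"
      using hp_mult[OF hq hp_pd(2)[OF hp, of i]] hp_pd(3)[OF hp, of i] hp_0 by (cases "m = 0") (simp_all add: add.commute)
  qed
  let ?P = "\<lambda>i x. ?R i x * ?Q x ^ k"
  have P: "?P i \<in> homogeneous_poly (m + n - 1 + 2 * k)" for i by (rule hp_mult_norm_sq[OF R])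
  let ?D = "\<lambda>i x. ?R i x * (2 * of_real (x $ i) * (of_nat k * ?Q x ^ (k - 1))) +
     (p x * partial_deriv i (partial_deriv i q) x - q x * partial_deriv i (partial_deriv i p) x) * ?Q x ^ k"
  have D: "partial_deriv i (?P i) x = ?D i x" for i x
  proof (rule partial_deriv_eq)
    have 1: "has_pd (\<lambda>x. ?Q x ^ k) i x (2 * of_real (x $ i) * (of_nat k * ?Q x ^ (k - 1)))"
      using has_pd_radial[OF power_has_vector_derivative[of k], where x = x and i = i] by simp
    have 2: "has_pd (?R i) i x (p x * partial_deriv i (partial_deriv i q) x - q x * partial_deriv i (partial_deriv i p) x)"
    proof -
      have "has_pd (\<lambda>x. p x * partial_deriv i q x + (-1) * (q x * partial_deriv i p x)) i x
        ((p x * partial_deriv i (partial_deriv i q) x + partial_deriv i p x * partial_deriv i q x)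
        + (-1) * (q x * partial_deriv i (partial_deriv i p) x + partial_deriv i q x * partial_deriv i p x))"
        by (intro has_pd_add has_pd_cmult has_pd_mult hp_pd(1)[OF hp] hp_pd(1)[OF hq] hp_pd(1)[OF hp_pd(2)[OF hp]]
            hp_pd(1)[OF hp_pd(2)[OF hq]])
      then show ?thesis by (simp add: algebra_simps)
    qed
    show "has_pd (?P i) i x (?D i x)" by (rule has_pd_mult[OF 2 1])
  qed
  let ?I = "\<lambda>i x. (?D i x - 2 * of_real s * of_real (x $ i) * ?P i x) * ?e x"
  have I0: "(LINT x|lborel. ?I i x) = 0" for i
    using integral_hp_gauss_pd[OF P s, of i i] unfolding D .
  have sumI: "(\<Sum>i\<in>UNIV. ?I i x) = (of_nat n - of_nat m) *
      (2 * of_nat k * (?pq x * ?Q x ^ (k - 1) * ?e x) - 2 * of_real s * (?pq x * ?Q x ^ k * ?e x))" for x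
  proof -
    have xR: "(\<Sum>i\<in>UNIV. of_real (x $ i) * ?R i x) = (of_nat n - of_nat m) * ?pq x"
    proof -
      have "(\<Sum>i\<in>UNIV. of_real (x $ i) * ?R i x) = p x * (\<Sum>i\<in>UNIV. of_real (x $ i) * partial_deriv i q x)
          - q x * (\<Sum>i\<in>UNIV. of_real (x $ i) * partial_deriv i p x)"
        unfolding sum_distrib_left sum_subtractf[symmetric] by (rule sum.cong) (auto simp: algebra_simps)
      then show ?thesis unfolding hp_pd(4)[OF hp] hp_pd(4)[OF hq] by (simp add: algebra_simps)
    qed
    have lap: "(\<Sum>i\<in>UNIV. p x * partial_deriv i (partial_deriv i q) x - q x * partial_deriv i (partial_deriv i p) x) = 0"
      using harmonicD(2)[OF p, of x] harmonicD(2)[OF q, of x]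
      by (simp add: sum_subtractf laplacian_def flip: sum_distrib_left)
    have "(\<Sum>i\<in>UNIV. ?I i x) = ((\<Sum>i\<in>UNIV. of_real (x $ i) * ?R i x) * (2 * (of_nat k * ?Q x ^ (k - 1)))
       + (\<Sum>i\<in>UNIV. p x * partial_deriv i (partial_deriv i q) x - q x * partial_deriv i (partial_deriv i p) x) * ?Q x ^ k
       - (\<Sum>i\<in>UNIV. of_real (x $ i) * ?R i x) * (2 * of_real s * ?Q x ^ k)) * ?e x"
      unfolding sum_distrib_right sum_subtractf[symmetric] sum.distrib[symmetric]
      by (rule sum.cong) (auto simp: algebra_simps)
    then show ?thesis unfolding xR lap by (simp add: algebra_simps)
  qed
  have int: "integrable lborel (\<lambda>x. F x * ?e x)" if "F \<in> homogeneous_poly d" for F d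
  proof -
    have "integrable (weighted_measure 0) (\<lambda>x. F x * ?e x)"
      by (rule hp_integrable[OF _ _ that]) (use s in auto)
    then show ?thesis using weighted_0(1)[of "\<lambda>x. F x * ?e x"] hp_measurable[OF that] by simp
  qed
  have Ii: "integrable lborel (?I i)" for i
  proof -
    have "integrable lborel (\<lambda>x. partial_deriv i (?P i) x * ?e x - 2 * of_real s * ((of_real (x $ i) * ?P i x) * ?e x))"
      using hp_pd(2)[OF P[of i]] hp_mult[OF hp_coord P[of i]]
      by (intro Bochner_Integration.integrable_diff integrable_mult_right int)
    then show ?thesis unfolding D by (simp add: algebra_simps)
  qed
  have g: "gtrans (weighted_measure 0) ?pq j (of_real s) = (LINT x|lborel. ?pq x * ?Q x ^ j * ?e x)"
    and gi: "integrable lborel (\<lambda>x. ?pq x * ?Q x ^ j * ?e x)" for j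
    unfolding gtrans_def using hp_measurable[OF pq] int[OF hp_mult_norm_sq[OF pq]] by (auto intro!: weighted_0(2))
  have "0 = (\<Sum>i\<in>UNIV. LINT x|lborel. ?I i x)" by (simp only: I0 sum.neutral_const)
  also have "\<dots> = (LINT x|lborel. (\<Sum>i\<in>UNIV. ?I i x))" by (rule Bochner_Integration.integral_sum[symmetric]) (rule Ii)
  also have "\<dots> = (of_nat n - of_nat m) * (2 * of_nat k * gtrans (weighted_measure 0) ?pq (k - 1) (of_real s)
      - 2 * of_real s * gtrans (weighted_measure 0) ?pq k (of_real s))"
    unfolding sumI g using gi by simp
  finally have "2 * of_nat k * gtrans (weighted_measure 0) ?pq (k - 1) (of_real s) = 2 * of_real s * gtrans (weighted_measure 0) ?pq k (of_real s)"
    using mn by simp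
  moreover have "of_nat k * gtrans (weighted_measure 0) ?pq (k - 1) (of_real s) = 0"
    using less.IH[of "k - 1"] by (cases k) auto
  ultimately show ?case using s by simp
qed

text \<open>Euler's integral, used to write a negative power of $|x|^2$ as a superposition of Gaussians.\<close>

lemma Gamma_kernel:
  assumes a: "a > 0" and r: "r > 0"
  shows "has_bochner_integral lborel (\<lambda>t::real. indicator {0<..} t * (t powr (a - 1) * exp (- t * r))) (Gamma a * r powr (- a))"
proof -
  have "((\<lambda>t. t powr (a - 1) / exp t) has_integral Gamma a) {0..}" by (rule Gamma_integral_real[OF a])
  have "has_bochner_integral lborel (\<lambda>t::real. indicator {0..} t * t powr (a - 1) / exp t) (Gamma a)"
  proof (rule has_bochner_integral_nn_integral)
    show "(\<integral>\<^sup>+x. ennreal (indicator {0..} x * x powr (a - 1) / exp x) \<partial>lborel) = ennreal (Gamma a)"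
      using Gamma_conv_nn_integral_real[OF a] by simp
    show "0 \<le> Gamma a" using a by (simp add: less_imp_le)
  qed auto
  from lborel_has_bochner_integral_real_affine_iff[of r "\<lambda>t::real. indicator {0..} t * t powr (a - 1) / exp t" "Gamma a" 0] this r
  have "has_bochner_integral lborel (\<lambda>t. indicator {0..} (r * t) * (r * t) powr (a - 1) / exp (r * t)) (Gamma a / r)"
    by (simp add: divide_inverse mult.commute)
  then have "has_bochner_integral lborel (\<lambda>t. r powr (1 - a) * (indicator {0..} (r * t) * (r * t) powr (a - 1) / exp (r * t)))
      (r powr (1 - a) * (Gamma a / r))"
    by (rule has_bochner_integral_mult_right)
  moreover have "r powr (1 - a) * (Gamma a / r) = Gamma a * r powr (- a)"
    using r by (simp add: powr_diff powr_minus field_simps)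
  moreover have "r powr (1 - a) * (indicator {0..} (r * t) * (r * t) powr (a - 1) / exp (r * t))
     = indicator {0<..} t * (t powr (a - 1) * exp (- t * r))" for t
  proof (cases "t > 0")
    case True
    have "r powr (1 - a) * (r * t) powr (a - 1) = t powr (a - 1)"
      using True r by (simp add: powr_mult flip: powr_add mult.assoc)
    then show ?thesis using True r by (simp add: exp_minus field_simps indicator_def)
  next
    case False
    then have "t = 0 \<or> r * t < 0" using r by (auto simp: mult_less_0_iff)
    then show ?thesis using False by (auto simp: indicator_def)
  qed
  ultimately show ?thesis by simp
qed

text \<open>The weight is reduced to Lebesgue measure: for an integer $k > b$ and $a = k - b$,
  \[ \Gamma(a) |x|^{2b} = |x|^{2k} \int_0^\infty t^{a-1} e^{-t|x|^2} dt. \]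
  By Fubini's theorem the integral is a superposition of Lebesgue integrals with Gaussian exponent $s + t$, each of which vanishes.\<close>

lemma harmonic_orthogonal_real:
  fixes p q :: "real^'n \<Rightarrow> complex"
  assumes b: "b > - real CARD('n) / 2"
    and p: "p \<in> harmonic_poly m" and q: "q \<in> harmonic_poly n" and mn: "m \<noteq> n" and s: "s > 0"
  shows "gtrans (weighted_measure b) (\<lambda>x. p x * q x) 0 (of_real s) = 0"
proof -
  let ?pq = "\<lambda>x. p x * q x"
  have pq: "?pq \<in> homogeneous_poly (m + n)" by (rule hp_mult[OF harmonicD(1)[OF p] harmonicD(1)[OF q]])
  have [measurable]: "?pq \<in> borel_measurable borel" by (rule hp_measurable[OF pq])
  obtain k :: nat where k: "real k > b" using reals_Archimedean2 by blast
  define a where "a = real k - b"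
  have a: "a > 0" using k by (simp add: a_def)
  let ?Q = "\<lambda>x::real^'n. (norm x)\<^sup>2"
  let ?w = "\<lambda>t::real. indicator {0<..} t * t powr (a - 1)"
  let ?F = "\<lambda>x. ?pq x * of_real (?Q x) ^ k * exp (- of_real s * of_real (?Q x))"
  let ?f = "\<lambda>(x, t). ?F x * of_real (indicator {0<..} t * (t powr (a - 1) * exp (- t * ?Q x)))"
  have ker: "has_bochner_integral lborel (\<lambda>t. indicator {0<..} t * (t powr (a - 1) * exp (- t * ?Q x))) (Gamma a * ?Q x powr (- a))"
    if "x \<noteq> 0" for x :: "real^'n"
    by (rule Gamma_kernel[OF a]) (use that in simp)
  have pw: "?Q x powr (- a) * ?Q x ^ k = norm x powr (2 * b)" if "x \<noteq> 0" for x :: "real^'n"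
  proof -
    have "?Q x > 0" using that by simp
    then have "?Q x powr (- a) * ?Q x ^ k = ?Q x powr (- a + real k)"
      by (simp only: powr_add powr_realpow)
    also have "\<dots> = norm x powr (2 * b)"
    proof -
      have "?Q x = norm x powr 2" using that by (simp add: powr_numeral)
      then show ?thesis by (simp only: powr_powr) (simp add: a_def)
    qed
    finally show ?thesis .
  qed
  have ae: "AE x::real^'n in lborel. x \<noteq> 0" by (rule AE_lborel_singleton)
  have fm: "?f \<in> borel_measurable (lborel \<Otimes>\<^sub>M lborel)" by measurable
  have fint: "integrable (lborel \<Otimes>\<^sub>M lborel) ?f"
  proof (rule lborel_pair.Fubini_integrable[OF fm])
    have i: "integrable lborel (\<lambda>x. norm x powr (2 * b) *\<^sub>R (?pq x * exp (- of_real s * of_real (?Q x))))"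
    proof -
      have "(\<lambda>x. ?pq x * exp (- complex_of_real s * of_real (?Q x))) \<in> borel_measurable borel" by measurable
      from integrable_weighted[OF this, of b] show ?thesis
        using hp_integrable[OF b _ pq, of "of_real s"] s by simp
    qed
    have "integrable lborel (\<lambda>x. Gamma a * cmod (norm x powr (2 * b) *\<^sub>R (?pq x * exp (- of_real s * of_real (?Q x)))))"
      by (intro integrable_mult_right integrable_norm i)
    then show "integrable lborel (\<lambda>x. LINT t|lborel. norm (?f (x, t)))"
    proof (rule integrable_cong_AE_imp)
      show "AE x in lborel. Gamma a * cmod (norm x powr (2 * b) *\<^sub>R (?pq x * exp (- of_real s * of_real (?Q x)))) = (LINT t|lborel. norm (?f (x, t)))"
        using ae
      proof eventually_elim
        case (elim x)
        have "(LINT t|lborel. norm (?f (x, t))) = (LINT t|lborel. cmod (?F x) * (indicator {0<..} t * (t powr (a - 1) * exp (- t * ?Q x))))"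
          by (simp add: norm_mult)
        also have "\<dots> = cmod (?F x) * (Gamma a * ?Q x powr (- a))"
          using has_bochner_integral_integral_eq[OF ker[OF elim]] by simp
        also have "\<dots> = Gamma a * (?Q x powr (- a) * ?Q x ^ k) * cmod (?pq x * exp (- of_real s * of_real (?Q x)))"
          by (simp add: norm_mult norm_power)
        finally have "(LINT t|lborel. norm (?f (x, t))) = Gamma a * (norm x powr (2 * b)) * cmod (?pq x * exp (- of_real s * of_real (?Q x)))"
          unfolding pw[OF elim] .
        then show ?case by (simp only: norm_scaleR) simp
      qed
    qed (use fm in measurable)
    show "AE x in lborel. integrable lborel (\<lambda>t. ?f (x, t))"
      using ae
    proof eventually_elim
      case (elim x)
      have "integrable lborel (\<lambda>t. complex_of_real (indicator {0<..} t * (t powr (a - 1) * exp (- t * ?Q x))))"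
        using ker[OF elim] by (intro integrable_of_real) (auto simp: has_bochner_integral_iff)
      then show ?case unfolding prod.case by (rule integrable_mult_right)
    qed
  qed
  have "gtrans (weighted_measure b) ?pq 0 (of_real s)
     = (LINT x|lborel. norm x powr (2 * b) *\<^sub>R (?pq x * exp (- of_real s * of_real (?Q x))))"
    unfolding gtrans_def by (subst integral_weighted) auto
  then have "of_real (Gamma a) * gtrans (weighted_measure b) ?pq 0 (of_real s)
     = (LINT x|lborel. of_real (Gamma a) * (norm x powr (2 * b) *\<^sub>R (?pq x * exp (- of_real s * of_real (?Q x)))))"
    by (simp only: integral_mult_right_zero)
  also have "\<dots> = (LINT x|lborel. LINT t|lborel. ?f (x, t))"
  proof (rule integral_cong_AE)
    show "AE x in lborel. of_real (Gamma a) * (norm x powr (2 * b) *\<^sub>R (?pq x * exp (- of_real s * of_real (?Q x)))) = (LINT t|lborel. ?f (x, t))"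
      using ae
    proof eventually_elim
      case (elim x)
      have "(LINT t|lborel. ?f (x, t)) = ?F x * of_real (Gamma a * ?Q x powr (- a))"
        using has_bochner_integral_integral_eq[OF ker[OF elim]]
        by (simp del: of_real_mult add: integral_complex_of_real)
      also have "\<dots> = of_real (Gamma a * (?Q x powr (- a) * ?Q x ^ k)) * (?pq x * exp (- of_real s * of_real (?Q x)))"
        by simp
      finally have "(LINT t|lborel. ?f (x, t)) = of_real (Gamma a * norm x powr (2 * b)) * (?pq x * exp (- of_real s * of_real (?Q x)))"
        unfolding pw[OF elim] .
      then show ?case by (simp only: scaleR_conv_of_real of_real_mult mult_ac)
    qed
  qed (use fm in measurable)
  also have "\<dots> = (LINT t|lborel. LINT x|lborel. ?f (x, t))"
    using lborel_pair.Fubini_integral[of "\<lambda>x t. ?f (x, t)"] fint by simp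
  also have "\<dots> = (LINT t::real|lborel. 0)"
  proof (rule Bochner_Integration.integral_cong[OF refl])
    fix t :: real
    show "(LINT x|lborel. ?f (x, t)) = 0"
    proof (cases "t > 0")
      case True
      have "(LINT x|lborel. ?f (x, t)) = (LINT x|lborel. of_real (t powr (a - 1)) * (?pq x * of_real (?Q x) ^ k * exp (- of_real (s + t) * of_real (?Q x))))"
      proof (rule Bochner_Integration.integral_cong[OF refl])
        fix x :: "real^'n"
        have "exp (- complex_of_real (s + t) * of_real (?Q x)) = exp (- of_real s * of_real (?Q x)) * of_real (exp (- t * ?Q x))"
          by (simp add: exp_of_real[symmetric] exp_add[symmetric] algebra_simps)
        then show "?f (x, t) = of_real (t powr (a - 1)) * (?pq x * of_real (?Q x) ^ k * exp (- of_real (s + t) * of_real (?Q x)))"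
          using True by (simp add: indicator_def mult_ac)
      qed
      also have "\<dots> = of_real (t powr (a - 1)) * gtrans (weighted_measure 0) ?pq k (of_real (s + t))"
        unfolding gtrans_def by (subst weighted_0(2)) auto
      finally show ?thesis using harmonic_orthogonal_lborel[OF p q mn, of "s + t" k] True s by simp
    qed simp
  qed
  finally show ?thesis using Gamma_real_pos[OF a] by simp
qed

theorem harmonic_orthogonal:
  fixes p q :: "real^'n \<Rightarrow> complex"
  assumes b: "b > - real CARD('n) / 2"
    and p: "p \<in> harmonic_poly m" and q: "q \<in> harmonic_poly n" and mn: "m \<noteq> n" and s: "Re s > 0"
  shows "gtrans (weighted_measure b) (\<lambda>x. p x * q x) k s = 0"
proof -
  have g: "gauss_integrable (weighted_measure b) (\<lambda>x. p x * q x)"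
    by (rule hp_gauss_integrable[OF b hp_mult[OF harmonicD(1)[OF p] harmonicD(1)[OF q]]])
  show ?thesis
    by (rule gtrans_all_zero[OF g _ s], rule holomorphic_zero_on_positive_reals[OF gtrans_holomorphic[OF g]])
       (use harmonic_orthogonal_real[OF b p q mn] in auto)
qed

section \<open>Gaussian vectors\<close>

definition psi :: "complex \<Rightarrow> (real^'n \<Rightarrow> complex) \<Rightarrow> real^'n \<Rightarrow> complex" where
  "psi \<tau> p x = p x * exp (\<i> * \<tau> / 2 * of_real ((norm x)\<^sup>2))"

definition ebas :: "nat \<Rightarrow> (real^'n \<Rightarrow> complex) \<Rightarrow> real^'n \<Rightarrow> complex" where
  "ebas j p x = p x * of_real ((norm x)\<^sup>2) ^ j * exp (- (1/2) * of_real ((norm x)\<^sup>2))"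

text \<open>The lowest weight $\kappa = b + m + N/2$ of the part of degree \<^term>\<open>m\<close>. The summand is written as $(m + m + N)/2$ because products of
  two polynomials of degree \<^term>\<open>m\<close> are integrated.\<close>

definition kap :: "'n itself \<Rightarrow> real \<Rightarrow> nat \<Rightarrow> real" where
  "kap _ b m = b + (real m + real m + real CARD('n)) / 2"

lemma hp_gauss_sq:
  fixes p :: "real^'n \<Rightarrow> complex"
  assumes b: "b > - real CARD('n) / 2" and s: "Re s > 0" and p: "p \<in> homogeneous_poly m"
  shows "(\<lambda>x. p x * exp (- s * of_real ((norm x)\<^sup>2))) \<in> sq_integrable (weighted_measure b)"
proof -
  have m: "p \<in> borel_measurable borel" by (rule hp_measurable[OF p])
  have "integrable (weighted_measure b) (\<lambda>x. p x * cnj (p x) * exp (- (s + cnj s) * of_real ((norm x)\<^sup>2)))"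
    by (rule hp_integrable[OF b _ hp_mult[OF p hp_cnj[OF p]]]) (use s in simp)
  moreover have "p x * cnj (p x) * exp (- (s + cnj s) * of_real ((norm x)\<^sup>2)) = complex_of_real ((cmod (p x * exp (- s * of_real ((norm x)\<^sup>2))))\<^sup>2)" for x
    unfolding complex_norm_square by (simp add: exp_cnj exp_add[symmetric] algebra_simps)
  ultimately have "integrable (weighted_measure b) (\<lambda>x. complex_of_real ((cmod (p x * exp (- s * of_real ((norm x)\<^sup>2))))\<^sup>2))"
    by simp
  then have "integrable (weighted_measure b) (\<lambda>x. (cmod (p x * exp (- s * of_real ((norm x)\<^sup>2))))\<^sup>2)"
    by (simp only: complex_of_real_integrable_eq)
  then show ?thesis using m unfolding sq_integrable_def by auto
qed

definition poly_exp :: "(real^'n \<Rightarrow> complex) set" where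
  "poly_exp = cfun.span {\<lambda>x. q x * exp (- of_nat k * of_real ((norm x)\<^sup>2)) |q k d. q \<in> homogeneous_poly d}"

lemma poly_exp_base: "q \<in> homogeneous_poly d \<Longrightarrow> (\<lambda>x. q x * exp (- of_nat k * of_real ((norm x)\<^sup>2))) \<in> poly_exp"
  unfolding poly_exp_def by (rule cfun.span_base) auto

lemma poly_exp_add: "u \<in> poly_exp \<Longrightarrow> v \<in> poly_exp \<Longrightarrow> (\<lambda>x. u x + v x) \<in> poly_exp"
  unfolding poly_exp_def using cfun.span_add by (fastforce simp: plus_fun_def)

lemma poly_exp_cmult: "u \<in> poly_exp \<Longrightarrow> (\<lambda>x. c * u x) \<in> poly_exp"
  unfolding poly_exp_def using cfun.span_scale by (fastforce simp: cscale_def)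

lemma poly_exp_induct [consumes 1, case_names zero step]:
  assumes "u \<in> poly_exp" and zero: "P (\<lambda>x. 0)"
    and step: "\<And>c q k d v. q \<in> homogeneous_poly d \<Longrightarrow> P v \<Longrightarrow> P (\<lambda>x. c * (q x * exp (- of_nat k * of_real ((norm x)\<^sup>2))) + v x)"
  shows "P u"
  using assms(1) unfolding poly_exp_def
proof (induction rule: cfun.span_induct_alt)
  case base then show ?case using zero by (simp add: zero_fun_def)
next
  case (step c x y)
  then obtain q k d where q: "q \<in> homogeneous_poly d" "x = (\<lambda>x. q x * exp (- of_nat k * of_real ((norm x)\<^sup>2)))" by auto
  have "cscale c x + y = (\<lambda>z. c * (q z * exp (- of_nat k * of_real ((norm z)\<^sup>2))) + y z)"
    by (simp add: fun_eq_iff cscale_def q(2))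
  then show ?case using assms(3)[OF q(1) step(2), of c k] by (simp only:)
qed

lemma poly_exp_mult:
  assumes u: "u \<in> poly_exp" and v: "v \<in> poly_exp"
  shows "(\<lambda>x. u x * v x) \<in> poly_exp"
  using u
proof (induction rule: poly_exp_induct)
  case zero then show ?case using poly_exp_cmult[OF v, of 0] by simp
next
  case (step c q k d u')
  have "(\<lambda>x. (q x * exp (- of_nat k * of_real ((norm x)\<^sup>2))) * v x) \<in> poly_exp"
    using v
  proof (induction rule: poly_exp_induct)
    case zero then show ?case using poly_exp_cmult[OF v, of 0] by simp
  next
    case (step c' q' k' d' v')
    have "(\<lambda>x. c' * ((q x * q' x) * exp (- of_nat (k + k') * of_real ((norm x)\<^sup>2))) + (q x * exp (- of_nat k * of_real ((norm x)\<^sup>2))) * v' x) \<in> poly_exp"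
      by (rule poly_exp_add[OF poly_exp_cmult[OF poly_exp_base[OF hp_mult[OF \<open>q \<in> homogeneous_poly d\<close> step(1)]]] step(2)])
    moreover have "exp (- of_nat (k + k') * complex_of_real r) = exp (- of_nat k * of_real r) * exp (- of_nat k' * of_real r)" for r
      by (simp add: exp_add[symmetric] algebra_simps)
    ultimately show ?case by (simp only: distrib_left mult_ac)
  qed
  from poly_exp_add[OF poly_exp_cmult[OF this] step(2), of c] show ?case
    by (simp only: distrib_right mult.assoc)
qed

lemma poly_exp_const: "(\<lambda>x. c) \<in> poly_exp"
  using poly_exp_base[OF hp_const, of c 0] by simp

text \<open>Its image is relatively compact, so that the Weierstrass theorem applies there, and it determines $x$. Polynomials in its coordinates are combinations of
  polynomials in $x$ times Gaussians.\<close>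

definition embed :: "real^'n \<Rightarrow> real \<times> (real^'n)" where
  "embed x = (exp (- (norm x)\<^sup>2), exp (- (norm x)\<^sup>2) *\<^sub>R x)"

lemma real_polynomial_embed:
  fixes P :: "real \<times> (real^'n) \<Rightarrow> real"
  assumes "real_polynomial_function P"
  shows "(\<lambda>x. complex_of_real (P (embed x))) \<in> poly_exp"
  using assms
proof (induction rule: real_polynomial_function.induct)
  case (linear f)
  interpret bounded_linear f by fact
  have e: "complex_of_real (exp (- (norm x)\<^sup>2)) = exp (- of_nat 1 * of_real ((norm x)\<^sup>2))" for x :: "real^'n"
    by (simp add: exp_of_real[symmetric])
  have "f (embed x) = exp (- (norm x)\<^sup>2) * f (1, 0) + (\<Sum>i\<in>UNIV. exp (- (norm x)\<^sup>2) * x $ i * f (0, axis i 1))" for x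
  proof -
    have "x = (\<Sum>i\<in>UNIV. x $ i *\<^sub>R axis i 1)"
      using basis_expansion[of x] by (simp add: scalar_mult_eq_scaleR)
    from arg_cong[OF this, of "\<lambda>v. exp (- (norm x)\<^sup>2) *\<^sub>R v"]
    have "exp (- (norm x)\<^sup>2) *\<^sub>R x = (\<Sum>i\<in>UNIV. (exp (- (norm x)\<^sup>2) * x $ i) *\<^sub>R axis i 1)"
      by (simp only: scaleR_sum_right scaleR_scaleR)
    then have "embed x = exp (- (norm x)\<^sup>2) *\<^sub>R (1, 0) + (\<Sum>i\<in>UNIV. (exp (- (norm x)\<^sup>2) * x $ i) *\<^sub>R (0, axis i 1))"
      by (simp add: embed_def prod_eq_iff fst_sum snd_sum)
    then show ?thesis by (simp only: add sum scaleR) simp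
  qed
  then have eq: "(\<lambda>x. complex_of_real (f (embed x))) = (\<lambda>x. of_real (f (1, 0)) * (1 * exp (- of_nat 1 * of_real ((norm x)\<^sup>2)))
      + (\<Sum>i\<in>UNIV. of_real (f (0, axis i 1)) * (of_real (x $ i) * exp (- of_nat 1 * of_real ((norm x)\<^sup>2)))))"
    by (simp add: fun_eq_iff e mult_ac)
  have s: "(\<lambda>x. \<Sum>i\<in>A. of_real (f (0, axis i 1)) * (of_real (x $ i) * exp (- of_nat 1 * of_real ((norm x)\<^sup>2)))) \<in> poly_exp" for A :: "'n set"
  proof (induction A rule: infinite_finite_induct)
    case (insert i F)
    from poly_exp_add[OF poly_exp_cmult[OF poly_exp_base[OF hp_coord]] insert.IH] show ?case
      unfolding sum.insert[OF insert.hyps] .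
  qed (use poly_exp_const[of 0] in simp_all)
  show ?case unfolding eq
    by (intro poly_exp_add poly_exp_cmult s poly_exp_base[OF hp_const])
next
  case (const c) then show ?case by (rule poly_exp_const)
next
  case (add f g) then show ?case using poly_exp_add by simp
next
  case (mult f g) then show ?case using poly_exp_mult by simp
qed

context
  fixes b :: real and M :: "(real^'n) measure"
  assumes b: "b > - real CARD('n) / 2"
  defines "M \<equiv> weighted_measure b"
begin

lemma psi_sq: "Im \<tau> > 0 \<Longrightarrow> p \<in> homogeneous_poly m \<Longrightarrow> psi \<tau> p \<in> sq_integrable M"
  using hp_gauss_sq[OF b, of "- \<i> * \<tau> / 2" p m] by (simp add: psi_def[abs_def] M_def)

lemma ebas_sq: "p \<in> homogeneous_poly m \<Longrightarrow> ebas j p \<in> sq_integrable M"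
  using hp_gauss_sq[OF b _ hp_mult_norm_sq, of "1/2" p m j] by (simp add: ebas_def[abs_def] M_def)

lemma sq_mult_gauss_integrable:
  assumes f: "f \<in> sq_integrable M" and p: "p \<in> homogeneous_poly m"
  shows "gauss_integrable M (\<lambda>x. f x * p x)"
  unfolding gauss_integrable_def
proof (intro conjI allI impI)
  show "sets M = sets borel" by (simp add: M_def)
  show "(\<lambda>x. f x * p x) \<in> borel_measurable M"
    using sq_measurable[OF f] hp_measurable[OF p] by (simp add: M_def)
  fix k and s :: complex assume s: "0 < Re s"
  have "(\<lambda>x. cnj (p x) * of_real ((norm x)\<^sup>2) ^ k * exp (- cnj s * of_real ((norm x)\<^sup>2))) \<in> sq_integrable M"
    unfolding M_def by (rule hp_gauss_sq[OF b _ hp_mult_norm_sq[OF hp_cnj[OF p]]]) (use s in simp)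
  from integrable_ip[OF f this]
  show "integrable M (\<lambda>x. f x * p x * of_real ((norm x)\<^sup>2) ^ k * exp (- s * of_real ((norm x)\<^sup>2)))"
    by (simp add: exp_cnj mult.assoc)
qed

lemma ip_psi: "ip M f (psi (2 * \<i> * cnj s) p) = gtrans M (\<lambda>x. f x * cnj (p x)) 0 s"
  unfolding ip_def gtrans_def psi_def by (simp add: exp_cnj mult.assoc)

lemma ip_ebas: "ip M f (ebas j p) = gtrans M (\<lambda>x. f x * cnj (p x)) j (1/2)"
  unfolding ip_def gtrans_def ebas_def by (simp add: exp_cnj mult.assoc)

lemma ip_ebas_psi: "ip M (ebas j p) (psi \<sigma> q) = gtrans M (\<lambda>x. p x * cnj (q x)) j ((1 + \<i> * cnj \<sigma>) / 2)"
proof -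
  have "ebas j p x * cnj (psi \<sigma> q x)
    = p x * cnj (q x) * of_real ((norm x)\<^sup>2) ^ j * exp (- ((1 + \<i> * cnj \<sigma>) / 2) * of_real ((norm x)\<^sup>2))" for x
  proof -
    have "exp (- ((1 + \<i> * cnj \<sigma>) / 2) * of_real ((norm x)\<^sup>2)) = exp (- (1/2) * of_real ((norm x)\<^sup>2)) * cnj (exp (\<i> * \<sigma> / 2 * of_real ((norm x)\<^sup>2)))"
      unfolding exp_cnj exp_add[symmetric]
      by (rule arg_cong[where f = exp]) (simp add: algebra_simps add_divide_distrib diff_divide_distrib)
    then show ?thesis by (simp add: ebas_def psi_def)
  qed
  then show ?thesis unfolding ip_def gtrans_def by (simp only:)
qed

text \<open>The product of the two Gaussians is a Gaussian with exponent $-i(\tau - \bar\sigma)/2$, and \<open>gtrans_hp\<close> evaluates its integral.\<close>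

lemma psi_gram:
  assumes \<tau>: "Im \<tau> > 0" and \<sigma>: "Im \<sigma> > 0" and p: "p \<in> harmonic_poly m" and q: "q \<in> harmonic_poly m"
  shows "ip M (psi \<tau> p) (psi \<sigma> q) = exp (- of_real (kap TYPE('n) b m) * Ln (- \<i> * (\<tau> - cnj \<sigma>)))
    * (exp (of_real (kap TYPE('n) b m) * of_real (ln 2)) * gtrans M (\<lambda>x. p x * cnj (q x)) 0 1)"
proof -
  let ?z = "- \<i> * (\<tau> - cnj \<sigma>)"
  have z: "Re ?z > 0" using \<tau> \<sigma> by simp
  then have z0: "?z \<noteq> 0" by force
  have "Ln (w / 2) = Ln w - of_real (ln 2)" if "w \<noteq> 0" for w :: complex
    using Ln_times_of_real[of "1/2" w] Ln_of_real[of "1/2"] that by (simp add: ln_div)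
  then have L: "Ln (?z / 2) = Ln ?z - of_real (ln 2)" using z0 .
  have "ip M (psi \<tau> p) (psi \<sigma> q) = gtrans M (\<lambda>x. p x * cnj (q x)) 0 (?z / 2)"
  proof -
    have "psi \<tau> p x * cnj (psi \<sigma> q x) = p x * cnj (q x) * of_real ((norm x)\<^sup>2) ^ 0 * exp (- (?z / 2) * of_real ((norm x)\<^sup>2))" for x
    proof -
      have "exp (- (?z / 2) * of_real ((norm x)\<^sup>2)) = exp (\<i> * \<tau> / 2 * of_real ((norm x)\<^sup>2)) * cnj (exp (\<i> * \<sigma> / 2 * of_real ((norm x)\<^sup>2)))"
        unfolding exp_cnj exp_add[symmetric]
      by (rule arg_cong[where f = exp]) (simp add: algebra_simps add_divide_distrib diff_divide_distrib)
      then show ?thesis by (simp add: psi_def)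
    qed
    then show ?thesis unfolding ip_def gtrans_def by (simp only:)
  qed
  also have "\<dots> = exp (- of_real (kap TYPE('n) b m) * Ln (?z / 2)) * gtrans M (\<lambda>x. p x * cnj (q x)) 0 1"
    unfolding M_def kap_def
    by (rule gtrans_hp[OF b hp_mult[OF harmonicD(1)[OF p] hp_cnj[OF harmonicD(1)[OF q]]], unfolded of_nat_add])
       (use z in simp)
  also have "exp (- of_real (kap TYPE('n) b m) * Ln (?z / 2)) =
      exp (- of_real (kap TYPE('n) b m) * Ln ?z) * exp (of_real (kap TYPE('n) b m) * of_real (ln 2))"
  proof -
    have "exp (- k * (u - l)) = exp (- k * u) * exp (k * l)" for k u l :: complex
      by (simp add: exp_add[symmetric] algebra_simps)
    then show ?thesis unfolding L .
  qed
  finally show ?thesis by (simp only: mult.assoc)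
qed

lemma ebas_psi_orthogonal:
  assumes \<sigma>: "Im \<sigma> > 0" and p: "p \<in> harmonic_poly m" and q: "q \<in> harmonic_poly n" and mn: "m \<noteq> n"
  shows "ip M (ebas j p) (psi \<sigma> q) = 0"
  unfolding ip_ebas_psi unfolding M_def
  by (rule harmonic_orthogonal[OF b p harmonic_cnj[OF q] mn]) (use \<sigma> in simp)

lemma psi_orthogonal:
  assumes \<tau>: "Im \<tau> > 0" and \<sigma>: "Im \<sigma> > 0" and p: "p \<in> harmonic_poly m" and q: "q \<in> harmonic_poly n" and mn: "m \<noteq> n"
  shows "ip M (psi \<tau> p) (psi \<sigma> q) = 0"
proof -
  have "psi \<tau> p x * cnj (psi \<sigma> q x) = p x * cnj (q x) * of_real ((norm x)\<^sup>2) ^ 0 * exp (- (- \<i> * (\<tau> - cnj \<sigma>) / 2) * of_real ((norm x)\<^sup>2))" for x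
  proof -
    have "exp (- (- \<i> * (\<tau> - cnj \<sigma>) / 2) * of_real ((norm x)\<^sup>2)) = exp (\<i> * \<tau> / 2 * of_real ((norm x)\<^sup>2)) * cnj (exp (\<i> * \<sigma> / 2 * of_real ((norm x)\<^sup>2)))"
      unfolding exp_cnj exp_add[symmetric]
      by (rule arg_cong[where f = exp]) (simp add: algebra_simps add_divide_distrib diff_divide_distrib)
    then show ?thesis by (simp add: psi_def)
  qed
  then have "ip M (psi \<tau> p) (psi \<sigma> q) = gtrans M (\<lambda>x. p x * cnj (q x)) 0 (- \<i> * (\<tau> - cnj \<sigma>) / 2)"
    unfolding ip_def gtrans_def by (simp only:)
  also have "\<dots> = 0" unfolding M_def
    by (rule harmonic_orthogonal[OF b p harmonic_cnj[OF q] mn]) (use \<tau> \<sigma> in simp)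
  finally show ?thesis .
qed

lemma kap_pos: "kap TYPE('n) b m > 0"
  using b by (simp add: kap_def add_divide_distrib)

lemma gtrans_hh_Suc:
  assumes p: "p \<in> harmonic_poly m" and q: "q \<in> harmonic_poly m" and s: "Re s > 0"
  shows "s * gtrans M (\<lambda>x. p x * cnj (q x)) (Suc k) s = of_real (kap TYPE('n) b m + real k) * gtrans M (\<lambda>x. p x * cnj (q x)) k s"
  using gtrans_hp_Suc[OF b hp_mult[OF harmonicD(1)[OF p] hp_cnj[OF harmonicD(1)[OF q]]] s, of k]
  by (simp only: M_def kap_def of_nat_add)

lemma gtrans_hh_deriv:
  assumes p: "p \<in> harmonic_poly m" and q: "q \<in> harmonic_poly m" and s: "Re s > 0"
  shows "(gtrans M (\<lambda>x. p x * cnj (q x)) k has_field_derivative - gtrans M (\<lambda>x. p x * cnj (q x)) (Suc k) s) (at s)"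
  unfolding M_def
  by (rule gtrans_deriv[OF hp_gauss_integrable[OF b hp_mult[OF harmonicD(1)[OF p] hp_cnj[OF harmonicD(1)[OF q]]]] s])

section \<open>Totality\<close>

lemma AE_zero_of_integrals:
  fixes g :: "'a \<Rightarrow> real"
  assumes g: "integrable N g" and 0: "\<And>A. A \<in> sets N \<Longrightarrow> (LINT x|N. indicator A x * g x) = 0"
  shows "AE x in N. g x \<le> 0"
proof -
  have m[measurable]: "g \<in> borel_measurable N" using g by auto
  let ?A = "{x \<in> space N. g x > 0}"
  have A: "?A \<in> sets N" by measurable
  have i: "integrable N (\<lambda>x. indicator ?A x * g x)"
    using integrable_mult_indicator[OF A g] by simp
  have "AE x in N. indicator ?A x * g x = 0"
    using 0[OF A] integral_nonneg_eq_0_iff_AE[OF i] by (auto simp: indicator_def)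
  then show ?thesis using AE_space by eventually_elim (auto simp: indicator_def split: if_splits)
qed

text \<open>Indicator functions of open sets are limits of continuous functions, and open sets generate the Borel sets.\<close>

lemma AE_zero_of_continuous:
  fixes g :: "real^'n \<Rightarrow> complex"
  assumes g: "integrable M g"
    and 0: "\<And>h. continuous_on UNIV h \<Longrightarrow> (\<And>x. 0 \<le> h x \<and> h x \<le> (1::real)) \<Longrightarrow> (LINT x|M. of_real (h x) * g x) = 0"
  shows "AE x in M. g x = 0"
proof -
  have m[measurable]: "g \<in> borel_measurable borel" using g by (auto simp: M_def)
  have sets: "sets M = sets borel" by (simp add: M_def)
  have int: "integrable M (\<lambda>x. of_real (indicator A x) * g x)" if "A \<in> sets borel" for A
    using integrable_mult_indicator[of A M g] that g sets by (simp add: scaleR_conv_of_real)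
  have opn: "(LINT x|M. of_real (indicator U x) * g x) = 0" if U: "open U" for U
  proof (cases "U = UNIV")
    case True
    then show ?thesis using 0[of "\<lambda>x. 1"] by simp
  next
    case False
    define h where "h k x = min 1 (real k * infdist x (- U))" for k and x :: "real^'n"
    have lim: "(\<lambda>k. LINT x|M. of_real (h k x) * g x) \<longlonglongrightarrow> (LINT x|M. of_real (indicator U x) * g x)"
    proof (rule integral_dominated_convergence[where w = "\<lambda>x. cmod (g x)"])
      show "(\<lambda>x. of_real (indicator U x) * g x) \<in> borel_measurable M" using int[of U] U by auto
      show "(\<lambda>x. of_real (h k x) * g x) \<in> borel_measurable M" for k
      proof -
        have "h k \<in> borel_measurable borel" unfolding h_def[abs_def]
          by (intro borel_measurable_continuous_onI continuous_intros)
        then show ?thesis using m by (simp add: M_def)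
      qed
      show "integrable M (\<lambda>x. cmod (g x))" using g by simp
      show "AE x in M. norm (of_real (h k x) * g x) \<le> cmod (g x)" for k
      proof (rule AE_I2)
        fix x
        have "0 \<le> h k x" "h k x \<le> 1" by (auto simp: h_def infdist_nonneg)
        then show "norm (of_real (h k x) * g x) \<le> cmod (g x)" by (simp add: norm_mult mult_left_le_one_le)
      qed
      show "AE x in M. (\<lambda>k. of_real (h k x) * g x) \<longlonglongrightarrow> of_real (indicator U x) * g x"
      proof (rule AE_I2)
        fix x
        have "(\<lambda>k. h k x) \<longlonglongrightarrow> indicator U x"
        proof (cases "x \<in> U")
          case True
          have "infdist x (- U) > 0"
            using U True False in_closed_iff_infdist_zero[of "- U" x] infdist_nonneg[of x "- U"]
            by (auto simp: closed_Compl less_le)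
          then obtain N :: nat where "real N * infdist x (- U) > 1" using reals_Archimedean3 by blast
          have "h k x = 1" if "k \<ge> N" for k
          proof -
            have "real N * infdist x (- U) \<le> real k * infdist x (- U)"
              using that by (intro mult_right_mono infdist_nonneg) simp
            then have "1 \<le> real k * infdist x (- U)" using \<open>real N * infdist x (- U) > 1\<close> by linarith
            then show ?thesis unfolding h_def by (rule min_absorb1)
          qed
          then show ?thesis using True
            by (intro tendsto_eventually) (auto simp: eventually_sequentially indicator_def intro!: exI[of _ N])
        next
          case F: False
          then have "infdist x (- U) = 0" by (intro infdist_zero) auto
          then show ?thesis using F by (simp add: h_def)
        qed
        then show "(\<lambda>k. of_real (h k x) * g x) \<longlonglongrightarrow> of_real (indicator U x) * g x"
          by (intro tendsto_mult tendsto_of_real tendsto_const)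
      qed
    qed
    have "(LINT x|M. of_real (h k x) * g x) = 0" for k
      by (rule 0) (auto simp: h_def[abs_def] infdist_nonneg intro!: continuous_intros)
    then have "(\<lambda>k. LINT x|M. of_real (h k x) * g x) = (\<lambda>k. 0)" by (rule ext)
    with lim have "(\<lambda>k. 0) \<longlonglongrightarrow> (LINT x|M. of_real (indicator U x) * g x)" by (simp only:)
    then show ?thesis using LIMSEQ_unique tendsto_const by blast
  qed
  have all: "(LINT x|M. of_real (indicator A x) * g x) = 0" if A: "A \<in> sets borel" for A
  proof -
    have IS: "Int_stable {S::(real^'n) set. open S}" by (auto simp: Int_stable_def)
    have PW: "{S::(real^'n) set. open S} \<subseteq> Pow UNIV" by simp
    have "A \<in> sigma_sets UNIV {S::(real^'n) set. open S}" using A by (simp add: borel_def)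
    with IS PW have "A \<in> sets borel \<and> (LINT x|M. of_real (indicator A x) * g x) = 0"
    proof (induction rule: sigma_sets_induct_disjoint)
      case (basic A)
      then show ?case using opn by auto
    next
      case empty
      show ?case by simp
    next
      case (compl A)
      have "(\<lambda>x. of_real (indicator (UNIV - A) x) * g x) = (\<lambda>x. g x - of_real (indicator A x) * g x)"
        by (auto simp: indicator_def fun_eq_iff)
      moreover have "(LINT x|M. g x) = 0" using opn[of UNIV] by simp
      ultimately show ?case using compl(2) g int[of A] by auto
    next
      case (union A)
      have A: "\<And>i. A i \<in> sets borel" using union(3) by blast
      have U: "(\<Union>i. A i) \<in> sets borel" using A by auto
      have "set_integrable M (\<Union>i. A i) g"
        unfolding set_integrable_def using int[OF U] by (simp add: scaleR_conv_of_real)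
      then have "(LINT x:(\<Union>i. A i)|M. g x) = (\<Sum>i. LINT x:A i|M. g x)"
        using A union(1) sets by (intro lebesgue_integral_countable_add) (auto simp: disjoint_family_on_def)
      then show ?case
        using union(3) U by (simp add: set_lebesgue_integral_def scaleR_conv_of_real)
    qed
    then show ?thesis by simp
  qed
  have re: "(LINT x|M. indicator A x * Re (g x)) = 0" and im: "(LINT x|M. indicator A x * Im (g x)) = 0" if "A \<in> sets M" for A
    using integral_Re[OF int[of A]] integral_Im[OF int[of A]] all[of A] that sets by simp_all
  have gr: "integrable M (\<lambda>x. Re (g x))" "integrable M (\<lambda>x. Im (g x))" using g by auto
  have "AE x in M. Re (g x) \<le> 0" by (rule AE_zero_of_integrals[OF gr(1) re])
  moreover have "AE x in M. - Re (g x) \<le> 0"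
    by (rule AE_zero_of_integrals) (use gr re in \<open>simp_all\<close>)
  moreover have "AE x in M. Im (g x) \<le> 0" by (rule AE_zero_of_integrals[OF gr(2) im])
  moreover have "AE x in M. - Im (g x) \<le> 0"
    by (rule AE_zero_of_integrals) (use gr im in \<open>simp_all\<close>)
  ultimately show ?thesis by eventually_elim (simp add: complex_eq_iff)
qed

text \<open>It suffices to integrate $f e^{-2|x|^2}$ against a bounded continuous $h$. The function $e^{-|x|^2} h$ factors through
  \<^const>\<open>embed\<close> as $H(r, y) = r h(y/r)$, which extends continuously by $0$ to $r = 0$. On a compact set containing the image
  $H$ is uniformly approximated by polynomials, and these yield functions against which the integral vanishes.\<close>

lemma total_poly_exp:
  assumes f: "f \<in> sq_integrable M"
    and 0: "\<And>q d s. q \<in> homogeneous_poly d \<Longrightarrow> s > 0 \<Longrightarrow> (LINT x|M. f x * q x * exp (- of_real s * of_real ((norm x)\<^sup>2))) = 0"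
  shows "AE x in M. f x = 0"
proof -
  let ?Q = "\<lambda>x::real^'n. (norm x)\<^sup>2"
  let ?e = "\<lambda>x::real^'n. complex_of_real (exp (- ?Q x))"
  have m[measurable]: "f \<in> borel_measurable borel" using sq_measurable[OF f] by (simp add: M_def)
  have int: "integrable M (\<lambda>x. f x * q x * exp (- of_real s * of_real (?Q x)))" if "q \<in> homogeneous_poly d" "s > 0" for q d s
    using gauss_integrableD[OF sq_mult_gauss_integrable[OF f that(1)], of "of_real s" 0] that(2) by simp
  have pe: "integrable M (\<lambda>x. f x * ?e x * u x) \<and> (LINT x|M. f x * ?e x * u x) = 0" if "u \<in> poly_exp" for u
    using that
  proof (induction rule: poly_exp_induct)
    case (step c q k d v)
    have eq: "f x * ?e x * (c * (q x * exp (- of_nat k * of_real (?Q x))) + v x)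
       = c * (f x * q x * exp (- of_real (real k + 1) * of_real (?Q x))) + f x * ?e x * v x" for x
    proof -
      have "exp (- of_real (real k + 1) * complex_of_real (?Q x)) = ?e x * exp (- of_nat k * of_real (?Q x))"
        by (simp add: exp_of_real[symmetric] exp_add[symmetric] algebra_simps)
      then show ?thesis by (simp add: algebra_simps)
    qed
    have k: "real k + 1 > 0" by simp
    show ?case unfolding eq using step int[OF step(1) k] 0[OF step(1) k] by simp
  qed simp
  have fe: "integrable M (\<lambda>x. f x * ?e x)" using pe[OF poly_exp_const[of 1]] by simp
  have "AE x in M. f x * ?e x * ?e x = 0"
  proof (rule AE_zero_of_continuous)
    have "(\<lambda>x. ?e x) \<in> poly_exp" using poly_exp_base[OF hp_const, of 1 1] by (simp add: exp_of_real[symmetric])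
    then show "integrable M (\<lambda>x. f x * ?e x * ?e x)" using pe by blast
    fix h :: "real^'n \<Rightarrow> real" assume h: "continuous_on UNIV h" and h01: "\<And>x. 0 \<le> h x \<and> h x \<le> 1"
    have hm[measurable]: "h \<in> borel_measurable borel" by (rule borel_measurable_continuous_onI[OF h])
    define K where "K = {0..1::real} \<times> cball (0::real^'n) 1"
    have K: "compact K" by (simp add: K_def compact_Times)
    have eK: "embed x \<in> K" for x
    proof -
      have "norm x * exp (- ?Q x) \<le> 1"
      proof -
        have "norm x \<le> 1 + ?Q x" using zero_le_power2[of "norm x - 1"] 
          unfolding power2_diff by (simp add: power2_eq_square) (use norm_ge_zero[of x] in linarith)
        also have "\<dots> \<le> exp (?Q x)" by (rule exp_ge_add_one_self)
        finally show ?thesis by (simp add: exp_minus field_simps)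
      qed
      then show ?thesis by (simp add: K_def embed_def mult.commute)
    qed
    define H where "H y = fst y * h (snd y /\<^sub>R fst y)" for y
    have He: "H (embed x) = exp (- ?Q x) * h x" for x by (simp add: H_def embed_def)
    have Hc: "continuous_on K H"
      unfolding continuous_on_eq_continuous_within
    proof
      fix y assume y: "y \<in> K"
      show "continuous (at y within K) H"
      proof (cases "fst y = 0")
        case True
        have "(H \<longlongrightarrow> 0) (at y within K)"
        proof (rule Lim_null_comparison)
          show "\<forall>\<^sub>F z in at y within K. norm (H z) \<le> \<bar>fst z\<bar>"
            using h01 by (auto simp: H_def abs_mult intro!: always_eventually mult_left_le)
          have "((\<lambda>z. \<bar>fst z\<bar>) \<longlongrightarrow> \<bar>fst y\<bar>) (at y within K)" by (intro tendsto_intros)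
          then show "((\<lambda>z. \<bar>fst z\<bar>) \<longlongrightarrow> 0) (at y within K)" using True by simp
        qed
        then show ?thesis using True by (simp add: continuous_within H_def)
      next
        case False
        have "isCont h (snd y /\<^sub>R fst y)" using h by (simp add: continuous_on_eq_continuous_at)
        then have "((\<lambda>z. h (snd z /\<^sub>R fst z)) \<longlongrightarrow> h (snd y /\<^sub>R fst y)) (at y within K)"
          by (rule isCont_tendsto_compose) (use False in \<open>auto intro!: tendsto_intros\<close>)
        then show ?thesis unfolding continuous_within H_def by (intro tendsto_intros)
      qed
    qed
    let ?I = "LINT x|M. of_real (h x) * (f x * ?e x * ?e x)"
    let ?C = "LINT x|M. cmod (f x * ?e x)"
    have "cmod ?I \<le> \<epsilon> * ?C" if \<epsilon>: "\<epsilon> > 0" for \<epsilon>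
    proof -
      obtain P where P: "real_polynomial_function P" "\<And>y. y \<in> K \<Longrightarrow> \<bar>H y - P y\<bar> < \<epsilon>"
        using Stone_Weierstrass_real_polynomial_function[OF K Hc \<epsilon>] by blast
      note p = pe[OF real_polynomial_embed[OF P(1)]]
      have iH: "integrable M (\<lambda>x. f x * ?e x * of_real (H (embed x)))"
      proof (rule Bochner_Integration.integrable_bound[OF fe])
        have "norm (f x * ?e x * of_real (H (embed x))) \<le> norm (f x * ?e x)" for x
        proof -
          have "\<bar>H (embed x)\<bar> \<le> 1 * 1" unfolding He abs_mult using h01[of x] by (intro mult_mono) auto
          then show ?thesis by (simp add: norm_mult mult_left_le del: norm_exp_eq_Re)
        qed
        then show "AE x in M. norm (f x * ?e x * of_real (H (embed x))) \<le> norm (f x * ?e x)" by simp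
        show "(\<lambda>x. f x * ?e x * of_real (H (embed x))) \<in> borel_measurable M"
          unfolding He by (simp add: M_def)
      qed
      have "?I = (LINT x|M. f x * ?e x * of_real (H (embed x)))"
        unfolding He by (simp add: mult_ac)
      also have "\<dots> = (LINT x|M. f x * ?e x * of_real (H (embed x)) - f x * ?e x * of_real (P (embed x)))"
        using p iH by simp
      also have "cmod \<dots> \<le> (LINT x|M. cmod (f x * ?e x * of_real (H (embed x)) - f x * ?e x * of_real (P (embed x))))"
        by (rule integral_norm_bound)
      also have "\<dots> \<le> (LINT x|M. \<epsilon> * cmod (f x * ?e x))"
      proof (rule integral_mono)
        show "integrable M (\<lambda>x. cmod (f x * ?e x * of_real (H (embed x)) - f x * ?e x * of_real (P (embed x))))"
          using p iH by (intro integrable_norm Bochner_Integration.integrable_diff) auto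
        show "integrable M (\<lambda>x. \<epsilon> * cmod (f x * ?e x))" by (intro integrable_mult_right integrable_norm fe)
        fix x
        have "cmod (f x * ?e x * of_real (H (embed x)) - f x * ?e x * of_real (P (embed x)))
          = cmod (f x * ?e x) * \<bar>H (embed x) - P (embed x)\<bar>"
          by (simp only: right_diff_distrib[symmetric] of_real_diff[symmetric] norm_mult norm_of_real)
        also have "\<dots> \<le> cmod (f x * ?e x) * \<epsilon>" using P(2)[OF eK[of x]] by (intro mult_left_mono) auto
        finally show "cmod (f x * ?e x * of_real (H (embed x)) - f x * ?e x * of_real (P (embed x))) \<le> \<epsilon> * cmod (f x * ?e x)"
          by (simp only: mult.commute)
      qed
      also have "\<dots> = \<epsilon> * ?C" by simp
      finally show ?thesis .
    qed
    note le = this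
    have C: "?C \<ge> 0" by (rule Bochner_Integration.integral_nonneg) simp
    have "cmod ?I \<le> 0 + \<delta>" if \<delta>: "\<delta> > 0" for \<delta>
    proof -
      have pos: "?C + 1 > 0" using C by (rule add_nonneg_pos) simp
      have "cmod ?I \<le> (\<delta> / (?C + 1)) * ?C" by (rule le[OF divide_pos_pos[OF \<delta> pos]])
      also have "\<dots> \<le> \<delta>"
      proof -
        have "\<delta> * ?C \<le> \<delta> * (?C + 1)" by (rule mult_left_mono) (use \<delta> in auto)
        then show ?thesis unfolding times_divide_eq_left pos_divide_le_eq[OF pos] .
      qed
      finally show ?thesis by simp
    qed
    then have "cmod ?I \<le> 0" by (rule field_le_epsilon)
    then show "?I = 0" by simp
  qed
  then show ?thesis by eventually_elim simp
qed

text \<open>If the transform vanishes at exponent $0$, so do its derivatives, which are the transforms with additional powers of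
  $|x|^2$; by \<open>hp_decomposition\<close> these account for all polynomials.\<close>

lemma total_gtrans:
  assumes f: "f \<in> sq_integrable M"
    and 0: "\<And>p m s. p \<in> harmonic_poly m \<Longrightarrow> Re s > 0 \<Longrightarrow> gtrans M (\<lambda>x. f x * cnj (p x)) 0 s = 0"
  shows "AE x in M. f x = 0"
proof (rule total_poly_exp[OF f])
  fix q :: "real^'n \<Rightarrow> complex" and d and s :: real assume q: "q \<in> homogeneous_poly d" and s: "s > 0"
  let ?J = "\<lambda>u. integrable M (\<lambda>x. f x * u x * exp (- of_real s * of_real ((norm x)\<^sup>2))) \<and>
    (LINT x|M. f x * u x * exp (- of_real s * of_real ((norm x)\<^sup>2))) = 0"
  have "?J q"
    using hp_decomposition[OF q]
  proof (induction rule: cfun.span_induct_alt)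
    case base
    show ?case by simp
  next
    case (step c u y)
    then obtain j k h where u: "u = (\<lambda>x. complex_of_real ((norm x)\<^sup>2) ^ j * h x)" and h: "h \<in> harmonic_poly k"
      by (auto simp: radial_harmonics_def)
    have g: "gauss_integrable M (\<lambda>x. f x * h x)" by (rule sq_mult_gauss_integrable[OF f harmonicD(1)[OF h]])
    have "gtrans M (\<lambda>x. f x * h x) j (of_real s) = 0"
      by (rule gtrans_all_zero[OF g]) (use 0[OF harmonic_cnj[OF h]] s in auto)
    moreover have "integrable M (\<lambda>x. f x * h x * of_real ((norm x)\<^sup>2) ^ j * exp (- of_real s * of_real ((norm x)\<^sup>2)))"
      by (rule gauss_integrableD[OF g]) (use s in simp)
    moreover have eq: "f x * (cscale c u + y) x * exp (- of_real s * of_real ((norm x)\<^sup>2))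
       = c * (f x * h x * of_real ((norm x)\<^sup>2) ^ j * exp (- of_real s * of_real ((norm x)\<^sup>2))) + f x * y x * exp (- of_real s * of_real ((norm x)\<^sup>2))" for x
      by (simp add: u cscale_def algebra_simps)
    ultimately show ?case unfolding eq using step(2) by (simp add: gtrans_def)
  qed
  then show "(LINT x|M. f x * q x * exp (- of_real s * of_real ((norm x)\<^sup>2))) = 0" by simp
qed

theorem psi_total:
  assumes f: "f \<in> sq_integrable M" and 0: "\<And>\<tau> m p. Im \<tau> > 0 \<Longrightarrow> p \<in> harmonic_poly m \<Longrightarrow> ip M f (psi \<tau> p) = 0"
  shows "AE x in M. f x = 0"
proof (rule total_gtrans[OF f])
  fix p :: "real^'n \<Rightarrow> complex" and m s assume p: "p \<in> harmonic_poly m" and s: "Re s > 0"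
  show "gtrans M (\<lambda>x. f x * cnj (p x)) 0 s = 0"
    using 0[of "2 * \<i> * cnj s", OF _ p] s by (simp only: ip_psi) simp
qed

theorem ebas_total:
  assumes f: "f \<in> sq_integrable M" and 0: "\<And>j m p. p \<in> harmonic_poly m \<Longrightarrow> ip M f (ebas j p) = 0"
  shows "AE x in M. f x = 0"
proof (rule total_gtrans[OF f])
  fix p :: "real^'n \<Rightarrow> complex" and m s assume p: "p \<in> harmonic_poly m" and s: "Re s > 0"
  have g: "gauss_integrable M (\<lambda>x. f x * cnj (p x))"
    by (rule sq_mult_gauss_integrable[OF f hp_cnj[OF harmonicD(1)[OF p]]])
  show "gtrans M (\<lambda>x. f x * cnj (p x)) 0 s = 0"
    by (rule gtrans_zero_of_derivs[OF g _ _ s, of "1/2"]) (use 0[OF p] in \<open>simp_all only: ip_ebas\<close>, simp)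
qed

end

section \<open>The operator R is well defined\<close>

lemma continuous_AE_zero:
  fixes f :: "real^'n \<Rightarrow> complex"
  assumes f: "continuous_on UNIV f" and ae: "AE x in lborel. f x = 0"
  shows "f x = 0"
proof (rule ccontr)
  assume x: "f x \<noteq> 0"
  have "open (f -` (- {0}))" using continuous_open_vimage[of "- {0}" f] f
    by (simp add: continuous_on_eq_continuous_at open_Compl)
  moreover have "f -` (- {0}) \<noteq> {}" using x by auto
  ultimately have "\<not> negligible (f -` (- {0}))" by (rule open_not_negligible)
  moreover have "f -` (- {0}) \<in> null_sets lborel"
  proof -
    have "{x \<in> space lborel. \<not> f x = 0} \<in> null_sets lborel"
      using ae AE_iff_null_sets[of "{x \<in> space lborel. \<not> f x = 0}" lborel] borel_measurable_continuous_onI[OF f]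
      by (auto elim: eventually_mono)
    then show ?thesis by (simp add: vimage_def)
  qed
  ultimately show False by (simp add: negligible_iff_null_sets null_sets_completionI)
qed

text \<open>Homogeneity turns the relation on one sphere into the relation $\sum_m r^m |x|^{N-m} q_m(x) = 0$ everywhere. Integrating
  it against $\overline{q_k} e^{-|x|^2}$ isolates one component by orthogonality, each summand being an inner product for the weight
  $|x|^{2b}$ with $b = (N - m)/2$.\<close>

lemma harmonic_components_vanish:
  fixes q :: "nat \<Rightarrow> real^'n \<Rightarrow> complex"
  assumes q: "\<And>m. q m \<in> harmonic_poly m" and r: "r > 0"
    and 0: "\<And>x. norm x = r \<Longrightarrow> (\<Sum>m<N. q m x) = 0" and k: "k < N"
  shows "q k x = 0"
proof -
  note hp = harmonicD(1)[OF q]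
  let ?e = "\<lambda>x::real^'n. exp (- 1 * complex_of_real ((norm x)\<^sup>2))"
  let ?b = "\<lambda>m. (real N - real m) / 2"
  let ?I = "\<lambda>m x. norm x powr (2 * ?b m) *\<^sub>R (q m x * cnj (q k x) * ?e x)"
  have pt: "(\<Sum>m<N. of_real (r ^ m) * ?I m x) = 0" for x :: "real^'n"
  proof (cases "x = 0")
    case False
    define y where "y = (r / norm x) *\<^sub>R x"
    have "norm y = r" using False r by (simp add: y_def)
    have "(\<Sum>m<N. of_real (r / norm x) ^ m * q m x) = (\<Sum>m<N. q m y)"
      by (simp add: y_def hp_homogeneous[OF hp])
    also have "\<dots> = 0" by (rule 0) fact
    finally have s: "(\<Sum>m<N. of_real (r / norm x) ^ m * q m x) = 0" .
    have "of_real (r ^ m) * ?I m x = of_real (norm x ^ N) * cnj (q k x) * ?e x * (of_real (r / norm x) ^ m * q m x)" if "m < N" for m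
    proof -
      have "2 * ?b m = real (N - m)" using that by (simp add: of_nat_diff)
      then have "norm x powr (2 * ?b m) = norm x powr (real (N - m))" by (simp only:)
      also have "\<dots> = norm x ^ (N - m)" by (rule powr_realpow) (use False in simp)
      also have "\<dots> = norm x ^ N / norm x ^ m" by (rule power_diff) (use False that in auto)
      finally show ?thesis by (simp add: scaleR_conv_of_real power_divide)
    qed
    then have "(\<Sum>m<N. of_real (r ^ m) * ?I m x) = of_real (norm x ^ N) * cnj (q k x) * ?e x * (\<Sum>m<N. of_real (r / norm x) ^ m * q m x)"
      unfolding sum_distrib_left by (intro sum.cong) auto
    then show ?thesis unfolding s by simp
  qed simp
  have b: "?b m > - real CARD('n) / 2" if "m < N" for m using that by simp
  have meas: "(\<lambda>x. q m x * cnj (q k x) * ?e x) \<in> borel_measurable borel" for m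
    using hp_measurable[OF hp] by measurable
  have int: "integrable lborel (?I m)" if "m < N" for m
    using hp_integrable[OF b[OF that] _ hp_mult[OF hp[of m] hp_cnj[OF hp[of k]]], of 1]
      integrable_weighted[OF meas[of m], of "?b m"] by simp
  have val: "(LINT x|lborel. ?I m x) = gtrans (weighted_measure (?b m)) (\<lambda>x. q m x * cnj (q k x)) 0 1" for m
    unfolding gtrans_def using integral_weighted[OF meas[of m], of "?b m"] by simp
  have "0 = (LINT x|lborel. (\<Sum>m<N. of_real (r ^ m) * ?I m x))" unfolding pt by simp
  also have "\<dots> = (\<Sum>m<N. LINT x|lborel. of_real (r ^ m) * ?I m x)"
    by (rule Bochner_Integration.integral_sum) (rule integrable_mult_right, rule int, simp)
  also have "\<dots> = (\<Sum>m<N. of_real (r ^ m) * (LINT x|lborel. ?I m x))"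
    by (simp only: integral_mult_right_zero)
  also have "\<dots> = (\<Sum>m<N. if m = k then of_real (r ^ k) * (LINT x|lborel. ?I k x) else 0)"
  proof (rule sum.cong[OF refl])
    fix m assume "m \<in> {..<N}"
    then show "of_real (r ^ m) * (LINT x|lborel. ?I m x) = (if m = k then of_real (r ^ k) * (LINT x|lborel. ?I k x) else 0)"
      unfolding val using harmonic_orthogonal[OF b q harmonic_cnj[OF q], of m m k 1 0] by auto
  qed
  also have "\<dots> = of_real (r ^ k) * (LINT x|lborel. ?I k x)" using k by simp
  finally have I0: "(LINT x|lborel. ?I k x) = 0" using r by simp
  let ?R = "\<lambda>x. norm x powr (2 * ?b k) * ((cmod (q k x))\<^sup>2 * exp (- (norm x)\<^sup>2))"
  have IR: "?I k = (\<lambda>x. complex_of_real (?R x))"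
    by (simp add: fun_eq_iff scaleR_conv_of_real complex_norm_square[symmetric] exp_of_real[symmetric])
  have "AE x in lborel. ?R x = 0"
  proof (subst integral_nonneg_eq_0_iff_AE[symmetric])
    show "integrable lborel ?R" using int[OF k] unfolding IR by (simp only: complex_of_real_integrable_eq)
    show "integral\<^sup>L lborel ?R = 0" using I0 unfolding IR integral_complex_of_real by simp
  qed auto
  then have "AE x in lborel. q k x = 0"
    using AE_lborel_singleton[of "0::real^'n"] by eventually_elim simp
  then show ?thesis by (rule continuous_AE_zero[OF hp_continuous[OF hp]])
qed

text \<open>The prescribed values in the definition of \<^const>\<open>R_op\<close>.\<close>

definition R_pairs :: "((real^'n \<Rightarrow> complex) \<times> (real^'n \<Rightarrow> complex)) set" where
  "R_pairs = {(\<lambda>x. f ((norm x)\<^sup>2) * p x, \<lambda>x. euler (\<lambda>y. f ((norm y)\<^sup>2)) x * p x) |(f :: real \<Rightarrow> complex) p m.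
        (\<forall>t. f differentiable (at t)) \<and> p \<in> harmonic_poly m}"

lemma euler_radial:
  fixes x :: "real^'n"
  assumes "(f has_vector_derivative d) (at ((norm x)\<^sup>2))"
  shows "euler (\<lambda>y. f ((norm y)\<^sup>2)) x = 2 * of_real ((norm x)\<^sup>2) * d"
proof -
  have "euler (\<lambda>y. f ((norm y)\<^sup>2)) x = (\<Sum>i\<in>UNIV. complex_of_real (x $ i) * (complex_of_real (2 * x $ i) * d))"
    by (rule euler_eq) (rule has_pd_radial[OF assms])
  also have "\<dots> = 2 * of_real ((norm x)\<^sup>2) * d"
    unfolding norm_sq_coord sum_distrib_left sum_distrib_right by (simp add: algebra_simps)
  finally show ?thesis .
qed

text \<open>Grouping a combination of prescribed pairs by degree: \<^term>\<open>h m t\<close> is the harmonic polynomial of degree \<^term>\<open>m\<close> on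
  the sphere of squared radius \<^term>\<open>t\<close>, differentiable in \<^term>\<open>t\<close>, and the second component is recovered from the derivative.\<close>

lemma R_pairs_form:
  assumes "z \<in> cfun2.span (R_pairs :: ((real^'n \<Rightarrow> complex) \<times> (real^'n \<Rightarrow> complex)) set)"
  shows "\<exists>N h h'. (\<forall>m t. h m t \<in> harmonic_poly m) \<and> (\<forall>m t x. ((\<lambda>t. h m t x) has_vector_derivative h' m t x) (at t)) \<and>
    (\<forall>m\<ge>N. \<forall>t x. h m t x = 0 \<and> h' m t x = 0) \<and>
    (\<forall>x. fst z x = (\<Sum>m<N. h m ((norm x)\<^sup>2) x)) \<and> (\<forall>x. snd z x = (\<Sum>m<N. 2 * of_real ((norm x)\<^sup>2) * h' m ((norm x)\<^sup>2) x))"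
  using assms
proof (induction rule: cfun2.span_induct_alt)
  case base
  have "(\<lambda>x::real^'n. 0) \<in> harmonic_poly m" for m
    using cfun.subspace_0[OF harmonic_subspace, of m] by (simp add: zero_fun_def)
  then show ?case by (intro exI[of _ "0::nat"] exI[of _ "\<lambda>m t x. 0"]) simp
next
  case (step c z y)
  obtain f p k where z: "z = (\<lambda>x. f ((norm x)\<^sup>2) * p x, \<lambda>x. euler (\<lambda>y. f ((norm y)\<^sup>2)) x * p x)"
    and f: "\<And>t. f differentiable (at t)" and p: "p \<in> harmonic_poly k"
    using step(1) unfolding R_pairs_def by auto
  from step(2) obtain N h h' where H: "(\<forall>m t. h m t \<in> harmonic_poly m) \<and> (\<forall>m t x. ((\<lambda>t. h m t x) has_vector_derivative h' m t x) (at t)) \<and>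
    (\<forall>m\<ge>N. \<forall>t x. h m t x = 0 \<and> h' m t x = 0) \<and>
    (\<forall>x. fst y x = (\<Sum>m<N. h m ((norm x)\<^sup>2) x)) \<and> (\<forall>x. snd y x = (\<Sum>m<N. 2 * of_real ((norm x)\<^sup>2) * h' m ((norm x)\<^sup>2) x))"
    by (elim exE)
  define f' where "f' t = vector_derivative f (at t)" for t
  have f': "(f has_vector_derivative f' t) (at t)" for t using f[of t] by (simp add: f'_def vector_derivative_works)
  let ?N = "max N (Suc k)"
  let ?h = "\<lambda>m t x. (if m = k then c * f t else 0) * p x + h m t x"
  let ?h' = "\<lambda>m t x. (if m = k then c * f' t else 0) * p x + h' m t x"
  have ext: "(\<Sum>m<N. F m) = (\<Sum>m<?N. F m)" if "\<And>m. m \<ge> N \<Longrightarrow> F m = 0" for F :: "nat \<Rightarrow> complex"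
    by (rule sum.mono_neutral_left) (use that in auto)
  show ?case
  proof (rule exI[of _ ?N], rule exI[of _ ?h], rule exI[of _ ?h'], intro conjI allI impI)
    fix m t
    have "cscale (if m = k then c * f t else 0) p + h m t \<in> harmonic_poly m"
    proof (rule cfun.subspace_add[OF harmonic_subspace])
      show "cscale (if m = k then c * f t else 0) p \<in> harmonic_poly m"
        using cfun.subspace_scale[OF harmonic_subspace p] cfun.subspace_0[OF harmonic_subspace, of m]
        by (cases "m = k") (auto simp: cscale_def zero_fun_def)
    qed (use H in blast)
    then show "?h m t \<in> harmonic_poly m" by (simp add: cscale_def plus_fun_def)
    show "((\<lambda>t. ?h m t x) has_vector_derivative ?h' m t x) (at t)" for x
      using H f' by (intro has_vector_derivative_add has_vector_derivative_mult_left)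
        (auto intro!: has_vector_derivative_mult_right)
    show "?h m t x = 0" "?h' m t x = 0" if "?N \<le> m" for x using that H by auto
  next
    fix x :: "real^'n"
    let ?t = "(norm x)\<^sup>2"
    have "(\<Sum>m<?N. ?h m ?t x) = (\<Sum>m<?N. if m = k then c * (f ?t * p x) else 0) + (\<Sum>m<?N. h m ?t x)"
      unfolding sum.distrib[symmetric] by (rule sum.cong) auto
    also have "(\<Sum>m<?N. if m = k then c * (f ?t * p x) else 0) = c * (f ?t * p x)" by simp
    also have "(\<Sum>m<?N. h m ?t x) = fst y x" using H ext[of "\<lambda>m. h m ?t x"] by simp
    finally show "fst (cscale2 c z + y) x = (\<Sum>m<?N. ?h m ?t x)"
      by (simp add: cscale2_def cscale_def z)
    have "(\<Sum>m<?N. 2 * of_real ?t * ?h' m ?t x) = (\<Sum>m<?N. if m = k then c * (2 * of_real ?t * f' ?t * p x) else 0) + (\<Sum>m<?N. 2 * of_real ?t * h' m ?t x)"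
      unfolding sum.distrib[symmetric] by (rule sum.cong) (auto simp: algebra_simps)
    also have "(\<Sum>m<?N. if m = k then c * (2 * of_real ?t * f' ?t * p x) else 0) = c * (2 * of_real ?t * f' ?t * p x)" by simp
    also have "(\<Sum>m<?N. 2 * of_real ?t * h' m ?t x) = snd y x" using H ext[of "\<lambda>m. 2 * of_real ?t * h' m ?t x"] by simp
    finally show "snd (cscale2 c z + y) x = (\<Sum>m<?N. 2 * of_real ?t * ?h' m ?t x)"
      unfolding euler_radial[OF f', of x, symmetric] by (simp add: cscale2_def cscale_def z)
  qed
qed

text \<open>If the first component vanishes, the harmonic polynomials on each sphere vanish degree by degree, and so
  do their derivatives in the radius.\<close>

lemma R_pairs_zero:
  assumes "(0, v) \<in> cfun2.span (R_pairs :: ((real^'n \<Rightarrow> complex) \<times> (real^'n \<Rightarrow> complex)) set)"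
  shows "v = 0"
proof
  from R_pairs_form[OF assms] obtain N h h' where H: "(\<forall>m t. h m t \<in> harmonic_poly m) \<and> (\<forall>m t x. ((\<lambda>t. h m t x) has_vector_derivative h' m t x) (at t)) \<and>
    (\<forall>m\<ge>N. \<forall>t x. h m t x = 0 \<and> h' m t x = 0) \<and>
    (\<forall>x. fst (0::real^'n \<Rightarrow> complex, v) x = (\<Sum>m<N. h m ((norm x)\<^sup>2) x)) \<and> (\<forall>x. snd (0::real^'n \<Rightarrow> complex, v) x = (\<Sum>m<N. 2 * of_real ((norm x)\<^sup>2) * h' m ((norm x)\<^sup>2) x))"
    by (elim exE)
  have van: "h m t x = 0" if "m < N" "t > 0" for m t x
  proof (rule harmonic_components_vanish[where r = "sqrt t" and N = N, OF _ _ _ that(1)])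
    show "h m t \<in> harmonic_poly m" for m using H by blast
    show "(\<Sum>m<N. h m t x) = 0" if x: "norm x = sqrt t" for x
    proof -
      have "(norm x)\<^sup>2 = t" using x \<open>t > 0\<close> by simp
      then show ?thesis using H by (metis fst_conv zero_fun_apply)
    qed
  qed (use that in simp)
  fix x :: "real^'n"
  show "v x = 0 x"
  proof (cases "x = 0")
    case False
    then have t: "(norm x)\<^sup>2 > 0" by simp
    have "h' m ((norm x)\<^sup>2) x = 0" if m: "m < N" for m
    proof -
      have "((\<lambda>t. h m t x) has_vector_derivative h' m ((norm x)\<^sup>2) x) (at ((norm x)\<^sup>2))" using H by blast
      then have "((\<lambda>t. 0) has_vector_derivative h' m ((norm x)\<^sup>2) x) (at ((norm x)\<^sup>2))"
        by (rule has_vector_derivative_transform_within_open[where S = "{0<..}"]) (use t van[OF m] in auto)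
      then show ?thesis using vector_derivative_unique_at has_vector_derivative_const by blast
    qed
    then show ?thesis using H by simp
  qed (use H in simp)
qed

lemma R_op_eq:
  assumes "(u, r) \<in> cfun2.span R_pairs"
  shows "R_op u = r"
  unfolding R_op_def linear_op_from_def R_pairs_def[symmetric]
proof (rule the_equality)
  show "(u, r) \<in> cfun2.span R_pairs" by (rule assms)
next
  fix v assume "(u, v) \<in> cfun2.span R_pairs"
  from cfun2.span_diff[OF this assms] have "(0, v - r) \<in> cfun2.span R_pairs" by simp
  then have "v - r = 0" by (rule R_pairs_zero)
  then show "v = r" by (simp add: fun_eq_iff)
qed

section \<open>The action on the algebraic module\<close>

text \<open>A certificate that \<^term>\<open>hu\<close> and \<^term>\<open>eu\<close> are the values of \<^const>\<open>H_op\<close> and \<^const>\<open>euler\<close> at \<^term>\<open>u\<close>.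
  Its form is stable under linear combinations (\<open>good_linear\<close>), while additivity of \<^const>\<open>laplacian\<close> itself would need
  differentiability at every use.\<close>

definition good :: "real \<Rightarrow> (real^'n \<Rightarrow> complex) \<Rightarrow> (real^'n \<Rightarrow> complex) \<Rightarrow> (real^'n \<Rightarrow> complex) \<Rightarrow> bool" where
  "good b u hu eu \<longleftrightarrow> (\<exists>U UU r. (\<forall>i x. has_pd u i x (U i x)) \<and> (\<forall>i x. has_pd (U i) i x (UU i x)) \<and>
     (u, r) \<in> cfun2.span R_pairs \<and>
     (\<forall>x. x \<noteq> 0 \<longrightarrow> hu x = (\<Sum>i\<in>UNIV. UU i x) + of_real (2 * b / (norm x)\<^sup>2) * r x) \<and>
     continuous_on UNIV hu \<and> (\<forall>x. eu x = (\<Sum>i\<in>UNIV. of_real (x $ i) * U i x)))"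

lemma good_H_op:
  assumes "good b u hu eu"
  shows "H_op b u = hu" "euler u = eu"
proof -
  from assms obtain U UU r where G: "(\<forall>i x. has_pd u i x (U i x)) \<and> (\<forall>i x. has_pd (U i) i x (UU i x)) \<and>
     (u, r) \<in> cfun2.span R_pairs \<and>
     (\<forall>x. x \<noteq> 0 \<longrightarrow> hu x = (\<Sum>i\<in>UNIV. UU i x) + of_real (2 * b / (norm x)\<^sup>2) * r x) \<and>
     continuous_on UNIV hu \<and> (\<forall>x. eu x = (\<Sum>i\<in>UNIV. of_real (x $ i) * U i x))"
    unfolding good_def by (elim exE)
  have lap: "laplacian u x = (\<Sum>i\<in>UNIV. UU i x)" for x
    by (rule laplacian_eq[where d = U]) (use G in auto)
  have R: "R_op u = r" using G R_op_eq by blast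
  let ?h = "\<lambda>y. laplacian u y + complex_of_real (2 * b / (norm y)\<^sup>2) * R_op u y"
  have h: "?h y = hu y" if "y \<noteq> 0" for y using G that by (simp add: lap R)
  have "(hu \<longlongrightarrow> hu 0) (at 0)" using G by (simp add: continuous_on_eq_continuous_at isCont_def)
  then have "(?h \<longlongrightarrow> hu 0) (at 0)"
    by (rule Lim_transform_eventually) (unfold eventually_at_filter, intro always_eventually allI impI, rule h[symmetric])
  then have "Lim (at 0) ?h = hu 0" by (intro tendsto_Lim) simp
  then show "H_op b u = hu" using h by (auto simp: H_op_def fun_eq_iff Let_def)
  show "euler u = eu"
  proof
    fix x show "euler u x = eu x" using euler_eq[of u x "\<lambda>i. U i x"] G by simp
  qed
qed

lemma good_linear:
  assumes "good b u hu eu" "good b v hv ev"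
  shows "good b (\<lambda>x. c * u x + v x) (\<lambda>x. c * hu x + hv x) (\<lambda>x. c * eu x + ev x)"
proof -
  from assms(1) obtain U UU r where G: "(\<forall>i x. has_pd u i x (U i x)) \<and> (\<forall>i x. has_pd (U i) i x (UU i x)) \<and>
     (u, r) \<in> cfun2.span R_pairs \<and>
     (\<forall>x. x \<noteq> 0 \<longrightarrow> hu x = (\<Sum>i\<in>UNIV. UU i x) + of_real (2 * b / (norm x)\<^sup>2) * r x) \<and>
     continuous_on UNIV hu \<and> (\<forall>x. eu x = (\<Sum>i\<in>UNIV. of_real (x $ i) * U i x))"
    unfolding good_def by (elim exE)
  from assms(2) obtain V VV s where G': "(\<forall>i x. has_pd v i x (V i x)) \<and> (\<forall>i x. has_pd (V i) i x (VV i x)) \<and>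
     (v, s) \<in> cfun2.span R_pairs \<and>
     (\<forall>x. x \<noteq> 0 \<longrightarrow> hv x = (\<Sum>i\<in>UNIV. VV i x) + of_real (2 * b / (norm x)\<^sup>2) * s x) \<and>
     continuous_on UNIV hv \<and> (\<forall>x. ev x = (\<Sum>i\<in>UNIV. of_real (x $ i) * V i x))"
    unfolding good_def by (elim exE)
  show ?thesis unfolding good_def
  proof (rule exI[of _ "\<lambda>i x. c * U i x + V i x"], rule exI[of _ "\<lambda>i x. c * UU i x + VV i x"], rule exI[of _ "\<lambda>x. c * r x + s x"], intro conjI allI impI)
    have "cscale2 c (u, r) + (v, s) \<in> cfun2.span R_pairs"
      using G G' by (intro cfun2.span_add cfun2.span_scale) auto
    then show "(\<lambda>x. c * u x + v x, \<lambda>x. c * r x + s x) \<in> cfun2.span R_pairs"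
      by (simp add: cscale2_def cscale_def plus_fun_def)
    show "continuous_on UNIV (\<lambda>x. c * hu x + hv x)" using G G' by (intro continuous_intros) auto
    show "c * hu x + hv x = (\<Sum>i\<in>UNIV. c * UU i x + VV i x) + of_real (2 * b / (norm x)\<^sup>2) * (c * r x + s x)" if "x \<noteq> 0" for x
      using G G' that by (simp add: sum.distrib sum_distrib_left[symmetric] ring_distribs mult.left_commute[of c])
    show "c * eu x + ev x = (\<Sum>i\<in>UNIV. of_real (x $ i) * (c * U i x + V i x))" for x
      using G G' by (simp add: sum.distrib sum_distrib_left algebra_simps)
  qed (use G G' in \<open>auto intro!: has_pd_add has_pd_cmult\<close>)
qed

lemma good_zero: "good b (\<lambda>x. 0) (\<lambda>x. 0) (\<lambda>x. 0)"
  unfolding good_def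
  using cfun2.span_zero[of R_pairs]
  by (intro exI[of _ "\<lambda>i x. 0"] exI[of _ "\<lambda>x. 0"]) (auto simp: has_pd_const zero_prod_def zero_fun_def)

text \<open>The radial factor of \<^const>\<open>ebas\<close> as a function of $t = |x|^2$.\<close>

definition gj :: "nat \<Rightarrow> real \<Rightarrow> complex" where
  "gj j t = of_real t ^ j * exp (- (1/2) * of_real t)"

lemma gj_deriv: "(gj j has_vector_derivative of_nat j * gj (j - 1) t - gj j t / 2) (at t)"
proof -
  have "((\<lambda>t. exp (- (1/2) * complex_of_real t)) has_vector_derivative - (1/2) * exp (- (1/2) * of_real t)) (at t)"
  proof -
    have "((\<lambda>z. exp (- (1/2) * z)) has_field_derivative - (1/2) * exp (- (1/2) * complex_of_real t)) (at (of_real t))"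
      by (auto intro!: derivative_eq_intros)
    from has_vector_derivative_real_field[OF this] show ?thesis .
  qed
  from has_vector_derivative_mult[OF power_has_vector_derivative[of j t UNIV] this]
  show ?thesis unfolding gj_def[abs_def] by (simp add: algebra_simps)
qed

lemma gj_Suc: "of_real t * gj j t = gj (Suc j) t"
  by (simp add: gj_def)

lemma ebas_gj: "ebas j p = (\<lambda>x. gj j ((norm x)\<^sup>2) * p x)"
  by (simp add: ebas_def gj_def fun_eq_iff mult_ac)

lemma ebas_continuous: "p \<in> homogeneous_poly m \<Longrightarrow> continuous_on S (ebas j p)"
  unfolding ebas_def[abs_def] by (intro continuous_intros hp_continuous)

text \<open>The value of $H_b$ at \<^term>\<open>ebas j p\<close> for \<^term>\<open>p\<close> harmonic of degree \<^term>\<open>m\<close>. For \<^term>\<open>j = 0\<close> the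
  coefficient of the first term is zero, so that truncated subtraction does no harm.\<close>

definition hact :: "real \<Rightarrow> nat \<Rightarrow> nat \<Rightarrow> (real^'n \<Rightarrow> complex) \<Rightarrow> real^'n \<Rightarrow> complex" where
  "hact b m j p x = 4 * of_nat j * (of_nat j + of_real (kap TYPE('n) b m) - 1) * ebas (j - 1) p x
     - (4 * of_nat j + 2 * of_real (kap TYPE('n) b m)) * ebas j p x + ebas (Suc j) p x"

text \<open>The value of the Euler operator at \<^term>\<open>ebas j p\<close> for \<^term>\<open>p\<close> harmonic of degree \<^term>\<open>m\<close>.\<close>

definition eact :: "nat \<Rightarrow> nat \<Rightarrow> (real^'n \<Rightarrow> complex) \<Rightarrow> real^'n \<Rightarrow> complex" where
  "eact m j p x = (2 * of_nat j + of_nat m) * ebas j p x - ebas (Suc j) p x"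

text \<open>For a radial factor $g(|x|^2)$ the Laplacian contributes $4 t g'' + (2N + 4m) g'$ and the second term of $H_b$ contributes $4 b g'$,
  which is $4(t g'' + \kappa g')$ in total. The singularity at the origin has cancelled.\<close>

lemma good_ebas:
  fixes p :: "real^'n \<Rightarrow> complex"
  assumes p: "p \<in> harmonic_poly m"
  shows "good b (ebas j p) (hact b m j p) (eact m j p)"
proof -
  note hp = harmonicD(1)[OF p]
  let ?g1 = "\<lambda>t. of_nat j * gj (j - 1) t - gj j t / 2"
  let ?g2 = "\<lambda>t. of_nat j * (of_nat (j - 1) * gj (j - 1 - 1) t - gj (j - 1) t / 2) - (of_nat j * gj (j - 1) t - gj j t / 2) / 2"
  have g1: "(?g1 has_vector_derivative ?g2 t) (at t)" for t
    by (intro has_vector_derivative_diff has_vector_derivative_mult_right has_vector_derivative_divide gj_deriv)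
  let ?U = "\<lambda>i x. 2 * of_real (x $ i) * (?g1 ((norm x)\<^sup>2) * p x) + gj j ((norm x)\<^sup>2) * partial_deriv i p x"
  let ?UU = "\<lambda>i x. 2 * ?g1 ((norm x)\<^sup>2) * p x + 4 * (of_real (x $ i) * of_real (x $ i)) * (?g2 ((norm x)\<^sup>2) * p x)
      + 4 * of_real (x $ i) * partial_deriv i p x * ?g1 ((norm x)\<^sup>2)
      + gj j ((norm x)\<^sup>2) * partial_deriv i (partial_deriv i p) x"
  let ?r = "\<lambda>x. euler (\<lambda>y. gj j ((norm y)\<^sup>2)) x * p x"
  show ?thesis unfolding good_def
  proof (rule exI[of _ ?U], rule exI[of _ ?UU], rule exI[of _ ?r], intro conjI allI impI)
    show "has_pd (ebas j p) i x (?U i x)" for i x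
      unfolding ebas_gj by (rule has_pd_radial_hp[OF hp gj_deriv])
    show "has_pd (?U i) i x (?UU i x)" for i x
      by (rule radial_hp_second[OF hp gj_deriv g1])
    show "(ebas j p, ?r) \<in> cfun2.span R_pairs"
    proof (rule cfun2.span_base)
      have "gj j differentiable (at t)" for t using gj_deriv[of j t] by (auto simp: has_vector_derivative_def differentiable_def)
      then show "(ebas j p, ?r) \<in> R_pairs" unfolding R_pairs_def ebas_gj using p by blast
    qed
    show "continuous_on UNIV (hact b m j p)"
      unfolding hact_def[abs_def] by (intro continuous_intros ebas_continuous[OF hp])
  next
    fix x :: "real^'n" assume x: "x \<noteq> 0"
    let ?t = "(norm x)\<^sup>2"
    have r: "of_real (2 * b / ?t) * ?r x = 4 * of_real b * ?g1 ?t * p x"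
      using x by (simp add: euler_radial[OF gj_deriv, of j x])
    have s: "(\<Sum>i\<in>UNIV. ?UU i x) = (4 * of_real ?t * ?g2 ?t + (2 * of_nat CARD('n) + 4 * of_nat m) * ?g1 ?t) * p x"
      using radial_hp_second_sum[OF hp, of ?g1 x ?g2 "gj j"] harmonicD(2)[OF p, of x] by simp
    have k: "4 * of_real (kap TYPE('n) b m) = 4 * of_real b + 2 * of_nat CARD('n) + (4 * of_nat m :: complex)"
      by (simp add: kap_def)
    have t0: "of_real ?t * gj j ?t = gj (Suc j) ?t" by (rule gj_Suc)
    have t1: "of_nat j * (of_real ?t * gj (j - 1) ?t) = of_nat j * gj j ?t"
      by (cases j) (simp_all only: gj_Suc diff_Suc_1, simp)
    have t2: "of_nat j * (of_nat (j - 1) * (of_real ?t * gj (j - 1 - 1) ?t)) = of_nat j * ((of_nat j - 1) * gj (j - 1) ?t)"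
    proof (cases j)
      case (Suc i)
      then show ?thesis by (cases i) (simp_all only: gj_Suc diff_Suc_1 of_nat_Suc, simp_all)
    qed simp
    have "(\<Sum>i\<in>UNIV. ?UU i x) + of_real (2 * b / ?t) * ?r x
      = (4 * (of_real ?t * ?g2 ?t) + (4 * of_real (kap TYPE('n) b m)) * ?g1 ?t) * p x"
      unfolding r s k by (simp only: distrib_right mult.assoc add_ac)
    also have "of_real ?t * ?g2 ?t = of_nat j * (of_nat (j - 1) * (of_real ?t * gj (j - 1 - 1) ?t))
        - of_nat j * (of_real ?t * gj (j - 1) ?t) + of_real ?t * gj j ?t / 4"
      by (simp add: right_diff_distrib mult.left_commute) (simp add: field_simps)
    also have "(4 * (of_nat j * (of_nat (j - 1) * (of_real ?t * gj (j - 1 - 1) ?t))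
        - of_nat j * (of_real ?t * gj (j - 1) ?t) + of_real ?t * gj j ?t / 4) + (4 * of_real (kap TYPE('n) b m)) * ?g1 ?t) * p x = hact b m j p x"
    proof -
      have "(4 * (J * ((J - 1) * A) - J * B + C / 4) + (4 * K) * (J * A - B / 2)) * P
        = 4 * J * (J + K - 1) * (A * P) - (4 * J + 2 * K) * (B * P) + C * P" for A B C J K P :: complex
        by (simp add: algebra_simps)
      then show ?thesis unfolding t0 t1 t2 hact_def ebas_gj .
    qed
    finally show "hact b m j p x = (\<Sum>i\<in>UNIV. ?UU i x) + of_real (2 * b / ?t) * ?r x" by (rule sym)
  next
    fix x :: "real^'n"
    let ?t = "(norm x)\<^sup>2"
    have t0: "of_real ?t * gj j ?t = gj (Suc j) ?t" by (rule gj_Suc)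
    have t1: "of_nat j * (of_real ?t * gj (j - 1) ?t) = of_nat j * gj j ?t"
      by (cases j) (simp_all only: gj_Suc diff_Suc_1, simp)
    have "(\<Sum>i\<in>UNIV. of_real (x $ i) * ?U i x) = 2 * of_real ?t * ?g1 ?t * p x + gj j ?t * (\<Sum>i\<in>UNIV. of_real (x $ i) * partial_deriv i p x)"
      unfolding norm_sq_coord[of x] sum_distrib_left sum_distrib_right sum.distrib[symmetric]
      by (rule sum.cong) (auto simp: algebra_simps)
    also have "\<dots> = (2 * (of_nat j * (of_real ?t * gj (j - 1) ?t)) - of_real ?t * gj j ?t + of_nat m * gj j ?t) * p x"
      unfolding hp_pd(4)[OF hp] by (simp add: algebra_simps)
    also have "\<dots> = eact m j p x" unfolding t0 t1 eact_def ebas_gj by (simp add: algebra_simps)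
    finally show "eact m j p x = (\<Sum>i\<in>UNIV. of_real (x $ i) * ?U i x)" by (rule sym)
  qed
qed

text \<open>Another basis of the module, on which $\mathfrak{sl}_2$ acts by explicit three-term formulas.\<close>

definition ospan :: "(real^'n \<Rightarrow> complex) set" where
  "ospan = cfun.span {ebas j p |j p m. p \<in> harmonic_poly m}"

text \<open>The value of $\omega_b(X)$ at \<^term>\<open>ebas j p\<close> for \<^term>\<open>p\<close> harmonic of degree \<^term>\<open>m\<close>.\<close>

definition oact :: "real \<Rightarrow> real^2^2 \<Rightarrow> nat \<Rightarrow> nat \<Rightarrow> (real^'n \<Rightarrow> complex) \<Rightarrow> real^'n \<Rightarrow> complex" where
  "oact b X m j p x = of_real (X$1$2) * (\<i> / 2 * ebas (Suc j) p x) + of_real (X$2$1) * (\<i> / 2 * hact b m j p x)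
    + of_real (X$1$1) * ((2 * of_nat j + of_real (kap TYPE('n) b m)) * ebas j p x - ebas (Suc j) p x)"

definition opairs :: "real \<Rightarrow> real^2^2 \<Rightarrow> ((real^'n \<Rightarrow> complex) \<times> (real^'n \<Rightarrow> complex)) set" where
  "opairs b X = {(ebas j p, oact b X m j p) |j p m. p \<in> harmonic_poly m}"

lemma ospan_base: "p \<in> harmonic_poly m \<Longrightarrow> ebas j p \<in> ospan"
  unfolding ospan_def by (rule cfun.span_base) auto

lemma ospan_cmult: "u \<in> ospan \<Longrightarrow> (\<lambda>x. c * u x) \<in> ospan"
  unfolding ospan_def using cfun.span_scale by (fastforce simp: cscale_def)

lemma ospan_add: "u \<in> ospan \<Longrightarrow> v \<in> ospan \<Longrightarrow> (\<lambda>x. u x + v x) \<in> ospan"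
  unfolding ospan_def using cfun.span_add by (fastforce simp: plus_fun_def)

lemma ospan_sum: "(\<And>k. k \<in> A \<Longrightarrow> u k \<in> ospan) \<Longrightarrow> (\<lambda>x. \<Sum>k\<in>A. u k x) \<in> ospan"
proof (induction A rule: infinite_finite_induct)
  case (insert a A)
  then have "(\<lambda>x. u a x + (\<Sum>k\<in>A. u k x)) \<in> ospan" by (intro ospan_add) auto
  then show ?case using insert by simp
qed (use ospan_cmult[OF ospan_base[OF cfun.subspace_0[OF harmonic_subspace]], of 0] in simp_all)

lemma ebas_Suc: "of_real ((norm x)\<^sup>2) * ebas j p x = ebas (Suc j) p x"
  by (simp add: ebas_def mult_ac)

lemma omega_ospan:
  fixes u :: "real^'n \<Rightarrow> complex"
  assumes "u \<in> ospan"
  shows "\<exists>hu eu. good b u hu eu" "(u, omega b X u) \<in> cfun2.span (opairs b X)"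
proof -
  have "\<exists>hu eu. good b u hu eu \<and> (u, \<lambda>x. of_real (X$1$2) * (\<i> / 2 * (of_real ((norm x)\<^sup>2) * u x)) + of_real (X$2$1) * (\<i> / 2 * hu x)
    + of_real (X$1$1) * (eu x + of_real ((real CARD('n) + 2 * b) / 2) * u x)) \<in> cfun2.span (opairs b X)" (is "\<exists>hu eu. ?P u hu eu")
    using assms unfolding ospan_def
  proof (induction rule: cfun.span_induct_alt)
    case base
    have "?P (\<lambda>x. 0) (\<lambda>x. 0) (\<lambda>x. 0)"
      using good_zero cfun2.span_zero[of "opairs b X :: ((real^'n \<Rightarrow> complex) \<times> (real^'n \<Rightarrow> complex)) set"] by (simp add: zero_prod_def zero_fun_def)
    then show ?case unfolding zero_fun_def by blast
  next
    case (step c e y)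
    obtain j p m where e: "e = ebas j p" and p: "p \<in> harmonic_poly m" using step(1) by auto
    from step(2) obtain hy ey where y: "?P y hy ey" by blast
    have ce: "cscale c e + y = (\<lambda>x. c * ebas j p x + y x)" by (simp add: fun_eq_iff cscale_def e)
    let ?h = "\<lambda>x. c * hact b m j p x + hy x" and ?e = "\<lambda>x. c * eact m j p x + ey x"
    have "?P (\<lambda>x. c * ebas j p x + y x) ?h ?e"
    proof
      show "good b (\<lambda>x. c * ebas j p x + y x) ?h ?e" by (rule good_linear[OF good_ebas[OF p]]) (use y in blast)
      have "cscale2 c (ebas j p, oact b X m j p) + (y, \<lambda>x. of_real (X$1$2) * (\<i> / 2 * (of_real ((norm x)\<^sup>2) * y x)) + of_real (X$2$1) * (\<i> / 2 * hy x)
        + of_real (X$1$1) * (ey x + of_real ((real CARD('n) + 2 * b) / 2) * y x)) \<in> cfun2.span (opairs b X)" (is "?z \<in> _")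
        using y p by (intro cfun2.span_add cfun2.span_scale) (auto intro!: cfun2.span_base simp: opairs_def)
      moreover have "?z = (\<lambda>x. c * ebas j p x + y x, \<lambda>x. of_real (X$1$2) * (\<i> / 2 * (of_real ((norm x)\<^sup>2) * (c * ebas j p x + y x))) + of_real (X$2$1) * (\<i> / 2 * ?h x)
        + of_real (X$1$1) * (?e x + of_real ((real CARD('n) + 2 * b) / 2) * (c * ebas j p x + y x)))" (is "_ = (_, ?w)")
      proof -
        have "c * oact b X m j p x + (of_real (X$1$2) * (\<i> / 2 * (of_real ((norm x)\<^sup>2) * y x)) + of_real (X$2$1) * (\<i> / 2 * hy x)
        + of_real (X$1$1) * (ey x + of_real ((real CARD('n) + 2 * b) / 2) * y x)) = ?w x" for x
        proof -
          have k: "complex_of_real (kap TYPE('n) b m) = of_nat m + of_real ((real CARD('n) + 2 * b) / 2)"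
            by (simp add: kap_def add_divide_distrib)
          have q: "of_real ((norm x)\<^sup>2) * (c * ebas j p x + y x) = c * ebas (Suc j) p x + of_real ((norm x)\<^sup>2) * y x"
            unfolding ebas_Suc[symmetric] by (simp add: algebra_simps)
          show ?thesis unfolding oact_def eact_def q k by (simp only: algebra_simps)
        qed
        then show ?thesis by (simp add: cscale2_def cscale_def fun_eq_iff)
      qed
      ultimately show "(\<lambda>x. c * ebas j p x + y x, ?w) \<in> cfun2.span (opairs b X)" by (simp only:)
    qed
    then show ?case unfolding ce by blast
  qed
  then obtain hu eu where g: "?P u hu eu" by blast
  then show "\<exists>hu eu. good b u hu eu" by blast
  have eq: "omega b X u = (\<lambda>x. of_real (X$1$2) * (\<i> / 2 * (of_real ((norm x)\<^sup>2) * u x)) + of_real (X$2$1) * (\<i> / 2 * hu x)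
    + of_real (X$1$1) * (eu x + of_real ((real CARD('n) + 2 * b) / 2) * u x))"
    using good_H_op[OF conjunct1[OF g]] by (simp add: omega_def[abs_def] mult.assoc)
  show "(u, omega b X u) \<in> cfun2.span (opairs b X)" unfolding eq using g by blast
qed

lemma hact_ospan: "p \<in> harmonic_poly m \<Longrightarrow> hact b m j p \<in> ospan"
proof -
  assume p: "p \<in> harmonic_poly m"
  have "hact b m j p = (\<lambda>x. 4 * of_nat j * (of_nat j + of_real (kap TYPE('a) b m) - 1) * ebas (j - 1) p x
     + ((- (4 * of_nat j + 2 * of_real (kap TYPE('a) b m))) * ebas j p x + 1 * ebas (Suc j) p x))"
    by (simp add: hact_def fun_eq_iff algebra_simps)
  then show ?thesis by (simp only:) (intro ospan_add ospan_cmult ospan_base[OF p])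
qed

lemma oact_ospan: "p \<in> harmonic_poly m \<Longrightarrow> oact b X m j p \<in> ospan"
proof -
  assume p: "p \<in> harmonic_poly m"
  have "oact b X m j p = (\<lambda>x. (of_real (X$1$2) * (\<i> / 2)) * ebas (Suc j) p x + ((of_real (X$2$1) * (\<i> / 2)) * hact b m j p x
    + ((of_real (X$1$1) * (2 * of_nat j + of_real (kap TYPE('a) b m))) * ebas j p x + (- of_real (X$1$1)) * ebas (Suc j) p x)))"
    by (simp add: oact_def fun_eq_iff algebra_simps)
  then show ?thesis by (simp only:) (intro ospan_add ospan_cmult ospan_base[OF p] hact_ospan[OF p])
qed

lemma opairs_span_ospan: "z \<in> cfun2.span (opairs b X) \<Longrightarrow> fst z \<in> ospan \<and> snd z \<in> ospan"
proof (induction rule: cfun2.span_induct_alt)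
  case base
  have "0 \<in> ospan" unfolding ospan_def by (rule cfun.span_zero)
  then show ?case by (simp only: fst_zero snd_zero simp_thms)
next
  case (step c z y)
  then obtain j p m where z: "z = (ebas j p, oact b X m j p)" and p: "p \<in> harmonic_poly m" by (auto simp: opairs_def)
  have "cscale c (ebas j p) + fst y \<in> ospan \<and> cscale c (oact b X m j p) + snd y \<in> ospan"
    using step(2) ospan_base[OF p] oact_ospan[OF p] unfolding ospan_def
    by (intro conjI cfun.span_add cfun.span_scale) blast+
  then show ?case by (simp only: z cscale2_def fst_add snd_add fst_conv snd_conv)
qed

lemma omega_in_ospan: "u \<in> ospan \<Longrightarrow> omega b X u \<in> ospan"
  using opairs_span_ospan[OF omega_ospan(2)] by fastforce

lemma ospan_continuous: "u \<in> ospan \<Longrightarrow> continuous_on S u"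
  unfolding ospan_def
proof (induction rule: cfun.span_induct_alt)
  case base show ?case by (simp add: zero_fun_def)
next
  case (step c x y)
  then obtain j p m where "x = ebas j p" "p \<in> harmonic_poly m" by auto
  then have "continuous_on S (\<lambda>z. c * x z + y z)"
    using step(2) ebas_continuous[OF harmonicD(1)] by (intro continuous_intros) auto
  then show ?case by (simp add: cscale_def plus_fun_def)
qed

section \<open>Laguerre eigenvectors\<close>

text \<open>The coefficients of the Laguerre polynomial, with \<^term>\<open>\<kappa>\<close> standing for $\nu + 1$.\<close>

definition lcoeff :: "nat \<Rightarrow> real \<Rightarrow> nat \<Rightarrow> real" where
  "lcoeff l \<kappa> k = (-1) ^ k * Gamma (\<kappa> + real l) / (Gamma (\<kappa> + real k) * fact (l - k) * fact k)"

lemma kap_lambda: "b + lambda TYPE('n) m + real k + 1 = kap TYPE('n::finite) b m + real k"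
  by (simp add: kap_def lambda_def add_divide_distrib diff_divide_distrib)

lemma Phi_ebas:
  fixes p :: "real^'n \<Rightarrow> complex"
  shows "Phi b l m p = (\<lambda>x. \<Sum>k\<le>l. of_real (lcoeff l (kap TYPE('n) b m) k) * ebas k p x)"
proof
  fix x :: "real^'n"
  let ?t = "(norm x)\<^sup>2"
  have "laguerre l (b + lambda TYPE('n) m) ?t = (\<Sum>k\<le>l. lcoeff l (kap TYPE('n) b m) k * ?t ^ k)"
    unfolding laguerre_def kap_lambda lcoeff_def by (rule sum.cong) (auto simp: field_simps)
  then have "Phi b l m p x = (\<Sum>k\<le>l. of_real (lcoeff l (kap TYPE('n) b m) k) * (of_real (exp (- ?t / 2)) * of_real ?t ^ k * p x))"
    by (simp add: Phi_def sum_distrib_left sum_distrib_right mult_ac)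
  moreover have "complex_of_real (exp (- ?t / 2)) = exp (- (1/2) * of_real ?t)" by (simp add: exp_of_real[symmetric])
  ultimately show "Phi b l m p x = (\<Sum>k\<le>l. of_real (lcoeff l (kap TYPE('n) b m) k) * ebas k p x)"
    by (simp only: ebas_def mult_ac)
qed

lemma lcoeff_rec:
  assumes \<kappa>: "\<kappa> > 0" and k: "k < l"
  shows "real (Suc k) * (\<kappa> + real k) * lcoeff l \<kappa> (Suc k) = - (real l - real k) * lcoeff l \<kappa> k"
proof -
  have G: "Gamma (\<kappa> + real (Suc k)) = (\<kappa> + real k) * Gamma (\<kappa> + real k)"
  proof -
    have "\<kappa> + real k \<notin> \<int>\<^sub>\<le>\<^sub>0" using \<kappa> by (auto elim!: nonpos_Ints_cases)
    from Gamma_plus1[OF this] show ?thesis by (simp add: add_ac)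
  qed
  have g0: "Gamma (\<kappa> + real k) > 0" using \<kappa> by (intro Gamma_real_pos) simp
  have f: "fact (l - k) = (real l - real k) * (fact (l - Suc k) :: real)"
    using k fact_reduce[of "l - k", where 'a=real] by (simp add: of_nat_diff)
  have a: "\<kappa> + real k > 0" "real l - real k > 0" using \<kappa> k by auto
  have field: "S * A * (- s * T / (A * g * F * (S * h))) = - D * (s * T / (g * (D * F) * h))"
    if "S \<noteq> 0" "A \<noteq> 0" "D \<noteq> 0" "g \<noteq> 0" "F \<noteq> 0" "h \<noteq> 0" for S A D g F h s T :: real
    using that by (simp add: field_simps)
  show ?thesis unfolding lcoeff_def G f fact_Suc power_Suc mult_minus1
    by (rule field) (use a in \<open>auto simp: less_imp_neq[OF g0, THEN not_sym] simp del: of_nat_Suc\<close>)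
qed

lemma lcoeff_top: "\<kappa> > 0 \<Longrightarrow> lcoeff l \<kappa> l \<noteq> 0"
proof -
  assume "\<kappa> > 0"
  then have "Gamma (\<kappa> + real l) > 0" by (intro Gamma_real_pos) simp
  then show ?thesis by (simp add: lcoeff_def)
qed

text \<open>The Laguerre polynomial of degree \<^term>\<open>l\<close> has nonzero leading coefficient, so the change of basis is triangular.\<close>

lemma W_alg_ospan:
  assumes b: "b > - real CARD('n) / 2"
  shows "(W_alg b :: (real^'n \<Rightarrow> complex) set) = ospan"
proof
  show "(W_alg b :: (real^'n \<Rightarrow> complex) set) \<subseteq> ospan"
    unfolding W_alg_def
  proof (rule cfun.span_minimal)
    show "cfun.subspace ospan" by (simp add: ospan_def)
    show "{Phi b l m p |l m p. p \<in> harmonic_poly m} \<subseteq> ospan"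
      unfolding Phi_ebas by (auto intro!: ospan_sum ospan_cmult ospan_base)
  qed
  have Wadd: "(\<lambda>x. u x + v x) \<in> W_alg b" if "u \<in> W_alg b" "v \<in> W_alg b" for u v :: "real^'n \<Rightarrow> complex"
    using cfun.span_add[of u _ v] that unfolding W_alg_def by (fastforce simp: plus_fun_def)
  have Wcm: "(\<lambda>x. c * u x) \<in> W_alg b" if "u \<in> W_alg b" for c and u :: "real^'n \<Rightarrow> complex"
    using cfun.span_scale[of u _ c] that unfolding W_alg_def by (fastforce simp: cscale_def)
  have Wsum: "(\<lambda>x. \<Sum>k\<in>A. u k x) \<in> W_alg b" if "finite A" "\<And>k. k \<in> A \<Longrightarrow> u k \<in> W_alg b" for A and u :: "nat \<Rightarrow> real^'n \<Rightarrow> complex"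
    using that
  proof (induction A rule: finite_induct)
    case empty
    have "0 \<in> W_alg b" unfolding W_alg_def by (rule cfun.span_zero)
    then show ?case by (simp add: zero_fun_def)
  next
    case (insert a A)
    then have "(\<lambda>x. u a x + (\<Sum>k\<in>A. u k x)) \<in> W_alg b" by (intro Wadd) auto
    then show ?case using insert by simp
  qed
  have e: "ebas l p \<in> W_alg b" if p: "p \<in> harmonic_poly m" for l m and p :: "real^'n \<Rightarrow> complex"
  proof (induction l rule: less_induct)
    case (less l)
    let ?a = "\<lambda>k. complex_of_real (lcoeff l (kap TYPE('n) b m) k)"
    have a0: "?a l \<noteq> 0" using lcoeff_top[OF kap_pos[OF b]] by simp
    have P: "Phi b l m p \<in> W_alg b" unfolding W_alg_def by (rule cfun.span_base) (use p in auto)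
    have "ebas l p = (\<lambda>x. (1 / ?a l) * (Phi b l m p x + (-1) * (\<Sum>k<l. ?a k * ebas k p x)))"
      unfolding Phi_ebas using a0 by (simp add: fun_eq_iff lessThan_Suc_atMost[symmetric] field_simps)
    then show ?case
      by (simp only:) (intro Wcm Wadd P Wsum less.IH, auto)
  qed
  show "ospan \<subseteq> (W_alg b :: (real^'n \<Rightarrow> complex) set)"
    unfolding ospan_def by (rule cfun.span_minimal) (use e in \<open>auto simp: W_alg_def\<close>)
qed

lemma good_sum:
  assumes "\<And>k::nat. good b (u k) (h k) (e k)"
  shows "good b (\<lambda>x. \<Sum>k<n. c k * u k x) (\<lambda>x. \<Sum>k<n. c k * h k x) (\<lambda>x. \<Sum>k<n. c k * e k x)"
proof (induction n)
  case 0 show ?case by (simp add: good_zero)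
next
  case (Suc n)
  from good_linear[OF assms[of n] Suc, of "c n"] show ?case by (simp add: add.commute)
qed

text \<open>In the basis \<^const>\<open>ebas\<close> the operator $\frac12 (H_b - |x|^2)$ is triangular, because the terms with $j + 1$ cancel; the recursion
  \<open>lcoeff_rec\<close> of the Laguerre coefficients is the eigenvalue equation.\<close>

lemma Phi_eigenvector:
  fixes p :: "real^'n \<Rightarrow> complex"
  assumes b: "b > - real CARD('n) / 2" and p: "p \<in> harmonic_poly m"
  shows "A_op b (Phi b l m p) = cscale (- of_real (kap TYPE('n) b m + 2 * real l)) (Phi b l m p)"
proof
  fix x :: "real^'n"
  let ?\<kappa> = "kap TYPE('n) b m" and ?k = "complex_of_real (kap TYPE('n) b m)"
  let ?a = "\<lambda>k. complex_of_real (lcoeff l ?\<kappa> k)"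
  have Phi: "Phi b l m p = (\<lambda>x. \<Sum>k<Suc l. ?a k * ebas k p x)"
    unfolding Phi_ebas lessThan_Suc_atMost ..
  have H: "H_op b (Phi b l m p) x = (\<Sum>k<Suc l. ?a k * hact b m k p x)"
    unfolding Phi using good_H_op(1)[OF good_sum[where c = ?a and n = "Suc l" and u = "\<lambda>k. ebas k p" and h = "\<lambda>k. hact b m k p" and e = "\<lambda>k. eact m k p", OF good_ebas[OF p]]] by simp
  have "A_op b (Phi b l m p) x = (\<Sum>k<Suc l. ?a k * ((hact b m k p x - ebas (Suc k) p x) / 2))"
  proof -
    have "of_real ((norm x)\<^sup>2) * Phi b l m p x = (\<Sum>k<Suc l. ?a k * ebas (Suc k) p x)"
      unfolding Phi sum_distrib_left by (rule sum.cong) (auto simp: ebas_Suc[symmetric] mult_ac)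
    then show ?thesis unfolding A_op_def H
      by (simp only: sum_subtractf[symmetric] sum_divide_distrib right_diff_distrib[symmetric]) simp
  qed
  also have "\<dots> = (\<Sum>k<Suc l. ?a k * (2 * of_nat k * (of_nat k + ?k - 1)) * ebas (k - 1) p x) - (\<Sum>k<Suc l. (2 * of_nat k + ?k) * ?a k * ebas k p x)"
    unfolding sum_subtractf[symmetric] hact_def by (rule sum.cong) (auto simp: field_simps)
  also have "(\<Sum>k<Suc l. ?a k * (2 * of_nat k * (of_nat k + ?k - 1)) * ebas (k - 1) p x)
      = (\<Sum>k<l. ?a (Suc k) * (2 * of_nat (Suc k) * (of_nat (Suc k) + ?k - 1)) * ebas k p x)"
    by (subst sum.lessThan_Suc_shift) simp
  also have "\<dots> = (\<Sum>k<l. - 2 * (of_nat l - of_nat k) * ?a k * ebas k p x)"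
  proof (rule sum.cong[OF refl])
    fix k assume "k \<in> {..<l}"
    then have r: "real (Suc k) * (?\<kappa> + real k) * lcoeff l ?\<kappa> (Suc k) = - (real l - real k) * lcoeff l ?\<kappa> k"
      by (intro lcoeff_rec kap_pos[OF b]) auto
    have "?a (Suc k) * (2 * of_nat (Suc k) * (of_nat (Suc k) + ?k - 1)) = of_real (2 * (real (Suc k) * (?\<kappa> + real k) * lcoeff l ?\<kappa> (Suc k)))"
      by (simp add: algebra_simps)
    also have "\<dots> = - 2 * (of_nat l - of_nat k) * ?a k" unfolding r by (simp add: algebra_simps)
    finally show "?a (Suc k) * (2 * of_nat (Suc k) * (of_nat (Suc k) + ?k - 1)) * ebas k p x = - 2 * (of_nat l - of_nat k) * ?a k * ebas k p x"
      by simp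
  qed
  also have "\<dots> = (\<Sum>k<Suc l. - 2 * (of_nat l - of_nat k) * ?a k * ebas k p x)" by simp
  also have "(\<Sum>k<Suc l. - 2 * (of_nat l - of_nat k) * ?a k * ebas k p x) - (\<Sum>k<Suc l. (2 * of_nat k + ?k) * ?a k * ebas k p x)
     = (\<Sum>k<Suc l. (- (?k + 2 * of_nat l)) * (?a k * ebas k p x))"
    unfolding sum_subtractf[symmetric] by (rule sum.cong) (auto simp: algebra_simps)
  also have "\<dots> = cscale (- of_real (?\<kappa> + 2 * real l)) (Phi b l m p) x"
    unfolding Phi cscale_def sum_distrib_left[symmetric] by simp
  finally show "A_op b (Phi b l m p) x = cscale (- of_real (?\<kappa> + 2 * real l)) (Phi b l m p) x" .
qed

lemma omega_Jmat: "omega b Jmat u = cscale \<i> (A_op b u)"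
  by (simp add: omega_def A_op_def cscale_def fun_eq_iff Jmat_def algebra_simps)

section \<open>Moebius action and the logarithm of the automorphy factor\<close>

definition autf :: "real^2^2 \<Rightarrow> complex \<Rightarrow> complex" where
  "autf A \<tau> = of_real (A$2$1) * \<tau> + of_real (A$2$2)"

definition mob :: "real^2^2 \<Rightarrow> complex \<Rightarrow> complex" where
  "mob A \<tau> = (of_real (A$1$1) * \<tau> + of_real (A$1$2)) / autf A \<tau>"

lemma SL2R_det: "A \<in> SL2R \<Longrightarrow> A$1$1 * A$2$2 - A$1$2 * A$2$1 = 1"
  by (simp add: SL2R_def det_2)

lemma autf_nonzero:
  assumes "A \<in> SL2R" "Im \<tau> > 0"
  shows "autf A \<tau> \<noteq> 0"
proof
  assume 0: "autf A \<tau> = 0"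
  then have "Im (autf A \<tau>) = 0" "Re (autf A \<tau>) = 0" by auto
  then have "A$2$1 = 0" "A$2$2 = 0" using assms(2) by (auto simp: autf_def)
  then show False using SL2R_det[OF assms(1)] by simp
qed

lemma mob_diff:
  assumes "A \<in> SL2R" "Im \<tau> > 0" "Im \<sigma> > 0"
  shows "(mob A \<tau> - cnj (mob A \<sigma>)) * (autf A \<tau> * cnj (autf A \<sigma>)) = \<tau> - cnj \<sigma>"
proof -
  let ?a = "complex_of_real (A$1$1)" and ?b = "complex_of_real (A$1$2)"
  let ?c = "complex_of_real (A$2$1)" and ?d = "complex_of_real (A$2$2)"
  have nz: "autf A \<tau> \<noteq> 0" "cnj (autf A \<sigma>) \<noteq> 0" using assms by (auto simp: autf_nonzero)
  have det: "?a * ?d - ?b * ?c = 1"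
    using SL2R_det[OF assms(1)] by (metis of_real_1 of_real_diff of_real_mult)
  have "(mob A \<tau> - cnj (mob A \<sigma>)) * (autf A \<tau> * cnj (autf A \<sigma>))
      = (?a * \<tau> + ?b) * cnj (autf A \<sigma>) - cnj (?a * \<sigma> + ?b) * autf A \<tau>"
    using nz unfolding mob_def by (simp add: field_simps)
  also have "\<dots> = (?a * ?d - ?b * ?c) * (\<tau> - cnj \<sigma>)"
    by (simp add: autf_def algebra_simps)
  finally show ?thesis using det by simp
qed

lemma Im_mob:
  assumes "A \<in> SL2R" "Im \<tau> > 0"
  shows "Im (mob A \<tau>) > 0"
proof -
  have "Im ((mob A \<tau> - cnj (mob A \<tau>)) * (autf A \<tau> * cnj (autf A \<tau>))) = 2 * Im \<tau>"
    unfolding mob_diff[OF assms assms(2)] by simp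
  moreover have "mob A \<tau> - cnj (mob A \<tau>) = 2 * \<i> * Im (mob A \<tau>)" by (simp add: complex_eq_iff)
  moreover have "autf A \<tau> * cnj (autf A \<tau>) = of_real ((cmod (autf A \<tau>))\<^sup>2)"
    using complex_norm_square by metis
  ultimately have "Im (mob A \<tau>) * (cmod (autf A \<tau>))\<^sup>2 = Im \<tau>" by simp
  with assms(2) have "0 < Im (mob A \<tau>) * (cmod (autf A \<tau>))\<^sup>2" by simp
  then show ?thesis by (simp add: zero_less_mult_iff)
qed

lemma autf_mult:
  assumes "B \<in> SL2R" "Im \<tau> > 0"
  shows "autf (A ** B) \<tau> = autf A (mob B \<tau>) * autf B \<tau>"
  using autf_nonzero[OF assms]
  by (simp add: autf_def[of A] autf_def[of "A ** B"] mob_def matrix_matrix_mult_def sum_2 field_simps)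
     (simp add: autf_def algebra_simps)

lemma mob_mult:
  assumes "A \<in> SL2R" "B \<in> SL2R" "Im \<tau> > 0"
  shows "mob (A ** B) \<tau> = mob A (mob B \<tau>)"
proof -
  have nz: "autf B \<tau> \<noteq> 0" "autf A (mob B \<tau>) \<noteq> 0" using assms by (auto simp: autf_nonzero Im_mob)
  have "(of_real ((A ** B)$1$1) * \<tau> + of_real ((A ** B)$1$2)) =
      (of_real (A$1$1) * mob B \<tau> + of_real (A$1$2)) * autf B \<tau>"
    using nz(1) by (simp add: mob_def matrix_matrix_mult_def sum_2 field_simps)
      (simp add: autf_def algebra_simps)
  then show ?thesis
    using nz unfolding mob_def[of "A ** B"] mob_def[of A] autf_mult[OF assms(2,3)] by simp
qed

lemma autf_mat_1 [simp]: "autf (mat 1) \<tau> = 1"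
  by (simp add: autf_def mat_def)

lemma mob_mat_1 [simp]: "mob (mat 1) \<tau> = \<tau>"
  unfolding mob_def by (simp, simp add: mat_def)

lemma continuous_on_autf [continuous_intros]:
  assumes "continuous_on S A" "continuous_on S z"
  shows "continuous_on S (\<lambda>s. autf (A s) (z s))"
  unfolding autf_def by (intro continuous_intros assms)

lemma continuous_on_mob [continuous_intros]:
  assumes "continuous_on S A" "continuous_on S z" "\<And>s. s \<in> S \<Longrightarrow> A s \<in> SL2R" "\<And>s. s \<in> S \<Longrightarrow> Im (z s) > 0"
  shows "continuous_on S (\<lambda>s. mob (A s) (z s))"
  unfolding mob_def by (intro continuous_intros assms) (auto simp: autf_nonzero assms)

lemma homotopic_paths_autf:
  assumes "homotopic_paths SL2R p q" "Im \<tau> > 0"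
  shows "homotopic_paths (-{0}) (\<lambda>s. autf (p s) \<tau>) (\<lambda>s. autf (q s) \<tau>)"
proof -
  have "homotopic_paths (-{0}) ((\<lambda>A. autf A \<tau>) \<circ> p) ((\<lambda>A. autf A \<tau>) \<circ> q)"
    by (rule homotopic_paths_continuous_image[OF assms(1)])
       (auto intro!: continuous_intros simp: autf_nonzero assms(2))
  then show ?thesis by (simp add: o_def)
qed

lift_definition cover_end :: "sl2_cover \<Rightarrow> real^2^2" is "\<lambda>p. p 1"
  using homotopic_paths_imp_pathfinish by (auto simp: sl2_path_rel_def pathfinish_def)

text \<open>The value at the end of the path of the continuous logarithm of the automorphy factor that starts at $0$. It is expressed through the
  winding number, whose homotopy invariance shows that it depends on the class only.\<close>

lift_definition autlog :: "sl2_cover \<Rightarrow> complex \<Rightarrow> complex" is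
  "\<lambda>p \<tau>. if Im \<tau> > 0 then 2 * of_real pi * \<i> * winding_number (\<lambda>s. autf (p s) \<tau>) 0 else 0"
  by (auto simp: sl2_path_rel_def fun_eq_iff dest!: homotopic_paths_autf intro!: winding_number_homotopic_paths)

lemma sl2_path_relD:
  assumes "sl2_path_rel p p"
  shows "continuous_on {0..1} p" "\<And>s. s \<in> {0..1} \<Longrightarrow> p s \<in> SL2R" "p 0 = mat 1"
  using assms by (auto simp: sl2_path_rel_refl_iff path_def path_image_def pathstart_def)

lemma sl2_path_relI:
  assumes "continuous_on {0..1} p" "\<And>s. s \<in> {0..1} \<Longrightarrow> p s \<in> SL2R" "p 0 = mat 1"
  shows "sl2_path_rel p p"
  using assms by (auto simp: sl2_path_rel_refl_iff path_def path_image_def pathstart_def)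

lemma abs_sl2_cover_eqI: "sl2_path_rel p q \<Longrightarrow> abs_sl2_cover p = abs_sl2_cover q"
  by (rule Quotient_rel_abs[OF Quotient_sl2_cover])

lemma abs_sl2_cover_eqD: "sl2_path_rel p p \<Longrightarrow> sl2_path_rel q q \<Longrightarrow> abs_sl2_cover p = abs_sl2_cover q \<Longrightarrow> sl2_path_rel p q"
  using Quotient_rel[OF Quotient_sl2_cover] by metis

lemma sl2_path_rel_pointwise:
  assumes "sl2_path_rel p p" "\<And>s. s \<in> {0..1} \<Longrightarrow> p s = q s"
  shows "sl2_path_rel p q"
  using assms homotopic_paths_eq[of p SL2R q] by (auto simp: sl2_path_rel_refl_iff sl2_path_rel_def)

lemma sl2_cover_cases:
  obtains p where "sl2_path_rel p p" "g = abs_sl2_cover p"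
proof -
  have "\<exists>p. sl2_path_rel p p \<and> g = abs_sl2_cover p"
    by (rule sl2_cover.abs_induct) blast
  then show ?thesis using that by blast
qed

lemma cover_end_SL2R: "cover_end g \<in> SL2R"
  by (rule sl2_cover_cases[of g]) (auto simp: cover_end.abs_eq dest: sl2_path_relD(2)[of _ 1])

lemma cover_end_mult: "cover_end (g * h) = cover_end g ** cover_end h"
proof -
  obtain p q where "sl2_path_rel p p" "g = abs_sl2_cover p" "sl2_path_rel q q" "h = abs_sl2_cover q"
    using sl2_cover_cases by metis
  then show ?thesis by (simp add: times_sl2_cover.abs_eq cover_end.abs_eq sl2_path_rel_mult)
qed

lemma cover_end_1 [simp]: "cover_end 1 = mat 1"
  by (simp add: one_sl2_cover.abs_eq cover_end.abs_eq sl2_path_rel_one)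

lemma winding_number_log:
  assumes "continuous_on {0..1} l" "\<And>s. s \<in> {0..1} \<Longrightarrow> p s = exp (l s)"
  shows "2 * of_real pi * \<i> * winding_number p 0 = l 1 - l 0"
proof -
  have "winding_number p 0 = winding_number (exp \<circ> l) 0"
    by (rule winding_number_cong) (simp add: assms)
  then show ?thesis
    using winding_number_compose_exp[of l] assms(1) by (simp add: path_def pathfinish_def pathstart_def)
qed

lemma autlog_unique:
  assumes "sl2_path_rel p p" "Im \<tau> > 0" "continuous_on {0..1} l" "l 0 = 0"
    "\<And>s. s \<in> {0..1} \<Longrightarrow> autf (p s) \<tau> = exp (l s)"
  shows "autlog (abs_sl2_cover p) \<tau> = l 1"
  using winding_number_log[OF assms(3,5)] assms by (simp add: autlog.abs_eq)

lemma continuous_log_exists: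
  assumes "continuous_on {0..1} p" "\<And>s. s \<in> {0..1} \<Longrightarrow> p s \<noteq> 0" "p 0 = (1::complex)"
  obtains l where "continuous_on {0..1} l" "l 0 = 0" "\<And>s. s \<in> {0..1} \<Longrightarrow> p s = exp (l s)"
    "l 1 = 2 * of_real pi * \<i> * winding_number p 0"
proof -
  have "path p" "0 \<notin> path_image p" using assms by (auto simp: path_def path_image_def)
  then obtain q where q: "path q" "pathfinish q - pathstart q = 2 * of_real pi * \<i> * winding_number p 0"
    "\<And>t. t \<in> {0..1} \<Longrightarrow> p t = 0 + exp (q t)"
    using winding_number_as_continuous_log by blast
  have "exp (q 0) = 1" using q(3)[of 0] assms(3) by simp
  then show ?thesis
    using q by (intro that[of "\<lambda>t. q t - q 0"])
      (auto simp: path_def pathfinish_def pathstart_def exp_diff intro!: continuous_intros)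
qed

lemma autlog_exists:
  assumes p: "sl2_path_rel p p" and \<tau>: "Im \<tau> > 0"
  obtains l where "continuous_on {0..1} l" "l 0 = 0" "\<And>s. s \<in> {0..1} \<Longrightarrow> autf (p s) \<tau> = exp (l s)"
    "l 1 = autlog (abs_sl2_cover p) \<tau>"
proof (rule continuous_log_exists[of "\<lambda>s. autf (p s) \<tau>"])
  show "continuous_on {0..1} (\<lambda>s. autf (p s) \<tau>)"
    using sl2_path_relD[OF p] by (intro continuous_intros) auto
qed (use sl2_path_relD[OF p] \<tau> that p in \<open>auto simp: autf_nonzero autlog.abs_eq\<close>)

lemma autlog_1 [simp]: "autlog 1 \<tau> = 0"
proof (cases "Im \<tau> > 0")
  case True
  have "autlog (abs_sl2_cover (\<lambda>t. mat 1)) \<tau> = (\<lambda>s. 0) (1::real)"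
    by (rule autlog_unique[OF sl2_path_rel_one True]) auto
  then show ?thesis by (simp add: one_sl2_cover.abs_eq)
next
  case False
  then show ?thesis unfolding one_sl2_cover.abs_eq
    by (subst autlog.abs_eq[OF sl2_path_rel_one]) simp
qed

lemma autf_convex:
  "autf A ((1 - u) *\<^sub>R z + u *\<^sub>R w) = (1 - u) *\<^sub>R autf A z + u *\<^sub>R autf A w"
  by (simp add: autf_def algebra_simps scaleR_conv_of_real)

text \<open>The cocycle identity holds for the automorphy factors along the product path. It involves the factor of \<^term>\<open>g\<close> at a moving
  point of the upper half plane, which may be frozen at its end point: the upper half plane is convex and the factor is affine in the point, so that the
  straight homotopy avoids $0$.\<close>

lemma autlog_mult:
  assumes \<tau>: "Im \<tau> > 0"
  shows "autlog (g * h) \<tau> = autlog g (mob (cover_end h) \<tau>) + autlog h \<tau>"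
proof -
  obtain p q where p: "sl2_path_rel p p" "g = abs_sl2_cover p" and q: "sl2_path_rel q q" "h = abs_sl2_cover q"
    using sl2_cover_cases by metis
  note pD = sl2_path_relD[OF p(1)] and qD = sl2_path_relD[OF q(1)]
  have Im: "Im (mob (q s) \<tau>) > 0" if "s \<in> {0..1}" for s using qD(2)[OF that] \<tau> by (rule Im_mob)
  let ?P = "\<lambda>s. autf (p s) (mob (q s) \<tau>)"
  let ?P' = "\<lambda>s. autf (p s) (mob (q 1) \<tau>)"
  have cP: "continuous_on {0..1} ?P" using pD qD \<tau> by (intro continuous_intros) auto
  have cP': "continuous_on {0..1} ?P'" using pD qD \<tau> by (intro continuous_intros) auto
  have "homotopic_paths (-{0}) ?P ?P'"
  proof (rule homotopic_paths_linear)
    fix t :: real assume t: "t \<in> {0..1}"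
    show "closed_segment (?P t) (?P' t) \<subseteq> -{0}"
    proof
      fix z assume "z \<in> closed_segment (?P t) (?P' t)"
      then obtain u where u: "0 \<le> u" "u \<le> 1" "z = (1 - u) *\<^sub>R ?P t + u *\<^sub>R ?P' t"
        by (auto simp: closed_segment_def)
      let ?w = "(1 - u) *\<^sub>R mob (q t) \<tau> + u *\<^sub>R mob (q 1) \<tau>"
      have "z = autf (p t) ?w" by (simp only: u(3) autf_convex)
      moreover have "Im ?w > 0"
      proof -
        have "?w \<in> {w. Im w > 0}"
          using convex_halfspace_Im_gt[of 0] u Im[OF t] Im[of 1] unfolding convex_alt by auto
        then show ?thesis by simp
      qed
      ultimately show "z \<in> -{0}" using autf_nonzero pD(2)[OF t] by auto
    qed
  qed (use cP cP' pD in \<open>auto simp: path_def pathstart_def pathfinish_def\<close>)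
  then have wn: "winding_number ?P 0 = winding_number ?P' 0" by (rule winding_number_homotopic_paths)
  obtain lP where lP: "continuous_on {0..1} lP" "lP 0 = 0" "\<And>s. s \<in> {0..1} \<Longrightarrow> ?P s = exp (lP s)"
    "lP 1 = 2 * of_real pi * \<i> * winding_number ?P 0"
    by (rule continuous_log_exists[OF cP]) (use pD qD Im in \<open>auto simp: autf_nonzero\<close>)
  obtain lq where lq: "continuous_on {0..1} lq" "lq 0 = 0" "\<And>s. s \<in> {0..1} \<Longrightarrow> autf (q s) \<tau> = exp (lq s)"
    "lq 1 = autlog h \<tau>"
    using autlog_exists[OF q(1) \<tau>] q(2) by metis
  have "autlog (abs_sl2_cover (\<lambda>s. p s ** q s)) \<tau> = (\<lambda>s. lP s + lq s) 1"
  proof (rule autlog_unique[OF sl2_path_rel_mult[OF p(1) q(1)] \<tau>])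
    show "continuous_on {0..1} (\<lambda>s. lP s + lq s)" by (intro continuous_intros lP lq)
    fix s :: real assume "s \<in> {0..1}"
    then show "autf (p s ** q s) \<tau> = exp (lP s + lq s)"
      using qD(2) \<tau> lP(3) lq(3) by (simp add: autf_mult exp_add)
  qed (simp add: lP lq)
  moreover have "lP 1 = autlog g (mob (cover_end h) \<tau>)"
    using lP(4) wn Im[of 1] p q by (simp add: autlog.abs_eq cover_end.abs_eq)
  ultimately show ?thesis using lq(4) p q by (simp add: times_sl2_cover.abs_eq)
qed

lemma autlog_Ln:
  assumes "sl2_path_rel p p" "Im \<tau> > 0" "\<And>s. s \<in> {0..1} \<Longrightarrow> autf (p s) \<tau> \<notin> \<real>\<^sub>\<le>\<^sub>0"
  shows "autlog (abs_sl2_cover p) \<tau> = Ln (autf (p 1) \<tau>)"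
  by (rule autlog_unique[where l = "\<lambda>s. Ln (autf (p s) \<tau>)"])
     (use assms sl2_path_relD[OF assms(1)] in
       \<open>auto intro!: continuous_intros simp: autf_nonzero\<close>)

lemma Re_half_plane_diff: "Im \<tau> > 0 \<Longrightarrow> Im \<sigma> > 0 \<Longrightarrow> Re (- \<i> * (\<tau> - cnj \<sigma>)) > 0"
  by simp

text \<open>Along a path representing \<^term>\<open>g\<close> the exponential of the left hand side is constant by \<open>mob_diff\<close>, so that the left hand side, which varies
  continuously, is constant. At the start of the path it is the right hand side. The principal logarithm is continuous there since its
  argument has positive real part.\<close>

lemma Ln_mob_diff:
  assumes \<tau>: "Im \<tau> > 0" and \<sigma>: "Im \<sigma> > 0"
  shows "Ln (- \<i> * (mob (cover_end g) \<tau> - cnj (mob (cover_end g) \<sigma>))) + autlog g \<tau> + cnj (autlog g \<sigma>)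
    = Ln (- \<i> * (\<tau> - cnj \<sigma>))"
proof -
  obtain p where p: "sl2_path_rel p p" "g = abs_sl2_cover p" using sl2_cover_cases by metis
  note pD = sl2_path_relD[OF p(1)]
  obtain l where l: "continuous_on {0..1} l" "l 0 = 0" "\<And>s. s \<in> {0..1} \<Longrightarrow> autf (p s) \<tau> = exp (l s)" "l 1 = autlog g \<tau>"
    using autlog_exists[OF p(1) \<tau>] p(2) by metis
  obtain k where k: "continuous_on {0..1} k" "k 0 = 0" "\<And>s. s \<in> {0..1} \<Longrightarrow> autf (p s) \<sigma> = exp (k s)" "k 1 = autlog g \<sigma>"
    using autlog_exists[OF p(1) \<sigma>] p(2) by metis
  let ?d = "\<lambda>s. - \<i> * (mob (p s) \<tau> - cnj (mob (p s) \<sigma>))"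
  let ?r = "\<lambda>s. Ln (?d s) + l s + cnj (k s)"
  have Re: "Re (?d s) > 0" if "s \<in> {0..1}" for s
    by (intro Re_half_plane_diff Im_mob pD that \<tau> \<sigma>)
  have "2 * of_real pi * \<i> * winding_number (\<lambda>s. - \<i> * (\<tau> - cnj \<sigma>)) 0 = ?r 1 - ?r 0"
  proof (rule winding_number_log)
    show "continuous_on {0..1} ?r"
      using pD \<tau> \<sigma> Re by (intro continuous_intros l k) (auto simp: complex_nonpos_Reals_iff, (force simp: not_le)+)
    fix s :: real assume s: "s \<in> {0..1}"
    have "?d s \<noteq> 0" using Re[OF s] by force
    then have "exp (?r s) = ?d s * (autf (p s) \<tau> * cnj (autf (p s) \<sigma>))"
      using l(3)[OF s] k(3)[OF s] by (simp add: exp_add exp_cnj mult.assoc)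
    also have "\<dots> = - \<i> * (\<tau> - cnj \<sigma>)"
      using mob_diff[OF pD(2)[OF s] \<tau> \<sigma>] by (simp add: mult.assoc del: complex_cnj_mult)
    finally show "- \<i> * (\<tau> - cnj \<sigma>) = exp (?r s)" by simp
  qed
  moreover have "winding_number (\<lambda>s. - \<i> * (\<tau> - cnj \<sigma>)) 0 = 0"
    using Re_half_plane_diff[OF \<tau> \<sigma>] by (intro winding_number_constI[of "- \<i> * (\<tau> - cnj \<sigma>)"]) force+
  ultimately show ?thesis using l k p pD by (simp add: cover_end.abs_eq)
qed

section \<open>One-parameter subgroups\<close>

text \<open>With $\kappa^2 = - \det X$, the exponential of a trace-free matrix is $\cosh \kappa + (\sinh \kappa / \kappa) X$; a complex root $\kappa$ treats the hyperbolic, elliptic and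
  nilpotent cases at once.\<close>

definition sinhc :: "complex \<Rightarrow> complex" where
  "sinhc z = (if z = 0 then 1 else sinh z / z)"

lemma mult_sinhc: "z * sinhc z = sinh z"
  by (simp add: sinhc_def)

lemma sinhc_sums: "(\<lambda>n. if even n then 0 else z ^ (n - 1) /\<^sub>R fact n) sums sinhc z"
proof (cases "z = 0")
  case True
  have "(\<lambda>n::nat. if n = 1 then (1::complex) else 0) sums 1"
    by (rule sums_single)
  also have "(\<lambda>n::nat. if n = 1 then (1::complex) else 0) = (\<lambda>n. if even n then 0 else z ^ (n - 1) /\<^sub>R fact n)"
    using True by (auto simp: fun_eq_iff power_0_left le_Suc_eq)
  finally show ?thesis using True by (simp add: sinhc_def)
next
  case False
  have "(\<lambda>n. (if even n then 0 else z ^ n /\<^sub>R fact n) / z) sums (sinh z / z)"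
    by (intro sums_divide sinh_converges)
  also have "(\<lambda>n. (if even n then 0 else z ^ n /\<^sub>R fact n) / z) = (\<lambda>n. if even n then 0 else z ^ (n - 1) /\<^sub>R fact n)"
    using False by (auto simp: fun_eq_iff scaleR_conv_of_real elim!: oddE)
  finally show ?thesis using False by (simp add: sinhc_def)
qed

lemma sl2_square:
  assumes "Y \<in> sl2"
  shows "Y ** Y = (- det Y) *\<^sub>R mat 1"
proof -
  have "Y$2$2 = - Y$1$1" using assms by (simp add: sl2_def trace_def sum_2)
  then show ?thesis
    by (simp add: vec_eq_iff forall_2 matrix_matrix_mult_def sum_2 mat_def det_2 algebra_simps)
qed

lemma matrix_mult_scaleR: "A ** (c *\<^sub>R B) = c *\<^sub>R (A ** B)" for A :: "real^'n^'m" and B :: "real^'k^'n"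
  by (simp add: matrix_matrix_mult_def vec_eq_iff sum_distrib_left mult.left_commute)

lemma sl2_power:
  assumes "Y \<in> sl2"
  shows "((**) Y ^^ n) (mat 1) = (if even n then (- det Y) ^ (n div 2) *\<^sub>R mat 1 else (- det Y) ^ (n div 2) *\<^sub>R Y)"
proof (induction n)
  case (Suc n)
  then show ?case
    by (auto simp: matrix_mult_scaleR sl2_square[OF assms] elim!: evenE oddE)
qed simp

lemma mat_exp_entry:
  assumes Y: "Y \<in> sl2" and \<kappa>: "\<kappa>\<^sup>2 = complex_of_real (- det Y)"
  shows "complex_of_real (mat_exp Y $ i $ j) = cosh \<kappa> * (if i = j then 1 else 0) + sinhc \<kappa> * of_real (Y $ i $ j)"
proof -
  define T where "T k = (1 / fact k) *\<^sub>R (((**) Y ^^ k) (mat 1))" for k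
  have trm: "complex_of_real (T k $ i $ j) = (if even k then \<kappa> ^ k /\<^sub>R fact k else 0) * (if i = j then 1 else 0)
      + (if even k then 0 else \<kappa> ^ (k - 1) /\<^sub>R fact k) * of_real (Y $ i $ j)" for k i j
  proof -
    have "complex_of_real ((- det Y) ^ (k div 2)) = \<kappa> ^ (2 * (k div 2))"
      by (simp add: power_mult \<kappa> del: of_real_minus)
    then have "complex_of_real (T k $ i $ j) = (1 / fact k) * (if even k then \<kappa> ^ (2 * (k div 2)) * (if i = j then 1 else 0)
        else \<kappa> ^ (2 * (k div 2)) * of_real (Y $ i $ j))"
      unfolding T_def sl2_power[OF Y] by (simp add: mat_def del: of_real_power)
    then show ?thesis
      by (auto simp: scaleR_conv_of_real divide_inverse elim!: evenE oddE)
  qed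
  have sums: "(\<lambda>k. complex_of_real (T k $ i $ j)) sums
      (cosh \<kappa> * (if i = j then 1 else 0) + sinhc \<kappa> * of_real (Y $ i $ j))" for i j
    unfolding trm by (intro sums_add sums_mult2 cosh_converges sinhc_sums)
  have "(\<lambda>k. T k $ i $ j) sums Re (cosh \<kappa> * (if i = j then 1 else 0) + sinhc \<kappa> * of_real (Y $ i $ j))" for i j
    using sums_Re[OF sums[of i j]] by simp
  then have "T sums (\<chi> i j. Re (cosh \<kappa> * (if i = j then 1 else 0) + sinhc \<kappa> * of_real (Y $ i $ j)))"
    unfolding sums_def by (intro vec_tendstoI) (simp add: sum_component)
  then have "mat_exp Y = (\<chi> i j. Re (cosh \<kappa> * (if i = j then 1 else 0) + sinhc \<kappa> * of_real (Y $ i $ j)))"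
    unfolding mat_exp_def T_def[symmetric] by (rule sums_unique[symmetric])
  moreover have "Im (cosh \<kappa> * (if i = j then 1 else 0) + sinhc \<kappa> * of_real (Y $ i $ j)) = 0"
    using sums_unique2[OF sums_Im[OF sums[of i j]]] by (simp add: sums_0)
  then have "cosh \<kappa> * (if i = j then 1 else 0) + sinhc \<kappa> * of_real (Y $ i $ j) \<in> \<real>"
    by (simp only: complex_is_Real_iff)
  ultimately show ?thesis by (simp only: vec_lambda_beta of_real_Re)
qed

lemma sl2_scaleR: "X \<in> sl2 \<Longrightarrow> t *\<^sub>R X \<in> sl2"
  by (simp add: sl2_def trace_def sum_2 flip: distrib_left)

definition flow_s :: "complex \<Rightarrow> real \<Rightarrow> complex" where
  "flow_s \<kappa> t = of_real t * sinhc (\<kappa> * of_real t)"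

lemma mult_flow_s: "\<kappa> * flow_s \<kappa> t = sinh (\<kappa> * of_real t)"
  by (simp add: flow_s_def mult_sinhc flip: mult.assoc)

lemma flow_s_alt: "flow_s \<kappa> t = (if \<kappa> = 0 then of_real t else sinh (\<kappa> * of_real t) / \<kappa>)"
  by (auto simp: flow_s_def sinhc_def)

lemma mat_exp_flow:
  assumes X: "X \<in> sl2" and \<kappa>: "\<kappa>\<^sup>2 = complex_of_real (- det X)"
  shows "complex_of_real (mat_exp (t *\<^sub>R X) $ i $ j)
    = cosh (\<kappa> * of_real t) * (if i = j then 1 else 0) + flow_s \<kappa> t * of_real (X $ i $ j)"
proof -
  have "(\<kappa> * of_real t)\<^sup>2 = complex_of_real (- det (t *\<^sub>R X))"
    unfolding power_mult_distrib \<kappa> by (simp add: det_2 power2_eq_square algebra_simps)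
  from mat_exp_entry[OF sl2_scaleR[OF X] this] show ?thesis by (simp add: flow_s_def)
qed

lemma sl2_root: obtains \<kappa> where "\<kappa>\<^sup>2 = complex_of_real (- det (X :: real^2^2))"
  using that[of "csqrt (complex_of_real (- det X))"] by simp

lemma mat_exp_0 [simp]: "mat_exp (0 :: real^2^2) = mat 1"
proof -
  have "(0::real^2^2) \<in> sl2" by (simp add: sl2_def trace_def)
  then have "complex_of_real (mat_exp (0::real^2^2) $ i $ j) = of_real (mat 1 $ i $ j)" for i j :: 2
    by (subst mat_exp_entry[where \<kappa> = 0]) (auto simp: det_2 mat_def)
  then show ?thesis by (simp add: vec_eq_iff)
qed

lemma mat_exp_add:
  assumes X: "X \<in> sl2"
  shows "mat_exp ((s + t) *\<^sub>R X) = mat_exp (s *\<^sub>R X) ** mat_exp (t *\<^sub>R X)"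
proof -
  obtain \<kappa> where \<kappa>: "\<kappa>\<^sup>2 = complex_of_real (- det X)" by (rule sl2_root)
  note flow = mat_exp_flow[OF X \<kappa>]
  have X22: "X$2$2 = - X$1$1" using X by (simp add: sl2_def trace_def sum_2)
  have k2: "\<kappa>\<^sup>2 = of_real (X$1$1)^2 + of_real (X$1$2) * of_real (X$2$1)"
    using \<kappa> by (simp add: det_2 X22 power2_eq_square)
  have C: "cosh (\<kappa> * of_real (s + t)) = cosh (\<kappa> * of_real s) * cosh (\<kappa> * of_real t) + \<kappa>\<^sup>2 * flow_s \<kappa> s * flow_s \<kappa> t"
    by (simp add: distrib_left cosh_add power2_eq_square mult_flow_s[symmetric] ac_simps)
  have S: "flow_s \<kappa> (s + t) = flow_s \<kappa> s * cosh (\<kappa> * of_real t) + cosh (\<kappa> * of_real s) * flow_s \<kappa> t"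
    by (auto simp: flow_s_alt distrib_left sinh_add add_divide_distrib)
  have "complex_of_real (mat_exp ((s + t) *\<^sub>R X) $ i $ j) = of_real ((mat_exp (s *\<^sub>R X) ** mat_exp (t *\<^sub>R X)) $ i $ j)" for i j
  proof -
    have "complex_of_real ((mat_exp (s *\<^sub>R X) ** mat_exp (t *\<^sub>R X)) $ i $ j)
      = of_real (mat_exp (s *\<^sub>R X) $ i $ 1) * of_real (mat_exp (t *\<^sub>R X) $ 1 $ j)
      + of_real (mat_exp (s *\<^sub>R X) $ i $ 2) * of_real (mat_exp (t *\<^sub>R X) $ 2 $ j)"
      by (simp add: matrix_matrix_mult_def sum_2)
    then show ?thesis
      unfolding flow C S k2 using exhaust_2[of i] exhaust_2[of j]
      by (auto simp: X22 algebra_simps power2_eq_square)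
  qed
  then show ?thesis by (simp add: vec_eq_iff)
qed

lemma det_mat_exp:
  assumes X: "X \<in> sl2"
  shows "mat_exp X \<in> SL2R"
proof -
  obtain \<kappa> where \<kappa>: "\<kappa>\<^sup>2 = complex_of_real (- det X)" by (rule sl2_root)
  have X22: "X$2$2 = - X$1$1" using X by (simp add: sl2_def trace_def sum_2)
  have k2: "\<kappa>\<^sup>2 = of_real (X$1$1)^2 + of_real (X$1$2) * of_real (X$2$1)"
    using \<kappa> by (simp add: det_2 X22 power2_eq_square)
  have "complex_of_real (det (mat_exp X)) = of_real (mat_exp X $1$1) * of_real (mat_exp X $2$2)
     - of_real (mat_exp X $1$2) * of_real (mat_exp X $2$1)"
    by (simp add: det_2)
  also have "\<dots> = (cosh \<kappa>)\<^sup>2 - \<kappa>\<^sup>2 * (sinhc \<kappa>)\<^sup>2"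
    unfolding mat_exp_entry[OF X \<kappa>] k2 by (simp add: X22 power2_eq_square algebra_simps)
  also have "\<dots> = 1"
    using cosh_square_eq[of \<kappa>] mult_sinhc[of \<kappa>] by (simp flip: power_mult_distrib)
  finally show ?thesis by (simp add: SL2R_def)
qed

lemma flow_s_deriv: "(flow_s \<kappa> has_vector_derivative cosh (\<kappa> * of_real t)) (at t)"
proof (cases "\<kappa> = 0")
  case True
  then show ?thesis unfolding flow_s_alt
    by (auto intro!: derivative_eq_intros)
next
  case False
  have eq: "flow_s \<kappa> = (\<lambda>t. sinh (\<kappa> * of_real t) / \<kappa>)"
    using False by (auto simp: flow_s_alt)
  have "((\<lambda>z. sinh (\<kappa> * z) / \<kappa>) has_field_derivative cosh (\<kappa> * of_real t)) (at (of_real t))"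
    using False by (auto intro!: derivative_eq_intros)
  from has_vector_derivative_real_field[OF this] show ?thesis unfolding eq .
qed

lemma cosh_flow_deriv:
  "((\<lambda>t. cosh (\<kappa> * complex_of_real t)) has_vector_derivative \<kappa> * sinh (\<kappa> * of_real t)) (at t)"
proof -
  have "((\<lambda>z. cosh (\<kappa> * z)) has_field_derivative \<kappa> * sinh (\<kappa> * of_real t)) (at (of_real t))"
    by (auto intro!: derivative_eq_intros)
  from has_vector_derivative_real_field[OF this] show ?thesis .
qed

lemma mat_exp_deriv:
  assumes X: "X \<in> sl2"
  obtains D where "\<And>t i j. ((\<lambda>t. mat_exp (t *\<^sub>R X) $ i $ j) has_real_derivative D t i j) (at t)"
    "\<And>i j. D 0 i j = X $ i $ j"
proof -
  obtain \<kappa> where \<kappa>: "\<kappa>\<^sup>2 = complex_of_real (- det X)" by (rule sl2_root)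
  define D where "D t i j = Re (\<kappa> * sinh (\<kappa> * of_real t) * (if i = j then 1 else 0)
    + cosh (\<kappa> * of_real t) * of_real (X $ i $ j))" for t i j
  have "((\<lambda>t. mat_exp (t *\<^sub>R X) $ i $ j) has_real_derivative D t i j) (at t)" for t i j
  proof -
    have "((\<lambda>t. complex_of_real (mat_exp (t *\<^sub>R X) $ i $ j)) has_vector_derivative
       (\<kappa> * sinh (\<kappa> * of_real t) * (if i = j then 1 else 0) + cosh (\<kappa> * of_real t) * of_real (X $ i $ j))) (at t)"
      unfolding mat_exp_flow[OF X \<kappa>]
      by (intro has_vector_derivative_add has_vector_derivative_mult_left cosh_flow_deriv flow_s_deriv)
    from bounded_linear.has_vector_derivative[OF bounded_linear_Re this] show ?thesis
      unfolding D_def has_real_derivative_iff_has_vector_derivative by simp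
  qed
  moreover have "D 0 i j = X $ i $ j" for i j by (simp add: D_def)
  ultimately show ?thesis using that by blast
qed

lemma continuous_on_mat_exp [continuous_intros]:
  assumes X: "X \<in> sl2" and f: "continuous_on S f"
  shows "continuous_on S (\<lambda>s. mat_exp (f s *\<^sub>R X))"
proof -
  obtain D where D: "\<And>t i j. ((\<lambda>t. mat_exp (t *\<^sub>R X) $ i $ j) has_real_derivative D t i j) (at t)"
    using mat_exp_deriv[OF X] by metis
  have *: "continuous_on UNIV (\<lambda>t. mat_exp (t *\<^sub>R X) $ i $ j)" for i j
    by (intro continuous_at_imp_continuous_on ballI DERIV_isCont[OF D])
  have "continuous_on UNIV (\<lambda>t. \<chi> i j. mat_exp (t *\<^sub>R X) $ i $ j)"
    by (intro continuous_on_vec_lambda *)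
  also have "(\<lambda>t. \<chi> i j. mat_exp (t *\<^sub>R X) $ i $ j) = (\<lambda>t. mat_exp (t *\<^sub>R X))"
    by (simp add: fun_eq_iff vec_eq_iff)
  finally have "continuous_on UNIV (\<lambda>t. mat_exp (t *\<^sub>R X))" .
  from continuous_on_compose2[OF this f] show ?thesis by simp
qed

lemma mat_exp_path_rel:
  assumes X: "X \<in> sl2" and f: "continuous_on {0..1} f" "f 0 = 0"
  shows "sl2_path_rel (\<lambda>s. mat_exp (f s *\<^sub>R X)) (\<lambda>s. mat_exp (f s *\<^sub>R X))"
  by (rule sl2_path_relI) (use assms in \<open>auto intro!: continuous_intros det_mat_exp sl2_scaleR\<close>)

text \<open>Any path in a one-parameter group is homotopic to the straight one, as the parameter runs in the real line.\<close>

lemma cover_exp_path: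
  assumes X: "X \<in> sl2" and f: "continuous_on {0..1} f" "f 0 = 0"
  shows "abs_sl2_cover (\<lambda>s. mat_exp (f s *\<^sub>R X)) = cover_exp (f 1 *\<^sub>R X)"
proof -
  have "homotopic_paths UNIV f (\<lambda>s. s * f 1)"
    by (rule homotopic_paths_linear)
       (use f in \<open>auto simp: path_def pathstart_def pathfinish_def intro!: continuous_intros\<close>)
  then have "homotopic_paths SL2R ((\<lambda>t. mat_exp (t *\<^sub>R X)) \<circ> f) ((\<lambda>t. mat_exp (t *\<^sub>R X)) \<circ> (\<lambda>s. s * f 1))"
    by (rule homotopic_paths_continuous_image)
       (use X in \<open>auto intro!: continuous_intros det_mat_exp sl2_scaleR\<close>)
  then have "sl2_path_rel (\<lambda>s. mat_exp (f s *\<^sub>R X)) (\<lambda>s. mat_exp (s *\<^sub>R f 1 *\<^sub>R X))"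
    using f by (simp add: sl2_path_rel_def o_def pathstart_def)
  then show ?thesis unfolding cover_exp_def by (rule abs_sl2_cover_eqI)
qed

lemma cover_exp_rel: "X \<in> sl2 \<Longrightarrow> sl2_path_rel (\<lambda>s. mat_exp (s *\<^sub>R X)) (\<lambda>s. mat_exp (s *\<^sub>R X))"
  by (rule mat_exp_path_rel) (auto intro: continuous_intros)

lemma cover_exp_add:
  assumes X: "X \<in> sl2"
  shows "cover_exp ((s + t) *\<^sub>R X) = cover_exp (s *\<^sub>R X) * cover_exp (t *\<^sub>R X)"
proof -
  have "cover_exp (s *\<^sub>R X) * cover_exp (t *\<^sub>R X)
      = abs_sl2_cover (\<lambda>u. mat_exp (u *\<^sub>R s *\<^sub>R X) ** mat_exp (u *\<^sub>R t *\<^sub>R X))"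
    unfolding cover_exp_def by (intro times_sl2_cover.abs_eq cover_exp_rel sl2_scaleR X)
  then show ?thesis unfolding cover_exp_def by (simp add: mat_exp_add[OF X] distrib_left)
qed

lemma cover_exp_0 [simp]: "cover_exp 0 = 1"
  by (simp add: cover_exp_def one_sl2_cover.abs_eq)

lemma cover_exp_minus:
  assumes X: "X \<in> sl2"
  shows "cover_exp (- t *\<^sub>R X) * cover_exp (t *\<^sub>R X) = 1" "cover_exp (t *\<^sub>R X) * cover_exp (- t *\<^sub>R X) = 1"
  using cover_exp_add[OF X, of "-t" t] cover_exp_add[OF X, of t "-t"] by simp_all

lemma cover_end_exp: "X \<in> sl2 \<Longrightarrow> cover_end (cover_exp X) = mat_exp X"
  unfolding cover_exp_def by (subst cover_end.abs_eq) (auto intro: cover_exp_rel)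

lemma mat_1_entries:
  "(mat 1 :: real^2^2)$1$1 = 1" "(mat 1 :: real^2^2)$1$2 = 0" "(mat 1 :: real^2^2)$2$1 = 0" "(mat 1 :: real^2^2)$2$2 = 1"
  by (simp_all add: mat_def)

lemma autf_mat_exp_deriv:
  assumes X: "X \<in> sl2"
  shows "((\<lambda>t. autf (mat_exp (t *\<^sub>R X)) \<tau>) has_vector_derivative autf X \<tau>) (at 0)"
proof -
  obtain D where D: "\<And>t i j. ((\<lambda>t. mat_exp (t *\<^sub>R X) $ i $ j) has_real_derivative D t i j) (at t)"
    "\<And>i j. D 0 i j = X $ i $ j"
    using mat_exp_deriv[OF X] by metis
  have d: "((\<lambda>t. complex_of_real (mat_exp (t *\<^sub>R X) $ i $ j)) has_vector_derivative of_real (X $ i $ j)) (at 0)" for i j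
    using has_vector_derivative_of_real[OF D(1)[of i j 0]] D(2) by simp
  show ?thesis unfolding autf_def
    by (intro has_vector_derivative_add has_vector_derivative_mult_left d)
qed

lemma mob_mat_exp_deriv:
  assumes X: "X \<in> sl2" and \<tau>: "Im \<tau> > 0"
  shows "((\<lambda>t. mob (mat_exp (t *\<^sub>R X)) \<tau>) has_vector_derivative
    (of_real (X$1$2) + 2 * of_real (X$1$1) * \<tau> - of_real (X$2$1) * \<tau>\<^sup>2)) (at 0)"
proof -
  obtain D where D: "\<And>t i j. ((\<lambda>t. mat_exp (t *\<^sub>R X) $ i $ j) has_real_derivative D t i j) (at t)"
    "\<And>i j. D 0 i j = X $ i $ j"
    using mat_exp_deriv[OF X] by metis
  have d: "((\<lambda>t. complex_of_real (mat_exp (t *\<^sub>R X) $ i $ j)) has_vector_derivative of_real (X $ i $ j)) (at 0)" for i j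
    using has_vector_derivative_of_real[OF D(1)[of i j 0]] D(2) by simp
  have X22: "X$2$2 = - X$1$1" using X by (simp add: sl2_def trace_def sum_2)
  have n: "((\<lambda>t. of_real (mat_exp (t *\<^sub>R X) $1$1) * \<tau> + of_real (mat_exp (t *\<^sub>R X) $1$2)) has_vector_derivative
       (of_real (X$1$1) * \<tau> + of_real (X$1$2))) (at 0)"
    by (intro has_vector_derivative_add has_vector_derivative_mult_left d)
  have i: "((\<lambda>t. inverse (autf (mat_exp (t *\<^sub>R X)) \<tau>)) has_vector_derivative - autf X \<tau>) (at 0)"
  proof -
    have "(inverse has_field_derivative - 1) (at (autf (mat_exp (0 *\<^sub>R X)) \<tau>))"
      using DERIV_inverse[of "1::complex"] by simp
    from field_vector_diff_chain_at[OF autf_mat_exp_deriv[OF X] this] show ?thesis by (simp add: o_def)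
  qed
  show ?thesis
    using has_vector_derivative_mult[OF n i]
    by (simp add: mob_def divide_inverse autf_def[of X] X22 algebra_simps power2_eq_square mat_1_entries)
qed

text \<open>For small \<^term>\<open>t\<close> the automorphy factor has positive real part along the path, so that the continued logarithm is the principal one.\<close>

lemma autlog_exp_deriv:
  assumes X: "X \<in> sl2" and \<tau>: "Im \<tau> > 0"
  shows "((\<lambda>t. autlog (cover_exp (t *\<^sub>R X)) \<tau>) has_vector_derivative autf X \<tau>) (at 0)"
proof -
  let ?A = "\<lambda>t. autf (mat_exp (t *\<^sub>R X)) \<tau>"
  have "continuous_on UNIV (\<lambda>t. Re (?A t))" by (intro continuous_intros X)
  then have "isCont (\<lambda>t. Re (?A t)) 0" by (simp add: continuous_on_eq_continuous_at)
  moreover have "Re (?A 0) = 1" by simp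
  ultimately have "((\<lambda>t. Re (?A t)) \<longlongrightarrow> 1) (at 0)" by (metis isCont_def)
  from order_tendstoD(1)[OF this, of 0] obtain d where d: "d > 0" "\<And>t. t \<noteq> 0 \<Longrightarrow> \<bar>t\<bar> < d \<Longrightarrow> Re (?A t) > 0"
    by (auto simp: eventually_at dist_real_def)
  then have pos: "Re (?A t) > 0" if "\<bar>t\<bar> < d" for t using that by (cases "t = 0") auto
  have eq: "autlog (cover_exp (t *\<^sub>R X)) \<tau> = Ln (?A t)" if t: "\<bar>t\<bar> < d" for t
  proof -
    have "autlog (cover_exp (t *\<^sub>R X)) \<tau> = Ln (autf (mat_exp (1 *\<^sub>R t *\<^sub>R X)) \<tau>)"
      unfolding cover_exp_def
    proof (rule autlog_Ln[OF cover_exp_rel \<tau>])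
      fix s :: real assume s: "s \<in> {0..1}"
      have "\<bar>s * t\<bar> \<le> \<bar>t\<bar>" using s by (simp add: abs_mult mult_left_le_one_le)
      then have "Re (?A (s * t)) > 0" using pos t by (meson le_less_trans)
      then show "autf (mat_exp (s *\<^sub>R t *\<^sub>R X)) \<tau> \<notin> \<real>\<^sub>\<le>\<^sub>0" by (auto simp: complex_nonpos_Reals_iff)
    qed (simp add: sl2_scaleR X)
    then show ?thesis by simp
  qed
  have "(Ln has_field_derivative 1) (at (autf (mat_exp (0 *\<^sub>R X)) \<tau>))"
    using has_field_derivative_Ln[of 1] by simp
  from field_vector_diff_chain_at[OF autf_mat_exp_deriv[OF X] this]
  have L: "((\<lambda>t. Ln (?A t)) has_vector_derivative autf X \<tau>) (at 0)" by (simp add: o_def)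
  show ?thesis
    by (rule has_vector_derivative_transform_within_open[OF L, of "{-d<..<d}"])
       (use d eq in auto)
qed

section \<open>Generation of the covering group and its topology\<close>

definition Emat :: "real^2^2" where "Emat = vector [vector [0, 1], vector [0, 0]]"
definition Fmat :: "real^2^2" where "Fmat = vector [vector [0, 0], vector [1, 0]]"
definition Hmat :: "real^2^2" where "Hmat = vector [vector [1, 0], vector [0, -1]]"

lemma mat_entries:
  "Emat$1$1 = 0" "Emat$1$2 = 1" "Emat$2$1 = 0" "Emat$2$2 = 0"
  "Fmat$1$1 = 0" "Fmat$1$2 = 0" "Fmat$2$1 = 1" "Fmat$2$2 = 0"
  "Hmat$1$1 = 1" "Hmat$1$2 = 0" "Hmat$2$1 = 0" "Hmat$2$2 = -1"
  "Jmat$1$1 = 0" "Jmat$1$2 = -1" "Jmat$2$1 = 1" "Jmat$2$2 = 0"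
  by (simp_all add: Emat_def Fmat_def Hmat_def Jmat_def)

lemma sl2_basis [simp]: "Emat \<in> sl2" "Fmat \<in> sl2" "Hmat \<in> sl2" "Jmat \<in> sl2"
  by (simp_all add: sl2_def trace_def sum_2 mat_entries)

lemma mat_exp_Emat: "mat_exp (t *\<^sub>R Emat) = mat 1 + t *\<^sub>R Emat"
proof -
  have "complex_of_real (mat_exp (t *\<^sub>R Emat) $ i $ j) = of_real ((mat 1 + t *\<^sub>R Emat) $ i $ j)" for i j
    by (subst mat_exp_flow[where \<kappa> = 0]) (auto simp: det_2 mat_entries mat_def flow_s_alt)
  then show ?thesis by (simp only: of_real_eq_iff vec_eq_iff) simp
qed

lemma mat_exp_Fmat: "mat_exp (t *\<^sub>R Fmat) = mat 1 + t *\<^sub>R Fmat"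
proof -
  have "complex_of_real (mat_exp (t *\<^sub>R Fmat) $ i $ j) = of_real ((mat 1 + t *\<^sub>R Fmat) $ i $ j)" for i j
    by (subst mat_exp_flow[where \<kappa> = 0]) (auto simp: det_2 mat_entries mat_def flow_s_alt)
  then show ?thesis by (simp only: of_real_eq_iff vec_eq_iff) simp
qed

lemma mat_exp_Hmat:
  "mat_exp (t *\<^sub>R Hmat) $1$1 = exp t" "mat_exp (t *\<^sub>R Hmat) $2$2 = exp (-t)"
  "mat_exp (t *\<^sub>R Hmat) $1$2 = 0" "mat_exp (t *\<^sub>R Hmat) $2$1 = 0"
proof -
  have f: "complex_of_real (mat_exp (t *\<^sub>R Hmat) $ i $ j) =
      cosh (of_real t) * (if i = j then 1 else 0) + sinh (of_real t) * of_real (Hmat $ i $ j)" for i j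
    by (subst mat_exp_flow[where \<kappa> = 1]) (auto simp: det_2 mat_entries flow_s_alt)
  have "complex_of_real (mat_exp (t *\<^sub>R Hmat) $1$1) = of_real (exp t)"
    by (simp add: f mat_entries cosh_plus_sinh exp_of_real)
  then show "mat_exp (t *\<^sub>R Hmat) $1$1 = exp t" by (simp only: of_real_eq_iff)
  have "complex_of_real (mat_exp (t *\<^sub>R Hmat) $2$2) = of_real (exp (-t))"
    using cosh_minus_sinh[of "complex_of_real t"] by (simp add: f mat_entries exp_of_real[symmetric])
  then show "mat_exp (t *\<^sub>R Hmat) $2$2 = exp (-t)" by (simp only: of_real_eq_iff)
  show "mat_exp (t *\<^sub>R Hmat) $1$2 = 0" "mat_exp (t *\<^sub>R Hmat) $2$1 = 0"
    using f[of 1 2] f[of 2 1] by (simp_all add: mat_entries)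
qed

lemma mat_exp_Jmat: "mat_exp ((pi / 2) *\<^sub>R Jmat) = Jmat" "mat_exp (- (pi / 2) *\<^sub>R Jmat) = - Jmat"
proof -
  have f: "complex_of_real (mat_exp (t *\<^sub>R Jmat) $ i $ j) =
      cos (of_real t) * (if i = j then 1 else 0) + sin (of_real t) * of_real (Jmat $ i $ j)" for i j t
    by (subst mat_exp_flow[where \<kappa> = \<i>])
       (auto simp: det_2 mat_entries flow_s_alt cosh_conv_cos sinh_conv_sin)
  have "complex_of_real (mat_exp ((pi / 2) *\<^sub>R Jmat) $ i $ j) = of_real (Jmat $ i $ j)" for i j
    using f[of "pi/2" i j] cos_of_real_pi_half[where 'a=complex] sin_of_real_pi_half[where 'a=complex] by simp
  then show "mat_exp ((pi / 2) *\<^sub>R Jmat) = Jmat" by (simp add: vec_eq_iff)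
  have "complex_of_real (mat_exp (- (pi / 2) *\<^sub>R Jmat) $ i $ j) = of_real (- Jmat $ i $ j)" for i j
    using f[of "-(pi/2)" i j] cos_of_real_pi_half[where 'a=complex] sin_of_real_pi_half[where 'a=complex] by simp
  then show "mat_exp (- (pi / 2) *\<^sub>R Jmat) = - Jmat" by (simp add: vec_eq_iff)
qed


text \<open>The Gauss decomposition of a matrix with positive upper left entry depends continuously on the matrix. Along a path of such matrices it
  decomposes the path, hence its class.\<close>

lemma cover_exp_Emat_Fmat_Hmat:
  assumes p: "sl2_path_rel p p" and pos: "\<And>s. s \<in> {0..1} \<Longrightarrow> p s $1$1 > 0"
  shows "abs_sl2_cover p = cover_exp ((p 1 $2$1 / p 1 $1$1) *\<^sub>R Fmat) * cover_exp (ln (p 1 $1$1) *\<^sub>R Hmat)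
    * cover_exp ((p 1 $1$2 / p 1 $1$1) *\<^sub>R Emat)"
proof -
  note pD = sl2_path_relD[OF p]
  let ?y = "\<lambda>s. p s $2$1 / p s $1$1" and ?t = "\<lambda>s. ln (p s $1$1)" and ?x = "\<lambda>s. p s $1$2 / p s $1$1"
  have c: "continuous_on {0..1} (\<lambda>s. p s $ i $ j)" for i j by (intro continuous_intros pD)
  have nz: "p s $1$1 \<noteq> 0" if "s \<in> {0..1}" for s using pos[OF that] by simp
  have f: "continuous_on {0..1} ?y" "?y 0 = 0" and h: "continuous_on {0..1} ?t" "?t 0 = 0"
    and e: "continuous_on {0..1} ?x" "?x 0 = 0"
    using c nz pos pD(1,3) by (auto intro!: continuous_intros simp: mat_1_entries)
  let ?q = "\<lambda>s. mat_exp (?y s *\<^sub>R Fmat) ** mat_exp (?t s *\<^sub>R Hmat) ** mat_exp (?x s *\<^sub>R Emat)"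
  have pq: "?q s = p s" if s: "s \<in> {0..1}" for s
  proof -
    have "p s $1$1 * p s $2$2 - p s $1$2 * p s $2$1 = 1" by (rule SL2R_det[OF pD(2)[OF s]])
    then have d: "p s $2$2 = p s $2$1 / p s $1$1 * p s $1$1 * (p s $1$2 / p s $1$1) + 1 / p s $1$1"
      using nz[OF s] by (simp add: field_simps)
    have x: "exp (ln (p s $1$1)) = p s $1$1" "exp (- ln (p s $1$1)) = 1 / p s $1$1"
      using pos[OF s] by (simp_all add: exp_minus inverse_eq_divide)
    show ?thesis using nz[OF s] d
      by (simp add: vec_eq_iff forall_2 matrix_matrix_mult_def sum_2 mat_exp_Emat mat_exp_Fmat mat_exp_Hmat
          mat_entries mat_1_entries x)
  qed
  have rel: "sl2_path_rel (\<lambda>s. mat_exp (?y s *\<^sub>R Fmat)) (\<lambda>s. mat_exp (?y s *\<^sub>R Fmat))"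
    "sl2_path_rel (\<lambda>s. mat_exp (?t s *\<^sub>R Hmat)) (\<lambda>s. mat_exp (?t s *\<^sub>R Hmat))"
    "sl2_path_rel (\<lambda>s. mat_exp (?x s *\<^sub>R Emat)) (\<lambda>s. mat_exp (?x s *\<^sub>R Emat))"
    by (intro mat_exp_path_rel f h e sl2_basis)+
  have "cover_exp (?y 1 *\<^sub>R Fmat) * cover_exp (?t 1 *\<^sub>R Hmat) * cover_exp (?x 1 *\<^sub>R Emat) = abs_sl2_cover ?q"
    by (simp only: cover_exp_path[OF sl2_basis(2) f, symmetric] cover_exp_path[OF sl2_basis(3) h, symmetric]
      cover_exp_path[OF sl2_basis(1) e, symmetric] times_sl2_cover.abs_eq[OF rel(1,2)]
      times_sl2_cover.abs_eq[OF sl2_path_rel_mult[OF rel(1,2)] rel(3)])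
  also have "\<dots> = abs_sl2_cover p"
    by (rule abs_sl2_cover_eqI[symmetric], rule sl2_path_rel_pointwise[OF p]) (simp only: pq)
  finally show ?thesis by simp
qed

text \<open>A factorisation of the diagonal matrix into unipotent ones, chosen to depend continuously on $t \ge 0$ with all parameters $0$ at
  $t = 0$; it then holds along the path and thus in the covering group.\<close>

lemma cover_exp_Hmat_nonneg:
  assumes "t \<ge> 0"
  defines "r \<equiv> sqrt (exp t - 1)"
  shows "cover_exp (t *\<^sub>R Hmat) = cover_exp (r *\<^sub>R Emat) * cover_exp (r *\<^sub>R Fmat) *
     (cover_exp ((- r * exp (-t)) *\<^sub>R Emat) * cover_exp ((- r * exp t) *\<^sub>R Fmat))"
proof -
  let ?r = "\<lambda>s. sqrt (exp (s * t) - 1)"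
  let ?u = "\<lambda>s. - ?r s * exp (- (s * t))" and ?v = "\<lambda>s. - ?r s * exp (s * t)"
  have r: "continuous_on {0..1} ?r" "?r 0 = 0" and u: "continuous_on {0..1} ?u" "?u 0 = 0"
    and v: "continuous_on {0..1} ?v" "?v 0 = 0"
    by (auto intro!: continuous_intros)
  let ?q = "\<lambda>s. mat_exp (?r s *\<^sub>R Emat) ** mat_exp (?r s *\<^sub>R Fmat) ** (mat_exp (?u s *\<^sub>R Emat) ** mat_exp (?v s *\<^sub>R Fmat))"
  have pq: "mat_exp (s *\<^sub>R t *\<^sub>R Hmat) = ?q s" if s: "s \<in> {0..1}" for s
  proof -
    define a where "a = exp (s * t)"
    have a: "a \<ge> 1" "exp (- (s * t)) = 1 / a" using s assms by (auto simp: a_def exp_minus field_simps)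
    have sq: "sqrt (a - 1) * sqrt (a - 1) = a - 1" using a by simp
    have "mat_exp ((s * t) *\<^sub>R Hmat) = ?q s"
      unfolding a_def[symmetric] a(2) mat_exp_Emat mat_exp_Fmat using a
      by (simp add: vec_eq_iff forall_2 matrix_matrix_mult_def sum_2 mat_exp_Emat mat_exp_Fmat mat_exp_Hmat
          mat_entries mat_1_entries exp_minus a_def[symmetric] field_simps sq)
    then show ?thesis by simp
  qed
  have rel: "sl2_path_rel (\<lambda>s. mat_exp (?r s *\<^sub>R Emat)) (\<lambda>s. mat_exp (?r s *\<^sub>R Emat))"
    "sl2_path_rel (\<lambda>s. mat_exp (?r s *\<^sub>R Fmat)) (\<lambda>s. mat_exp (?r s *\<^sub>R Fmat))"
    "sl2_path_rel (\<lambda>s. mat_exp (?u s *\<^sub>R Emat)) (\<lambda>s. mat_exp (?u s *\<^sub>R Emat))"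
    "sl2_path_rel (\<lambda>s. mat_exp (?v s *\<^sub>R Fmat)) (\<lambda>s. mat_exp (?v s *\<^sub>R Fmat))"
    by (intro mat_exp_path_rel r u v sl2_basis)+
  have 1: "cover_exp (?r 1 *\<^sub>R Emat) * cover_exp (?r 1 *\<^sub>R Fmat) =
      abs_sl2_cover (\<lambda>s. mat_exp (?r s *\<^sub>R Emat) ** mat_exp (?r s *\<^sub>R Fmat))"
    unfolding cover_exp_path[OF sl2_basis(1) r, symmetric] cover_exp_path[OF sl2_basis(2) r, symmetric]
    by (rule times_sl2_cover.abs_eq[OF rel(1,2)])
  have 2: "cover_exp (?u 1 *\<^sub>R Emat) * cover_exp (?v 1 *\<^sub>R Fmat) =
      abs_sl2_cover (\<lambda>s. mat_exp (?u s *\<^sub>R Emat) ** mat_exp (?v s *\<^sub>R Fmat))"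
    unfolding cover_exp_path[OF sl2_basis(1) u, symmetric] cover_exp_path[OF sl2_basis(2) v, symmetric]
    by (rule times_sl2_cover.abs_eq[OF rel(3,4)])
  have "cover_exp (?r 1 *\<^sub>R Emat) * cover_exp (?r 1 *\<^sub>R Fmat) * (cover_exp (?u 1 *\<^sub>R Emat) * cover_exp (?v 1 *\<^sub>R Fmat))
    = abs_sl2_cover ?q"
    unfolding 1 2 by (rule times_sl2_cover.abs_eq[OF sl2_path_rel_mult[OF rel(1,2)] sl2_path_rel_mult[OF rel(3,4)]])
  also have "\<dots> = cover_exp (t *\<^sub>R Hmat)" unfolding cover_exp_def
    by (rule abs_sl2_cover_eqI[symmetric], rule sl2_path_rel_pointwise)
       (rule cover_exp_rel[OF sl2_scaleR[OF sl2_basis(3)]], rule pq)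
  finally show ?thesis by (simp add: r_def)
qed

text \<open>Conjugation by the rotation through $\pi/2$ exchanges the two unipotent groups up to sign. In the covering group the rotation is a path, and
  the homotopy lets the conjugating rotation start at larger and larger angles, until it is constant.\<close>

lemma cover_exp_Fmat_conj:
  "cover_exp (x *\<^sub>R Fmat) = cover_exp ((pi / 2) *\<^sub>R Jmat) * cover_exp (- x *\<^sub>R Emat) * cover_exp (- (pi / 2) *\<^sub>R Jmat)"
proof -
  let ?P = "\<lambda>s. mat_exp ((s * (pi / 2)) *\<^sub>R Jmat)" and ?Q = "\<lambda>s. mat_exp ((s * (- (pi / 2))) *\<^sub>R Jmat)"
  let ?R = "\<lambda>s. mat_exp ((s * (- x)) *\<^sub>R Emat)"
  let ?h = "\<lambda>z. ?P (snd z + fst z - fst z * snd z) ** ?R (snd z) ** ?Q (snd z + fst z - fst z * snd z)"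
  have PQ: "?P s ** ?Q s = mat 1" for s
    using mat_exp_add[OF sl2_basis(4), of "s * (pi / 2)" "s * (- (pi / 2))"] by simp
  have "homotopic_paths SL2R (\<lambda>s. ?P s ** ?R s ** ?Q s) (\<lambda>s. mat_exp (s *\<^sub>R x *\<^sub>R Fmat))"
    unfolding homotopic_paths
  proof (intro exI conjI ballI)
    show "continuous_on ({0..1} \<times> {0..1}) ?h"
      by (intro continuous_on_mmult continuous_intros) auto
    show "?h \<in> {0..1} \<times> {0..1} \<rightarrow> SL2R"
      by (intro Pi_I SL2R_mult det_mat_exp sl2_scaleR sl2_basis)
    fix s :: real assume "s \<in> {0..1}"
    show "?h (0, s) = ?P s ** ?R s ** ?Q s" by simp
    have "?h (1, s) = Jmat ** ?R s ** (- Jmat)"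
      using mat_exp_Jmat by simp
    also have "\<dots> = mat_exp (s *\<^sub>R x *\<^sub>R Fmat)"
      unfolding scaleR_scaleR mat_exp_Emat mat_exp_Fmat
      by (simp add: vec_eq_iff forall_2 matrix_matrix_mult_def sum_2 mat_entries mat_1_entries)
    finally show "?h (1, s) = mat_exp (s *\<^sub>R x *\<^sub>R Fmat)" .
    show "pathstart (?h \<circ> Pair s) = pathstart (\<lambda>s. ?P s ** ?R s ** ?Q s)"
      using PQ[of s] by (simp add: pathstart_def)
    show "pathfinish (?h \<circ> Pair s) = pathfinish (\<lambda>s. ?P s ** ?R s ** ?Q s)"
      by (simp add: pathfinish_def)
  qed
  then have "sl2_path_rel (\<lambda>s. ?P s ** ?R s ** ?Q s) (\<lambda>s. mat_exp (s *\<^sub>R x *\<^sub>R Fmat))"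
    by (simp add: sl2_path_rel_def pathstart_def)
  then have "cover_exp (x *\<^sub>R Fmat) = abs_sl2_cover (\<lambda>s. ?P s ** ?R s ** ?Q s)"
    unfolding cover_exp_def by (rule abs_sl2_cover_eqI[symmetric])
  moreover have "sl2_path_rel ?P ?P" "sl2_path_rel ?Q ?Q" "sl2_path_rel ?R ?R"
    using cover_exp_rel[of "(pi / 2) *\<^sub>R Jmat"] cover_exp_rel[of "(- (pi / 2)) *\<^sub>R Jmat"] cover_exp_rel[of "(- x) *\<^sub>R Emat"]
    by (simp_all only: sl2_scaleR sl2_basis scaleR_scaleR simp_thms)
  ultimately show ?thesis
    by (simp add: cover_exp_def times_sl2_cover.abs_eq sl2_path_rel_mult)
qed

lemma adjugate2_path_rel:
  assumes "continuous_on {0..1} p" "\<And>s. s \<in> {0..1} \<Longrightarrow> p s \<in> SL2R"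
    "continuous_on {0..1} q" "\<And>s. s \<in> {0..1} \<Longrightarrow> q s \<in> SL2R" "p 0 = q 0"
  shows "sl2_path_rel (\<lambda>s. adjugate2 (p s) ** q s) (\<lambda>s. adjugate2 (p s) ** q s)"
proof (rule sl2_path_relI)
  show "continuous_on {0..1} (\<lambda>s. adjugate2 (p s) ** q s)"
    by (intro continuous_on_mmult continuous_on_adjugate2 assms)
  show "adjugate2 (p s) ** q s \<in> SL2R" if "s \<in> {0..1}" for s
    by (intro SL2R_mult adjugate2_SL2R assms that)
  have "q 0 \<in> SL2R" by (rule assms) auto
  then show "adjugate2 (p 0) ** q 0 = mat 1" unfolding assms(5) by (rule adjugate2_mult)
qed

text \<open>By uniform continuity a path can be cut into steps along which the relative position has positive upper left entry; every step
  is then a product of elements of the three subgroups.\<close>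

theorem cover_induct [case_names mult E F H]:
  assumes mult: "\<And>g h. P g \<Longrightarrow> P h \<Longrightarrow> P (g * h)"
    and E: "\<And>x. P (cover_exp (x *\<^sub>R Emat))" and F: "\<And>x. P (cover_exp (x *\<^sub>R Fmat))"
    and H: "\<And>x. P (cover_exp (x *\<^sub>R Hmat))"
  shows "P g"
proof -
  obtain p where p: "sl2_path_rel p p" "g = abs_sl2_cover p" using sl2_cover_cases by metis
  note pD = sl2_path_relD[OF p(1)]
  let ?f = "\<lambda>z. (adjugate2 (p (fst z)) ** p (snd z)) $1$1"
  have c1: "continuous_on ({0..1} \<times> {0..1}) (\<lambda>z. p (fst z))" "continuous_on ({0..1} \<times> {0..1}) (\<lambda>z. p (snd z))"
    by (rule continuous_on_compose2[OF pD(1)]; auto intro!: continuous_intros)+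
  have "continuous_on ({0..1::real} \<times> {0..1::real}) ?f"
    by (intro continuous_intros continuous_on_mmult continuous_on_adjugate2 c1)
  then have "uniformly_continuous_on ({0..1} \<times> {0..1}) ?f"
    by (intro compact_uniformly_continuous compact_Times) auto
  then obtain d where d: "d > 0" and dd: "\<And>z w. z \<in> {0..1} \<times> {0..1} \<Longrightarrow> w \<in> {0..1} \<times> {0..1} \<Longrightarrow> dist w z < d \<Longrightarrow>
      dist (?f w) (?f z) < 1"
    unfolding uniformly_continuous_on_def by (metis zero_less_one)
  have near: "?f (s, t) > 0" if st: "s \<in> {0..1}" "t \<in> {0..1}" "\<bar>s - t\<bar> < d" for s t
  proof -
    have "dist (?f (s, t)) (?f (s, s)) < 1"
      using st by (intro dd) (auto simp: dist_Pair_Pair dist_real_def abs_minus_commute)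
    moreover have "?f (s, s) = 1" using adjugate2_mult(1)[OF pD(2)[OF st(1)]] by (simp add: mat_1_entries)
    ultimately show ?thesis by (simp add: dist_real_def abs_if split: if_splits)
  qed
  obtain n :: nat where n: "n > 0" "1 / real n < d" using d by (metis gr0I nat_approx_posE of_nat_Suc zero_less_Suc)
  \<comment> \<open>The path stopped at time $k/n$.\<close>
  let ?p = "\<lambda>k s. p (min s (real k / real n))"
  have mem: "min s (real k / real n) \<in> {0..1}" if "s \<in> {0..1}" for s k
    using that by (auto simp: min_def)
  have cp: "continuous_on {0..1} (?p k)" for k
    by (rule continuous_on_compose2[OF pD(1)]) (use mem in \<open>auto intro!: continuous_intros\<close>)
  have rel: "sl2_path_rel (?p k) (?p k)" for k
    by (rule sl2_path_relI) (use cp pD mem in auto)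
  have "P (abs_sl2_cover (?p k))" for k
  proof (induction k)
    case 0
    have "abs_sl2_cover (?p 0) = 1" unfolding one_sl2_cover.abs_eq
      by (rule abs_sl2_cover_eqI[OF sl2_path_rel_pointwise[OF rel]]) (simp add: min_absorb2 pD)
    then show ?case using E[of 0] by simp
  next
    case (Suc k)
    let ?q = "\<lambda>s. adjugate2 (?p k s) ** ?p (Suc k) s"
    have relq: "sl2_path_rel ?q ?q"
      by (rule adjugate2_path_rel[OF cp _ cp]) (use pD mem in \<open>auto simp del: of_nat_Suc\<close>)
    have "?q s $1$1 > 0" if s: "s \<in> {0..1}" for s
    proof -
      have "real k / n \<le> real (Suc k) / n" by (simp add: divide_right_mono)
      then have "\<bar>min s (real k / n) - min s (real (Suc k) / n)\<bar> \<le> real (Suc k) / n - real k / n" by auto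
      also have "\<dots> = 1 / n" by (simp flip: diff_divide_distrib)
      finally show ?thesis using near[OF mem[OF s] mem[OF s], of k "Suc k"] n by simp
    qed
    from cover_exp_Emat_Fmat_Hmat[OF relq this] have Pq: "P (abs_sl2_cover ?q)"
      by (simp add: mult E F H)
    have "abs_sl2_cover (?p (Suc k)) = abs_sl2_cover (\<lambda>s. ?p k s ** ?q s)"
      by (rule abs_sl2_cover_eqI[OF sl2_path_rel_pointwise[OF rel]])
         (simp add: matrix_mul_assoc adjugate2_mult(2)[OF pD(2)[OF mem]])
    also have "\<dots> = abs_sl2_cover (?p k) * abs_sl2_cover ?q"
      by (rule times_sl2_cover.abs_eq[symmetric]) (rule rel relq)+
    finally show ?case using Suc Pq mult by simp
  qed
  moreover have "abs_sl2_cover (?p n) = g" unfolding p(2)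
    by (rule abs_sl2_cover_eqI[OF sl2_path_rel_pointwise[OF rel]]) (use n in \<open>auto simp: min_def\<close>)
  ultimately show ?thesis by metis
qed

text \<open>A basic neighbourhood of \<^term>\<open>g\<close> consists of the classes of a path for \<^term>\<open>g\<close> followed by a short path. Dividing by the end point
  of the former, the short path stays near the identity, where the Gauss decomposition has small parameters.\<close>

lemma cover_nhds:
  assumes e: "e > 0"
  obtains U where "open U" "g \<in> U"
    "\<And>h. h \<in> U \<Longrightarrow> \<exists>x y t. \<bar>x\<bar> < e \<and> \<bar>y\<bar> < e \<and> \<bar>t\<bar> < e \<and>
        h = g * (cover_exp (y *\<^sub>R Fmat) * cover_exp (t *\<^sub>R Hmat) * cover_exp (x *\<^sub>R Emat))"
proof -
  obtain p where p: "sl2_path_rel p p" "g = abs_sl2_cover p" using sl2_cover_cases by metis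
  note pD = sl2_path_relD[OF p(1)]
  have p1: "p 1 \<in> SL2R" by (rule pD) auto
  let ?B = "\<lambda>A. adjugate2 (p 1) ** A"
  let ?G = "\<lambda>B::real^2^2. B$1$1 > 0 \<and> \<bar>ln (B$1$1)\<bar> < e \<and> \<bar>B$1$2 / B$1$1\<bar> < e \<and> \<bar>B$2$1 / B$1$1\<bar> < e"
  have B1: "?B (p 1) = mat 1" by (rule adjugate2_mult(1)[OF p1])
  have ent: "((\<lambda>A. ?B A $ i $ j) \<longlongrightarrow> (mat 1 :: real^2^2) $ i $ j) (nhds (p 1))" for i j
  proof -
    have "continuous_on UNIV (\<lambda>A. ?B A $ i $ j)" by (intro continuous_intros continuous_on_mmult)
    then have "((\<lambda>A. ?B A $ i $ j) \<longlongrightarrow> ?B (p 1) $ i $ j) (at (p 1))"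
      by (simp add: continuous_on_eq_continuous_at isCont_def)
    then show ?thesis unfolding B1[symmetric] by (subst (asm) tendsto_at_iff_tendsto_nhds)
  qed
  have "((\<lambda>A. ln (?B A $1$1)) \<longlongrightarrow> 0) (nhds (p 1))" "((\<lambda>A. ?B A $1$2 / ?B A $1$1) \<longlongrightarrow> 0) (nhds (p 1))"
    "((\<lambda>A. ?B A $2$1 / ?B A $1$1) \<longlongrightarrow> 0) (nhds (p 1))"
    using tendsto_ln[OF ent[of 1 1]] tendsto_divide[OF ent[of 1 2] ent[of 1 1]] tendsto_divide[OF ent[of 2 1] ent[of 1 1]]
    by (simp_all add: mat_1_entries)
  from this[THEN tendstoD, OF e]
  have "\<forall>\<^sub>F A in nhds (p 1). \<bar>ln (?B A $1$1)\<bar> < e" "\<forall>\<^sub>F A in nhds (p 1). \<bar>?B A $1$2 / ?B A $1$1\<bar> < e"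
    "\<forall>\<^sub>F A in nhds (p 1). \<bar>?B A $2$1 / ?B A $1$1\<bar> < e"
    by (simp_all add: dist_real_def)
  moreover have "\<forall>\<^sub>F A in nhds (p 1). 0 < ?B A $1$1"
    using order_tendstoD(1)[OF ent[of 1 1], of 0] by (simp add: mat_1_entries)
  ultimately have "\<forall>\<^sub>F A in nhds (p 1). ?G (?B A)" by eventually_elim blast
  then obtain d where d: "d > 0" "\<And>A. dist A (p 1) < d \<Longrightarrow> ?G (?B A)"
    unfolding eventually_nhds_metric by blast
  define Q where "Q = {q. path q \<and> path_image q \<subseteq> SL2R \<inter> ball (p 1) d \<and> pathstart q = p 1}"
  define U where "U = {abs_sl2_cover (p +++ q) |q. q \<in> Q}"
  have pp: "path p" "path_image p \<subseteq> SL2R" "pathstart p = mat 1" "pathfinish p = p 1"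
    using p(1) by (auto simp: sl2_path_rel_refl_iff pathfinish_def)
  have join: "sl2_path_rel (p +++ q) (p +++ q)" if "q \<in> Q" for q
    using that pp by (auto simp: Q_def sl2_path_rel_refl_iff subset_path_image_join)
  show ?thesis
  proof
    show "open U" unfolding open_sl2_cover_def
    proof (intro allI impI, elim conjE)
      fix r assume r: "sl2_path_rel r r" "abs_sl2_cover r \<in> U"
      then obtain q where q: "q \<in> Q" "abs_sl2_cover r = abs_sl2_cover (p +++ q)" by (auto simp: U_def)
      have rq: "homotopic_paths SL2R r (p +++ q)"
        using abs_sl2_cover_eqD[OF r(1) join[OF q(1)] q(2)] by (simp add: sl2_path_rel_def)
      have rf: "pathfinish r = pathfinish q" using homotopic_paths_imp_pathfinish[OF rq] by simp
      have rs: "pathstart r = mat 1" using r(1) by (simp add: sl2_path_rel_def)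
      have "pathfinish q \<in> ball (p 1) d" using q(1) pathfinish_in_path_image by (fastforce simp: Q_def)
      then obtain \<epsilon> where \<epsilon>: "\<epsilon> > 0" "ball (pathfinish q) \<epsilon> \<subseteq> ball (p 1) d"
        using open_contains_ball[of "ball (p 1) d"] open_ball by blast
      show "\<exists>\<epsilon>>0. \<forall>q'. path q' \<and> path_image q' \<subseteq> SL2R \<inter> ball (pathfinish r) \<epsilon> \<and> pathstart q' = pathfinish r
              \<longrightarrow> abs_sl2_cover (r +++ q') \<in> U"
      proof (intro exI[of _ \<epsilon>] conjI allI impI \<epsilon>, elim conjE)
        fix q' assume q': "path q'" "path_image q' \<subseteq> SL2R \<inter> ball (pathfinish r) \<epsilon>" "pathstart q' = pathfinish r"
        have qq: "q +++ q' \<in> Q"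
        proof -
          have "path_image q' \<subseteq> SL2R \<inter> ball (p 1) d" using q'(2) \<epsilon>(2) rf by auto
          then have "path_image (q +++ q') \<subseteq> SL2R \<inter> ball (p 1) d"
            using q(1) by (intro subset_path_image_join) (auto simp: Q_def)
          then show ?thesis using q(1) q' rf by (auto simp: Q_def)
        qed
        have "homotopic_paths SL2R (r +++ q') ((p +++ q) +++ q')"
          using rq q' by (intro homotopic_paths_join) auto
        moreover have "homotopic_paths SL2R ((p +++ q) +++ q') (p +++ (q +++ q'))"
          using q(1) q' pp rf by (intro homotopic_paths_sym[OF homotopic_paths_assoc]) (auto simp: Q_def)
        ultimately have "homotopic_paths SL2R (r +++ q') (p +++ (q +++ q'))"
          by (rule homotopic_paths_trans)
        then have "sl2_path_rel (r +++ q') (p +++ (q +++ q'))" using rs by (simp add: sl2_path_rel_def)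
        from abs_sl2_cover_eqI[OF this] show "abs_sl2_cover (r +++ q') \<in> U"
          using qq unfolding U_def by blast
      qed
    qed
    have "(\<lambda>s. p 1) \<in> Q"
      using d p1 by (auto simp: Q_def path_def path_image_def pathstart_def)
    moreover have "g = abs_sl2_cover (p +++ (\<lambda>s. p 1))"
    proof -
      have "homotopic_paths SL2R (p +++ linepath (pathfinish p) (pathfinish p)) p"
        by (rule homotopic_paths_rid) (use pp in auto)
      moreover have "linepath (pathfinish p) (pathfinish p) = (\<lambda>s. p 1)"
        by (auto simp: linepath_def pp fun_eq_iff simp flip: scaleR_left_distrib)
      ultimately have "sl2_path_rel (p +++ (\<lambda>s. p 1)) p"
        using pp by (simp add: sl2_path_rel_def)
      then show ?thesis unfolding p(2) by (rule abs_sl2_cover_eqI[symmetric])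
    qed
    ultimately show "g \<in> U" by (auto simp: U_def)
  next
    fix h assume "h \<in> U"
    then obtain q where q: "q \<in> Q" "h = abs_sl2_cover (p +++ q)" by (auto simp: U_def)
    let ?r = "p +++ q"
    note rD = sl2_path_relD[OF join[OF q(1)]]
    \<comment> \<open>The concatenated path spends the time up to $1/2$ on the path for the given element, so stopping it there isolates that part.\<close>
    let ?r1 = "\<lambda>s. ?r (min s (1/2))"
    let ?r2 = "\<lambda>s. adjugate2 (?r1 s) ** ?r s"
    have mem: "min s (1/2) \<in> {0..1}" if "s \<in> {0..1::real}" for s using that by auto
    have c1: "continuous_on {0..1} ?r1"
      by (rule continuous_on_compose2[OF rD(1)]) (use mem in \<open>auto intro!: continuous_intros\<close>)
    have rel1: "sl2_path_rel ?r1 ?r1" by (rule sl2_path_relI) (use c1 rD mem in auto)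
    have rel2: "sl2_path_rel ?r2 ?r2"
      by (rule adjugate2_path_rel) (use c1 rD mem in auto)
    have "h = abs_sl2_cover (\<lambda>s. ?r1 s ** ?r2 s)" unfolding q(2)
      by (rule abs_sl2_cover_eqI[OF sl2_path_rel_pointwise[OF join[OF q(1)]]])
         (simp add: matrix_mul_assoc adjugate2_mult(2)[OF rD(2)[OF mem]])
    also have "\<dots> = abs_sl2_cover ?r1 * abs_sl2_cover ?r2"
      by (rule times_sl2_cover.abs_eq[symmetric]) (rule rel1 rel2)+
    also have "abs_sl2_cover ?r1 = g"
    proof -
      have "homotopic_paths SL2R p ?r1"
        by (rule homotopic_paths_reparametrize[where f = "\<lambda>s. 2 * min s (1/2)"])
           (use pp in \<open>auto intro!: continuous_intros simp: joinpaths_def\<close>)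
      then have "sl2_path_rel p ?r1" using pp by (simp add: sl2_path_rel_def)
      then show ?thesis unfolding p(2) by (rule abs_sl2_cover_eqI[symmetric])
    qed
    finally have h: "h = g * abs_sl2_cover ?r2" .
    have G: "?G (?r2 s)" if s: "s \<in> {0..1}" for s
    proof (cases "s \<le> 1/2")
      case True
      then have "?r2 s = mat 1" using adjugate2_mult(1)[OF rD(2)[OF s]] by (simp add: min_def)
      then show ?thesis using e by (simp add: mat_1_entries)
    next
      case False
      have "?r1 s = p 1" using False by (simp add: min_def joinpaths_def)
      moreover have "?r s = q (2 * s - 1)" using False by (simp add: joinpaths_def)
      moreover have "q (2 * s - 1) \<in> ball (p 1) d"
        using q(1) s False by (auto simp: Q_def path_image_def image_subset_iff)
      ultimately show ?thesis using d(2) by (simp add: dist_commute)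
    qed
    have eq: "h = g * (cover_exp ((?r2 1 $2$1 / ?r2 1 $1$1) *\<^sub>R Fmat) * cover_exp (ln (?r2 1 $1$1) *\<^sub>R Hmat)
      * cover_exp ((?r2 1 $1$2 / ?r2 1 $1$1) *\<^sub>R Emat))"
      unfolding h by (rule arg_cong[OF cover_exp_Emat_Fmat_Hmat[OF rel2]]) (use G in blast)
    have G1: "?G (?r2 1)" by (rule G) simp
    show "\<exists>x y t. \<bar>x\<bar> < e \<and> \<bar>y\<bar> < e \<and> \<bar>t\<bar> < e \<and>
        h = g * (cover_exp (y *\<^sub>R Fmat) * cover_exp (t *\<^sub>R Hmat) * cover_exp (x *\<^sub>R Emat))"
      by (rule exI, rule exI, rule exI, intro conjI) (rule G1[THEN conjunct2, THEN conjunct2, THEN conjunct1]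
        G1[THEN conjunct2, THEN conjunct2, THEN conjunct2] G1[THEN conjunct2, THEN conjunct1] eq)+
  qed
qed

section \<open>Linear isometries of $L^2$ and actions up to null sets\<close>

lemma ae_relI: "f \<in> sq_integrable M \<Longrightarrow> g \<in> sq_integrable M \<Longrightarrow> (AE x in M. f x = g x) \<Longrightarrow> (f, g) \<in> ae_rel M"
  by (simp add: ae_rel_def)

lemma ae_relD:
  assumes "(f, g) \<in> ae_rel M"
  shows "f \<in> sq_integrable M" "g \<in> sq_integrable M" "AE x in M. f x = g x"
  using assms by (simp_all add: ae_rel_def)

lemma ae_refl: "f \<in> sq_integrable M \<Longrightarrow> (f, f) \<in> ae_rel M"
  by (simp add: ae_rel_def)

lemma ae_sym: "(f, g) \<in> ae_rel M \<Longrightarrow> (g, f) \<in> ae_rel M"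
  by (auto simp: ae_rel_def)

lemma ae_trans [trans]: "(f, g) \<in> ae_rel M \<Longrightarrow> (g, h) \<in> ae_rel M \<Longrightarrow> (f, h) \<in> ae_rel M"
  by (auto simp: ae_rel_def)

lemma ae_add: "(f, f') \<in> ae_rel M \<Longrightarrow> (g, g') \<in> ae_rel M \<Longrightarrow> (f + g, f' + g') \<in> ae_rel M"
proof (rule ae_relI)
  assume a: "(f, f') \<in> ae_rel M" "(g, g') \<in> ae_rel M"
  then show "f + g \<in> sq_integrable M" "f' + g' \<in> sq_integrable M" by (auto intro: sq_add dest: ae_relD)
  show "AE x in M. (f + g) x = (f' + g') x"
    using ae_relD(3)[OF a(1)] ae_relD(3)[OF a(2)] by eventually_elim simp
qed

lemma ae_cscale: "(f, f') \<in> ae_rel M \<Longrightarrow> (cscale c f, cscale c f') \<in> ae_rel M"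
proof (rule ae_relI)
  assume "(f, f') \<in> ae_rel M"
  then show "cscale c f \<in> sq_integrable M" "cscale c f' \<in> sq_integrable M" by (auto intro: sq_cscale dest: ae_relD)
  show "AE x in M. cscale c f x = cscale c f' x"
    using ae_relD(3)[OF \<open>(f, f') \<in> ae_rel M\<close>] by eventually_elim (simp add: cscale_def)
qed

lemma ae_diff:
  assumes "(f, f') \<in> ae_rel M" "(g, g') \<in> ae_rel M"
  shows "(f - g, f' - g') \<in> ae_rel M"
proof -
  have "f - g = f + cscale (-1) g" "f' - g' = f' + cscale (-1) g'" by (auto simp: cscale_def)
  then show ?thesis using ae_add[OF assms(1) ae_cscale[OF assms(2), of "-1"]] by simp
qed

lemma ae_ip: "(f, f') \<in> ae_rel M \<Longrightarrow> (g, g') \<in> ae_rel M \<Longrightarrow> ip M f g = ip M f' g'"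
  by (rule ip_cong_AE) (auto dest: ae_relD)

lemma ae_nrm: "(f, g) \<in> ae_rel M \<Longrightarrow> nrm M f = nrm M g"
  by (rule nrm_cong_AE) (auto dest: ae_relD)

lemma ae_iff_nrm: "f \<in> sq_integrable M \<Longrightarrow> g \<in> sq_integrable M \<Longrightarrow> (f, g) \<in> ae_rel M \<longleftrightarrow> nrm M (f - g) = 0"
  by (simp add: ae_rel_def nrm_eq_0_iff sq_diff)

lemma l2_rep_L2:
  assumes "u \<in> L2 M"
  shows "l2_rep u \<in> sq_integrable M" "l2_class M (l2_rep u) = u"
proof -
  obtain f where f: "f \<in> sq_integrable M" "u = l2_class M f"
    using assms by (auto simp: L2_def l2_class_def elim!: quotientE)
  show "l2_rep u \<in> sq_integrable M" "l2_class M (l2_rep u) = u"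
    using l2_rep_class[OF f(1)] f by (auto simp: l2_class_eq_iff)
qed

lemma l2_class_eq: "f \<in> sq_integrable M \<Longrightarrow> g \<in> sq_integrable M \<Longrightarrow> l2_class M f = l2_class M g \<longleftrightarrow> (f, g) \<in> ae_rel M"
  by (simp add: l2_class_eq_iff ae_rel_def)

lemma l2_classI: "(f, g) \<in> ae_rel M \<Longrightarrow> l2_class M f = l2_class M g"
  using ae_relD l2_class_eq by blast

lemma l2_rep_ae: "f \<in> sq_integrable M \<Longrightarrow> (l2_rep (l2_class M f), f) \<in> ae_rel M"
  using l2_rep_class[of f M] by (simp add: ae_rel_def)

lemma l2_add_class:
  assumes "f \<in> sq_integrable M" "g \<in> sq_integrable M"
  shows "l2_add M (l2_class M f) (l2_class M g) = l2_class M (f + g)"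
  using l2_classI[OF ae_add[OF l2_rep_ae[OF assms(1)] l2_rep_ae[OF assms(2)]]] by (simp only: l2_add_def plus_fun_def)

lemma l2_scale_class:
  assumes "f \<in> sq_integrable M"
  shows "l2_scale M c (l2_class M f) = l2_class M (cscale c f)"
  using l2_classI[OF ae_cscale[OF l2_rep_ae[OF assms]]] by (simp only: l2_scale_def cscale_def)

lemma l2_diff_class:
  assumes "f \<in> sq_integrable M" "g \<in> sq_integrable M"
  shows "l2_diff M (l2_class M f) (l2_class M g) = l2_class M (f - g)"
proof -
  have "f - g = f + cscale (-1) g" by (auto simp: cscale_def)
  then show ?thesis by (simp only: l2_diff_def l2_scale_class l2_add_class assms sq_cscale)
qed

lemma l2_inner_class:
  assumes "f \<in> sq_integrable M" "g \<in> sq_integrable M"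
  shows "l2_inner M (l2_class M f) (l2_class M g) = ip M f g"
  using ae_ip[OF l2_rep_ae[OF assms(1)] l2_rep_ae[OF assms(2)]] by (simp add: l2_inner_def ip_def)

lemma l2_norm_class: "f \<in> sq_integrable M \<Longrightarrow> l2_norm M (l2_class M f) = nrm M f"
  by (simp add: l2_norm_def l2_inner_class ip_self)

lemma l2_has_derivative_at_0_class:
  assumes "\<And>t. \<phi> t \<in> sq_integrable M" "d \<in> sq_integrable M"
  shows "l2_has_derivative_at_0 M (\<lambda>t. l2_class M (\<phi> t)) (l2_class M d) \<longleftrightarrow>
    ((\<lambda>t. nrm M (cscale (complex_of_real (1 / t)) (\<phi> t - \<phi> 0) - d)) \<longlongrightarrow> 0) (at 0)"
  unfolding l2_has_derivative_at_0_def
  by (simp only: l2_class_in_L2 l2_diff_class l2_scale_class l2_norm_class assms sq_diff sq_cscale simp_thms)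

definition L2_linear_isometry :: "'a measure \<Rightarrow> (('a \<Rightarrow> complex) \<Rightarrow> 'a \<Rightarrow> complex) \<Rightarrow> bool" where
  "L2_linear_isometry M S \<longleftrightarrow>
     (\<forall>f\<in>sq_integrable M. S f \<in> sq_integrable M \<and> nrm M (S f) = nrm M f) \<and>
     (\<forall>f\<in>sq_integrable M. \<forall>h\<in>sq_integrable M. (S (f + h), S f + S h) \<in> ae_rel M) \<and>
     (\<forall>c. \<forall>f\<in>sq_integrable M. (S (cscale c f), cscale c (S f)) \<in> ae_rel M)"

lemma L2_linear_isometryD:
  assumes "L2_linear_isometry M S" "f \<in> sq_integrable M"
  shows "S f \<in> sq_integrable M" "nrm M (S f) = nrm M f"
    "h \<in> sq_integrable M \<Longrightarrow> (S (f + h), S f + S h) \<in> ae_rel M"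
    "(S (cscale c f), cscale c (S f)) \<in> ae_rel M"
  using assms unfolding L2_linear_isometry_def by blast+

context
  fixes M :: "'a measure" and S
  assumes S: "L2_linear_isometry M S"
begin

lemma isometry_diff:
  assumes f: "f \<in> sq_integrable M" and h: "h \<in> sq_integrable M"
  shows "(S (f - h), S f - S h) \<in> ae_rel M"
proof -
  note D = L2_linear_isometryD[OF S]
  have e: "f - h = f + cscale (-1) h" "S f - S h = S f + cscale (-1) (S h)" by (auto simp: cscale_def)
  have "(S (f + cscale (-1) h), S f + S (cscale (-1) h)) \<in> ae_rel M" by (rule D(3)[OF f sq_cscale[OF h]])
  also have "(S f + S (cscale (-1) h), S f + cscale (-1) (S h)) \<in> ae_rel M"
    by (intro ae_add ae_refl D f h)
  finally show ?thesis unfolding e .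
qed

lemma isometry_nrm_diff:
  assumes "f \<in> sq_integrable M" "h \<in> sq_integrable M"
  shows "nrm M (S f - S h) = nrm M (f - h)"
  using ae_nrm[OF isometry_diff[OF assms]] L2_linear_isometryD(2)[OF S sq_diff[OF assms]] by simp

lemma isometry_cong: "(f, h) \<in> ae_rel M \<Longrightarrow> (S f, S h) \<in> ae_rel M"
  using isometry_nrm_diff[of f h] ae_iff_nrm L2_linear_isometryD(1)[OF S] ae_relD by metis

text \<open>Polarisation.\<close>

lemma isometry_ip:
  assumes f: "f \<in> sq_integrable M" and h: "h \<in> sq_integrable M"
  shows "ip M (S f) (S h) = ip M f h"
proof -
  note D = L2_linear_isometryD[OF S]
  have re: "Re (ip M (S u) (S h)) = Re (ip M u h)" if u: "u \<in> sq_integrable M" for u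
    using isometry_nrm_diff[OF u h] nrm_diff_power2[OF u h] nrm_diff_power2[OF D(1)[OF u] D(1)[OF h]] D(2)[OF u] D(2)[OF h]
    by simp
  have "ip M (S (cscale \<i> f)) (S h) = \<i> * ip M (S f) (S h)"
    using ae_ip[OF D(4)[OF f, of \<i>] ae_refl[OF D(1)[OF h]]] by (simp add: ip_cscale_left)
  then have "Im (ip M (S f) (S h)) = Im (ip M f h)"
    using re[OF sq_cscale[OF f, of \<i>]] by (simp add: ip_cscale_left)
  then show ?thesis using re[OF f] by (simp add: complex_eq_iff)
qed

end

text \<open>The group law holds up to null sets, as the images of functions are chosen representatives of classes.\<close>

definition L2_action :: "'a measure \<Rightarrow> ('g::monoid_mult \<Rightarrow> ('a \<Rightarrow> complex) \<Rightarrow> 'a \<Rightarrow> complex) \<Rightarrow> bool" where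
  "L2_action M T \<longleftrightarrow> (\<forall>g. L2_linear_isometry M (T g)) \<and>
     (\<forall>f\<in>sq_integrable M. (T 1 f, f) \<in> ae_rel M) \<and>
     (\<forall>g h. \<forall>f\<in>sq_integrable M. (T (g * h) f, T g (T h f)) \<in> ae_rel M)"

lemma L2_actionD:
  assumes "L2_action M T"
  shows "L2_linear_isometry M (T g)"
    "f \<in> sq_integrable M \<Longrightarrow> (T 1 f, f) \<in> ae_rel M"
    "f \<in> sq_integrable M \<Longrightarrow> (T (g * h) f, T g (T h f)) \<in> ae_rel M"
  using assms by (auto simp: L2_action_def)

text \<open>The operators are unitary up to null sets, with the operators of inverse elements as adjoints.\<close>

lemma action_adjoint:
  assumes T: "L2_action M T" and gh: "h * g = 1" and f: "f \<in> sq_integrable M" and u: "u \<in> sq_integrable M"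
  shows "ip M (T g f) u = ip M f (T h u)"
proof -
  note sq = L2_linear_isometryD(1)[OF L2_actionD(1)[OF T]]
  have "(T h (T g f), T (h * g) f) \<in> ae_rel M" by (rule ae_sym[OF L2_actionD(3)[OF T f]])
  also have "(T (h * g) f, f) \<in> ae_rel M" unfolding gh by (rule L2_actionD(2)[OF T f])
  finally have "ip M (T h (T g f)) (T h u) = ip M f (T h u)"
    by (rule ae_ip[OF _ ae_refl[OF sq[OF u]]])
  then show ?thesis using isometry_ip[OF L2_actionD(1)[OF T] sq[OF f] u] by simp
qed

definition l2_lift :: "'a measure \<Rightarrow> ('g \<Rightarrow> ('a \<Rightarrow> complex) \<Rightarrow> 'a \<Rightarrow> complex) \<Rightarrow>
    'g \<Rightarrow> ('a \<Rightarrow> complex) set \<Rightarrow> ('a \<Rightarrow> complex) set" where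
  "l2_lift M T g = restrict (\<lambda>u. l2_class M (T g (l2_rep u))) (L2 M)"

lemma l2_lift_class:
  assumes "L2_linear_isometry M (T g)" "f \<in> sq_integrable M"
  shows "l2_lift M T g (l2_class M f) = l2_class M (T g f)"
  using l2_classI[OF isometry_cong[OF assms(1) l2_rep_ae[OF assms(2)]]] l2_class_in_L2[OF assms(2)]
  by (simp add: l2_lift_def)

lemma L2_cases:
  assumes "u \<in> L2 M"
  obtains f where "f \<in> sq_integrable M" "u = l2_class M f"
  using l2_rep_L2[OF assms] by metis

text \<open>Actions on functions up to null sets and representations on classes are passed to each other by this lemma and the next one.\<close>

lemma unitary_rep_l2_lift:
  fixes T :: "'g::{monoid_mult, topological_space} \<Rightarrow> ('a \<Rightarrow> complex) \<Rightarrow> 'a \<Rightarrow> complex"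
  assumes T: "L2_action M T" and inv: "\<And>g::'g. \<exists>h. h * g = 1 \<and> g * h = 1"
    and cont: "\<And>f g. f \<in> sq_integrable M \<Longrightarrow> ((\<lambda>h. nrm M (T h f - T g f)) \<longlongrightarrow> 0) (at g)"
  shows "unitary_rep M (l2_lift M T)"
proof -
  note I = L2_actionD(1)[OF T]
  note sq = L2_linear_isometryD(1)[OF I]
  note lift = l2_lift_class[OF I]
  have cl: "l2_lift M T g u \<in> L2 M" if "u \<in> L2 M" for g u
    using that by (elim L2_cases) (simp add: lift l2_class_in_L2 sq)
  have one: "l2_lift M T 1 u = u" if "u \<in> L2 M" for u
    using that by (elim L2_cases) (simp add: lift l2_classI L2_actionD(2)[OF T])
  have mult: "l2_lift M T (g * h) u = l2_lift M T g (l2_lift M T h u)" if "u \<in> L2 M" for g h u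
    using that by (elim L2_cases) (simp add: lift sq l2_classI[OF L2_actionD(3)[OF T]])
  have bij: "bij_betw (l2_lift M T g) (L2 M) (L2 M)" for g
  proof -
    obtain h where "h * g = 1" "g * h = 1" using inv by blast
    then show ?thesis
      by (intro bij_betw_byWitness[where f' = "l2_lift M T h"]) (auto simp: cl mult[symmetric] one)
  qed
  have add: "l2_lift M T g (l2_add M u v) = l2_add M (l2_lift M T g u) (l2_lift M T g v)"
    if uv: "u \<in> L2 M" "v \<in> L2 M" for g u v
  proof -
    obtain f where f: "f \<in> sq_integrable M" "u = l2_class M f" by (rule L2_cases[OF uv(1)])
    obtain h where h: "h \<in> sq_integrable M" "v = l2_class M h" by (rule L2_cases[OF uv(2)])
    have "l2_class M (T g (f + h)) = l2_class M (T g f + T g h)"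
      by (rule l2_classI[OF L2_linear_isometryD(3)[OF I f(1) h(1)]])
    then show ?thesis unfolding f(2) h(2) l2_add_class[OF f(1) h(1)] lift[OF f(1)] lift[OF h(1)] lift[OF sq_add[OF f(1) h(1)]]
      l2_add_class[OF sq[OF f(1)] sq[OF h(1)]] .
  qed
  have scale: "l2_lift M T g (l2_scale M c u) = l2_scale M c (l2_lift M T g u)" if uv: "u \<in> L2 M" for g c u
  proof -
    obtain f where f: "f \<in> sq_integrable M" "u = l2_class M f" by (rule L2_cases[OF uv])
    have "l2_class M (T g (cscale c f)) = l2_class M (cscale c (T g f))"
      by (rule l2_classI[OF L2_linear_isometryD(4)[OF I f(1)]])
    then show ?thesis unfolding f(2) l2_scale_class[OF f(1)] lift[OF f(1)] lift[OF sq_cscale[OF f(1)]]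
      l2_scale_class[OF sq[OF f(1)]] .
  qed
  have inner: "l2_inner M (l2_lift M T g u) (l2_lift M T g v) = l2_inner M u v"
    if uv: "u \<in> L2 M" "v \<in> L2 M" for g u v
  proof -
    obtain f where f: "f \<in> sq_integrable M" "u = l2_class M f" by (rule L2_cases[OF uv(1)])
    obtain h where h: "h \<in> sq_integrable M" "v = l2_class M h" by (rule L2_cases[OF uv(2)])
    show ?thesis unfolding f(2) h(2) lift[OF f(1)] lift[OF h(1)] l2_inner_class[OF f(1) h(1)]
      l2_inner_class[OF sq[OF f(1)] sq[OF h(1)]] by (rule isometry_ip[OF I f(1) h(1)])
  qed
  have c: "((\<lambda>h. l2_norm M (l2_diff M (l2_lift M T h u) (l2_lift M T g u))) \<longlongrightarrow> 0) (at g)"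
    if uv: "u \<in> L2 M" for g u
  proof -
    obtain f where f: "f \<in> sq_integrable M" "u = l2_class M f" by (rule L2_cases[OF uv])
    show ?thesis unfolding f(2) lift[OF f(1)] l2_diff_class[OF sq[OF f(1)] sq[OF f(1)]]
      l2_norm_class[OF sq_diff[OF sq[OF f(1)] sq[OF f(1)]]] by (rule cont[OF f(1)])
  qed
  show ?thesis unfolding unitary_rep_def unitary_op_def
    by (intro conjI allI ballI one mult bij add scale inner c) (simp add: l2_lift_def)
qed

lemma unitary_rep_L2_action:
  fixes \<Omega> :: "'g::{monoid_mult, topological_space} \<Rightarrow> ('a \<Rightarrow> complex) set \<Rightarrow> ('a \<Rightarrow> complex) set"
  assumes \<Omega>: "unitary_rep M \<Omega>"
  defines "T \<equiv> \<lambda>g f. l2_rep (\<Omega> g (l2_class M f))"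
  shows "L2_action M T"
    and "f \<in> sq_integrable M \<Longrightarrow> \<Omega> g (l2_class M f) = l2_class M (T g f)"
proof -
  have U: "unitary_op M (\<Omega> g)" for g using \<Omega> by (simp add: unitary_rep_def)
  have mem: "\<Omega> g (l2_class M f) \<in> L2 M" if "f \<in> sq_integrable M" for g f
    using U[of g] l2_class_in_L2[OF that] by (auto simp: unitary_op_def bij_betw_def)
  have sq: "T g f \<in> sq_integrable M" if "f \<in> sq_integrable M" for g f
    using l2_rep_L2(1)[OF mem[OF that]] by (simp add: T_def)
  have cl: "\<Omega> g (l2_class M f) = l2_class M (T g f)" if "f \<in> sq_integrable M" for g f
    using l2_rep_L2(2)[OF mem[OF that]] by (simp add: T_def)
  show "f \<in> sq_integrable M \<Longrightarrow> \<Omega> g (l2_class M f) = l2_class M (T g f)" by (rule cl)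
  have add: "(T g (f + h), T g f + T g h) \<in> ae_rel M" if "f \<in> sq_integrable M" "h \<in> sq_integrable M" for g f h
  proof -
    have "\<Omega> g (l2_add M (l2_class M f) (l2_class M h)) = l2_add M (\<Omega> g (l2_class M f)) (\<Omega> g (l2_class M h))"
      using U[of g] that l2_class_in_L2 unfolding unitary_op_def by blast
    then have "l2_class M (T g (f + h)) = l2_class M (T g f + T g h)"
      using that by (simp only: cl l2_add_class sq sq_add)
    then show ?thesis using that by (simp only: l2_class_eq sq sq_add)
  qed
  have scale: "(T g (cscale c f), cscale c (T g f)) \<in> ae_rel M" if "f \<in> sq_integrable M" for g f c
  proof -
    have "\<Omega> g (l2_scale M c (l2_class M f)) = l2_scale M c (\<Omega> g (l2_class M f))"
      using U[of g] that l2_class_in_L2 unfolding unitary_op_def by blast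
    then have "l2_class M (T g (cscale c f)) = l2_class M (cscale c (T g f))"
      using that by (simp only: cl l2_scale_class sq sq_cscale)
    then show ?thesis using that by (simp only: l2_class_eq sq sq_cscale)
  qed
  have nrm: "nrm M (T g f) = nrm M f" if "f \<in> sq_integrable M" for g f
  proof -
    have "l2_inner M (\<Omega> g (l2_class M f)) (\<Omega> g (l2_class M f)) = l2_inner M (l2_class M f) (l2_class M f)"
      using U[of g] that l2_class_in_L2 unfolding unitary_op_def by blast
    then have "l2_norm M (l2_class M (T g f)) = l2_norm M (l2_class M f)" using that by (simp add: l2_norm_def cl)
    then show ?thesis using that by (simp only: l2_norm_class sq)
  qed
  have one: "(T 1 f, f) \<in> ae_rel M" if f: "f \<in> sq_integrable M" for f
  proof -
    have "\<Omega> 1 (l2_class M f) = l2_class M f" using \<Omega> l2_class_in_L2[OF f] by (simp add: unitary_rep_def)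
    then show ?thesis using f by (simp only: cl l2_class_eq sq)
  qed
  have mult: "(T (g * h) f, T g (T h f)) \<in> ae_rel M" if f: "f \<in> sq_integrable M" for g h f
  proof -
    have "\<Omega> (g * h) (l2_class M f) = \<Omega> g (\<Omega> h (l2_class M f))" using \<Omega> l2_class_in_L2[OF f] by (simp add: unitary_rep_def)
    then show ?thesis using f by (simp only: cl l2_class_eq sq)
  qed
  show "L2_action M T"
    unfolding L2_action_def L2_linear_isometry_def
    by (intro conjI allI ballI sq nrm add scale one mult)
qed

text \<open>Choosing \<^term>\<open>u\<close> close to \<^term>\<open>D\<close>, the inner product is close to the square of the norm of \<^term>\<open>D\<close>. The second
  alternative covers negative \<^term>\<open>c\<close>.\<close>

lemma nrm_le_of_weak_bound:
  assumes S: "cfun.subspace S" "S \<subseteq> sq_integrable M" and D: "D \<in> sq_integrable M"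
    and total: "\<And>f. f \<in> sq_integrable M \<Longrightarrow> (\<And>v. v \<in> S \<Longrightarrow> ip M f v = 0) \<Longrightarrow> AE x in M. f x = 0"
    and bound: "\<And>u. u \<in> S \<Longrightarrow> cmod (ip M D u) \<le> c * nrm M u"
  shows "nrm M D \<le> c \<or> nrm M D = 0"
proof (rule ccontr)
  assume *: "\<not> ?thesis"
  then have pos: "nrm M D > 0" "nrm M D - c > 0" using nrm_nonneg[of M D] by linarith+
  define e where "e = nrm M D * (nrm M D - c) / (nrm M D + \<bar>c\<bar>)"
  have "e > 0" unfolding e_def using pos by (intro divide_pos_pos mult_pos_pos) auto
  obtain u where u: "u \<in> S" "nrm M (u - D) < e" using L2_dense[OF S D total \<open>e > 0\<close>] by blast
  have usq: "u \<in> sq_integrable M" using u S by auto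
  have "ip M D D = ip M D u - ip M D (u - D)" using ip_diff_right[OF usq D D] by simp
  then have "(nrm M D)\<^sup>2 \<le> cmod (ip M D u) + cmod (ip M D (u - D))"
    using norm_triangle_ineq4[of "ip M D u" "ip M D (u - D)"] unfolding ip_self
    by (metis abs_power2 norm_of_real)
  also have "\<dots> \<le> c * nrm M u + nrm M D * nrm M (u - D)"
    by (intro add_mono bound u ip_Cauchy_Schwarz D sq_diff usq)
  also have "c * nrm M u \<le> c * nrm M D + \<bar>c\<bar> * nrm M (u - D)"
  proof -
    have "c * (nrm M u - nrm M D) \<le> \<bar>c\<bar> * \<bar>nrm M u - nrm M D\<bar>" using abs_ge_self[of "c * (nrm M u - nrm M D)"] by (simp add: abs_mult)
    also have "\<dots> \<le> \<bar>c\<bar> * nrm M (u - D)" by (intro mult_left_mono nrm_diff_abs usq D) simp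
    finally show ?thesis by (simp add: algebra_simps)
  qed
  finally have "nrm M D * (nrm M D - c) \<le> (nrm M D + \<bar>c\<bar>) * nrm M (u - D)"
    by (simp only: algebra_simps power2_eq_square)
  also have "\<dots> < (nrm M D + \<bar>c\<bar>) * e" using u(2) pos by (intro mult_strict_left_mono) auto
  also have "\<dots> = nrm M D * (nrm M D - c)" unfolding e_def using pos by (simp add: field_simps)
  finally show False by simp
qed

section \<open>Construction of the representation\<close>

text \<open>The image of \<^term>\<open>psi \<tau> p\<close> under the group element \<^term>\<open>g\<close>, with $(c \tau + d)^{-\kappa}$ defined by the continued logarithm.\<close>

definition gact :: "real \<Rightarrow> sl2_cover \<Rightarrow> complex \<Rightarrow> nat \<Rightarrow> (real^'n \<Rightarrow> complex) \<Rightarrow> real^'n \<Rightarrow> complex" where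
  "gact b g \<tau> m p = cscale (exp (- of_real (kap TYPE('n) b m) * autlog g \<tau>)) (psi (mob (cover_end g) \<tau>) p)"

text \<open>The unitary operator with \<^term>\<open>psi \<tau> p\<close> going to \<^term>\<open>gact b g \<tau> m p\<close>, described by what a unitary operator does to inner products. The description determines
  the value up to null sets, because the vectors \<^const>\<open>gact\<close> are total.\<close>

definition gop :: "real \<Rightarrow> sl2_cover \<Rightarrow> (real^'n \<Rightarrow> complex) \<Rightarrow> real^'n \<Rightarrow> complex" where
  "gop b g f = (SOME h. h \<in> sq_integrable (weighted_measure b) \<and> nrm (weighted_measure b) h = nrm (weighted_measure b) f \<and>
     (\<forall>\<tau> m p. Im \<tau> > 0 \<longrightarrow> p \<in> harmonic_poly m \<longrightarrow>
        ip (weighted_measure b) h (gact b g \<tau> m p) = ip (weighted_measure b) f (psi \<tau> p)))"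

definition psi_span :: "(real^'n \<Rightarrow> complex) set" where
  "psi_span = cfun.span {psi \<tau> p |\<tau> p m. Im \<tau> > 0 \<and> p \<in> harmonic_poly m}"

lemma gact_1: "gact b 1 \<tau> m p = psi \<tau> p"
  by (simp add: gact_def cscale_def)

lemma gact_mult:
  fixes p :: "real^'n \<Rightarrow> complex"
  assumes "Im \<tau> > 0"
  shows "gact b (g * h) \<tau> m p =
    cscale (exp (- of_real (kap TYPE('n) b m) * autlog h \<tau>)) (gact b g (mob (cover_end h) \<tau>) m p)"
proof -
  have "exp (- K * (x + y)) = exp (- K * y) * exp (- K * x)" for K x y :: complex
    by (simp add: exp_add[symmetric] algebra_simps)
  then show ?thesis
    unfolding gact_def autlog_mult[OF assms] cover_end_mult mob_mult[OF cover_end_SL2R cover_end_SL2R assms]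
    by (simp only: cfun.scale_scale)
qed

lemma mob_cover_end: "Im \<tau> > 0 \<Longrightarrow> Im (mob (cover_end g) \<tau>) > 0"
  by (rule Im_mob[OF cover_end_SL2R])

context
  fixes b :: real and M :: "(real^'n) measure"
  assumes b: "b > - real CARD('n) / 2"
  defines "M \<equiv> weighted_measure b"
begin

lemma psi_L2: "Im \<tau> > 0 \<Longrightarrow> p \<in> harmonic_poly m \<Longrightarrow> psi \<tau> p \<in> sq_integrable M"
  using psi_sq[OF b] harmonicD(1) unfolding M_def by blast

lemma gact_L2: "Im \<tau> > 0 \<Longrightarrow> p \<in> harmonic_poly m \<Longrightarrow> gact b g \<tau> m p \<in> sq_integrable M"
  unfolding gact_def by (intro sq_cscale psi_L2 mob_cover_end)

text \<open>The exponents combine to the one for \<^term>\<open>g = 1\<close> by \<open>Ln_mob_diff\<close>.\<close>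

lemma gact_gram:
  assumes \<tau>: "Im \<tau> > 0" and \<sigma>: "Im \<sigma> > 0" and p: "p \<in> harmonic_poly m" and q: "q \<in> harmonic_poly n"
  shows "ip M (gact b g \<tau> m p) (gact b g \<sigma> n q) = ip M (psi \<tau> p) (psi \<sigma> q)"
proof (cases "m = n")
  case False
  then show ?thesis
    using psi_orthogonal[OF b \<tau> \<sigma> p q False] psi_orthogonal[OF b mob_cover_end[OF \<tau>] mob_cover_end[OF \<sigma>] p q False]
    by (simp add: gact_def ip_cscale_left ip_cscale_right M_def)
next
  case True
  define K where "K = complex_of_real (kap TYPE('n) b m)"
  have q': "q \<in> harmonic_poly m" using q True by simp
  have K: "cnj K = K" by (simp add: K_def)
  have e: "cnj (exp (- K * y)) * (exp (- K * x) * (exp (- K * L) * C)) = exp (- K * (L + x + cnj y)) * C" for x y L C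
  proof -
    have "- K * (L + x + cnj y) = cnj (- K * y) + (- K * x + - K * L)" by (simp add: K algebra_simps)
    then show ?thesis by (simp only: exp_add exp_cnj mult.assoc)
  qed
  show ?thesis
    unfolding gact_def True[symmetric] ip_cscale_left ip_cscale_right M_def
      psi_gram[OF b mob_cover_end[OF \<tau>] mob_cover_end[OF \<sigma>] p q'] psi_gram[OF b \<tau> \<sigma> p q']
      K_def[symmetric] e Ln_mob_diff[OF \<tau> \<sigma>] ..
qed

lemma psi_total_M:
  assumes "f \<in> sq_integrable M" "\<And>\<tau> m p. Im \<tau> > 0 \<Longrightarrow> p \<in> harmonic_poly m \<Longrightarrow> ip M f (psi \<tau> p) = 0"
  shows "AE x in M. f x = 0"
  using assms psi_total[OF b] unfolding M_def by blast

text \<open>Since \<^term>\<open>gact b (g * h)\<close> at a point is a multiple of \<^term>\<open>gact b g\<close> at the point moved by \<^term>\<open>h\<close>, the choice of an inverse \<^term>\<open>h\<close>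
  exhibits every Gaussian.\<close>

lemma gact_total:
  assumes f: "f \<in> sq_integrable M" and 0: "\<And>\<tau> m p. Im \<tau> > 0 \<Longrightarrow> p \<in> harmonic_poly m \<Longrightarrow> ip M f (gact b g \<tau> m p) = 0"
  shows "AE x in M. f x = 0"
proof (rule psi_total_M[OF f])
  fix \<tau> m and p :: "real^'n \<Rightarrow> complex" assume \<tau>: "Im \<tau> > 0" and p: "p \<in> harmonic_poly m"
  obtain h where h: "g * h = 1" using sl2_cover_inverse by blast
  have "ip M f (gact b (g * h) \<tau> m p) = 0"
    unfolding gact_mult[OF \<tau>] ip_cscale_right using 0[OF mob_cover_end[OF \<tau>] p] by simp
  then show "ip M f (psi \<tau> p) = 0" unfolding h gact_1 .
qed

lemma gop_spec:
  assumes f: "f \<in> sq_integrable M"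
  shows "gop b g f \<in> sq_integrable M" "nrm M (gop b g f) = nrm M f"
    "Im \<tau> > 0 \<Longrightarrow> p \<in> harmonic_poly m \<Longrightarrow> ip M (gop b g f) (gact b g \<tau> m p) = ip M f (psi \<tau> p)"
proof -
  define I where "I = {(\<tau>, m, p :: real^'n \<Rightarrow> complex). Im \<tau> > 0 \<and> p \<in> harmonic_poly m}"
  let ?u = "\<lambda>(\<tau>, m, p). psi \<tau> p" and ?v = "\<lambda>(\<tau>, m, p). gact b g \<tau> m p"
  obtain h where h: "h \<in> sq_integrable M" "nrm M h = nrm M f" "\<And>i. i \<in> I \<Longrightarrow> ip M h (?v i) = ip M f (?u i)"
  proof (rule L2_isometry_extension[of I ?u M ?v f])
    show "?u i \<in> sq_integrable M" "?v i \<in> sq_integrable M" if "i \<in> I" for i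
      using that by (auto simp: I_def psi_L2 gact_L2)
    show "ip M (?v i) (?v j) = ip M (?u i) (?u j)" if "i \<in> I" "j \<in> I" for i j
      using that by (auto simp: I_def gact_gram)
    show "AE x in M. f x = 0" if "f \<in> sq_integrable M" "\<And>i. i \<in> I \<Longrightarrow> ip M f (?u i) = 0" for f
    proof (rule psi_total_M[OF that(1)])
      fix \<tau> m and p :: "real^'n \<Rightarrow> complex" assume "Im \<tau> > 0" "p \<in> harmonic_poly m"
      then show "ip M f (psi \<tau> p) = 0" using that(2)[of "(\<tau>, m, p)"] by (simp add: I_def)
    qed
  qed (use f in auto)
  have h3: "ip M h (gact b g \<tau> m p) = ip M f (psi \<tau> p)" if "Im \<tau> > 0" "p \<in> harmonic_poly m" for \<tau> m p
    using h(3)[of "(\<tau>, m, p)"] that by (simp add: I_def)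
  have "gop b g f \<in> sq_integrable M \<and> nrm M (gop b g f) = nrm M f \<and>
     (\<forall>\<tau> m p. Im \<tau> > 0 \<longrightarrow> p \<in> harmonic_poly m \<longrightarrow> ip M (gop b g f) (gact b g \<tau> m p) = ip M f (psi \<tau> p))"
    unfolding gop_def M_def[symmetric]
    by (rule someI[where P = "\<lambda>h. h \<in> sq_integrable M \<and> nrm M h = nrm M f \<and>
     (\<forall>\<tau> m p. Im \<tau> > 0 \<longrightarrow> p \<in> harmonic_poly m \<longrightarrow> ip M h (gact b g \<tau> m p) = ip M f (psi \<tau> p))" and x = h])
       (intro conjI allI impI h(1,2) h3)
  then show "gop b g f \<in> sq_integrable M" "nrm M (gop b g f) = nrm M f"
    "Im \<tau> > 0 \<Longrightarrow> p \<in> harmonic_poly m \<Longrightarrow> ip M (gop b g f) (gact b g \<tau> m p) = ip M f (psi \<tau> p)"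
    by blast+
qed

lemma gop_unique:
  assumes f: "f \<in> sq_integrable M" and h: "h \<in> sq_integrable M"
    and eq: "\<And>\<tau> m p. Im \<tau> > 0 \<Longrightarrow> p \<in> harmonic_poly m \<Longrightarrow> ip M h (gact b g \<tau> m p) = ip M f (psi \<tau> p)"
  shows "(gop b g f, h) \<in> ae_rel M"
proof -
  have "AE x in M. (gop b g f - h) x = 0"
  proof (rule gact_total[where g = g, OF sq_diff[OF gop_spec(1)[OF f] h]])
    fix \<tau> m and p :: "real^'n \<Rightarrow> complex" assume "Im \<tau> > 0" "p \<in> harmonic_poly m"
    then show "ip M (gop b g f - h) (gact b g \<tau> m p) = 0"
      by (subst ip_diff_left[OF gop_spec(1)[OF f] h gact_L2]) (auto simp: gop_spec(3)[OF f] eq)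
  qed
  then show ?thesis using gop_spec(1)[OF f] h by (auto intro!: ae_relI)
qed

lemma gop_psi:
  assumes \<tau>: "Im \<tau> > 0" and p: "p \<in> harmonic_poly m"
  shows "(gop b g (psi \<tau> p), gact b g \<tau> m p) \<in> ae_rel M"
  by (rule gop_unique[OF psi_L2[OF \<tau> p] gact_L2[OF \<tau> p]]) (rule gact_gram[OF \<tau> _ p])

lemma gop_isometry: "L2_linear_isometry M (gop b g)"
  unfolding L2_linear_isometry_def
proof (intro conjI ballI allI)
  fix f h and c assume f: "f \<in> sq_integrable M"
  note G = gop_spec[OF f, where g = g]
  show "gop b g f \<in> sq_integrable M" "nrm M (gop b g f) = nrm M f" by (rule G)+
  show "(gop b g (cscale c f), cscale c (gop b g f)) \<in> ae_rel M"
    by (rule gop_unique[OF sq_cscale[OF f] sq_cscale[OF G(1)]]) (simp only: ip_cscale_left G(3))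
  assume h: "h \<in> sq_integrable M"
  note H = gop_spec[OF h, where g = g]
  show "(gop b g (f + h), gop b g f + gop b g h) \<in> ae_rel M"
    by (rule gop_unique[OF sq_add[OF f h] sq_add[OF G(1) H(1)]])
       (simp only: ip_add_left[OF G(1) H(1) gact_L2] ip_add_left[OF f h psi_L2] G(3) H(3))
qed

lemma gop_action: "L2_action M (gop b)"
  unfolding L2_action_def
proof (intro conjI ballI allI)
  fix f g h assume f: "f \<in> sq_integrable M"
  show "(gop b 1 f, f) \<in> ae_rel M"
    by (rule gop_unique[OF f f]) (simp only: gact_1)
  show "(gop b (g * h) f, gop b g (gop b h f)) \<in> ae_rel M"
  proof (rule gop_unique[OF f])
    fix \<tau> m and p :: "real^'n \<Rightarrow> complex" assume \<tau>: "Im \<tau> > 0" and p: "p \<in> harmonic_poly m"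
    have "ip M (gop b g (gop b h f)) (gact b (g * h) \<tau> m p) = ip M (gop b h f) (gact b h \<tau> m p)"
      unfolding gact_mult[OF \<tau>] ip_cscale_right gop_spec(3)[OF gop_spec(1)[OF f] mob_cover_end[OF \<tau>] p]
      by (simp only: gact_def ip_cscale_right)
    also have "\<dots> = ip M f (psi \<tau> p)" by (rule gop_spec(3)[OF f \<tau> p])
    finally show "ip M (gop b g (gop b h f)) (gact b (g * h) \<tau> m p) = ip M f (psi \<tau> p)" .
  qed (intro gop_spec(1) f)
qed (rule gop_isometry)

lemmas gop_L2 = gop_spec(1)

lemma gop_adjoint:
  assumes "h * g = 1" "f \<in> sq_integrable M" "u \<in> sq_integrable M"
  shows "ip M (gop b g f) u = ip M f (gop b h u)"
  using assms by (rule action_adjoint[OF gop_action])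

section \<open>Strong continuity\<close>

text \<open>For vectors of equal norm, $|u - v|^2 = 2 |v|^2 - 2 Re \langle u, v \rangle$, and the inner product is an explicit continuous function of \<^term>\<open>t\<close>.\<close>

lemma gop_psi_continuous:
  assumes X: "X \<in> sl2" and \<tau>: "Im \<tau> > 0" and p: "p \<in> harmonic_poly m"
  shows "((\<lambda>t. nrm M (gop b (cover_exp (t *\<^sub>R X)) (psi \<tau> p) - psi \<tau> p)) \<longlongrightarrow> 0) (at 0)"
proof -
  let ?g = "\<lambda>t. cover_exp (t *\<^sub>R X)" and ?P = "psi \<tau> p"
  define K where "K = complex_of_real (kap TYPE('n) b m)"
  define C where "C = exp (K * of_real (ln 2)) * gtrans M (\<lambda>x. p x * cnj (p x)) 0 1"
  let ?F = "\<lambda>t. exp (- K * autlog (?g t) \<tau>) * (exp (- K * Ln (- \<i> * (mob (mat_exp (t *\<^sub>R X)) \<tau> - cnj \<tau>))) * C)"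
  have ce: "cover_end (?g t) = mat_exp (t *\<^sub>R X)" for t by (rule cover_end_exp[OF sl2_scaleR[OF X]])
  have F: "ip M (gop b (?g t) ?P) ?P = ?F t" for t
  proof -
    have "ip M (gop b (?g t) ?P) ?P = ip M (gact b (?g t) \<tau> m p) ?P"
      by (rule ae_ip[OF gop_psi[OF \<tau> p] ae_refl[OF psi_L2[OF \<tau> p]]])
    also have "\<dots> = ?F t" unfolding gact_def ip_cscale_left M_def psi_gram[OF b mob_cover_end[OF \<tau>] \<tau> p p]
      by (simp only: K_def C_def M_def ce)
    finally show ?thesis .
  qed
  have c1: "isCont (\<lambda>t. autlog (?g t) \<tau>) 0" "isCont (\<lambda>t. mob (mat_exp (t *\<^sub>R X)) \<tau>) 0"
    using autlog_exp_deriv[OF X \<tau>] mob_mat_exp_deriv[OF X \<tau>] has_vector_derivative_continuous by blast+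
  have "- \<i> * (mob (mat_exp (0 *\<^sub>R X)) \<tau> - cnj \<tau>) \<notin> \<real>\<^sub>\<le>\<^sub>0"
    using Re_half_plane_diff[OF \<tau> \<tau>] by (auto simp: complex_nonpos_Reals_iff)
  then have "isCont ?F 0" by (intro continuous_intros c1)
  then have "(?F \<longlongrightarrow> ?F 0) (at 0)" by (simp only: isCont_def)
  then have l: "((\<lambda>t. ip M (gop b (?g t) ?P) ?P) \<longlongrightarrow> ip M (gop b (?g 0) ?P) ?P) (at 0)" by (simp only: F)
  have "ip M (gop b (?g 0) ?P) ?P = ip M ?P ?P"
    by (rule ae_ip[OF _ ae_refl]) (use L2_actionD(2)[OF gop_action psi_L2[OF \<tau> p]] psi_L2[OF \<tau> p] in simp_all)
  then have l: "((\<lambda>t. ip M (gop b (?g t) ?P) ?P) \<longlongrightarrow> of_real ((nrm M ?P)\<^sup>2)) (at 0)" using l by (simp only: ip_self)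
  have e: "(nrm M (gop b (?g t) ?P - ?P))\<^sup>2 = 2 * (nrm M ?P)\<^sup>2 - 2 * Re (ip M (gop b (?g t) ?P) ?P)" for t
    by (subst nrm_diff_power2[OF gop_L2[OF psi_L2[OF \<tau> p]] psi_L2[OF \<tau> p]]) (simp add: gop_spec(2)[OF psi_L2[OF \<tau> p]])
  have "((\<lambda>t. (nrm M (gop b (?g t) ?P - ?P))\<^sup>2) \<longlongrightarrow> 2 * (nrm M ?P)\<^sup>2 - 2 * Re (of_real ((nrm M ?P)\<^sup>2))) (at 0)"
    unfolding e by (intro tendsto_intros l)
  then have "((\<lambda>t. (nrm M (gop b (?g t) ?P - ?P))\<^sup>2) \<longlongrightarrow> 0) (at 0)" by simp
  from tendsto_real_sqrt[OF this] show ?thesis by simp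
qed

lemma psi_span_subspace: "cfun.subspace psi_span"
  by (simp add: psi_span_def)

lemma psi_span_L2: "psi_span \<subseteq> sq_integrable M"
  unfolding psi_span_def by (rule cfun.span_minimal[OF _ sq_subspace]) (auto intro: psi_L2)

lemma psi_span_total:
  assumes "f \<in> sq_integrable M" "\<And>v. v \<in> psi_span \<Longrightarrow> ip M f v = 0"
  shows "AE x in M. f x = 0"
  by (rule psi_total_M[OF assms(1)]) (rule assms(2), unfold psi_span_def, rule cfun.span_base, blast)

lemma gop_continuous_0:
  assumes X: "X \<in> sl2" and f: "f \<in> sq_integrable M"
  shows "((\<lambda>t. nrm M (gop b (cover_exp (t *\<^sub>R X)) f - f)) \<longlongrightarrow> 0) (at 0)"
proof -
  let ?T = "\<lambda>t. gop b (cover_exp (t *\<^sub>R X))"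
  have span: "u \<in> sq_integrable M \<and> ((\<lambda>t. nrm M (?T t u - u)) \<longlongrightarrow> 0) (at 0)" if "u \<in> psi_span" for u
    using that unfolding psi_span_def
  proof (induction rule: cfun.span_induct_alt)
    case base
    have "nrm M (?T t 0 - 0) = 0" for t using gop_spec(2)[OF sq_zero] by (simp only: diff_zero nrm_zero)
    then show ?case by (simp only: sq_zero tendsto_const simp_thms)
  next
    case (step c e y)
    then obtain \<tau> p m where e: "e = psi \<tau> p" and \<tau>: "Im \<tau> > 0" and p: "p \<in> harmonic_poly m" by auto
    have esq: "e \<in> sq_integrable M" unfolding e by (rule psi_L2[OF \<tau> p])
    have ysq: "y \<in> sq_integrable M" using step by blast
    have le: "nrm M (?T t (cscale c e + y) - (cscale c e + y)) \<le> cmod c * nrm M (?T t e - e) + nrm M (?T t y - y)" for t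
    proof -
      note D = L2_linear_isometryD[OF gop_isometry]
      have "(?T t (cscale c e + y), ?T t (cscale c e) + ?T t y) \<in> ae_rel M" by (rule D(3)[OF sq_cscale[OF esq] ysq])
      also have "(?T t (cscale c e) + ?T t y, cscale c (?T t e) + ?T t y) \<in> ae_rel M"
        by (rule ae_add[OF D(4)[OF esq] ae_refl[OF D(1)[OF ysq]]])
      finally have "nrm M (?T t (cscale c e + y) - (cscale c e + y)) = nrm M (cscale c (?T t e) + ?T t y - (cscale c e + y))"
        by (rule ae_nrm[OF ae_diff[OF _ ae_refl[OF sq_add[OF sq_cscale[OF esq] ysq]]]])
      also have "cscale c (?T t e) + ?T t y - (cscale c e + y) = cscale c (?T t e - e) + (?T t y - y)"
        by (auto simp: cscale_def algebra_simps)
      also have "nrm M \<dots> \<le> nrm M (cscale c (?T t e - e)) + nrm M (?T t y - y)"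
        by (intro nrm_triangle sq_cscale sq_diff D(1) esq ysq)
      finally show ?thesis unfolding nrm_cscale .
    qed
    have l: "((\<lambda>t. nrm M (?T t e - e)) \<longlongrightarrow> 0) (at 0)" "((\<lambda>t. nrm M (?T t y - y)) \<longlongrightarrow> 0) (at 0)"
      unfolding e by (rule gop_psi_continuous[OF X \<tau> p]) (rule conjunct2[OF step(2)])
    have "((\<lambda>t. cmod c * nrm M (?T t e - e) + nrm M (?T t y - y)) \<longlongrightarrow> cmod c * 0 + 0) (at 0)"
      by (intro tendsto_intros l)
    then have l0: "((\<lambda>t. cmod c * nrm M (?T t e - e) + nrm M (?T t y - y)) \<longlongrightarrow> 0) (at 0)"
      by (simp only: mult_zero_right add_0_right)
    have "((\<lambda>t. nrm M (?T t (cscale c e + y) - (cscale c e + y))) \<longlongrightarrow> 0) (at 0)"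
    proof (rule Lim_null_comparison[OF always_eventually[OF allI] l0])
      fix t
      show "norm (nrm M (?T t (cscale c e + y) - (cscale c e + y))) \<le> cmod c * nrm M (?T t e - e) + nrm M (?T t y - y)"
        using le[of t] by (simp only: real_norm_def abs_of_nonneg[OF nrm_nonneg])
    qed
    then show ?case by (intro conjI sq_add sq_cscale esq ysq)
  qed
  show ?thesis
  proof (rule tendstoI)
    fix e :: real assume e: "e > 0"
    obtain u where u: "u \<in> psi_span" "nrm M (u - f) < e / 3"
      using L2_dense[OF psi_span_subspace psi_span_L2 f psi_span_total, of "e / 3"] e by auto
    have usq: "u \<in> sq_integrable M" using u psi_span_L2 by blast
    have "\<forall>\<^sub>F t in at 0. nrm M (?T t u - u) < e / 3"
      using order_tendstoD(2)[OF conjunct2[OF span[OF u(1)]], of "e / 3"] e by simp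
    then show "\<forall>\<^sub>F t in at 0. dist (nrm M (?T t f - f)) 0 < e"
    proof eventually_elim
      case (elim t)
      have "nrm M (?T t f - f) \<le> nrm M (?T t f - ?T t u) + (nrm M (?T t u - u) + nrm M (u - f))"
        using nrm_triangle_diff[OF gop_L2[OF f] gop_L2[OF usq] f, of "cover_exp (t *\<^sub>R X)" "cover_exp (t *\<^sub>R X)"]
          nrm_triangle_diff[OF gop_L2[OF usq] usq f, of "cover_exp (t *\<^sub>R X)"] by linarith
      also have "nrm M (?T t f - ?T t u) = nrm M (u - f)"
        unfolding isometry_nrm_diff[OF gop_isometry f usq] by (rule nrm_minus)
      finally show ?case using elim u(2) unfolding dist_real_def diff_zero abs_of_nonneg[OF nrm_nonneg] by linarith
    qed
  qed
qed

lemma gop_mult_diff: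
  assumes f: "f \<in> sq_integrable M"
  shows "nrm M (gop b (g * h) f - gop b g f) = nrm M (gop b h f - f)"
proof -
  have "nrm M (gop b (g * h) f - gop b g f) = nrm M (gop b g (gop b h f) - gop b g f)"
    by (intro ae_nrm ae_diff ae_refl L2_actionD(3)[OF gop_action] gop_L2 f)
  then show ?thesis using isometry_nrm_diff[OF gop_isometry gop_L2[OF f] f] by simp
qed

lemma gop_near_0:
  assumes X: "X \<in> sl2" and f: "f \<in> sq_integrable M" and e: "e > 0"
  shows "\<exists>d>0. \<forall>t. \<bar>t\<bar> < d \<longrightarrow> nrm M (gop b (cover_exp (t *\<^sub>R X)) f - f) < e"
proof -
  from order_tendstoD(2)[OF gop_continuous_0[OF X f] e] obtain d where d: "d > 0"
    "\<And>t. t \<noteq> 0 \<Longrightarrow> \<bar>t\<bar> < d \<Longrightarrow> nrm M (gop b (cover_exp (t *\<^sub>R X)) f - f) < e"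
    by (auto simp: eventually_at dist_real_def)
  have "nrm M (gop b (cover_exp (0 *\<^sub>R X)) f - f) = 0"
    using L2_actionD(2)[OF gop_action f] ae_iff_nrm[OF gop_L2[OF f] f, of 1] by simp
  then show ?thesis using d e by metis
qed

text \<open>Unitarity moves the question to the unit element, and near it the group element is a product of small elements of
  three one-parameter groups, whose displacements add up.\<close>

lemma gop_continuous:
  assumes f: "f \<in> sq_integrable M"
  shows "((\<lambda>h. nrm M (gop b h f - gop b g f)) \<longlongrightarrow> 0) (at g)"
proof (rule tendstoI)
  fix e :: real assume "e > 0"
  then have e: "e / 3 > 0" by simp
  obtain dE where dE: "dE > 0" "\<And>t. \<bar>t\<bar> < dE \<Longrightarrow> nrm M (gop b (cover_exp (t *\<^sub>R Emat)) f - f) < e / 3"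
    using gop_near_0[OF sl2_basis(1) f e] by blast
  obtain dF where dF: "dF > 0" "\<And>t. \<bar>t\<bar> < dF \<Longrightarrow> nrm M (gop b (cover_exp (t *\<^sub>R Fmat)) f - f) < e / 3"
    using gop_near_0[OF sl2_basis(2) f e] by blast
  obtain dH where dH: "dH > 0" "\<And>t. \<bar>t\<bar> < dH \<Longrightarrow> nrm M (gop b (cover_exp (t *\<^sub>R Hmat)) f - f) < e / 3"
    using gop_near_0[OF sl2_basis(3) f e] by blast
  have "min dE (min dF dH) > 0" using dE dF dH by simp
  from cover_nhds[OF this, of g] obtain U where U: "open U" "g \<in> U"
    "\<And>h. h \<in> U \<Longrightarrow> \<exists>x y t. \<bar>x\<bar> < min dE (min dF dH) \<and> \<bar>y\<bar> < min dE (min dF dH) \<and> \<bar>t\<bar> < min dE (min dF dH) \<and>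
        h = g * (cover_exp (y *\<^sub>R Fmat) * cover_exp (t *\<^sub>R Hmat) * cover_exp (x *\<^sub>R Emat))"
    by blast
  have "nrm M (gop b h f - gop b g f) < e" if "h \<in> U" for h
  proof -
    obtain x y t where xyt: "\<bar>x\<bar> < dE" "\<bar>y\<bar> < dF" "\<bar>t\<bar> < dH"
      and h: "h = g * (cover_exp (y *\<^sub>R Fmat) * cover_exp (t *\<^sub>R Hmat) * cover_exp (x *\<^sub>R Emat))"
      using U(3)[OF \<open>h \<in> U\<close>] by auto
    let ?F = "cover_exp (y *\<^sub>R Fmat)" and ?H = "cover_exp (t *\<^sub>R Hmat)" and ?E = "cover_exp (x *\<^sub>R Emat)"
    have "nrm M (gop b h f - gop b g f) = nrm M (gop b (?F * ?H * ?E) f - f)" unfolding h by (rule gop_mult_diff[OF f])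
    also have "\<dots> \<le> nrm M (gop b (?F * ?H * ?E) f - gop b (?F * ?H) f) + (nrm M (gop b (?F * ?H) f - gop b ?F f) + nrm M (gop b ?F f - f))"
      using nrm_triangle_diff[OF gop_L2[OF f] gop_L2[OF f] f, of "?F * ?H * ?E" "?F * ?H"]
        nrm_triangle_diff[OF gop_L2[OF f] gop_L2[OF f] f, of "?F * ?H" ?F] by linarith
    also have "\<dots> < e" unfolding gop_mult_diff[OF f] using dE(2)[OF xyt(1)] dF(2)[OF xyt(2)] dH(2)[OF xyt(3)] by linarith
    finally show ?thesis .
  qed
  then show "\<forall>\<^sub>F h in at g. dist (nrm M (gop b h f - gop b g f)) 0 < e"
    unfolding eventually_at_topological using U(1,2) by (intro exI[of _ U]) auto
qed

end

section \<open>The infinitesimal action\<close>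

lemma sl2_uminus: "X \<in> sl2 \<Longrightarrow> - X \<in> sl2"
  using sl2_scaleR[of X "-1"] by simp

text \<open>Here $e$, $f$, $h$ stand for the entries $X_{12}$, $X_{21}$, $X_{11}$ and $I$ for the imaginary unit. The left hand side is the derivative of the moving Gaussian
  pairing, the right hand side the pairing of $\omega_b(X) v$, both times $2$; \<^term>\<open>s\<close> is the exponent of the pairing and the last two premises
  are the recursion \<open>gtrans_hp_Suc\<close>.\<close>

lemma coherent_derivative_identity:
  fixes z s e f h K J A B C I :: complex
  assumes "I * I = - 1" "2 * s = 1 + I * z" "s * C = (K + J) * B" "J * (s * B) = J * ((J + K - 1) * A)"
  shows "I * (e + 2 * h * z - f * z\<^sup>2) * C + 2 * K * (f * z - h) * B
    = e * (I * C) + f * (I * (4 * J * (J + K - 1) * A - (4 * J + 2 * K) * B + C)) + 2 * h * ((2 * J + K) * B - C)"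
  using assms by algebra

context
  fixes b :: real and M :: "(real^'n) measure"
  assumes b: "b > - real CARD('n) / 2"
  defines "M \<equiv> weighted_measure b"
begin

lemma ebas_L2: "p \<in> harmonic_poly m \<Longrightarrow> ebas j p \<in> sq_integrable M"
  using ebas_sq[OF b] harmonicD(1) unfolding M_def by blast

lemma ospan_L2: "u \<in> ospan \<Longrightarrow> u \<in> sq_integrable M"
proof -
  have "ospan \<subseteq> sq_integrable M"
    unfolding ospan_def by (rule cfun.span_minimal[OF _ sq_subspace]) (auto intro: ebas_L2)
  then show "u \<in> ospan \<Longrightarrow> u \<in> sq_integrable M" by blast
qed

lemma ospan_total:
  assumes f: "f \<in> sq_integrable M" and 0: "\<And>v. v \<in> ospan \<Longrightarrow> ip M f v = 0"
  shows "AE x in M. f x = 0"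
  using ebas_total[OF b, of f] f 0 ospan_base unfolding M_def by blast

lemma ip_oact:
  fixes p :: "real^'n \<Rightarrow> complex"
  assumes p: "p \<in> harmonic_poly m" and w: "w \<in> sq_integrable M"
  shows "ip M (oact b X m j p) w = of_real (X$1$2) * (\<i> / 2 * ip M (ebas (Suc j) p) w)
    + of_real (X$2$1) * (\<i> / 2 * (4 * of_nat j * (of_nat j + of_real (kap TYPE('n) b m) - 1) * ip M (ebas (j - 1) p) w
       - (4 * of_nat j + 2 * of_real (kap TYPE('n) b m)) * ip M (ebas j p) w + ip M (ebas (Suc j) p) w))
    + of_real (X$1$1) * ((2 * of_nat j + of_real (kap TYPE('n) b m)) * ip M (ebas j p) w - ip M (ebas (Suc j) p) w)"
proof -
  let ?K = "complex_of_real (kap TYPE('n) b m)"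
  have "oact b X m j p = cscale (of_real (X$1$2)) (cscale (\<i> / 2) (ebas (Suc j) p))
    + cscale (of_real (X$2$1)) (cscale (\<i> / 2) (cscale (4 * of_nat j * (of_nat j + ?K - 1)) (ebas (j - 1) p)
       - cscale (4 * of_nat j + 2 * ?K) (ebas j p) + ebas (Suc j) p))
    + cscale (of_real (X$1$1)) (cscale (2 * of_nat j + ?K) (ebas j p) - ebas (Suc j) p)"
    by (simp add: fun_eq_iff oact_def hact_def cscale_def)
  then show ?thesis
    by (simp only: ip_add_left ip_diff_left ip_cscale_left sq_add sq_diff sq_cscale ebas_L2[OF p] w)
qed

lemma gop_ebas_psi:
  assumes X: "X \<in> sl2" and p: "p \<in> harmonic_poly m" and q: "q \<in> harmonic_poly n" and \<sigma>: "Im \<sigma> > 0"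
  shows "ip M (gop b (cover_exp (t *\<^sub>R X)) (ebas j p)) (psi \<sigma> q)
    = exp (- of_real (kap TYPE('n) b n) * cnj (autlog (cover_exp (t *\<^sub>R (- X))) \<sigma>))
      * ip M (ebas j p) (psi (mob (mat_exp (t *\<^sub>R (- X))) \<sigma>) q)"
proof -
  have "cover_exp (t *\<^sub>R (- X)) * cover_exp (t *\<^sub>R X) = 1" using cover_exp_minus(1)[OF X, of t] by simp
  from gop_adjoint[OF b this, folded M_def, OF ebas_L2[OF p] psi_L2[OF b \<sigma> q, folded M_def]]
  have "ip M (gop b (cover_exp (t *\<^sub>R X)) (ebas j p)) (psi \<sigma> q) = ip M (ebas j p) (gop b (cover_exp (t *\<^sub>R (- X))) (psi \<sigma> q))" .
  also have "\<dots> = ip M (ebas j p) (gact b (cover_exp (t *\<^sub>R (- X))) \<sigma> n q)"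
    by (rule ae_ip[OF ae_refl[OF ebas_L2[OF p]] gop_psi[OF b \<sigma> q, folded M_def]])
  finally show ?thesis
    unfolding gact_def ip_cscale_right cover_end_exp[OF sl2_scaleR[OF sl2_uminus[OF X]]]
    by (simp add: exp_cnj)
qed

text \<open>Moving the operator to the Gaussian makes the pairing an explicit function of \<^term>\<open>t\<close>, to be differentiated by the chain rule. The sign of
  \<^term>\<open>X\<close> changes, since the adjoint is the operator of the inverse element.\<close>

lemma gop_ebas_weak_derivative_0:
  assumes X: "X \<in> sl2" and p: "p \<in> harmonic_poly m" and q: "q \<in> harmonic_poly n" and \<sigma>: "Im \<sigma> > 0"
  shows "((\<lambda>t. ip M (gop b (cover_exp (t *\<^sub>R X)) (ebas j p)) (psi \<sigma> q)) has_vector_derivative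
    ip M (oact b X m j p) (psi \<sigma> q)) (at 0)"
proof (cases "m = n")
  case False
  note o = ebas_psi_orthogonal[OF b _ p q False, folded M_def]
  have "Im (mob (mat_exp (t *\<^sub>R (- X))) \<sigma>) > 0" for t
    by (rule Im_mob[OF det_mat_exp[OF sl2_scaleR[OF sl2_uminus[OF X]]] \<sigma>])
  then show ?thesis
    unfolding gop_ebas_psi[OF X p q \<sigma>] ip_oact[OF p psi_L2[OF b \<sigma> q, folded M_def]]
    by (simp add: o \<sigma>)
next
  case True
  have q': "q \<in> harmonic_poly m" using q True by simp
  let ?Y = "- X" and ?K = "complex_of_real (kap TYPE('n) b m)"
  have Y: "?Y \<in> sl2" by (rule sl2_uminus[OF X])
  define G where "G j = gtrans M (\<lambda>x. p x * cnj (q x)) j" for j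
  define s where "s = (1 + \<i> * cnj \<sigma>) / 2"
  have s: "Re s > 0" using \<sigma> by (simp add: s_def)
  let ?w = "\<lambda>t. (1 + \<i> * cnj (mob (mat_exp (t *\<^sub>R ?Y)) \<sigma>)) / 2"
  let ?w' = "(\<i> * cnj (of_real (?Y$1$2) + 2 * of_real (?Y$1$1) * \<sigma> - of_real (?Y$2$1) * \<sigma>\<^sup>2)) / 2"
  have w: "(?w has_vector_derivative ?w') (at 0)"
  proof -
    have "((\<lambda>t. 1 + \<i> * cnj (mob (mat_exp (t *\<^sub>R ?Y)) \<sigma>)) has_vector_derivative
      0 + \<i> * cnj (of_real (?Y$1$2) + 2 * of_real (?Y$1$1) * \<sigma> - of_real (?Y$2$1) * \<sigma>\<^sup>2)) (at 0)"
      by (intro has_vector_derivative_add has_vector_derivative_const has_vector_derivative_mult_right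
          bounded_linear.has_vector_derivative[OF bounded_linear_cnj] mob_mat_exp_deriv[OF Y \<sigma>])
    from has_vector_derivative_divide[OF this, of 2] show ?thesis by simp
  qed
  have w0: "?w 0 = s" by (simp add: s_def)
  have "(G j has_field_derivative - G (Suc j) s) (at (?w 0))"
    unfolding w0 G_def M_def by (rule gtrans_hh_deriv[OF b p q' s])
  from field_vector_diff_chain_at[OF w this]
  have Gd: "((\<lambda>t. G j (?w t)) has_vector_derivative ?w' * - G (Suc j) s) (at 0)" by (simp add: o_def)
  have a: "((\<lambda>t. - ?K * cnj (autlog (cover_exp (t *\<^sub>R ?Y)) \<sigma>)) has_vector_derivative - ?K * cnj (autf ?Y \<sigma>)) (at 0)"
    by (intro has_vector_derivative_mult_right bounded_linear.has_vector_derivative[OF bounded_linear_cnj] autlog_exp_deriv[OF Y \<sigma>])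
  have "(exp has_field_derivative 1) (at (- ?K * cnj (autlog (cover_exp (0 *\<^sub>R ?Y)) \<sigma>)))"
    using DERIV_exp[of "0::complex"] by simp
  from field_vector_diff_chain_at[OF a this]
  have ad: "((\<lambda>t. exp (- ?K * cnj (autlog (cover_exp (t *\<^sub>R ?Y)) \<sigma>))) has_vector_derivative - ?K * cnj (autf ?Y \<sigma>)) (at 0)"
    by (simp add: o_def)
  have ipG: "ip M (ebas i p) (psi \<tau> q) = G i ((1 + \<i> * cnj \<tau>) / 2)" for i \<tau>
    unfolding G_def M_def by (rule ip_ebas_psi[OF b])
  have F: "ip M (gop b (cover_exp (t *\<^sub>R X)) (ebas j p)) (psi \<sigma> q) = exp (- ?K * cnj (autlog (cover_exp (t *\<^sub>R ?Y)) \<sigma>)) * G j (?w t)" for t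
    unfolding gop_ebas_psi[OF X p q \<sigma>] ipG True ..
  have "exp (- ?K * cnj (autlog (cover_exp (0 *\<^sub>R ?Y)) \<sigma>)) * (?w' * - G (Suc j) s) + - ?K * cnj (autf ?Y \<sigma>) * G j (?w 0)
    = ip M (oact b X m j p) (psi \<sigma> q)"
  proof -
    define z where "z = cnj \<sigma>"
    define e where "e = complex_of_real (X$1$2)"
    define f where "f = complex_of_real (X$2$1)"
    define h where "h = complex_of_real (X$1$1)"
    have X22: "X$2$2 = - X$1$1" using X by (simp add: sl2_def trace_def sum_2)
    have af: "cnj (autf ?Y \<sigma>) = - (f * z - h)" by (simp add: autf_def f_def h_def z_def X22)
    have w'': "?w' = - (\<i> * (e + 2 * h * z - f * z\<^sup>2)) / 2" by (simp add: e_def f_def h_def z_def algebra_simps)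
    have r1: "s * G (Suc j) s = (?K + of_nat j) * G j s"
      using gtrans_hh_Suc[OF b p q' s, of j] by (simp add: G_def M_def)
    have r2: "of_nat j * (s * G j s) = of_nat j * ((of_nat j + ?K - 1) * G (j - 1) s)"
    proof (cases j)
      case (Suc i)
      then show ?thesis using gtrans_hh_Suc[OF b p q' s, of i] by (simp add: G_def M_def algebra_simps)
    qed simp
    have "2 * s = 1 + \<i> * z" by (simp add: s_def z_def)
    from coherent_derivative_identity[OF _ this r1 r2, of e h f]
    have id: "\<i> * (e + 2 * h * z - f * z\<^sup>2) * G (Suc j) s + 2 * ?K * (f * z - h) * G j s
    = e * (\<i> * G (Suc j) s) + f * (\<i> * (4 * of_nat j * (of_nat j + ?K - 1) * G (j - 1) s - (4 * of_nat j + 2 * ?K) * G j s + G (Suc j) s)) + 2 * h * ((2 * of_nat j + ?K) * G j s - G (Suc j) s)"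
      by simp
    have half: "- P / 2 * - C + - K * - Q * B = e * (\<i> / 2 * C) + f * (\<i> / 2 * R) + h * T"
      if "P * C + 2 * K * Q * B = e * (\<i> * C) + f * (\<i> * R) + 2 * h * T" for P C K Q B R T :: complex
    proof -
      have "- P / 2 * - C + - K * - Q * B = (P * C + 2 * K * Q * B) / 2" by (simp add: field_simps)
      also have "\<dots> = e * (\<i> / 2 * C) + f * (\<i> / 2 * R) + h * T" unfolding that by (simp add: field_simps)
      finally show ?thesis .
    qed
    show ?thesis
      unfolding ip_oact[OF p psi_L2[OF b \<sigma> q, folded M_def]] ipG s_def[symmetric] w0 af w''
        e_def[symmetric] f_def[symmetric] h_def[symmetric]
      using half[OF id] by simp
  qed
  then show ?thesis unfolding F using has_vector_derivative_mult[OF ad Gd] by (simp only:)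
qed

lemma gop_weak_derivative_0:
  assumes X: "X \<in> sl2" and u: "u \<in> ospan" and q: "q \<in> harmonic_poly n" and \<sigma>: "Im \<sigma> > 0"
  shows "((\<lambda>t. ip M (gop b (cover_exp (t *\<^sub>R X)) u) (psi \<sigma> q)) has_vector_derivative
    ip M (omega b X u) (psi \<sigma> q)) (at 0)"
proof -
  note psq = psi_L2[OF b \<sigma> q, folded M_def]
  let ?\<phi> = "\<lambda>t. gop b (cover_exp (t *\<^sub>R (- X))) (psi \<sigma> q)"
  have \<phi>sq: "?\<phi> t \<in> sq_integrable M" for t by (rule gop_L2[OF b, folded M_def, OF psq])
  have adj: "ip M (gop b (cover_exp (t *\<^sub>R X)) v) (psi \<sigma> q) = ip M v (?\<phi> t)" if "v \<in> sq_integrable M" for v t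
  proof (rule gop_adjoint[OF b, folded M_def, OF _ that psq])
    show "cover_exp (t *\<^sub>R (- X)) * cover_exp (t *\<^sub>R X) = 1" using cover_exp_minus(1)[OF X, of t] by simp
  qed
  have "(fst z \<in> sq_integrable M \<and> snd z \<in> sq_integrable M) \<and>
      ((\<lambda>t. ip M (fst z) (?\<phi> t)) has_vector_derivative ip M (snd z) (psi \<sigma> q)) (at 0)"
    if "z \<in> cfun2.span (opairs b X)" for z
    using that
  proof (induction rule: cfun2.span_induct_alt)
    case base
    show ?case by (simp only: fst_zero snd_zero sq_zero ip_zero has_vector_derivative_const simp_thms)
  next
    case (step c z y)
    obtain j p m where z: "z = (ebas j p, oact b X m j p)" and p: "p \<in> harmonic_poly m"
      using step(1) by (auto simp: opairs_def)
    have zsq: "ebas j p \<in> sq_integrable M" "oact b X m j p \<in> sq_integrable M"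
      using ebas_L2[OF p] ospan_L2[OF oact_ospan[OF p]] by auto
    have ysq: "fst y \<in> sq_integrable M" "snd y \<in> sq_integrable M" using step(2) by auto
    have d: "((\<lambda>t. c * ip M (ebas j p) (?\<phi> t) + ip M (fst y) (?\<phi> t)) has_vector_derivative
        c * ip M (oact b X m j p) (psi \<sigma> q) + ip M (snd y) (psi \<sigma> q)) (at 0)"
      using gop_ebas_weak_derivative_0[OF X p q \<sigma>, of j] unfolding adj[OF zsq(1)]
      by (intro has_vector_derivative_add has_vector_derivative_mult_right conjunct2[OF step(2)])
    then show ?case
      by (simp only: z cscale2_def fst_add snd_add fst_conv snd_conv sq_add sq_cscale zsq ysq
          ip_add_left ip_cscale_left \<phi>sq psq simp_thms)
  qed
  from this[OF omega_ospan(2)[OF u]] show ?thesis by (simp only: adj[OF ospan_L2[OF u]] fst_conv snd_conv)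
qed

text \<open>At \<^term>\<open>t\<close> other than $0$ the operator at \<^term>\<open>t\<close> is again moved to the Gaussian, which becomes a multiple of another Gaussian.\<close>

lemma gop_weak_derivative:
  assumes X: "X \<in> sl2" and u: "u \<in> ospan" and v: "v \<in> psi_span"
  shows "((\<lambda>t. ip M (gop b (cover_exp (t *\<^sub>R X)) u) v) has_vector_derivative
    ip M (gop b (cover_exp (t *\<^sub>R X)) (omega b X u)) v) (at t)"
proof -
  note usq = ospan_L2[OF u] and osq = ospan_L2[OF omega_in_ospan[OF u, where b = b and X = X]]
  note gsq = gop_L2[OF b, folded M_def]
  note act = gop_action[OF b, folded M_def]
  have psi: "((\<lambda>t. ip M (gop b (cover_exp (t *\<^sub>R X)) u) (psi \<sigma> q)) has_vector_derivative
    ip M (gop b (cover_exp (t *\<^sub>R X)) (omega b X u)) (psi \<sigma> q)) (at t)" if \<sigma>: "Im \<sigma> > 0" and q: "q \<in> harmonic_poly n" for \<sigma> q n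
  proof -
    let ?h = "cover_exp (- t *\<^sub>R X)"
    note psq = psi_L2[OF b \<sigma> q, folded M_def]
    define c where "c = exp (- of_real (kap TYPE('n) b n) * autlog ?h \<sigma>)"
    define \<sigma>' where "\<sigma>' = mob (cover_end ?h) \<sigma>"
    have \<sigma>': "Im \<sigma>' > 0" unfolding \<sigma>'_def by (rule mob_cover_end[OF \<sigma>])
    have eq: "ip M (gop b (cover_exp (t *\<^sub>R X)) w) (psi \<sigma> q) = cnj c * ip M w (psi \<sigma>' q)" if w: "w \<in> sq_integrable M" for w
    proof -
      have "ip M (gop b (cover_exp (t *\<^sub>R X)) w) (psi \<sigma> q) = ip M w (gop b ?h (psi \<sigma> q))"
        by (rule gop_adjoint[OF b cover_exp_minus(1)[OF X], folded M_def, OF w psq])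
      also have "\<dots> = ip M w (gact b ?h \<sigma> n q)" by (rule ae_ip[OF ae_refl[OF w] gop_psi[OF b \<sigma> q, folded M_def]])
      finally show ?thesis unfolding gact_def ip_cscale_right c_def \<sigma>'_def .
    qed
    have shift: "ip M (gop b (cover_exp (r *\<^sub>R X)) u) (psi \<sigma> q) = cnj c * ip M (gop b (cover_exp ((r - t) *\<^sub>R X)) u) (psi \<sigma>' q)" for r
    proof -
      have "ip M (gop b (cover_exp (r *\<^sub>R X)) u) (psi \<sigma> q) = ip M (gop b (cover_exp (t *\<^sub>R X)) (gop b (cover_exp ((r - t) *\<^sub>R X)) u)) (psi \<sigma> q)"
        using cover_exp_add[OF X, of t "r - t"] by (intro ae_ip[OF _ ae_refl[OF psq]]) (simp add: L2_actionD(3)[OF act usq])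
      then show ?thesis unfolding eq[OF gsq[OF usq]] .
    qed
    have "((\<lambda>s. cnj c * ip M (gop b (cover_exp (s *\<^sub>R X)) u) (psi \<sigma>' q)) has_vector_derivative cnj c * ip M (omega b X u) (psi \<sigma>' q)) (at (t - t))"
      using has_vector_derivative_mult_right[OF gop_weak_derivative_0[OF X u q \<sigma>']] by simp
    moreover have "((\<lambda>r. r - t) has_vector_derivative 1) (at t)"
      by (auto intro!: derivative_eq_intros)
    ultimately have "((\<lambda>r. cnj c * ip M (gop b (cover_exp ((r - t) *\<^sub>R X)) u) (psi \<sigma>' q)) has_vector_derivative cnj c * ip M (omega b X u) (psi \<sigma>' q)) (at t)"
      using vector_diff_chain_at[of "\<lambda>r. r - t" 1 t "\<lambda>s. cnj c * ip M (gop b (cover_exp (s *\<^sub>R X)) u) (psi \<sigma>' q)"] by (simp add: o_def)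
    then show ?thesis unfolding shift eq[OF osq] .
  qed
  have "v \<in> sq_integrable M \<and> ((\<lambda>t. ip M (gop b (cover_exp (t *\<^sub>R X)) u) v) has_vector_derivative
    ip M (gop b (cover_exp (t *\<^sub>R X)) (omega b X u)) v) (at t)"
    using v unfolding psi_span_def
  proof (induction rule: cfun.span_induct_alt)
    case base show ?case by (simp only: sq_zero ip_zero has_vector_derivative_const simp_thms)
  next
    case (step c e y)
    then obtain \<sigma> q n where e: "e = psi \<sigma> q" and \<sigma>: "Im \<sigma> > 0" and q: "q \<in> harmonic_poly n" by auto
    have esq: "e \<in> sq_integrable M" unfolding e by (rule psi_L2[OF b \<sigma> q, folded M_def])
    have ysq: "y \<in> sq_integrable M" using step by blast
    have "((\<lambda>t. cnj c * ip M (gop b (cover_exp (t *\<^sub>R X)) u) e + ip M (gop b (cover_exp (t *\<^sub>R X)) u) y) has_vector_derivative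
      cnj c * ip M (gop b (cover_exp (t *\<^sub>R X)) (omega b X u)) e + ip M (gop b (cover_exp (t *\<^sub>R X)) (omega b X u)) y) (at t)"
      using psi[OF \<sigma> q] unfolding e
      by (intro has_vector_derivative_add has_vector_derivative_mult_right conjunct2[OF step(2)])
    then show ?case
      by (simp only: ip_add_right ip_cscale_right sq_add sq_cscale esq ysq gsq usq osq simp_thms)
  qed
  then show ?thesis by (rule conjunct2)
qed

text \<open>The weak derivative is the operator applied to $\omega_b(X) u$, which is close to $\omega_b(X) u$ for small times by strong continuity. The mean value inequality bounds
  the pairing of the error with every combination of Gaussians, uniformly in its norm.\<close>

lemma gop_derivative:
  assumes X: "X \<in> sl2" and u: "u \<in> ospan"
  shows "((\<lambda>t. nrm M (cscale (complex_of_real (1 / t)) (gop b (cover_exp (t *\<^sub>R X)) u - gop b (cover_exp (0 *\<^sub>R X)) u) - omega b X u)) \<longlongrightarrow> 0) (at 0)"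
proof (rule tendstoI)
  let ?T = "\<lambda>t. gop b (cover_exp (t *\<^sub>R X))" and ?w = "omega b X u"
  note usq = ospan_L2[OF u] and wsq = ospan_L2[OF omega_in_ospan[OF u, where b = b and X = X]]
  note gsq = gop_L2[OF b, folded M_def]
  fix e :: real assume e: "e > 0"
  then have "e / 2 > 0" by simp
  then obtain d where d: "d > 0" "\<And>t. \<bar>t\<bar> < d \<Longrightarrow> nrm M (?T t ?w - ?w) < e / 2"
    using gop_near_0[OF b X, folded M_def, OF wsq] by blast
  have "nrm M (cscale (complex_of_real (1 / t)) (?T t u - ?T 0 u) - ?w) < e" if t: "t \<noteq> 0" "\<bar>t\<bar> < d" for t
  proof -
    define D where "D = ?T t u - ?T 0 u - cscale (of_real t) ?w"
    have Dsq: "D \<in> sq_integrable M" unfolding D_def by (intro sq_diff sq_cscale gsq usq wsq)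
    have bound: "cmod (ip M D v) \<le> (\<bar>t\<bar> * (e / 2)) * nrm M v" if v: "v \<in> psi_span" for v
    proof -
      have vsq: "v \<in> sq_integrable M" using v psi_span_L2[OF b, folded M_def] by blast
      have w0: "ip M (?T 0 ?w) v = ip M ?w v"
        using ae_ip[OF L2_actionD(2)[OF gop_action[OF b, folded M_def] wsq] ae_refl[OF vsq]] by simp
      have "norm (ip M (?T t u) v - ip M (?T 0 u) v - (t - 0) *\<^sub>R ip M (?T 0 ?w) v) \<le> norm (t - 0) * ((e / 2) * nrm M v)"
      proof (rule vector_differentiable_bound_linearization[where S = "closed_segment 0 t" and f' = "\<lambda>s. ip M (?T s ?w) v"])
        show "((\<lambda>s. ip M (?T s u) v) has_vector_derivative ip M (?T s ?w) v) (at s within closed_segment 0 t)" for s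
          by (rule has_vector_derivative_at_within[OF gop_weak_derivative[OF X u v]])
        fix s assume s: "s \<in> closed_segment 0 t"
        then have "\<bar>s\<bar> < d" using t by (auto simp: closed_segment_eq_real_ivl split: if_splits)
        have "ip M (?T s ?w) v - ip M (?T 0 ?w) v = ip M (?T s ?w - ?w) v"
          unfolding w0 by (rule ip_diff_left[OF gsq[OF wsq] wsq vsq, symmetric])
        also have "cmod \<dots> \<le> nrm M (?T s ?w - ?w) * nrm M v" by (intro ip_Cauchy_Schwarz sq_diff gsq wsq vsq)
        also have "\<dots> \<le> (e / 2) * nrm M v" using d(2)[OF \<open>\<bar>s\<bar> < d\<close>] by (intro mult_right_mono) auto
        finally show "norm (ip M (?T s ?w) v - ip M (?T 0 ?w) v) \<le> (e / 2) * nrm M v" .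
      qed auto
      moreover have "ip M D v = ip M (?T t u) v - ip M (?T 0 u) v - (t - 0) *\<^sub>R ip M (?T 0 ?w) v"
        unfolding D_def w0 by (simp add: ip_diff_left ip_cscale_left sq_diff sq_cscale gsq usq wsq vsq scaleR_conv_of_real)
      ultimately show ?thesis by (simp add: mult.assoc)
    qed
    have "nrm M D \<le> \<bar>t\<bar> * (e / 2) \<or> nrm M D = 0"
      by (rule nrm_le_of_weak_bound[OF psi_span_subspace[OF b] psi_span_L2[OF b, folded M_def] Dsq psi_span_total[OF b, folded M_def] bound])
    then have nD: "nrm M D \<le> \<bar>t\<bar> * (e / 2)" using e by auto
    have "cscale (complex_of_real (1 / t)) (?T t u - ?T 0 u) - ?w = cscale (complex_of_real (1 / t)) D"
      using t by (auto simp: D_def cscale_def fun_eq_iff field_simps)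
    then have "nrm M (cscale (complex_of_real (1 / t)) (?T t u - ?T 0 u) - ?w) = nrm M D / \<bar>t\<bar>"
      by (simp only: nrm_cscale) (simp add: norm_divide)
    also have "\<dots> \<le> e / 2" using nD t by (simp add: field_simps)
    finally show ?thesis using e by simp
  qed
  then show "\<forall>\<^sub>F t in at 0. dist (nrm M (cscale (complex_of_real (1 / t)) (?T t u - ?T 0 u) - ?w)) 0 < e"
    using d(1) by (auto simp: eventually_at dist_real_def intro!: exI[of _ d])
qed

section \<open>The compact direction\<close>

text \<open>Paired with any Gaussian the orbit satisfies $\phi' = i \mu \phi$.\<close>

lemma gop_eigenvector:
  assumes u: "u \<in> ospan" and \<mu>: "A_op b u = cscale \<mu> u"
  shows "(gop b (cover_exp (t *\<^sub>R Jmat)) u, cscale (exp (\<i> * complex_of_real t * \<mu>)) u) \<in> ae_rel M"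
proof -
  let ?T = "\<lambda>t. gop b (cover_exp (t *\<^sub>R Jmat))"
  note usq = ospan_L2[OF u]
  note gsq = gop_L2[OF b, folded M_def]
  have "AE x in M. (?T t u - cscale (exp (\<i> * complex_of_real t * \<mu>)) u) x = 0"
  proof (rule psi_span_total[OF b, folded M_def])
    show "?T t u - cscale (exp (\<i> * complex_of_real t * \<mu>)) u \<in> sq_integrable M" by (intro sq_diff sq_cscale gsq usq)
    fix v :: "real^'n \<Rightarrow> complex" assume v: "v \<in> psi_span"
    have vsq: "v \<in> sq_integrable M" using v psi_span_L2[OF b, folded M_def] by blast
    let ?\<chi> = "\<lambda>s. ip M (?T s u) v * exp (- \<i> * \<mu> * complex_of_real s)"
    have "(?\<chi> has_vector_derivative 0) (at s)" for s
    proof -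
      have om: "omega b Jmat u = cscale (\<i> * \<mu>) u" unfolding omega_Jmat \<mu> by simp
      have "ip M (?T s (omega b Jmat u)) v = ip M (cscale (\<i> * \<mu>) (?T s u)) v"
        unfolding om by (rule ae_ip[OF L2_linear_isometryD(4)[OF gop_isometry[OF b, folded M_def] usq] ae_refl[OF vsq]])
      then have 1: "((\<lambda>s. ip M (?T s u) v) has_vector_derivative \<i> * \<mu> * ip M (?T s u) v) (at s)"
        using gop_weak_derivative[OF sl2_basis(4) u v, of s] by (simp only: ip_cscale_left)
      have "((\<lambda>z. exp (- \<i> * \<mu> * z)) has_field_derivative exp (- \<i> * \<mu> * of_real s) * (- \<i> * \<mu>)) (at (complex_of_real s))"
        by (auto intro!: derivative_eq_intros)
      from has_vector_derivative_real_field[OF this]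
      have 2: "((\<lambda>s. exp (- \<i> * \<mu> * complex_of_real s)) has_vector_derivative exp (- \<i> * \<mu> * of_real s) * (- \<i> * \<mu>)) (at s)" .
      show ?thesis using has_vector_derivative_mult[OF 1 2] by (simp add: algebra_simps)
    qed
    then obtain c where c: "\<And>s. ?\<chi> s = c"
      using has_vector_derivative_zero_constant[of UNIV ?\<chi>] by auto
    have "ip M (?T t u) v * exp (- \<i> * \<mu> * complex_of_real t) = ip M u v"
    proof -
      have "?\<chi> t = ?\<chi> 0" unfolding c ..
      also have "\<dots> = ip M u v"
        using ae_ip[OF L2_actionD(2)[OF gop_action[OF b, folded M_def] usq] ae_refl[OF vsq]] by simp
      finally show ?thesis .
    qed
    then have "ip M (?T t u) v * exp (- \<i> * \<mu> * complex_of_real t) * exp (\<i> * complex_of_real t * \<mu>) = exp (\<i> * complex_of_real t * \<mu>) * ip M u v"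
      by simp
    moreover have "exp (- \<i> * \<mu> * complex_of_real t) * exp (\<i> * complex_of_real t * \<mu>) = 1"
      by (simp add: exp_add[symmetric] mult_ac)
    ultimately have "ip M (?T t u) v = exp (\<i> * complex_of_real t * \<mu>) * ip M u v" by (simp only: mult.assoc mult_1_right)
    then show "ip M (?T t u - cscale (exp (\<i> * complex_of_real t * \<mu>)) u) v = 0"
      by (simp only: ip_diff_left gsq usq vsq sq_cscale ip_cscale_left diff_self)
  qed
  then show ?thesis by (auto intro!: ae_relI gsq usq sq_cscale)
qed

lemma weighted_AE_eq:
  fixes f :: "real^'n \<Rightarrow> complex"
  assumes "continuous_on UNIV f" "continuous_on UNIV g" "AE x in M. f x = g x"
  shows "f = g"
proof
  fix x
  have "AE x in lborel. 0 < ennreal (norm x powr (2 * b)) \<longrightarrow> f x = g x"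
    using assms(3) unfolding M_def weighted_measure_def by (subst (asm) AE_density) auto
  then have "AE x in lborel. f x - g x = 0"
    using AE_lborel_singleton[of "0::real^'n"] by eventually_elim auto
  from continuous_AE_zero[OF _ this, of x] show "f x = g x"
    using assms(1,2) by (simp add: continuous_on_diff)
qed

text \<open>On eigenvectors the operator multiplies by the prescribed scalar, so its graph contains the span of the prescribed pairs. Two continuous functions
  in the same class are equal, and therefore the span is single valued and \<^const>\<open>omega_K\<close> is given by it.\<close>

lemma omega_K_gop:
  fixes u :: "real^'n \<Rightarrow> complex"
  assumes u: "u \<in> W_alg b"
  shows "omega_K b t u \<in> ospan" "(gop b (cover_exp (t *\<^sub>R Jmat)) u, omega_K b t u) \<in> ae_rel M"
proof -
  let ?T = "gop b (cover_exp (t *\<^sub>R Jmat)) :: (real^'n \<Rightarrow> complex) \<Rightarrow> _"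
  let ?P = "{(u :: real^'n \<Rightarrow> complex, cscale (exp (\<i> * complex_of_real t * \<mu>)) u) |u \<mu>. u \<in> W_alg b \<and> A_op b u = cscale \<mu> u}"
  note iso = gop_isometry[OF b, folded M_def]
  have P: "fst z \<in> ospan \<and> snd z \<in> ospan \<and> (?T (fst z), snd z) \<in> ae_rel M" if "z \<in> cfun2.span ?P" for z
    using that
  proof (induction rule: cfun2.span_induct_alt)
    case base
    have "nrm M (?T 0 - 0) = 0" using gop_spec(2)[OF b sq_zero] by (simp only: diff_zero nrm_zero M_def)
    then have "(?T 0, 0) \<in> ae_rel M" using ae_iff_nrm[OF gop_L2[OF b, folded M_def, OF sq_zero] sq_zero] by blast
    then show ?case unfolding ospan_def by (simp only: fst_zero snd_zero cfun.span_zero simp_thms)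
  next
    case (step c z y)
    obtain v \<mu> where z: "z = (v, cscale (exp (\<i> * complex_of_real t * \<mu>)) v)" and v: "v \<in> ospan" and \<mu>: "A_op b v = cscale \<mu> v"
      using step(1) W_alg_ospan[OF b] by auto
    have y: "fst y \<in> ospan" "snd y \<in> ospan" "(?T (fst y), snd y) \<in> ae_rel M" using step(2) by auto
    note vsq = ospan_L2[OF v] and ysq = ospan_L2[OF y(1)]
    have "(?T (cscale c v + fst y), ?T (cscale c v) + ?T (fst y)) \<in> ae_rel M"
      by (rule L2_linear_isometryD(3)[OF iso sq_cscale[OF vsq] ysq])
    also have "(?T (cscale c v) + ?T (fst y), cscale c (?T v) + snd y) \<in> ae_rel M"
      by (rule ae_add[OF L2_linear_isometryD(4)[OF iso vsq] y(3)])
    also have "(cscale c (?T v) + snd y, cscale c (cscale (exp (\<i> * complex_of_real t * \<mu>)) v) + snd y) \<in> ae_rel M"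
      by (intro ae_add ae_cscale gop_eigenvector[OF v \<mu>] ae_refl ospan_L2 y)
    finally have "(?T (cscale c v + fst y), cscale c (cscale (exp (\<i> * complex_of_real t * \<mu>)) v) + snd y) \<in> ae_rel M" .
    moreover have "cscale c v + fst y \<in> ospan"
      unfolding ospan_def by (intro cfun.span_add cfun.span_scale v[unfolded ospan_def] y(1)[unfolded ospan_def])
    moreover have "cscale c (cscale (exp (\<i> * complex_of_real t * \<mu>)) v) + snd y \<in> ospan"
      unfolding ospan_def by (intro cfun.span_add cfun.span_scale v[unfolded ospan_def] y(2)[unfolded ospan_def])
    ultimately show ?case by (simp only: z cscale2_def fst_add snd_add fst_conv snd_conv simp_thms)
  qed
  have ex: "\<exists>v. (u, v) \<in> cfun2.span ?P"
    using u[unfolded W_alg_def]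
  proof (induction rule: cfun.span_induct_alt)
    case base
    show ?case using cfun2.span_zero[of ?P] unfolding zero_prod_def by blast
  next
    case (step c e y)
    then obtain l m p where e: "e = Phi b l m p" and p: "p \<in> harmonic_poly m" by auto
    from step(2) obtain v where v: "(y, v) \<in> cfun2.span ?P" by blast
    have "Phi b l m p \<in> W_alg b" unfolding W_alg_def by (rule cfun.span_base) (use p in auto)
    then have "(e, cscale (exp (\<i> * complex_of_real t * - of_real (kap TYPE('n) b m + 2 * real l))) e) \<in> ?P"
      unfolding e using Phi_eigenvector[OF b p, of l] by blast
    from cfun2.span_add[OF cfun2.span_scale[OF cfun2.span_base[OF this], of c] v]
    show ?case unfolding cscale2_def fst_conv snd_conv add_Pair by blast
  qed
  then obtain v where v: "(u, v) \<in> cfun2.span ?P" by blast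
  have "v' = v" if v': "(u, v') \<in> cfun2.span ?P" for v'
  proof (rule weighted_AE_eq)
    show "continuous_on UNIV v'" "continuous_on UNIV v" using P[OF v] P[OF v'] by (auto intro: ospan_continuous)
    have "(v', v) \<in> ae_rel M" using P[OF v] P[OF v'] ae_trans[OF ae_sym] by (simp only: fst_conv snd_conv) blast
    then show "AE x in M. v' x = v x" by (rule ae_relD)
  qed
  then have "omega_K b t u = v"
    unfolding omega_K_def linear_op_from_def by (intro the_equality v) blast
  then show "omega_K b t u \<in> ospan" "(?T u, omega_K b t u) \<in> ae_rel M" using P[OF v] by auto
qed

end

section \<open>Uniqueness\<close>

text \<open>Taylor's formula at $0$: the remainder is at most $C (2|x|)^n$.\<close>

lemma flat_function_zero_real:
  fixes g :: "nat \<Rightarrow> real \<Rightarrow> real"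
  assumes d: "\<And>n t. (g n has_real_derivative g (Suc n) t) (at t)" and 0: "\<And>n. g n 0 = 0"
    and bound: "\<And>n t. \<bar>g n t\<bar> \<le> C * 2 ^ n * fact n" and x: "\<bar>x\<bar> < 1 / 2"
  shows "g 0 x = 0"
proof -
  have le: "\<bar>g 0 x\<bar> \<le> C * (2 * \<bar>x\<bar>) ^ n" for n
  proof -
    obtain t where "g 0 x = (\<Sum>m<n. (g m 0 / fact m) * x ^ m) + (g n t / fact n) * x ^ n"
      using Maclaurin_all_le[of g "g 0" x n] d by blast
    then have "\<bar>g 0 x\<bar> = \<bar>g n t\<bar> / fact n * \<bar>x\<bar> ^ n" by (simp add: 0 abs_mult power_abs)
    also have "\<dots> \<le> (C * 2 ^ n) * \<bar>x\<bar> ^ n"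
      using bound[of n t] by (intro mult_right_mono) (auto simp: divide_le_eq)
    finally show ?thesis by (simp add: power_mult_distrib mult.assoc)
  qed
  have "(\<lambda>n. C * (2 * \<bar>x\<bar>) ^ n) \<longlonglongrightarrow> C * 0"
    using x by (intro tendsto_intros LIMSEQ_realpow_zero) auto
  then have "\<bar>g 0 x\<bar> \<le> C * 0" by (rule LIMSEQ_le_const) (use le in blast)
  then show ?thesis by simp
qed

lemma flat_function_zero:
  fixes f :: "nat \<Rightarrow> real \<Rightarrow> complex"
  assumes d: "\<And>n t. (f n has_vector_derivative f (Suc n) t) (at t)" and 0: "\<And>n. f n 0 = 0"
    and bound: "\<And>n t. cmod (f n t) \<le> C * 2 ^ n * fact n" and x: "\<bar>x\<bar> < 1 / 2"
  shows "f 0 x = 0"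
proof (rule complex_eqI)
  have "((\<lambda>t. Re (f n t)) has_real_derivative Re (f (Suc n) t)) (at t)"
    "((\<lambda>t. Im (f n t)) has_real_derivative Im (f (Suc n) t)) (at t)" for n t
    using bounded_linear.has_vector_derivative[OF bounded_linear_Re d[of n t]]
      bounded_linear.has_vector_derivative[OF bounded_linear_Im d[of n t]]
    by (simp_all add: has_real_derivative_iff_has_vector_derivative)
  then show "Re (f 0 x) = Re 0" "Im (f 0 x) = Im 0"
    using flat_function_zero_real[of "\<lambda>n t. Re (f n t)" C x] flat_function_zero_real[of "\<lambda>n t. Im (f n t)" C x]
      0 x order_trans[OF abs_Re_le_cmod bound] order_trans[OF abs_Im_le_cmod bound] by auto
qed

text \<open>The two conditions of the theorem for an action on functions.\<close>

definition integrates :: "real \<Rightarrow> (sl2_cover \<Rightarrow> (real^'n \<Rightarrow> complex) \<Rightarrow> real^'n \<Rightarrow> complex) \<Rightarrow> bool" where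
  "integrates b V \<longleftrightarrow> L2_action (weighted_measure b) V \<and>
    (\<forall>X\<in>sl2. \<forall>u\<in>ospan. ((\<lambda>t. nrm (weighted_measure b) (cscale (complex_of_real (1 / t))
       (V (cover_exp (t *\<^sub>R X)) u - V (cover_exp (0 *\<^sub>R X)) u) - omega b X u)) \<longlongrightarrow> 0) (at 0)) \<and>
    (\<forall>t. \<forall>u\<in>ospan. (V (cover_exp (t *\<^sub>R Jmat)) u, omega_K b t u) \<in> ae_rel (weighted_measure b))"

lemma omega_Emat: "omega b Emat u x = \<i> / 2 * of_real ((norm x)\<^sup>2) * u x"
  by (simp add: omega_def mat_entries)

lemma omega_Emat_power: "(omega b Emat ^^ n) u x = (\<i> / 2 * of_real ((norm x)\<^sup>2)) ^ n * u x"
  by (induction n) (simp_all add: omega_Emat)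

lemma omega_power_ospan: "u \<in> ospan \<Longrightarrow> (omega b X ^^ n) u \<in> ospan"
  by (induction n) (simp_all add: omega_in_ospan)

context
  fixes b :: real and M :: "(real^'n) measure"
  assumes b: "b > - real CARD('n) / 2"
  defines "M \<equiv> weighted_measure b"
begin

text \<open>With $y = |x|^2/4$ the factor $(|x|^2/2)^n e^{-|x|^2/2}$ is $2^n y^n e^{-2y} \le 2^n n! e^{-y}$.\<close>

lemma ebas_analytic_bound:
  assumes p: "p \<in> harmonic_poly m"
  shows "nrm M ((omega b Emat ^^ n) (ebas j p)) \<le> 
    nrm M (\<lambda>x. p x * of_real ((norm x)\<^sup>2) ^ j * exp (- (1/4) * of_real ((norm x)\<^sup>2))) * 2 ^ n * fact n"
proof -
  let ?g = "\<lambda>x. p x * of_real ((norm x)\<^sup>2) ^ j * exp (- (1/4) * of_real ((norm x)\<^sup>2))"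
  let ?f = "(omega b Emat ^^ n) (ebas j p)"
  let ?h = "cscale (of_real (2 ^ n * fact n)) ?g"
  have g: "?g \<in> sq_integrable M"
    using hp_gauss_sq[OF b _ hp_mult_norm_sq[OF harmonicD(1)[OF p]], of "1/4" j] by (simp add: M_def)
  have f: "?f \<in> sq_integrable M"
    by (rule ospan_L2[OF b, folded M_def, OF omega_power_ospan[OF ospan_base[OF p]]])
  have pt: "cmod (?f x) \<le> cmod (?h x)" for x
  proof -
    let ?y = "(norm x)\<^sup>2 / 4"
    have "cmod (?f x) = 2 ^ n * (?y ^ n * exp (- 2 * ?y)) * (cmod (p x) * ((norm x)\<^sup>2) ^ j)"
      unfolding omega_Emat_power ebas_def
      by (simp add: norm_mult norm_power norm_divide power_mult_distrib power_divide field_simps)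
         (simp add: power_mult_distrib[symmetric])
    also have "\<dots> \<le> 2 ^ n * (fact n * exp (- ?y)) * (cmod (p x) * ((norm x)\<^sup>2) ^ j)"
    proof (intro mult_right_mono mult_left_mono)
      have "?y ^ n * exp (- 2 * ?y) \<le> (fact n * exp ?y) * exp (- 2 * ?y)"
        by (intro mult_right_mono power_le_fact_exp) auto
      also have "\<dots> = fact n * exp (- ?y)" by (simp add: mult.assoc exp_add[symmetric])
      finally show "?y ^ n * exp (- 2 * ?y) \<le> fact n * exp (- ?y)" .
    qed auto
    also have "\<dots> = cmod (?h x)" by (simp add: cscale_def norm_mult norm_power)
    finally show ?thesis .
  qed
  have "(nrm M ?f)\<^sup>2 \<le> (nrm M ?h)\<^sup>2"
    unfolding nrm_power2
    by (intro integral_mono sq_integrableD f sq_cscale g power_mono pt) auto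
  then have "nrm M ?f \<le> nrm M ?h" by (rule power2_le_imp_le) simp
  then show ?thesis unfolding nrm_cscale by (simp add: norm_mult norm_power mult_ac)
qed

lemma ospan_analytic_bound:
  assumes "u \<in> ospan"
  shows "\<exists>C. \<forall>n. nrm M ((omega b Emat ^^ n) u) \<le> C * 2 ^ n * fact n"
proof -
  have "u \<in> ospan \<and> (\<exists>C. \<forall>n. nrm M ((omega b Emat ^^ n) u) \<le> C * 2 ^ n * fact n)"
    using assms unfolding ospan_def
  proof (induction rule: cfun.span_induct_alt)
    case base
    have z0: "(omega b Emat ^^ n) 0 = (0 :: real^'n \<Rightarrow> complex)" for n by (rule ext) (simp add: omega_Emat_power)
    show ?case by (intro conjI cfun.span_zero exI[of _ 0] allI) (simp only: z0 nrm_zero mult_zero_left order_refl)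
  next
    case (step c e y)
    then obtain j p m where e: "e = ebas j p" and p: "p \<in> harmonic_poly m" by auto
    from step(2) obtain C where C: "\<And>n. nrm M ((omega b Emat ^^ n) y) \<le> C * 2 ^ n * fact n" and y: "y \<in> ospan"
      unfolding ospan_def by blast
    have eo: "e \<in> ospan" unfolding e by (rule ospan_base[OF p])
    obtain D where D: "\<And>n. nrm M ((omega b Emat ^^ n) e) \<le> D * 2 ^ n * fact n"
      using ebas_analytic_bound[OF p, of _ j] unfolding e by blast
    note osq = ospan_L2[OF b, folded M_def]
    have "nrm M ((omega b Emat ^^ n) (cscale c e + y)) \<le> (cmod c * D + C) * 2 ^ n * fact n" for n
    proof -
      have "(omega b Emat ^^ n) (cscale c e + y) = cscale c ((omega b Emat ^^ n) e) + (omega b Emat ^^ n) y"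
        by (rule ext) (simp add: omega_Emat_power cscale_def algebra_simps)
      then have "nrm M ((omega b Emat ^^ n) (cscale c e + y)) \<le> cmod c * nrm M ((omega b Emat ^^ n) e) + nrm M ((omega b Emat ^^ n) y)"
        unfolding nrm_cscale[symmetric] by (simp only:) (intro nrm_triangle sq_cscale osq omega_power_ospan eo y)
      also have "\<dots> \<le> cmod c * (D * 2 ^ n * fact n) + C * 2 ^ n * fact n" by (intro add_mono mult_left_mono D C) auto
      finally show ?thesis by (simp add: algebra_simps)
    qed
    moreover have "cscale c e + y \<in> cfun.span {ebas j p |j p m. p \<in> harmonic_poly m}"
      by (intro cfun.span_add cfun.span_scale eo[unfolded ospan_def] y[unfolded ospan_def])
    ultimately show ?case by blast
  qed
  then show ?thesis by blast
qed

text \<open>As \<^term>\<open>V\<close> is an action, its operator at \<^term>\<open>t\<close> can be moved to \<^term>\<open>w\<close>, and the derivative at $0$ is the one assumed.\<close>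

lemma integrates_weak_derivative:
  assumes V: "integrates b V" and X: "X \<in> sl2" and u: "u \<in> ospan" and w: "w \<in> sq_integrable M"
  shows "((\<lambda>t. ip M (V (cover_exp (t *\<^sub>R X)) u) w) has_vector_derivative ip M (V (cover_exp (t *\<^sub>R X)) (omega b X u)) w) (at t)"
proof -
  have act: "L2_action M V" using V by (simp add: integrates_def M_def)
  note iso = L2_actionD(1)[OF act]
  note sq = L2_linear_isometryD(1)[OF iso]
  note usq = ospan_L2[OF b u, folded M_def]
  note osq = ospan_L2[OF b omega_in_ospan[OF u, where b = b and X = X], folded M_def]
  let ?T = "\<lambda>t. V (cover_exp (t *\<^sub>R X))"
  let ?L = "\<lambda>x. ip M x (?T (- t) w)"
  let ?Q = "\<lambda>h. cscale (complex_of_real (1 / h)) (?T h u - ?T 0 u) - omega b X u"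
  have L: "ip M (?T t x) w = ?L x" if "x \<in> sq_integrable M" for x
    by (rule action_adjoint[OF act cover_exp_minus(1)[OF X] that w])
  have Lt: "ip M (?T (t + h) u) w = ?L (?T h u)" for h
  proof -
    have "(?T (t + h) u, ?T t (?T h u)) \<in> ae_rel M" unfolding cover_exp_add[OF X] by (rule L2_actionD(3)[OF act usq])
    from ae_ip[OF this ae_refl[OF w]] show ?thesis unfolding L[OF sq[OF usq]] .
  qed
  have L0: "ip M (?T t u) w = ?L (?T 0 u)" using Lt[of 0] by simp
  have "((\<lambda>h. norm (ip M (?T (t + h) u) w - ip M (?T t u) w - h *\<^sub>R ip M (?T t (omega b X u)) w) / norm h) \<longlongrightarrow> 0) (at 0)"
  proof (rule Lim_null_comparison)
    have Q0: "((\<lambda>h. nrm M (?Q h)) \<longlongrightarrow> 0) (at 0)" using V X u unfolding integrates_def M_def by blast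
    show "((\<lambda>h. nrm M (?Q h) * nrm M (?T (- t) w)) \<longlongrightarrow> 0) (at 0)" using tendsto_mult_left_zero[OF Q0] .
    have "norm (norm (ip M (?T (t + h) u) w - ip M (?T t u) w - h *\<^sub>R ip M (?T t (omega b X u)) w) / norm h) \<le> nrm M (?Q h) * nrm M (?T (- t) w)"
      if h: "h \<noteq> 0" for h
    proof -
      have "of_real h * ?L (?Q h) = of_real h * (of_real (1 / h) * (?L (?T h u) - ?L (?T 0 u)) - ?L (omega b X u))"
        by (simp only: ip_diff_left ip_cscale_left sq_diff sq_cscale sq usq osq w)
      also have "\<dots> = ?L (?T h u) - ?L (?T 0 u) - h *\<^sub>R ?L (omega b X u)"
        using h by (simp add: right_diff_distrib scaleR_conv_of_real)
      finally have "ip M (?T (t + h) u) w - ip M (?T t u) w - h *\<^sub>R ip M (?T t (omega b X u)) w = of_real h * ?L (?Q h)"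
        unfolding Lt L0 L[OF osq] by (rule sym)
      then have "norm (norm (ip M (?T (t + h) u) w - ip M (?T t u) w - h *\<^sub>R ip M (?T t (omega b X u)) w) / norm h) = cmod (?L (?Q h))"
        using h by (simp only:) (simp add: norm_mult)
      also have "\<dots> \<le> nrm M (?Q h) * nrm M (?T (- t) w)"
        by (intro ip_Cauchy_Schwarz sq_diff sq_cscale sq usq osq w)
      finally show ?thesis .
    qed
    then show "\<forall>\<^sub>F h in at 0. norm (norm (ip M (?T (t + h) u) w - ip M (?T t u) w - h *\<^sub>R ip M (?T t (omega b X u)) w) / norm h) \<le> nrm M (?Q h) * nrm M (?T (- t) w)"
      unfolding eventually_at_filter by (intro always_eventually allI impI)
  qed
  then show ?thesis unfolding has_vector_derivative_def has_derivative_at by (simp add: bounded_linear_scaleR_left)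
qed

context
  fixes V W :: "sl2_cover \<Rightarrow> (real^'n \<Rightarrow> complex) \<Rightarrow> real^'n \<Rightarrow> complex"
  assumes V: "integrates b V" and W: "integrates b W"
begin

definition agree :: "sl2_cover \<Rightarrow> bool" where
  "agree g \<longleftrightarrow> (\<forall>f\<in>sq_integrable M. (V g f, W g f) \<in> ae_rel M)"

lemma Vact: "L2_action M V" and Wact: "L2_action M W"
  using V W by (simp_all add: integrates_def M_def)

lemmas Viso = L2_actionD(1)[OF Vact]
lemmas Wiso = L2_actionD(1)[OF Wact]
lemmas Vsq = L2_linear_isometryD(1)[OF Viso]
lemmas Wsq = L2_linear_isometryD(1)[OF Wiso]

lemma agree_dense:
  assumes a: "\<And>v. v \<in> ospan \<Longrightarrow> (V g v, W g v) \<in> ae_rel M"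
  shows "agree g"
  unfolding agree_def
proof
  fix f assume f: "f \<in> sq_integrable M"
  have "nrm M (V g f - W g f) \<le> e" if e: "e > 0" for e
  proof -
    have "\<exists>s\<in>ospan. nrm M (s - f) < e / 2"
    proof (rule L2_dense[OF _ _ f])
      show "cfun.subspace ospan" by (simp add: ospan_def)
      show "ospan \<subseteq> sq_integrable M" using ospan_L2[OF b, folded M_def] by blast
      show "AE x in M. f x = 0" if "f \<in> sq_integrable M" "\<And>v. v \<in> ospan \<Longrightarrow> ip M f v = 0" for f
        by (rule ospan_total[OF b, folded M_def]) (use that in auto)
    qed (use e in simp)
    then obtain v where v: "v \<in> ospan" "nrm M (v - f) < e / 2" by blast
    note vsq = ospan_L2[OF b v(1), folded M_def]
    have "nrm M (V g f - W g f) \<le> nrm M (V g f - V g v) + (nrm M (V g v - W g v) + nrm M (W g v - W g f))"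
      using nrm_triangle_diff[OF Vsq[OF f] Vsq[OF vsq] Wsq[OF f], of g g g]
        nrm_triangle_diff[OF Vsq[OF vsq] Wsq[OF vsq] Wsq[OF f], of g g g] by linarith
    also have "nrm M (V g v - W g v) = 0" using a[OF v(1)] ae_iff_nrm[OF Vsq[OF vsq] Wsq[OF vsq]] by blast
    also have "nrm M (V g f - V g v) = nrm M (v - f)" unfolding isometry_nrm_diff[OF Viso f vsq] by (rule nrm_minus)
    also have "nrm M (W g v - W g f) = nrm M (v - f)" by (rule isometry_nrm_diff[OF Wiso vsq f])
    finally show ?thesis using v(2) by linarith
  qed
  then have "nrm M (V g f - W g f) \<le> 0" by (rule field_le_epsilon[of _ 0, simplified])
  then have "nrm M (V g f - W g f) = 0" using nrm_nonneg by (rule antisym)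
  then show "(V g f, W g f) \<in> ae_rel M" using ae_iff_nrm[OF Vsq[OF f] Wsq[OF f]] by blast
qed

lemma agree_mult:
  assumes g: "agree g" and h: "agree h"
  shows "agree (g * h)"
  unfolding agree_def
proof
  fix f assume f: "f \<in> sq_integrable M"
  have "(V (g * h) f, V g (V h f)) \<in> ae_rel M" by (rule L2_actionD(3)[OF Vact f])
  also have "(V g (V h f), V g (W h f)) \<in> ae_rel M" using h f unfolding agree_def by (intro isometry_cong[OF Viso]) blast
  also have "(V g (W h f), W g (W h f)) \<in> ae_rel M" using g Wsq[OF f] unfolding agree_def by blast
  also have "(W g (W h f), W (g * h) f) \<in> ae_rel M" by (rule ae_sym[OF L2_actionD(3)[OF Wact f]])
  finally show "(V (g * h) f, W (g * h) f) \<in> ae_rel M" .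
qed

lemma agree_1: "agree 1"
  unfolding agree_def using L2_actionD(2)[OF Vact] L2_actionD(2)[OF Wact] ae_trans ae_sym by blast

lemma agree_inverse:
  assumes g: "agree g" and gh: "h * g = 1" "g * h = 1"
  shows "agree h"
  unfolding agree_def
proof
  fix f assume f: "f \<in> sq_integrable M"
  have "(W g (W h f), f) \<in> ae_rel M"
    using ae_trans[OF ae_sym[OF L2_actionD(3)[OF Wact f, of g h]]] L2_actionD(2)[OF Wact f] unfolding gh by blast
  then have "(V g (W h f), f) \<in> ae_rel M" using g Wsq[OF f] ae_trans unfolding agree_def by blast
  from isometry_cong[OF Viso this, of h]
  have "(V h f, V h (V g (W h f))) \<in> ae_rel M" by (rule ae_sym)
  also have "(V h (V g (W h f)), V (h * g) (W h f)) \<in> ae_rel M" by (rule ae_sym[OF L2_actionD(3)[OF Vact Wsq[OF f]]])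
  also have "(V (h * g) (W h f), W h f) \<in> ae_rel M" unfolding gh by (rule L2_actionD(2)[OF Vact Wsq[OF f]])
  finally show "(V h f, W h f) \<in> ae_rel M" .
qed

lemma agree_Jmat: "agree (cover_exp (t *\<^sub>R Jmat))"
  using V W ae_trans ae_sym unfolding integrates_def M_def[symmetric] by (intro agree_dense) blast

text \<open>The difference of the two pairings has all its derivatives at $0$ equal to $0$, and their growth is that of an analytic function with radius of convergence at least $1/2$.\<close>

lemma agree_Emat_small:
  assumes t: "\<bar>t\<bar> < 1 / 2"
  shows "agree (cover_exp (t *\<^sub>R Emat))"
proof (rule agree_dense)
  fix v :: "real^'n \<Rightarrow> complex" assume v: "v \<in> ospan"
  let ?B = "\<lambda>n. (omega b Emat ^^ n) v"
  let ?V = "\<lambda>t. V (cover_exp (t *\<^sub>R Emat))" and ?W = "\<lambda>t. W (cover_exp (t *\<^sub>R Emat))"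
  have B: "?B n \<in> ospan" for n by (rule omega_power_ospan[OF v])
  note Bsq = ospan_L2[OF b B, folded M_def]
  note vsq = ospan_L2[OF b v, folded M_def]
  obtain C where C: "\<And>n. nrm M (?B n) \<le> C * 2 ^ n * fact n" using ospan_analytic_bound[OF v] by blast
  have eq: "ip M (?V t v) w = ip M (?W t v) w" if w: "w \<in> sq_integrable M" for w
  proof -
    let ?f = "\<lambda>n t. ip M (?V t (?B n)) w - ip M (?W t (?B n)) w"
    have "?f 0 t = 0"
    proof (rule flat_function_zero[OF _ _ _ t, where C = "2 * C * nrm M w"])
      fix n s
      have "?B (Suc n) = omega b Emat (?B n)" by simp
      then show "(?f n has_vector_derivative ?f (Suc n) s) (at s)"
        by (simp only:) (rule has_vector_derivative_diff[OF integrates_weak_derivative[OF V sl2_basis(1) B w] integrates_weak_derivative[OF W sl2_basis(1) B w]])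
      have "ip M (?V 0 (?B n)) w = ip M (?B n) w" "ip M (?W 0 (?B n)) w = ip M (?B n) w"
        using ae_ip[OF L2_actionD(2)[OF Vact Bsq] ae_refl[OF w]] ae_ip[OF L2_actionD(2)[OF Wact Bsq] ae_refl[OF w]] by simp_all
      then show "?f n 0 = 0" by simp
      have "cmod (?f n s) \<le> cmod (ip M (?V s (?B n)) w) + cmod (ip M (?W s (?B n)) w)" by (rule norm_triangle_ineq4)
      also have "\<dots> \<le> nrm M (?V s (?B n)) * nrm M w + nrm M (?W s (?B n)) * nrm M w"
        by (intro add_mono ip_Cauchy_Schwarz Vsq Wsq Bsq w)
      also have "\<dots> = 2 * nrm M w * nrm M (?B n)"
        unfolding L2_linear_isometryD(2)[OF Viso Bsq] L2_linear_isometryD(2)[OF Wiso Bsq] by simp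
      also have "\<dots> \<le> 2 * nrm M w * (C * 2 ^ n * fact n)" by (intro mult_left_mono C) simp
      finally show "cmod (?f n s) \<le> 2 * C * nrm M w * 2 ^ n * fact n" by (simp only: mult_ac)
    qed
    then show ?thesis by simp
  qed
  let ?D = "?V t v - ?W t v"
  have Dsq: "?D \<in> sq_integrable M" by (intro sq_diff Vsq Wsq vsq)
  have "ip M ?D ?D = 0" using eq[OF Dsq] by (subst ip_diff_left[OF Vsq[OF vsq] Wsq[OF vsq] Dsq]) simp
  then have "nrm M ?D = 0" unfolding ip_self by simp
  then show "(?V t v, ?W t v) \<in> ae_rel M" using ae_iff_nrm[OF Vsq[OF vsq] Wsq[OF vsq]] by blast
qed

lemma agree_Emat: "agree (cover_exp (t *\<^sub>R Emat))"
proof -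
  obtain n where n: "2 * \<bar>t\<bar> < real n" using reals_Archimedean2 by blast
  then have n0: "real n > 0" by linarith
  have s: "\<bar>t / n\<bar> < 1 / 2" using n n0 by (simp add: abs_divide divide_less_eq)
  have "agree (cover_exp ((real k * (t / n)) *\<^sub>R Emat))" for k
  proof (induction k)
    case 0 show ?case by (simp add: agree_1)
  next
    case (Suc k)
    have e: "real (Suc k) * (t / n) = real k * (t / n) + t / n" by (simp add: algebra_simps add_divide_distrib)
    show ?case unfolding e cover_exp_add[OF sl2_basis(1)] by (rule agree_mult[OF Suc agree_Emat_small[OF s]])
  qed
  from this[of n] show ?thesis using n0 by simp
qed

lemma agree_Fmat: "agree (cover_exp (t *\<^sub>R Fmat))"
  unfolding cover_exp_Fmat_conj[of t] by (intro agree_mult agree_Jmat agree_Emat)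

lemma agree_all: "agree g"
proof (induction g rule: cover_induct)
  case (H t)
  have nonneg: "agree (cover_exp (t *\<^sub>R Hmat))" if "t \<ge> 0" for t
    unfolding cover_exp_Hmat_nonneg[OF that] by (intro agree_mult agree_Emat agree_Fmat)
  show ?case
  proof (cases "t \<ge> 0")
    case False
    then have "agree (cover_exp (- t *\<^sub>R Hmat))" by (intro nonneg) simp
    then show ?thesis by (rule agree_inverse) (rule cover_exp_minus[OF sl2_basis(3)])+
  qed (rule nonneg)
qed (simp_all add: agree_mult agree_Emat agree_Fmat)

end

lemma integrates_unique:
  assumes "integrates b V" "integrates b W" "f \<in> sq_integrable M"
  shows "(V g f, W g f) \<in> ae_rel M"
  using agree_all[OF assms(1,2)] assms(3) agree_def[OF assms(1,2)] by blast

lemma gop_integrates: "integrates b (gop b :: sl2_cover \<Rightarrow> (real^'n \<Rightarrow> complex) \<Rightarrow> real^'n \<Rightarrow> complex)"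
  unfolding integrates_def
proof (intro conjI ballI allI)
  show "L2_action (weighted_measure b) (gop b :: sl2_cover \<Rightarrow> (real^'n \<Rightarrow> complex) \<Rightarrow> _)" by (rule gop_action[OF b])
qed (use gop_derivative[OF b] omega_K_gop(2)[OF b] W_alg_ospan[OF b] in auto)

end

section \<open>Existence and uniqueness of the representation\<close>

theorem theorem2p2p13:
  fixes b :: real
  assumes "b > - real CARD('n) / 2"
  shows "\<exists>!\<Omega> :: sl2_cover \<Rightarrow> (real^'n \<Rightarrow> complex) set \<Rightarrow> (real^'n \<Rightarrow> complex) set.
    unitary_rep (weighted_measure b) \<Omega> \<and>
    (\<forall>X\<in>sl2. \<forall>v\<in>W_alg b.
       l2_has_derivative_at_0 (weighted_measure b)
         (\<lambda>t. \<Omega> (cover_exp (t *\<^sub>R X)) (l2_class (weighted_measure b) v))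
         (l2_class (weighted_measure b) (omega b X v))) \<and>
    (\<forall>t. \<forall>v\<in>W_alg b.
       \<Omega> (cover_exp (t *\<^sub>R Jmat)) (l2_class (weighted_measure b) v) =
       l2_class (weighted_measure b) (omega_K b t v))"
    (is "\<exists>!\<Omega>. ?R \<Omega>")
proof -
  note b = assms
  let ?M = "weighted_measure b :: (real^'n) measure"
  let ?T = "gop b :: sl2_cover \<Rightarrow> (real^'n \<Rightarrow> complex) \<Rightarrow> real^'n \<Rightarrow> complex"
  have W: "(W_alg b :: (real^'n \<Rightarrow> complex) set) = ospan" by (rule W_alg_ospan[OF b])
  have osq: "v \<in> sq_integrable ?M" if "v \<in> ospan" for v by (rule ospan_L2[OF b that])
  have Ksq: "omega_K b t v \<in> sq_integrable ?M" if "v \<in> ospan" for t v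
    by (rule osq, rule omega_K_gop(1)[OF b]) (simp add: W that)
  \<comment> \<open>The conditions on classes, rewritten for an action on functions that induces the representation.\<close>
  have iff: "?R \<Omega> \<longleftrightarrow> unitary_rep ?M \<Omega> \<and> integrates b V"
    if act: "L2_action ?M V" and cl: "\<And>f g. f \<in> sq_integrable ?M \<Longrightarrow> \<Omega> g (l2_class ?M f) = l2_class ?M (V g f)" for \<Omega> V
  proof -
    note sq = L2_linear_isometryD(1)[OF L2_actionD(1)[OF act]]
    have "l2_has_derivative_at_0 ?M (\<lambda>t. \<Omega> (cover_exp (t *\<^sub>R X)) (l2_class ?M v)) (l2_class ?M (omega b X v)) \<longleftrightarrow>
        ((\<lambda>t. nrm ?M (cscale (complex_of_real (1 / t)) (V (cover_exp (t *\<^sub>R X)) v - V (cover_exp (0 *\<^sub>R X)) v) - omega b X v)) \<longlongrightarrow> 0) (at 0)"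
      if v: "v \<in> ospan" for X v
      unfolding cl[OF osq[OF v]]
      by (rule l2_has_derivative_at_0_class[OF sq[OF osq[OF v]] osq[OF omega_in_ospan[OF v]]])
    moreover have "\<Omega> (cover_exp (t *\<^sub>R Jmat)) (l2_class ?M v) = l2_class ?M (omega_K b t v) \<longleftrightarrow>
        (V (cover_exp (t *\<^sub>R Jmat)) v, omega_K b t v) \<in> ae_rel ?M" if v: "v \<in> ospan" for t v
      unfolding cl[OF osq[OF v]] by (rule l2_class_eq[OF sq[OF osq[OF v]] Ksq[OF v]])
    ultimately show ?thesis using act unfolding W integrates_def by (simp cong: ball_cong)
  qed
  have cl: "l2_lift ?M ?T g (l2_class ?M f) = l2_class ?M (?T g f)" if "f \<in> sq_integrable ?M" for f g
    by (rule l2_lift_class[where T = ?T and g = g, OF gop_isometry[OF b] that])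
  have U: "unitary_rep ?M (l2_lift ?M ?T)"
    by (rule unitary_rep_l2_lift[OF gop_action[OF b] sl2_cover_inverse gop_continuous[OF b]])
  show ?thesis
  proof (rule ex1I)
    show "?R (l2_lift ?M ?T)" using iff[OF gop_action[OF b] cl] U gop_integrates[OF b] by blast
  next
    fix \<Omega> assume R: "?R \<Omega>"
    define V where "V = (\<lambda>g f. l2_rep (\<Omega> g (l2_class ?M f)))"
    have rep: "unitary_rep ?M \<Omega>" using R by blast
    have V_act: "L2_action ?M V" unfolding V_def by (rule unitary_rep_L2_action(1)[OF rep])
    have V_class: "\<Omega> g (l2_class ?M f) = l2_class ?M (V g f)" if "f \<in> sq_integrable ?M" for f g
      unfolding V_def by (rule unitary_rep_L2_action(2)[OF rep that])
    have V: "integrates b V" using iff[OF V_act V_class] R by blast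
    show "\<Omega> = l2_lift ?M ?T"
    proof (rule ext, rule extensionalityI)
      fix g
      show "\<Omega> g \<in> extensional (L2 ?M)" "l2_lift ?M ?T g \<in> extensional (L2 ?M)"
        using rep U by (simp_all add: unitary_rep_def unitary_op_def)
      fix u assume "u \<in> L2 ?M"
      then obtain f where f: "f \<in> sq_integrable ?M" "u = l2_class ?M f" by (rule L2_cases)
      show "\<Omega> g u = l2_lift ?M ?T g u"
        unfolding f(2) V_class[OF f(1)] cl[OF f(1)]
        by (rule l2_classI[OF integrates_unique[OF b V gop_integrates[OF b] f(1)]])
    qed
  qed
qed

end
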